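(* Let $\mathcal{A}$ be an abelian category. Then there exists a bijection between the following: (1) Exact structures on $\mathcal{A}$. (2) Resolving subcategories $\mathcal{X}$ of $\operatorname{mod}(\mathcal{A})$ for which $\operatorname{Tr}(\mathcal{X})$ is a resolving subcategory of $\operatorname{mod}(\mathcal{A}^{\operatorname{op}})$.
   Context: All categories are essentially small; subcategories are full and closed under isomorphisms. An exact structure on the additive category $\mathcal{A}$ is a class of kernel-cokernel pairs (conflations), closed under isomorphism, making $\mathcal{A}$ an exact category in the sense of Quillen. $\operatorname{mod}(\mathcal{A})$ is the category of finitely presented additive contravariant functors $F\colon\mathcal{A}\to\mathsf{Ab}$, i.e. those with an exact sequence $\operatorname{Hom}_{\mathcal{A}}(-,X)\to\operatorname{Hom}_{\mathcal{A}}(-,Y)\to F\to 0$; it is abelian. A subcategory $\mathcal{X}$ of $\operatorname{mod}(\mathcal{A})$ is resolving if it is closed under extensions, direct summands and kernels of epimorphisms between objects of $\mathcal{X}$, and every object of $\operatorname{mod}(\mathcal{A})$ is a quotient of an object of $\mathcal{X}$; similarly for $\operatorname{mod}(\mathcal{A}^{\operatorname{op}})$. $\underline{\operatorname{mod}}(\mathcal{A})$ is the quotient of $\operatorname{mod}(\mathcal{A})$ by morphisms factoring through representable functors. The Auslander-Bridger transpose $\operatorname{Tr}\colon\underline{\operatorname{mod}}(\mathcal{A})\to\underline{\operatorname{mod}}(\mathcal{A}^{\operatorname{op}})^{\operatorname{op}}$ sends $F$ with presentation $\operatorname{Hom}_{\mathcal{A}}(-,X)\xrightarrow{\operatorname{Hom}_{\mathcal{A}}(-,f)}\operatorname{Hom}_{\mathcal{A}}(-,Y)\to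 F\to 0$ to $\operatorname{Tr}(F)=\operatorname{coker}(\operatorname{Hom}_{\mathcal{A}}(Y,-)\xrightarrow{\operatorname{Hom}_{\mathcal{A}}(f,-)}\operatorname{Hom}_{\mathcal{A}}(X,-))$; it is well defined up to isomorphism in the stable category. For a subcategory $\mathcal{X}$ of $\operatorname{mod}(\mathcal{A})$, $\operatorname{Tr}(\mathcal{X})$ is the subcategory of $\operatorname{mod}(\mathcal{A}^{\operatorname{op}})$ of all objects which are isomorphic in $\underline{\operatorname{mod}}(\mathcal{A}^{\operatorname{op}})$ to $\operatorname{Tr}(F)$ for some $F\in\mathcal{X}$. *)

theory Defs
  imports "HOL-Algebra.Group" "HOL-Library.FuncSet"
begin

section \<open>Preadditive categories\<close>

text \<open>
  A category is given by a set of objects and a set of arrows, each arrow having a domain and a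
  codomain, so hom-sets between different pairs of objects are disjoint. The value of the
  operations outside these sets is irrelevant.
\<close>

record ('o, 'm) acat =
  Ob :: "'o set"
  Mor :: "'m set"
  Dom :: "'m \<Rightarrow> 'o"
  Cod :: "'m \<Rightarrow> 'o"
  Id :: "'o \<Rightarrow> 'm"
  Cmp :: "'m \<Rightarrow> 'm \<Rightarrow> 'm"  (infixl "\<cdot>\<index>" 70)
  Add :: "'m \<Rightarrow> 'm \<Rightarrow> 'm"
  Zero :: "'o \<Rightarrow> 'o \<Rightarrow> 'm"

definition homset :: "('o, 'm) acat \<Rightarrow> 'o \<Rightarrow> 'o \<Rightarrow> 'm set" where
  "homset C X Y = {f \<in> Mor C. Dom C f = X \<and> Cod C f = Y}"

definition homgrp :: "('o, 'm) acat \<Rightarrow> 'o \<Rightarrow> 'o \<Rightarrow> 'm monoid" where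
  "homgrp C X Y = \<lparr>carrier = homset C X Y, mult = Add C, one = Zero C X Y\<rparr>"

definition opcat :: "('o, 'm) acat \<Rightarrow> ('o, 'm) acat" where
  "opcat C = \<lparr>Ob = Ob C, Mor = Mor C, Dom = Cod C, Cod = Dom C, Id = Id C,
              Cmp = (\<lambda>g f. f \<cdot>\<^bsub>C\<^esub> g), Add = Add C, Zero = (\<lambda>X Y. Zero C Y X)\<rparr>"

locale preadditive_category =
  fixes C :: "('o, 'm) acat"
  assumes Dom_Ob: "f \<in> Mor C \<Longrightarrow> Dom C f \<in> Ob C"
    and Cod_Ob: "f \<in> Mor C \<Longrightarrow> Cod C f \<in> Ob C"
    and Id_hom: "X \<in> Ob C \<Longrightarrow> Id C X \<in> homset C X X"
    and Cmp_hom: "f \<in> homset C X Y \<Longrightarrow> g \<in> homset C Y Z \<Longrightarrow> g \<cdot>\<^bsub>C\<^esub> f \<in> homset C X Z"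
    and Cmp_Id: "f \<in> homset C X Y \<Longrightarrow> f \<cdot>\<^bsub>C\<^esub> Id C X = f"
    and Id_Cmp: "f \<in> homset C X Y \<Longrightarrow> Id C Y \<cdot>\<^bsub>C\<^esub> f = f"
    and Cmp_assoc: "f \<in> homset C W X \<Longrightarrow> g \<in> homset C X Y \<Longrightarrow> h \<in> homset C Y Z
           \<Longrightarrow> (h \<cdot>\<^bsub>C\<^esub> g) \<cdot>\<^bsub>C\<^esub> f = h \<cdot>\<^bsub>C\<^esub> (g \<cdot>\<^bsub>C\<^esub> f)"
    and hom_group: "X \<in> Ob C \<Longrightarrow> Y \<in> Ob C \<Longrightarrow> comm_group (homgrp C X Y)"
    and Cmp_Add: "f \<in> homset C X Y \<Longrightarrow> f' \<in> homset C X Y \<Longrightarrow> g \<in> homset C Y Z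
           \<Longrightarrow> g \<cdot>\<^bsub>C\<^esub> Add C f f' = Add C (g \<cdot>\<^bsub>C\<^esub> f) (g \<cdot>\<^bsub>C\<^esub> f')"
    and Add_Cmp: "f \<in> homset C X Y \<Longrightarrow> g \<in> homset C Y Z \<Longrightarrow> g' \<in> homset C Y Z
           \<Longrightarrow> Add C g g' \<cdot>\<^bsub>C\<^esub> f = Add C (g \<cdot>\<^bsub>C\<^esub> f) (g' \<cdot>\<^bsub>C\<^esub> f)"

definition mono_arrow :: "('o, 'm) acat \<Rightarrow> 'm \<Rightarrow> bool" where
  "mono_arrow C f \<longleftrightarrow> f \<in> Mor C \<and>
     (\<forall>g \<in> Mor C. \<forall>h \<in> Mor C. Dom C g = Dom C h \<longrightarrow> Cod C g = Dom C f \<longrightarrow> Cod C h = Dom C f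
        \<longrightarrow> f \<cdot>\<^bsub>C\<^esub> g = f \<cdot>\<^bsub>C\<^esub> h \<longrightarrow> g = h)"

definition epi_arrow :: "('o, 'm) acat \<Rightarrow> 'm \<Rightarrow> bool" where
  "epi_arrow C f \<longleftrightarrow> mono_arrow (opcat C) f"

definition iso_arrow :: "('o, 'm) acat \<Rightarrow> 'm \<Rightarrow> bool" where
  "iso_arrow C f \<longleftrightarrow> f \<in> Mor C \<and>
     (\<exists>g \<in> homset C (Cod C f) (Dom C f).
        g \<cdot>\<^bsub>C\<^esub> f = Id C (Dom C f) \<and> f \<cdot>\<^bsub>C\<^esub> g = Id C (Cod C f))"

definition isomorphic :: "('o, 'm) acat \<Rightarrow> 'o \<Rightarrow> 'o \<Rightarrow> bool" where
  "isomorphic C X Y \<longleftrightarrow> (\<exists>f \<in> homset C X Y. iso_arrow C f)"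

definition is_zero_object :: "('o, 'm) acat \<Rightarrow> 'o \<Rightarrow> bool" where
  "is_zero_object C Z \<longleftrightarrow> Z \<in> Ob C \<and>
     (\<forall>X \<in> Ob C. (\<exists>!f. f \<in> homset C X Z) \<and> (\<exists>!f. f \<in> homset C Z X))"

text \<open>\<open>k\<close> is a kernel of \<open>g\<close>; the kernel object is the domain of \<open>k\<close>.\<close>

definition is_kernel :: "('o, 'm) acat \<Rightarrow> 'm \<Rightarrow> 'm \<Rightarrow> bool" where
  "is_kernel C k g \<longleftrightarrow> k \<in> Mor C \<and> g \<in> Mor C \<and> Cod C k = Dom C g \<and>
     g \<cdot>\<^bsub>C\<^esub> k = Zero C (Dom C k) (Cod C g) \<and>
     (\<forall>h \<in> Mor C. Cod C h = Dom C g \<longrightarrow> g \<cdot>\<^bsub>C\<^esub> h = Zero C (Dom C h) (Cod C g)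
        \<longrightarrow> (\<exists>!u. u \<in> homset C (Dom C h) (Dom C k) \<and> k \<cdot>\<^bsub>C\<^esub> u = h))"

definition is_cokernel :: "('o, 'm) acat \<Rightarrow> 'm \<Rightarrow> 'm \<Rightarrow> bool" where
  "is_cokernel C c f \<longleftrightarrow> is_kernel (opcat C) c f"

definition kernel_cokernel_pair :: "('o, 'm) acat \<Rightarrow> 'm \<Rightarrow> 'm \<Rightarrow> bool" where
  "kernel_cokernel_pair C i p \<longleftrightarrow> is_kernel C i p \<and> is_cokernel C p i"

definition is_biproduct :: "('o, 'm) acat \<Rightarrow> 'o \<Rightarrow> 'o \<Rightarrow> 'o \<Rightarrow> bool" where
  "is_biproduct C X Y P \<longleftrightarrow> X \<in> Ob C \<and> Y \<in> Ob C \<and> P \<in> Ob C \<and>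
     (\<exists>i \<in> homset C X P. \<exists>j \<in> homset C Y P. \<exists>p \<in> homset C P X. \<exists>q \<in> homset C P Y.
        p \<cdot>\<^bsub>C\<^esub> i = Id C X \<and> q \<cdot>\<^bsub>C\<^esub> j = Id C Y \<and>
        p \<cdot>\<^bsub>C\<^esub> j = Zero C Y X \<and> q \<cdot>\<^bsub>C\<^esub> i = Zero C X Y \<and>
        Add C (i \<cdot>\<^bsub>C\<^esub> p) (j \<cdot>\<^bsub>C\<^esub> q) = Id C P)"

locale abelian_category = preadditive_category A for A :: "('o, 'm) acat" +
  assumes zero_object: "\<exists>Z. is_zero_object A Z"
    and biproducts: "X \<in> Ob A \<Longrightarrow> Y \<in> Ob A \<Longrightarrow> \<exists>P. is_biproduct A X Y P"
    and kernels: "f \<in> Mor A \<Longrightarrow> \<exists>k. is_kernel A k f"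
    and cokernels: "f \<in> Mor A \<Longrightarrow> \<exists>c. is_cokernel A c f"
    and mono_normal: "mono_arrow A f \<Longrightarrow> \<exists>g. is_kernel A f g"
    and epi_normal: "epi_arrow A f \<Longrightarrow> \<exists>g. is_cokernel A f g"

section \<open>Exact structures\<close>

text \<open>\<open>f \<cdot> q = g \<cdot> p\<close> is a pullback square, with \<open>q\<close> parallel to \<open>g\<close> and \<open>p\<close> parallel to \<open>f\<close>.\<close>

definition is_pullback :: "('o, 'm) acat \<Rightarrow> 'm \<Rightarrow> 'm \<Rightarrow> 'm \<Rightarrow> 'm \<Rightarrow> bool" where
  "is_pullback C f g p q \<longleftrightarrow>
     f \<in> Mor C \<and> g \<in> Mor C \<and> p \<in> Mor C \<and> q \<in> Mor C \<and>
     Cod C f = Cod C g \<and> Dom C p = Dom C q \<and> Cod C p = Dom C g \<and> Cod C q = Dom C f \<and>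
     f \<cdot>\<^bsub>C\<^esub> q = g \<cdot>\<^bsub>C\<^esub> p \<and>
     (\<forall>s \<in> Mor C. \<forall>t \<in> Mor C. Dom C s = Dom C t \<longrightarrow> Cod C s = Dom C g \<longrightarrow> Cod C t = Dom C f
        \<longrightarrow> f \<cdot>\<^bsub>C\<^esub> t = g \<cdot>\<^bsub>C\<^esub> s
        \<longrightarrow> (\<exists>!u. u \<in> homset C (Dom C s) (Dom C p) \<and> p \<cdot>\<^bsub>C\<^esub> u = s \<and> q \<cdot>\<^bsub>C\<^esub> u = t))"

definition is_pushout :: "('o, 'm) acat \<Rightarrow> 'm \<Rightarrow> 'm \<Rightarrow> 'm \<Rightarrow> 'm \<Rightarrow> bool" where
  "is_pushout C f g p q \<longleftrightarrow> is_pullback (opcat C) f g p q"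

definition admissible_mono :: "('m \<times> 'm) set \<Rightarrow> 'm \<Rightarrow> bool" where
  "admissible_mono E i \<longleftrightarrow> (\<exists>p. (i, p) \<in> E)"

definition admissible_epi :: "('m \<times> 'm) set \<Rightarrow> 'm \<Rightarrow> bool" where
  "admissible_epi E p \<longleftrightarrow> (\<exists>i. (i, p) \<in> E)"

text \<open>Quillen's axioms, in the self-dual form of Buehler, \<^emph>\<open>Exact categories\<close>, Definition 2.1.\<close>

definition exact_structure :: "('o, 'm) acat \<Rightarrow> ('m \<times> 'm) set \<Rightarrow> bool" where
  "exact_structure C E \<longleftrightarrow>
     (\<forall>(i, p) \<in> E. kernel_cokernel_pair C i p) \<and>
     (\<forall>(i, p) \<in> E. \<forall>i' \<in> Mor C. \<forall>p' \<in> Mor C. \<forall>a b c.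
        Cod C i' = Dom C p' \<longrightarrow>
        a \<in> homset C (Dom C i) (Dom C i') \<longrightarrow> b \<in> homset C (Cod C i) (Cod C i') \<longrightarrow>
        c \<in> homset C (Cod C p) (Cod C p') \<longrightarrow>
        iso_arrow C a \<longrightarrow> iso_arrow C b \<longrightarrow> iso_arrow C c \<longrightarrow>
        b \<cdot>\<^bsub>C\<^esub> i = i' \<cdot>\<^bsub>C\<^esub> a \<longrightarrow> c \<cdot>\<^bsub>C\<^esub> p = p' \<cdot>\<^bsub>C\<^esub> b \<longrightarrow> (i', p') \<in> E) \<and>
     (\<forall>X \<in> Ob C. admissible_mono E (Id C X)) \<and>
     (\<forall>X \<in> Ob C. admissible_epi E (Id C X)) \<and>
     (\<forall>i j. admissible_mono E i \<longrightarrow> admissible_mono E j \<longrightarrow> Cod C i = Dom C j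
        \<longrightarrow> admissible_mono E (j \<cdot>\<^bsub>C\<^esub> i)) \<and>
     (\<forall>p q. admissible_epi E p \<longrightarrow> admissible_epi E q \<longrightarrow> Cod C p = Dom C q
        \<longrightarrow> admissible_epi E (q \<cdot>\<^bsub>C\<^esub> p)) \<and>
     (\<forall>i. \<forall>f \<in> Mor C. admissible_mono E i \<longrightarrow> Dom C f = Dom C i
        \<longrightarrow> (\<exists>i' f'. is_pushout C i f i' f' \<and> admissible_mono E i')) \<and>
     (\<forall>p. \<forall>f \<in> Mor C. admissible_epi E p \<longrightarrow> Cod C f = Cod C p
        \<longrightarrow> (\<exists>p' f'. is_pullback C p f p' f' \<and> admissible_epi E p'))"

section \<open>Resolving subcategories\<close>

text \<open>A full subcategory is given by its set of objects.\<close>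

definition subcategory :: "('o, 'm) acat \<Rightarrow> 'o set \<Rightarrow> bool" where
  "subcategory C \<X> \<longleftrightarrow> \<X> \<subseteq> Ob C \<and> (\<forall>X \<in> \<X>. \<forall>Y \<in> Ob C. isomorphic C X Y \<longrightarrow> Y \<in> \<X>)"

definition resolving :: "('o, 'm) acat \<Rightarrow> 'o set \<Rightarrow> bool" where
  "resolving C \<X> \<longleftrightarrow> subcategory C \<X> \<and>
     (\<forall>i p. kernel_cokernel_pair C i p \<longrightarrow> Dom C i \<in> \<X> \<longrightarrow> Cod C p \<in> \<X> \<longrightarrow> Cod C i \<in> \<X>) \<and>
     (\<forall>X Y P. is_biproduct C X Y P \<longrightarrow> P \<in> \<X> \<longrightarrow> X \<in> \<X>) \<and>
     (\<forall>k p. epi_arrow C p \<longrightarrow> Dom C p \<in> \<X> \<longrightarrow> Cod C p \<in> \<X> \<longrightarrow> is_kernel C k p \<longrightarrow> Dom C k \<in> \<X>) \<and>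
     (\<forall>Y \<in> Ob C. \<exists>p. epi_arrow C p \<and> Dom C p \<in> \<X> \<and> Cod C p = Y)"

section \<open>Finitely presented functors\<close>

text \<open>
  Contravariant functors to abelian groups. The groups are written multiplicatively and their
  carriers are sets of elements of a type \<open>'g\<close>, which plays the role of the universe. The values
  of a finitely presented functor are quotients of hom-groups of \<open>A\<close>; so once the arrows of \<open>A\<close>
  inject into \<open>'g\<close>, every finitely presented functor to abelian groups is isomorphic to one with
  values in \<open>'g\<close>.
\<close>

record ('o, 'm, 'g) afun =
  FOb :: "'o \<Rightarrow> 'g monoid"
  FMor :: "'m \<Rightarrow> 'g \<Rightarrow> 'g"

definition additive_functor :: "('o, 'm) acat \<Rightarrow> ('o, 'm, 'g) afun \<Rightarrow> bool" where
  "additive_functor A F \<longleftrightarrow>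
     (\<forall>X \<in> Ob A. comm_group (FOb F X)) \<and>
     (\<forall>f \<in> Mor A. FMor F f \<in> hom (FOb F (Cod A f)) (FOb F (Dom A f))) \<and>
     (\<forall>X \<in> Ob A. \<forall>x \<in> carrier (FOb F X). FMor F (Id A X) x = x) \<and>
     (\<forall>f \<in> Mor A. \<forall>g \<in> Mor A. Cod A f = Dom A g \<longrightarrow>
        (\<forall>x \<in> carrier (FOb F (Cod A g)). FMor F (g \<cdot>\<^bsub>A\<^esub> f) x = FMor F f (FMor F g x))) \<and>
     (\<forall>f \<in> Mor A. \<forall>g \<in> Mor A. Dom A f = Dom A g \<longrightarrow> Cod A f = Cod A g \<longrightarrow>
        (\<forall>x \<in> carrier (FOb F (Cod A f)).
           FMor F (Add A f g) x = FMor F f x \<otimes>\<^bsub>FOb F (Dom A f)\<^esub> FMor F g x))"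

text \<open>The functor \<open>Hom(-, Y)\<close>; its values have carriers in the type of arrows.\<close>

definition hom_functor :: "('o, 'm) acat \<Rightarrow> 'o \<Rightarrow> ('o, 'm, 'm) afun" where
  "hom_functor A Y = \<lparr>FOb = (\<lambda>X. homgrp A X Y), FMor = (\<lambda>f g. g \<cdot>\<^bsub>A\<^esub> f)\<rparr>"

text \<open>The two functors may take values in different universes, so that \<open>hom_functor\<close> can be compared
  with functors valued in \<open>'g\<close>.\<close>

definition nat_trans ::
    "('o, 'm) acat \<Rightarrow> ('o, 'm, 'g) afun \<Rightarrow> ('o, 'm, 'h) afun \<Rightarrow> ('o \<Rightarrow> 'g \<Rightarrow> 'h) \<Rightarrow> bool" where
  "nat_trans A F G \<alpha> \<longleftrightarrow>
     (\<forall>X \<in> Ob A. \<alpha> X \<in> hom (FOb F X) (FOb G X)) \<and>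
     (\<forall>f \<in> Mor A. \<forall>x \<in> carrier (FOb F (Cod A f)).
        \<alpha> (Dom A f) (FMor F f x) = FMor G f (\<alpha> (Cod A f) x))"

text \<open>\<open>Hom(-, X) \<rightarrow> Hom(-, Y) \<rightarrow> F \<rightarrow> 0\<close> is exact, where \<open>f : X \<rightarrow> Y\<close> induces the first map and
  the second one is some \<open>\<pi>\<close>.\<close>

definition presents :: "('o, 'm) acat \<Rightarrow> 'm \<Rightarrow> ('o, 'm, 'g) afun \<Rightarrow> bool" where
  "presents A f F \<longleftrightarrow> f \<in> Mor A \<and> (\<exists>\<pi>. nat_trans A (hom_functor A (Cod A f)) F \<pi> \<and>
     (\<forall>W \<in> Ob A. \<pi> W ` homset A W (Cod A f) = carrier (FOb F W) \<and>
        {g \<in> homset A W (Cod A f). \<pi> W g = \<one>\<^bsub>FOb F W\<^esub>} = (\<lambda>h. f \<cdot>\<^bsub>A\<^esub> h) ` homset A W (Dom A f)))"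

definition finitely_presented :: "('o, 'm) acat \<Rightarrow> ('o, 'm, 'g) afun \<Rightarrow> bool" where
  "finitely_presented A F \<longleftrightarrow> additive_functor A F \<and> (\<exists>f. presents A f F)"

text \<open>An arrow of the functor category is a triple of source, target and components; the latter are
  required to be extensional so that equality of arrows is equality of natural transformations.\<close>

type_synonym ('o, 'm, 'g) ftrans =
  "('o, 'm, 'g) afun \<times> ('o, 'm, 'g) afun \<times> ('o \<Rightarrow> 'g \<Rightarrow> 'g)"

definition ext_trans ::
    "('o, 'm) acat \<Rightarrow> ('o, 'm, 'g) afun \<Rightarrow> ('o \<Rightarrow> 'g \<Rightarrow> 'g) \<Rightarrow> ('o \<Rightarrow> 'g \<Rightarrow> 'g)" where
  "ext_trans A F \<alpha> = (\<lambda>X \<in> Ob A. \<lambda>x \<in> carrier (FOb F X). \<alpha> X x)"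

definition modcat :: "('o, 'm) acat \<Rightarrow> (('o, 'm, 'g) afun, ('o, 'm, 'g) ftrans) acat" where
  "modcat A = \<lparr>
     Ob = {F. finitely_presented A F},
     Mor = {(F, G, \<alpha>). finitely_presented A F \<and> finitely_presented A G \<and> nat_trans A F G \<alpha> \<and>
              \<alpha> = ext_trans A F \<alpha>},
     Dom = (\<lambda>(F, G, \<alpha>). F),
     Cod = (\<lambda>(F, G, \<alpha>). G),
     Id = (\<lambda>F. (F, F, ext_trans A F (\<lambda>X x. x))),
     Cmp = (\<lambda>(G, H, \<beta>) (F, G', \<alpha>). (F, H, ext_trans A F (\<lambda>X x. \<beta> X (\<alpha> X x)))),
     Add = (\<lambda>(F, G, \<alpha>) (F', G', \<beta>). (F, G, ext_trans A F (\<lambda>X x. \<alpha> X x \<otimes>\<^bsub>FOb G X\<^esub> \<beta> X x))),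
     Zero = (\<lambda>F G. (F, G, ext_trans A F (\<lambda>X x. \<one>\<^bsub>FOb G X\<^esub>)))\<rparr>"

section \<open>The stable category and the transpose\<close>

definition representable :: "('o, 'm) acat \<Rightarrow> ('o, 'm, 'g) afun \<Rightarrow> bool" where
  "representable A F \<longleftrightarrow> additive_functor A F \<and>
     (\<exists>Y \<in> Ob A. \<exists>\<alpha>. nat_trans A (hom_functor A Y) F \<alpha> \<and>
        (\<forall>X \<in> Ob A. bij_betw (\<alpha> X) (homset A X Y) (carrier (FOb F X))))"

definition factors_through :: "('o, 'm) acat \<Rightarrow> 'o set \<Rightarrow> 'm set" where
  "factors_through C \<P> = {f \<in> Mor C. \<exists>P \<in> \<P> \<inter> Ob C. \<exists>h \<in> homset C (Dom C f) P.
     \<exists>g \<in> homset C P (Cod C f). f = g \<cdot>\<^bsub>C\<^esub> h}"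

text \<open>Quotient of a preadditive category by an ideal \<open>I\<close> of arrows: arrows are the cosets of the
  subgroups \<open>I \<inter> Hom(X, Y)\<close>, and the operations are computed
  on representatives.\<close>

definition arrow_class :: "('o, 'm) acat \<Rightarrow> 'm set \<Rightarrow> 'm \<Rightarrow> 'm set" where
  "arrow_class C I f = {Add C h f | h. h \<in> I \<inter> homset C (Dom C f) (Cod C f)}"

definition quotcat :: "('o, 'm) acat \<Rightarrow> 'm set \<Rightarrow> ('o, 'm set) acat" where
  "quotcat C I = (let rep = (\<lambda>u. SOME f. f \<in> u) in \<lparr>
     Ob = Ob C,
     Mor = arrow_class C I ` Mor C,
     Dom = (\<lambda>u. Dom C (rep u)),
     Cod = (\<lambda>u. Cod C (rep u)),
     Id = (\<lambda>X. arrow_class C I (Id C X)),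
     Cmp = (\<lambda>v u. arrow_class C I (rep v \<cdot>\<^bsub>C\<^esub> rep u)),
     Add = (\<lambda>u v. arrow_class C I (Add C (rep u) (rep v))),
     Zero = (\<lambda>X Y. arrow_class C I (Zero C X Y))\<rparr>)"

definition stable_modcat ::
    "('o, 'm) acat \<Rightarrow> (('o, 'm, 'g) afun, ('o, 'm, 'g) ftrans set) acat" where
  "stable_modcat A = quotcat (modcat A) (factors_through (modcat A) {P. representable A P})"

text \<open>
  \<open>T\<close> is a transpose of \<open>F\<close> if some \<open>f : X \<rightarrow> Y\<close> presents \<open>F\<close> and \<open>T\<close> is the cokernel of
  \<open>Hom(f, -) : Hom(Y, -) \<rightarrow> Hom(X, -)\<close>, that is, if \<open>f\<close>, viewed as an arrow \<open>Y \<rightarrow> X\<close> of the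
  opposite category, presents \<open>T\<close>. Functors on \<open>A\<^sup>o\<^sup>p\<close> are modelled as functors on \<open>opcat A\<close>.
\<close>

definition is_transpose ::
    "('o, 'm) acat \<Rightarrow> ('o, 'm, 'g) afun \<Rightarrow> ('o, 'm, 'g) afun \<Rightarrow> bool" where
  "is_transpose A F T \<longleftrightarrow> T \<in> Ob (modcat (opcat A)) \<and> (\<exists>f. presents A f F \<and> presents (opcat A) f T)"

definition Tr :: "('o, 'm) acat \<Rightarrow> ('o, 'm, 'g) afun set \<Rightarrow> ('o, 'm, 'g) afun set" where
  "Tr A \<X> = {G \<in> Ob (modcat (opcat A)).
     \<exists>F \<in> \<X>. \<exists>T. is_transpose A F T \<and> isomorphic (stable_modcat (opcat A)) G T}"

end

theory Submission
  imports Defs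
begin

text \<open>
  Write \<open>M\<^sub>f\<close> for the cokernel of \<open>Hom(-, f)\<close>. An exact structure \<open>E\<close> corresponds to the class \<open>\<X>\<^sub>E\<close> of
  all \<open>M\<^sub>f\<close> with \<open>f = i p\<close>, \<open>p\<close> a deflation and \<open>i\<close> an inflation. The deflations are the covers of a
  topology for which representable functors are sheaves, and \<open>\<X>\<^sub>E\<close> consists of the finitely presented
  functors whose sheafification is representable, which makes \<open>\<X>\<^sub>E\<close> resolving. The condition on \<open>f\<close> is
  self-dual, so \<open>Tr \<X>\<^sub>E\<close> is the class that belongs to the opposite exact structure, and it is resolving
  too.

  Conversely, for a resolving \<open>\<X>\<close> consider the arrows \<open>f\<close> with \<open>M\<^sub>f \<in> \<X>\<close>. That \<open>M\<^sub>f\<close> is a retract of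
  \<open>M\<^sub>g\<close> in the stable category can be expressed by equations between \<open>f\<close> and \<open>g\<close> that are self-dual,
  and \<open>\<X>\<close> is closed under such retracts. Hence \<open>Tr \<X>\<close> defines the same arrows in the opposite category,
  and every closure property of this class of arrows that holds because \<open>\<X>\<close> is resolving has a dual
  that holds because \<open>Tr \<X>\<close> is. Together they say that the kernel-cokernel pairs with second arrow in
  the class form an exact structure.
\<close>

section \<open>Preadditive and abelian categories\<close>

text \<open>\<open>modcat A\<close> contains functors with values in \<open>'g\<close>, whereas
  \<open>hom_functor\<close> takes values in the arrows. So representable functors enter as those
  presented by a zero endomorphism, and functors with a given presentation are built from cosets
  transported along \<open>\<iota>\<close>. Sheafification is never constructed: a map to
  \<open>Hom(-, Y)\<close> that is locally injective, locally surjective and universal among maps to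
  representable functors takes its place, where \<open>Y\<close> is the cokernel of a presentation.
  With all epimorphisms as covers such a map always exists; the question is whether deflations
  suffice as covers. Right cancellation of deflations (Quillen's obscure axiom) turns an affirmative
  answer back into conditions on the two factors of \<open>f\<close>. In the reverse direction the
  delicate point is composition of deflations: the exact sequence behind it lives in
  \<open>\<X>\<close>, but the cancellation that it needs is the mirror image of one proved for
  \<open>\<X>\<close> and comes from \<open>Tr \<X>\<close>. The structure is recovered because an
  epimorphism \<open>p\<close> is a deflation iff the functor presented by \<open>p\<close> lies in
  the subcategory.\<close>

lemma opcat_simps [simp]:
  "Ob (opcat C) = Ob C" "Mor (opcat C) = Mor C" "Dom (opcat C) = Cod C" "Cod (opcat C) = Dom C"
  "Id (opcat C) = Id C" "g \<cdot>\<^bsub>opcat C\<^esub> f = f \<cdot>\<^bsub>C\<^esub> g" "Add (opcat C) = Add C"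
  "Zero (opcat C) X Y = Zero C Y X"
  by (simp_all add: opcat_def)

lemma opcat_opcat [simp]: "opcat (opcat C) = C"
  by (simp add: opcat_def)

lemma hom_iff: "f \<in> homset C X Y \<longleftrightarrow> f \<in> Mor C \<and> Dom C f = X \<and> Cod C f = Y"
  by (auto simp: homset_def)

lemma homset_opcat [simp]: "homset (opcat C) X Y = homset C Y X"
  by (auto simp: homset_def)

lemma homgrp_opcat [simp]: "homgrp (opcat C) X Y = homgrp C Y X"
  by (simp add: homgrp_def)

definition neg :: "('o, 'm) acat \<Rightarrow> 'm \<Rightarrow> 'm" where
  "neg C f = inv\<^bsub>homgrp C (Dom C f) (Cod C f)\<^esub> f"

section \<open>Additive arithmetic, monomorphisms and kernels in a preadditive category\<close>

context preadditive_category
begin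

abbreviation comp (infixl "\<odot>" 70) where "g \<odot> f \<equiv> g \<cdot>\<^bsub>C\<^esub> f"
abbreviation plus (infixl "\<oplus>" 65) where "f \<oplus> g \<equiv> Add C f g"

lemma preadditive_opcat: "preadditive_category (opcat C)"
  by (intro preadditive_category.intro)
    (auto simp: Dom_Ob Cod_Ob Id_hom Cmp_hom Cmp_Id Id_Cmp hom_group Cmp_Add Add_Cmp
      intro: Cmp_assoc[symmetric])

declare Dom_Ob [simp] Cod_Ob [simp]

lemma Id_Mor [simp]:
  "X \<in> Ob C \<Longrightarrow> Id C X \<in> Mor C" "X \<in> Ob C \<Longrightarrow> Dom C (Id C X) = X"
  "X \<in> Ob C \<Longrightarrow> Cod C (Id C X) = X"
  using Id_hom by (auto simp: hom_iff)

lemma Cmp_Mor [simp]: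
  assumes "f \<in> Mor C" "g \<in> Mor C" "Cod C f = Dom C g"
  shows "g \<odot> f \<in> Mor C" "Dom C (g \<odot> f) = Dom C f" "Cod C (g \<odot> f) = Cod C g"
  using Cmp_hom[of f "Dom C f" "Dom C g" g "Cod C g"] assms by (auto simp: hom_iff)

lemma Cmp_Id_Mor [simp]: "f \<in> Mor C \<Longrightarrow> Dom C f = X \<Longrightarrow> f \<odot> Id C X = f"
  and Id_Cmp_Mor [simp]: "f \<in> Mor C \<Longrightarrow> Cod C f = X \<Longrightarrow> Id C X \<odot> f = f"
  using Cmp_Id Id_Cmp by (auto simp: hom_iff)

lemma assoc:
  "f \<in> Mor C \<Longrightarrow> g \<in> Mor C \<Longrightarrow> h \<in> Mor C \<Longrightarrow> Cod C f = Dom C g \<Longrightarrow> Cod C g = Dom C h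
    \<Longrightarrow> (h \<odot> g) \<odot> f = h \<odot> (g \<odot> f)"
  using Cmp_assoc by (auto simp: hom_iff)

lemma hom_comm_group: "f \<in> Mor C \<Longrightarrow> comm_group (homgrp C (Dom C f) (Cod C f))"
  by (simp add: hom_group)

lemma Zero_Mor [simp]:
  assumes "X \<in> Ob C" "Y \<in> Ob C"
  shows "Zero C X Y \<in> Mor C" "Dom C (Zero C X Y) = X" "Cod C (Zero C X Y) = Y"
  using monoid.one_closed[of "homgrp C X Y"] hom_group[OF assms]
  by (auto simp: homgrp_def hom_iff comm_group_def comm_monoid_def)

lemma Add_Mor [simp]:
  assumes "f \<in> Mor C" "g \<in> Mor C" "Dom C f = Dom C g" "Cod C f = Cod C g"
  shows "f \<oplus> g \<in> Mor C" "Dom C (f \<oplus> g) = Dom C g" "Cod C (f \<oplus> g) = Cod C g"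
  using monoid.m_closed[of "homgrp C (Dom C g) (Cod C g)" f g] hom_comm_group[OF assms(2)] assms
  by (auto simp: homgrp_def hom_iff comm_group_def comm_monoid_def)

lemma Add_assoc:
  assumes "f \<in> Mor C" "g \<in> Mor C" "h \<in> Mor C"
    "Dom C f = Dom C h" "Cod C f = Cod C h" "Dom C g = Dom C h" "Cod C g = Cod C h"
  shows "f \<oplus> g \<oplus> h = f \<oplus> (g \<oplus> h)"
  using monoid.m_assoc[of "homgrp C (Dom C h) (Cod C h)" f g h] hom_comm_group[OF assms(3)] assms
  by (auto simp: homgrp_def hom_iff comm_group_def comm_monoid_def)

lemma Add_comm:
  assumes "f \<in> Mor C" "g \<in> Mor C" "Dom C f = Dom C g" "Cod C f = Cod C g"
  shows "f \<oplus> g = g \<oplus> f"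
  using comm_monoid.m_comm[of "homgrp C (Dom C g) (Cod C g)" f g] hom_comm_group[OF assms(2)] assms
  by (auto simp: homgrp_def hom_iff comm_group_def comm_monoid_def)

lemma Add_left_comm:
  assumes "f \<in> Mor C" "g \<in> Mor C" "h \<in> Mor C"
    "Dom C f = Dom C h" "Cod C f = Cod C h" "Dom C g = Dom C h" "Cod C g = Cod C h"
  shows "f \<oplus> (g \<oplus> h) = g \<oplus> (f \<oplus> h)"
  using assms Add_assoc[of f g h] Add_assoc[of g f h] Add_comm[of f g] by simp

lemma Add_Zero [simp]: "f \<in> Mor C \<Longrightarrow> Dom C f = X \<Longrightarrow> Cod C f = Y \<Longrightarrow> f \<oplus> Zero C X Y = f"
  using monoid.r_one[of "homgrp C (Dom C f) (Cod C f)" f] hom_comm_group[of f]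
  by (auto simp: homgrp_def hom_iff comm_group_def comm_monoid_def)

lemma Zero_Add [simp]: "f \<in> Mor C \<Longrightarrow> Dom C f = X \<Longrightarrow> Cod C f = Y \<Longrightarrow> Zero C X Y \<oplus> f = f"
  using monoid.l_one[of "homgrp C (Dom C f) (Cod C f)" f] hom_comm_group[of f]
  by (auto simp: homgrp_def hom_iff comm_group_def comm_monoid_def)

lemma neg_Mor [simp]:
  assumes "f \<in> Mor C"
  shows "neg C f \<in> Mor C" "Dom C (neg C f) = Dom C f" "Cod C (neg C f) = Cod C f"
  using group.inv_closed[of "homgrp C (Dom C f) (Cod C f)" f] hom_comm_group[OF assms] assms
  by (auto simp: homgrp_def hom_iff comm_group_def neg_def)

lemma Add_neg [simp]: "f \<in> Mor C \<Longrightarrow> f \<oplus> neg C f = Zero C (Dom C f) (Cod C f)"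
  using group.r_inv[of "homgrp C (Dom C f) (Cod C f)" f] hom_comm_group[of f]
  by (auto simp: homgrp_def hom_iff comm_group_def neg_def)

lemma neg_Add [simp]: "f \<in> Mor C \<Longrightarrow> neg C f \<oplus> f = Zero C (Dom C f) (Cod C f)"
  using Add_comm[of "neg C f" f] by simp

lemma neg_cancel [simp]:
  assumes "f \<in> Mor C" "g \<in> Mor C" "Dom C f = Dom C g" "Cod C f = Cod C g"
  shows "f \<oplus> (neg C f \<oplus> g) = g" "neg C f \<oplus> (f \<oplus> g) = g"
    "g \<oplus> f \<oplus> neg C f = g" "g \<oplus> neg C f \<oplus> f = g"
  using assms Add_assoc[of f "neg C f" g] Add_assoc[of "neg C f" f g]
    Add_assoc[of g f "neg C f"] Add_assoc[of g "neg C f" f]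
  by simp_all

lemma distrib [simp]:
  "f \<in> Mor C \<Longrightarrow> f' \<in> Mor C \<Longrightarrow> g \<in> Mor C \<Longrightarrow> Dom C f = Dom C f' \<Longrightarrow> Cod C f = Cod C f'
    \<Longrightarrow> Cod C f' = Dom C g \<Longrightarrow> g \<odot> (f \<oplus> f') = g \<odot> f \<oplus> g \<odot> f'"
  "f \<in> Mor C \<Longrightarrow> g \<in> Mor C \<Longrightarrow> g' \<in> Mor C \<Longrightarrow> Dom C g = Dom C g' \<Longrightarrow> Cod C g = Cod C g'
    \<Longrightarrow> Cod C f = Dom C g' \<Longrightarrow> (g \<oplus> g') \<odot> f = g \<odot> f \<oplus> g' \<odot> f"
  using Cmp_Add Add_Cmp by (auto simp: hom_iff)

lemma idem_zero: "f \<in> Mor C \<Longrightarrow> f \<oplus> f = f \<Longrightarrow> f = Zero C (Dom C f) (Cod C f)"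
  using neg_cancel(2)[of f f] by simp

text \<open>Bilinearity is the only link between composition and zero: the composite equals its own
  double, and zero is the only such arrow.\<close>

lemma Cmp_Zero [simp]:
  assumes "g \<in> Mor C" "Dom C g = Y" "X \<in> Ob C"
  shows "g \<odot> Zero C X Y = Zero C X (Cod C g)"
proof -
  have Y: "Y \<in> Ob C" using assms by auto
  have "g \<odot> Zero C X Y = g \<odot> (Zero C X Y \<oplus> Zero C X Y)" using assms Y by simp
  also have "\<dots> = g \<odot> Zero C X Y \<oplus> g \<odot> Zero C X Y"
    using assms Y by (subst distrib) simp_all
  finally show ?thesis using idem_zero[of "g \<odot> Zero C X Y"] assms Y by simp
qed

lemma Zero_Cmp [simp]:
  assumes "g \<in> Mor C" "Cod C g = X" "Y \<in> Ob C"
  shows "Zero C X Y \<odot> g = Zero C (Dom C g) Y"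
  using preadditive_category.Cmp_Zero[OF preadditive_opcat, of g X Y] assms by simp

text \<open>Composites are normalised to the right by \<open>assoc\<close>, and in
  \<open>g (f h)\<close> the product \<open>g f\<close> is no longer visible to rewriting. This
  form, and \<open>comp_square\<close> for two equal products, applies an equation at the head of
  such a composite.\<close>

lemma comp_reassoc:
  "g \<odot> f = k \<Longrightarrow> f \<in> Mor C \<Longrightarrow> g \<in> Mor C \<Longrightarrow> h \<in> Mor C \<Longrightarrow> Cod C f = Dom C g \<Longrightarrow> Cod C h = Dom C f
    \<Longrightarrow> g \<odot> (f \<odot> h) = k \<odot> h"
  using assoc[of h f g] by simp

lemma comp_square:
  "g \<odot> f = g' \<odot> f' \<Longrightarrow> f \<in> Mor C \<Longrightarrow> g \<in> Mor C \<Longrightarrow> f' \<in> Mor C \<Longrightarrow> g' \<in> Mor C \<Longrightarrow> h \<in> Mor C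
    \<Longrightarrow> Cod C f = Dom C g \<Longrightarrow> Cod C f' = Dom C g' \<Longrightarrow> Cod C h = Dom C f \<Longrightarrow> Cod C h = Dom C f'
    \<Longrightarrow> g \<odot> (f \<odot> h) = g' \<odot> (f' \<odot> h)"
  using assoc[of h f g] assoc[of h f' g'] by simp

lemma Cmp_eq_Zero:
  assumes "g \<odot> f = Zero C (Dom C f) (Cod C g)" "f \<in> Mor C" "g \<in> Mor C" "h \<in> Mor C"
    "Cod C f = Dom C g" "Cod C h = Dom C f"
  shows "g \<odot> (f \<odot> h) = Zero C (Dom C h) (Cod C g)"
proof -
  have "g \<odot> (f \<odot> h) = (g \<odot> f) \<odot> h" using assms(2-) by (simp add: assoc)
  then show ?thesis unfolding assms(1) using assms(2-) by simp
qed

lemma neg_unique: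
  assumes "f \<in> Mor C" "g \<in> Mor C" "Dom C f = Dom C g" "Cod C f = Cod C g"
    "f \<oplus> g = Zero C (Dom C g) (Cod C g)"
  shows "g = neg C f"
  using assms neg_cancel(2)[of f g] by simp

lemma neg_Zero [simp]: "X \<in> Ob C \<Longrightarrow> Y \<in> Ob C \<Longrightarrow> neg C (Zero C X Y) = Zero C X Y"
  using neg_unique[of "Zero C X Y" "Zero C X Y"] by simp

lemma Cmp_neg [simp]:
  "f \<in> Mor C \<Longrightarrow> g \<in> Mor C \<Longrightarrow> Cod C f = Dom C g \<Longrightarrow> g \<odot> neg C f = neg C (g \<odot> f)"
  "f \<in> Mor C \<Longrightarrow> g \<in> Mor C \<Longrightarrow> Cod C f = Dom C g \<Longrightarrow> neg C g \<odot> f = neg C (g \<odot> f)"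
proof -
  assume *: "f \<in> Mor C" "g \<in> Mor C" "Cod C f = Dom C g"
  have "g \<odot> (f \<oplus> neg C f) = g \<odot> f \<oplus> g \<odot> neg C f" "(g \<oplus> neg C g) \<odot> f = g \<odot> f \<oplus> neg C g \<odot> f"
    using * by (subst distrib, simp_all del: Add_neg)+
  then show "g \<odot> neg C f = neg C (g \<odot> f)" "neg C g \<odot> f = neg C (g \<odot> f)"
    using * by (auto intro!: neg_unique)
qed

lemma minus_eq_Zero:
  assumes "f \<in> Mor C" "g \<in> Mor C" "Dom C f = Dom C g" "Cod C f = Cod C g"
  shows "f \<oplus> neg C g = Zero C (Dom C g) (Cod C g) \<longleftrightarrow> f = g"
  using assms neg_cancel(4)[of g f] by (metis Add_neg Zero_Add)

text \<open>Two arrows with equal composites may be replaced by their difference, so only arrows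
  with composite zero have to be tested.\<close>

lemma mono_arrow_iff:
  "mono_arrow C f \<longleftrightarrow> f \<in> Mor C \<and>
     (\<forall>g \<in> Mor C. Cod C g = Dom C f \<longrightarrow> f \<odot> g = Zero C (Dom C g) (Cod C f) \<longrightarrow>
        g = Zero C (Dom C g) (Dom C f))"
proof (intro iffI conjI ballI impI)
  fix g assume *: "mono_arrow C f" "g \<in> Mor C" "Cod C g = Dom C f"
    "f \<odot> g = Zero C (Dom C g) (Cod C f)"
  then have f: "f \<in> Mor C" by (simp add: mono_arrow_def)
  moreover have "Zero C (Dom C g) (Dom C f) \<in> Mor C" using f * by simp
  ultimately show "g = Zero C (Dom C g) (Dom C f)" using * unfolding mono_arrow_def
    by (metis Cmp_Zero Dom_Ob Zero_Mor)
next
  assume *: "f \<in> Mor C \<and> (\<forall>g \<in> Mor C. Cod C g = Dom C f \<longrightarrow>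
     f \<odot> g = Zero C (Dom C g) (Cod C f) \<longrightarrow> g = Zero C (Dom C g) (Dom C f))"
  then have f: "f \<in> Mor C" by simp
  show "mono_arrow C f" unfolding mono_arrow_def
  proof (intro conjI ballI impI f)
    fix g h assume g: "g \<in> Mor C" "h \<in> Mor C" "Dom C g = Dom C h" "Cod C g = Dom C f"
      "Cod C h = Dom C f" "f \<odot> g = f \<odot> h"
    have "f \<odot> (g \<oplus> neg C h) = Zero C (Dom C (g \<oplus> neg C h)) (Cod C f)" using g f by simp
    moreover have "g \<oplus> neg C h \<in> Mor C" "Cod C (g \<oplus> neg C h) = Dom C f" using g by simp_all
    ultimately have "g \<oplus> neg C h = Zero C (Dom C (g \<oplus> neg C h)) (Dom C f)" using * by blast
    then show "g = h" using g minus_eq_Zero[of g h] by simp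
  qed
qed (simp add: mono_arrow_def)

lemma mono_zero:
  "mono_arrow C f \<Longrightarrow> g \<in> Mor C \<Longrightarrow> Cod C g = Dom C f \<Longrightarrow> f \<odot> g = Zero C (Dom C g) (Cod C f)
    \<Longrightarrow> g = Zero C (Dom C g) (Dom C f)"
  by (simp add: mono_arrow_iff)

lemma is_kernelD:
  assumes "is_kernel C k g"
  shows "k \<in> Mor C" "g \<in> Mor C" "Cod C k = Dom C g" "g \<odot> k = Zero C (Dom C k) (Cod C g)"
  using assms by (auto simp: is_kernel_def)

lemma is_kernel_lift:
  assumes "is_kernel C k g" "h \<in> Mor C" "Cod C h = Dom C g" "g \<odot> h = Zero C (Dom C h) (Cod C g)"
  obtains u where "u \<in> Mor C" "Dom C u = Dom C h" "Cod C u = Dom C k" "k \<odot> u = h"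
  using assms unfolding is_kernel_def hom_iff by blast

lemma is_kernel_ex:
  assumes "is_kernel C k g" "h \<in> Mor C" "Cod C h = Dom C g" "g \<odot> h = Zero C (Dom C h) (Cod C g)"
  shows "\<exists>u \<in> homset C (Dom C h) (Dom C k). k \<odot> u = h"
  using assms unfolding is_kernel_def by blast

text \<open>The zero arrow lifts through \<open>k\<close> as zero, and lifts are unique, so no other
  arrow composes with \<open>k\<close> to zero.\<close>

lemma is_kernel_mono: assumes "is_kernel C k g" shows "mono_arrow C k"
  unfolding mono_arrow_iff
proof (intro conjI ballI impI)
  note K = is_kernelD[OF assms]
  show "k \<in> Mor C" by fact
  fix u assume u: "u \<in> Mor C" "Cod C u = Dom C k" "k \<odot> u = Zero C (Dom C u) (Cod C k)"
  have "Zero C (Dom C u) (Dom C g) \<in> Mor C" "Dom C (Zero C (Dom C u) (Dom C g)) = Dom C u"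
    "Cod C (Zero C (Dom C u) (Dom C g)) = Dom C g"
    "g \<odot> Zero C (Dom C u) (Dom C g) = Zero C (Dom C u) (Cod C g)"
    using K(2) u(1) by simp_all
  then have "\<exists>!v. v \<in> homset C (Dom C u) (Dom C k) \<and> k \<odot> v = Zero C (Dom C u) (Dom C g)"
    using assms unfolding is_kernel_def by metis
  moreover have "k \<odot> Zero C (Dom C u) (Dom C k) = Zero C (Dom C u) (Dom C g)"
      "Zero C (Dom C u) (Dom C k) \<in> homset C (Dom C u) (Dom C k)"
    using K u by (simp_all add: hom_iff)
  moreover have "u \<in> homset C (Dom C u) (Dom C k)" "k \<odot> u = Zero C (Dom C u) (Dom C g)"
    using u K by (simp_all add: hom_iff)
  ultimately show "u = Zero C (Dom C u) (Dom C k)" by blast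
qed

lemma is_kernelI:
  assumes "mono_arrow C k" "g \<in> Mor C" "Cod C k = Dom C g" "g \<odot> k = Zero C (Dom C k) (Cod C g)"
    and "\<And>h. h \<in> Mor C \<Longrightarrow> Cod C h = Dom C g \<Longrightarrow> g \<odot> h = Zero C (Dom C h) (Cod C g) \<Longrightarrow>
      \<exists>u \<in> homset C (Dom C h) (Dom C k). k \<odot> u = h"
  shows "is_kernel C k g"
proof -
  have "u = v" if "u \<in> homset C X (Dom C k)" "v \<in> homset C X (Dom C k)" "k \<odot> u = k \<odot> v" for u v X
    using assms(1) that by (auto simp: mono_arrow_def hom_iff)
  then show ?thesis unfolding is_kernel_def using assms by (metis mono_arrow_def)
qed

lemma monoD:
  "mono_arrow C f \<Longrightarrow> g \<in> Mor C \<Longrightarrow> h \<in> Mor C \<Longrightarrow> Dom C g = Dom C h \<Longrightarrow> Cod C g = Dom C f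
    \<Longrightarrow> Cod C h = Dom C f \<Longrightarrow> f \<odot> g = f \<odot> h \<Longrightarrow> g = h"
  by (simp add: mono_arrow_def)

lemma mono_comp:
  assumes "mono_arrow C f" "mono_arrow C g" "Cod C f = Dom C g"
  shows "mono_arrow C (g \<odot> f)"
  unfolding mono_arrow_iff
proof (intro conjI ballI impI)
  have fg: "f \<in> Mor C" "g \<in> Mor C" using assms by (simp_all add: mono_arrow_iff)
  show "g \<odot> f \<in> Mor C" using fg assms by simp
  fix h assume h: "h \<in> Mor C" "Cod C h = Dom C (g \<odot> f)"
    "(g \<odot> f) \<odot> h = Zero C (Dom C h) (Cod C (g \<odot> f))"
  then have "g \<odot> (f \<odot> h) = Zero C (Dom C h) (Cod C g)" using fg assms(3) by (simp add: assoc)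
  then have "f \<odot> h = Zero C (Dom C h) (Cod C f)"
    using mono_zero[OF assms(2), of "f \<odot> h"] h fg assms(3) by simp
  then show "h = Zero C (Dom C h) (Dom C (g \<odot> f))"
    using mono_zero[OF assms(1), of h] h fg assms(3) by simp
qed

lemma mono_cancel:
  assumes "mono_arrow C (g \<odot> f)" "f \<in> Mor C" "g \<in> Mor C" "Cod C f = Dom C g"
  shows "mono_arrow C f"
  unfolding mono_arrow_iff
proof (intro conjI ballI impI)
  fix h assume h: "h \<in> Mor C" "Cod C h = Dom C f" "f \<odot> h = Zero C (Dom C h) (Cod C f)"
  have "g \<odot> (f \<odot> h) = Zero C (Dom C h) (Cod C g)" unfolding h(3) using assms(2-) h(1) by simp
  then show "h = Zero C (Dom C h) (Dom C f)"
    using mono_zero[OF assms(1), of h] h(1,2) assms(2-) by (simp add: assoc)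
qed (rule assms)

lemma iso_mono: assumes "iso_arrow C f" shows "mono_arrow C f"
proof -
  obtain g where g: "f \<in> Mor C" "g \<in> homset C (Cod C f) (Dom C f)" "g \<odot> f = Id C (Dom C f)"
    using assms by (auto simp: iso_arrow_def)
  show ?thesis unfolding mono_arrow_def
  proof (intro conjI ballI impI)
    fix h k assume *: "h \<in> Mor C" "k \<in> Mor C" "Cod C h = Dom C f" "Cod C k = Dom C f"
      "f \<odot> h = f \<odot> k"
    have "(g \<odot> f) \<odot> h = (g \<odot> f) \<odot> k" using * g(1,2) by (simp add: assoc hom_iff)
    then show "h = k" using * g(3) by simp
  qed (use g in simp)
qed

lemma iso_opcat [simp]: "iso_arrow (opcat C) f \<longleftrightarrow> iso_arrow C f"
  by (auto simp: iso_arrow_def)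

lemma Id_iso [simp]: "X \<in> Ob C \<Longrightarrow> iso_arrow C (Id C X)"
  unfolding iso_arrow_def by (auto simp: hom_iff intro!: bexI[of _ "Id C X"])

end

lemma epi_opcat [simp]: "epi_arrow (opcat C) f \<longleftrightarrow> mono_arrow C f"
  and mono_opcat [simp]: "mono_arrow (opcat C) f \<longleftrightarrow> epi_arrow C f"
  by (simp_all add: epi_arrow_def)

lemma is_kernel_opcat [simp]: "is_kernel (opcat C) c f \<longleftrightarrow> is_cokernel C c f"
  and is_cokernel_opcat [simp]: "is_cokernel (opcat C) c f \<longleftrightarrow> is_kernel C c f"
  by (simp_all add: is_cokernel_def)

lemma kernel_cokernel_pair_opcat [simp]:
  "kernel_cokernel_pair (opcat C) p i \<longleftrightarrow> kernel_cokernel_pair C i p"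
  by (auto simp: kernel_cokernel_pair_def)

lemma is_pullback_opcat [simp]: "is_pullback (opcat C) f g p q \<longleftrightarrow> is_pushout C f g p q"
  and is_pushout_opcat [simp]: "is_pushout (opcat C) f g p q \<longleftrightarrow> is_pullback C f g p q"
  by (simp_all add: is_pushout_def)

context preadditive_category
begin

text \<open>Dual facts are the facts for \<open>opcat C\<close>, translated back by the simp rules
  above; only one half of each dual pair needs a proof of its own.\<close>

lemmas epi_arrow_iff =
  preadditive_category.mono_arrow_iff[OF preadditive_opcat, simplified]
lemmas epi_zero = preadditive_category.mono_zero[OF preadditive_opcat, simplified]
lemmas is_cokernelD = preadditive_category.is_kernelD[OF preadditive_opcat, simplified]
lemmas is_cokernel_ex = preadditive_category.is_kernel_ex[OF preadditive_opcat, simplified]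
lemmas is_cokernel_desc = preadditive_category.is_kernel_lift[OF preadditive_opcat, simplified]
lemmas is_cokernel_epi = preadditive_category.is_kernel_mono[OF preadditive_opcat, simplified]
lemmas is_cokernelI = preadditive_category.is_kernelI[OF preadditive_opcat, simplified]
lemmas epiD = preadditive_category.monoD[OF preadditive_opcat, simplified]
lemmas epi_comp = preadditive_category.mono_comp[OF preadditive_opcat, simplified]
lemmas epi_cancel = preadditive_category.mono_cancel[OF preadditive_opcat, simplified]
lemmas iso_epi = preadditive_category.iso_mono[OF preadditive_opcat, simplified]

end

lemma (in preadditive_category) biproductE:
  assumes "is_biproduct C X Y B"
  obtains i j r s where "X \<in> Ob C" "Y \<in> Ob C" "B \<in> Ob C"
    "i \<in> Mor C" "Dom C i = X" "Cod C i = B" "j \<in> Mor C" "Dom C j = Y" "Cod C j = B"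
    "r \<in> Mor C" "Dom C r = B" "Cod C r = X" "s \<in> Mor C" "Dom C s = B" "Cod C s = Y"
    "r \<odot> i = Id C X" "s \<odot> j = Id C Y" "r \<odot> j = Zero C Y X" "s \<odot> i = Zero C X Y"
    "(i \<odot> r) \<oplus> (j \<odot> s) = Id C B"
  using assms unfolding is_biproduct_def hom_iff Bex_def by (elim conjE exE) (rule that; assumption)

section \<open>Normality, image factorization and pullbacks in an abelian category\<close>

context abelian_category
begin

abbreviation composite (infixl "\<odot>" 70) where "g \<odot> f \<equiv> g \<cdot>\<^bsub>A\<^esub> f"
abbreviation sum_arrow (infixl "\<oplus>" 65) where "f \<oplus> g \<equiv> Add A f g"

lemma abelian_opcat: "abelian_category (opcat A)"
proof -
  have "is_zero_object (opcat A) Z" if "is_zero_object A Z" for Z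
    using that by (auto simp: is_zero_object_def)
  moreover have "is_biproduct (opcat A) X Y P" if bp: "is_biproduct A X Y P" for X Y P
  proof -
    obtain i j p q where *: "X \<in> Ob A" "Y \<in> Ob A" "P \<in> Ob A"
      "i \<in> Mor A" "Dom A i = X" "Cod A i = P" "j \<in> Mor A" "Dom A j = Y" "Cod A j = P"
      "p \<in> Mor A" "Dom A p = P" "Cod A p = X" "q \<in> Mor A" "Dom A q = P" "Cod A q = Y"
      "p \<odot> i = Id A X" "q \<odot> j = Id A Y" "p \<odot> j = Zero A Y X" "q \<odot> i = Zero A X Y"
      "(i \<odot> p) \<oplus> (j \<odot> q) = Id A P"
      by (rule biproductE[OF bp])
    show ?thesis unfolding is_biproduct_def
      by (intro conjI bexI[of _ p] bexI[of _ q] bexI[of _ i] bexI[of _ j]) (simp_all add: * hom_iff)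
  qed
  ultimately have "\<exists>Z. is_zero_object (opcat A) Z"
    "X \<in> Ob A \<Longrightarrow> Y \<in> Ob A \<Longrightarrow> \<exists>P. is_biproduct (opcat A) X Y P" for X Y
    using zero_object biproducts by (blast, metis)
  then show ?thesis
    by (intro abelian_category.intro abelian_category_axioms.intro preadditive_opcat)
      (simp_all add: kernels cokernels mono_normal epi_normal)
qed

text \<open>Normality makes \<open>p\<close> the cokernel of some \<open>g\<close>. As
  \<open>p g = 0\<close>, this \<open>g\<close> factors through \<open>k\<close>, so an arrow that
  vanishes on \<open>k\<close> vanishes on \<open>g\<close> and descends along
  \<open>p\<close>.\<close>

lemma epi_cokernel_kernel:
  assumes "epi_arrow A p" "is_kernel A k p"
  shows "is_cokernel A p k"
proof (rule is_cokernelI)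
  note K = is_kernelD[OF assms(2)]
  show "epi_arrow A p" "k \<in> Mor A" "Dom A p = Cod A k" "p \<odot> k = Zero A (Dom A k) (Cod A p)"
    using assms K by simp_all
  obtain g where g: "is_cokernel A p g" using epi_normal assms by blast
  note G = is_cokernelD[OF g]
  fix t assume t: "t \<in> Mor A" "Dom A t = Cod A k" "t \<odot> k = Zero A (Dom A k) (Cod A t)"
  obtain u where u: "u \<in> Mor A" "Dom A u = Dom A g" "Cod A u = Dom A k" "k \<odot> u = g"
    by (rule is_kernel_lift[OF assms(2), of g]) (use G in auto)
  have "t \<odot> g = Zero A (Dom A g) (Cod A t)" using Cmp_eq_Zero[OF t(3), of u] t u K by simp
  then show "\<exists>u \<in> homset A (Cod A p) (Cod A t). u \<odot> p = t"
    using is_cokernel_ex[OF g, of t] t K G by simp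
qed

lemmas mono_kernel_cokernel =
  abelian_category.epi_cokernel_kernel[OF abelian_opcat, simplified]

lemma kernel_pair_epi: "epi_arrow A p \<Longrightarrow> is_kernel A k p \<Longrightarrow> kernel_cokernel_pair A k p"
  by (simp add: kernel_cokernel_pair_def epi_cokernel_kernel)

text \<open>Being mono, \<open>f\<close> is the kernel of some \<open>g\<close>; being epi, it
  forces \<open>g = 0\<close>. Hence the identity factors through \<open>f\<close>, which gives a
  right inverse, and cancelling \<open>f\<close> on the left makes it two-sided.\<close>

lemma balanced:
  assumes "mono_arrow A f" "epi_arrow A f"
  shows "iso_arrow A f"
proof -
  obtain g where g: "is_kernel A f g" using mono_normal assms by blast
  note K = is_kernelD[OF g]
  have "g = Zero A (Dom A g) (Cod A g)"
    using assms(2) K unfolding epi_arrow_iff by simp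
  then have "g \<odot> Id A (Dom A g) = Zero A (Dom A (Id A (Dom A g))) (Cod A g)" using K by simp
  then obtain u where u: "u \<in> Mor A" "Dom A u = Dom A g" "Cod A u = Dom A f" "f \<odot> u = Id A (Dom A g)"
    using is_kernel_lift[OF g, of "Id A (Dom A g)"] K by auto
  have "f \<odot> (u \<odot> f) = f \<odot> Id A (Dom A f)" using u K assoc[of f u f] by simp
  then have "u \<odot> f = Id A (Dom A f)" using monoD[OF assms(1)] u K by simp
  then show ?thesis using u K by (auto simp: iso_arrow_def hom_iff intro!: bexI[of _ u])
qed

text \<open>Take \<open>p\<close> as the cokernel of the kernel of \<open>f\<close>, and
  \<open>i\<close> as the induced arrow. The last clause is kept because it later puts
  \<open>p\<close> into any class of arrows that contains \<open>f\<close> and is closed under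
  kernels and cokernels.\<close>

lemma image_factorization:
  assumes "f \<in> Mor A"
  obtains p i where "epi_arrow A p" "mono_arrow A i" "Cod A p = Dom A i" "f = i \<odot> p"
    "\<And>k. is_kernel A k f \<Longrightarrow> is_cokernel A p k"
proof -
  obtain k where k: "is_kernel A k f" using kernels assms by blast
  note K = is_kernelD[OF k]
  obtain p where p: "is_cokernel A p k" using cokernels K by blast
  note P = is_cokernelD[OF p]
  obtain i where i: "i \<in> Mor A" "Dom A i = Cod A p" "Cod A i = Cod A f" "i \<odot> p = f"
    using is_cokernel_desc[OF p, of f] K by auto
  have "mono_arrow A i" unfolding mono_arrow_iff
  proof (intro conjI ballI impI)
    fix t assume t: "t \<in> Mor A" "Cod A t = Dom A i" "i \<odot> t = Zero A (Dom A t) (Cod A i)"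
    \<comment> \<open>Dividing out \<open>t\<close> changes nothing: \<open>q p\<close> is the
      cokernel of some \<open>l\<close>, and \<open>f l = 0\<close> puts \<open>l\<close> into the
      kernel of \<open>f\<close>, so \<open>p\<close> vanishes on \<open>l\<close> and factors
      through \<open>q p\<close>. Thus \<open>q\<close> has a left inverse, and
      \<open>q t = 0\<close> gives \<open>t = 0\<close>.\<close>
    obtain q where q: "is_cokernel A q t" using cokernels t by blast
    note Q = is_cokernelD[OF q]
    obtain i' where i': "i' \<in> Mor A" "Dom A i' = Cod A q" "Cod A i' = Cod A i" "i' \<odot> q = i"
      using is_cokernel_desc[OF q, of i] t i by auto
    have "epi_arrow A (q \<odot> p)"
      using epi_comp[OF is_cokernel_epi[OF q] is_cokernel_epi[OF p]] Q t i by simp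
    then obtain l where l: "is_cokernel A (q \<odot> p) l" using epi_normal by blast
    note L = is_cokernelD[OF l]
    have ty: "Cod A p = Dom A q" "Dom A (q \<odot> p) = Dom A p" "Cod A (q \<odot> p) = Cod A q"
      using Q P t i by simp_all
    have "i' \<odot> (q \<odot> p) = f" using i i' ty P Q by (simp flip: assoc)
    then have "f \<odot> l = i' \<odot> ((q \<odot> p) \<odot> l)"
      using assoc[of l "q \<odot> p" i'] i' L Q P ty by simp
    then have "f \<odot> l = Zero A (Dom A l) (Cod A f)" unfolding L(4) using L(1-3) ty i' i by simp
    then obtain l' where l': "l' \<in> Mor A" "Dom A l' = Dom A l" "Cod A l' = Dom A k" "k \<odot> l' = l"
      using is_kernel_lift[OF k, of l] L ty P K by auto
    have "p \<odot> l = Zero A (Dom A l) (Cod A p)" using Cmp_eq_Zero[OF P(4), of l'] l' P K by simp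
    then obtain r where r: "r \<in> Mor A" "Dom A r = Cod A q" "Cod A r = Cod A p" "r \<odot> (q \<odot> p) = p"
      using is_cokernel_desc[OF l, of p] L ty P by auto
    have "(r \<odot> q) \<odot> p = Id A (Cod A p) \<odot> p" using r ty P Q by (simp add: assoc)
    then have rq: "r \<odot> q = Id A (Cod A p)"
      using epiD[OF is_cokernel_epi[OF p], of "r \<odot> q" "Id A (Cod A p)"] r ty P Q by simp
    have "t = (r \<odot> q) \<odot> t" unfolding rq using t i by simp
    also have "\<dots> = r \<odot> (q \<odot> t)" using r ty Q t by (simp add: assoc)
    also have "\<dots> = Zero A (Dom A t) (Dom A i)" unfolding Q(4) using r ty(1) Q(1) t(1) i(2) by simp
    finally show "t = Zero A (Dom A t) (Dom A i)" .
  qed (rule i)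
  \<comment> \<open>As \<open>i\<close> is mono, a kernel of \<open>f\<close> is also a kernel of
    \<open>p\<close>.\<close>
  moreover have "is_cokernel A p k'" if k': "is_kernel A k' f" for k'
  proof (rule epi_cokernel_kernel[OF is_cokernel_epi[OF p]], rule is_kernelI)
    note K' = is_kernelD[OF k']
    show "mono_arrow A k'" by (rule is_kernel_mono[OF k'])
    show "p \<in> Mor A" "Cod A k' = Dom A p" using P K K' by simp_all
    have "i \<odot> (p \<odot> k') = Zero A (Dom A k') (Cod A i)" using i K' P K by (simp flip: assoc)
    then show "p \<odot> k' = Zero A (Dom A k') (Cod A p)"
      using mono_zero[OF \<open>mono_arrow A i\<close>, of "p \<odot> k'"] i K K' P by simp
    fix h assume h: "h \<in> Mor A" "Cod A h = Dom A p" "p \<odot> h = Zero A (Dom A h) (Cod A p)"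
    have "f \<odot> h = i \<odot> (p \<odot> h)" using comp_reassoc[OF i(4), of h] i h P K by simp
    also have "\<dots> = Zero A (Dom A h) (Cod A f)" unfolding h(3) using h(1,2) i by simp
    finally have "f \<odot> h = Zero A (Dom A h) (Cod A f)" .
    then show "\<exists>u \<in> homset A (Dom A h) (Dom A k'). k' \<odot> u = h"
      using is_kernel_ex[OF k', of h] h P K by simp
  qed
  ultimately show ?thesis using that[of p i] is_cokernel_epi[OF p] i by auto
qed

text \<open>The pullback is the kernel of the difference of \<open>p\<close> and \<open>f\<close> on
  the biproduct of their domains. The clause on kernels serves the pullback of conflations: a kernel
  of \<open>p\<close> is \<open>q\<close> after a kernel of \<open>p'\<close>, and left cancellation
  can be applied to that composite.\<close>

lemma epi_pullback:
  assumes "epi_arrow A p" "f \<in> Mor A" "Cod A f = Cod A p"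
  obtains p' q where "is_pullback A p f p' q" "epi_arrow A p'"
    "\<And>k. is_kernel A k p \<Longrightarrow> \<exists>k'. is_kernel A k' p' \<and> q \<odot> k' = k"
proof -
  have p: "p \<in> Mor A" using assms by (simp add: epi_arrow_iff)
  obtain B where "is_biproduct A (Dom A p) (Dom A f) B"
    using biproducts[OF Dom_Ob[OF p] Dom_Ob[OF assms(2)]] by blast
  then obtain i j r s where B: "B \<in> Ob A" "i \<in> Mor A" "Dom A i = Dom A p" "Cod A i = B"
      "j \<in> Mor A" "Dom A j = Dom A f" "Cod A j = B" "r \<in> Mor A" "Dom A r = B" "Cod A r = Dom A p"
      "s \<in> Mor A" "Dom A s = B" "Cod A s = Dom A f"
      "r \<odot> i = Id A (Dom A p)" "s \<odot> j = Id A (Dom A f)" "r \<odot> j = Zero A (Dom A f) (Dom A p)"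
      "s \<odot> i = Zero A (Dom A p) (Dom A f)" "(i \<odot> r) \<oplus> (j \<odot> s) = Id A B"
    by (rule biproductE)
  define m where "m = p \<odot> r \<oplus> neg A (f \<odot> s)"
  have m: "m \<in> Mor A" "Dom A m = B" "Cod A m = Cod A p" using B p assms by (simp_all add: m_def)
  have mi: "m \<odot> i = p" using B p assms by (simp add: m_def assoc)
  have epi_m: "epi_arrow A m" using epi_cancel[of m i] mi m assms B by simp
  obtain \<kappa> where \<kappa>: "is_kernel A \<kappa> m" using kernels m by blast
  note K = is_kernelD[OF \<kappa>]
  have cok: "is_cokernel A m \<kappa>" by (rule epi_cokernel_kernel[OF epi_m \<kappa>])
  define p' where "p' = s \<odot> \<kappa>"
  define q where "q = r \<odot> \<kappa>"
  have ty: "p' \<in> Mor A" "q \<in> Mor A" "Dom A p' = Dom A \<kappa>" "Dom A q = Dom A \<kappa>"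
     "Cod A p' = Dom A f" "Cod A q = Dom A p"
    using B K m by (simp_all add: p'_def q_def)
  have "m \<odot> \<kappa> = p \<odot> q \<oplus> neg A (f \<odot> p')"
    using B K m p assms by (simp add: m_def p'_def q_def assoc)
  then have comm: "p \<odot> q = f \<odot> p'"
    using K m minus_eq_Zero[of "p \<odot> q" "f \<odot> p'"] p ty assms by simp
  have mono_pq: "u = v" if "u \<in> Mor A" "v \<in> Mor A" "Dom A u = Dom A v" "Cod A u = Dom A \<kappa>"
    "Cod A v = Dom A \<kappa>" "p' \<odot> u = p' \<odot> v" "q \<odot> u = q \<odot> v" for u v
  proof -
    have e: "\<kappa> \<odot> w = i \<odot> (q \<odot> w) \<oplus> j \<odot> (p' \<odot> w)" if "w \<in> Mor A" "Cod A w = Dom A \<kappa>" for w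
    proof -
      have "\<kappa> \<odot> w = (i \<odot> r \<oplus> j \<odot> s) \<odot> (\<kappa> \<odot> w)" unfolding B using that K m by simp
      also have "\<dots> = i \<odot> (q \<odot> w) \<oplus> j \<odot> (p' \<odot> w)"
        using that K m B(1-13) by (simp add: q_def p'_def assoc)
      finally show ?thesis .
    qed
    have "\<kappa> \<odot> u = \<kappa> \<odot> v" using that e by metis
    then show ?thesis using monoD[OF is_kernel_mono[OF \<kappa>]] that by blast
  qed
  have ex: "\<exists>u \<in> homset A (Dom A x) (Dom A p'). p' \<odot> u = x \<and> q \<odot> u = y"
    if x: "x \<in> Mor A" "y \<in> Mor A" "Dom A x = Dom A y" "Cod A x = Dom A f"
      "Cod A y = Dom A p" "p \<odot> y = f \<odot> x" for x y
  proof -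
    define h where "h = i \<odot> y \<oplus> j \<odot> x"
    have h: "h \<in> Mor A" "Dom A h = Dom A x" "Cod A h = B" using x B by (simp_all add: h_def)
    have r: "r \<odot> h = (r \<odot> i) \<odot> y \<oplus> (r \<odot> j) \<odot> x" and s: "s \<odot> h = (s \<odot> i) \<odot> y \<oplus> (s \<odot> j) \<odot> x"
      using x B(1-13) by (simp_all add: h_def assoc)
    have rs: "r \<odot> h = y" "s \<odot> h = x" using r s x B p assms by simp_all
    have "m \<odot> h = p \<odot> (r \<odot> h) \<oplus> neg A (f \<odot> (s \<odot> h))"
      using B(1-13) h p assms by (simp add: m_def assoc)
    also have "\<dots> = Zero A (Dom A h) (Cod A m)" using rs x p assms h m by simp
    finally obtain u where u: "u \<in> Mor A" "Dom A u = Dom A h" "Cod A u = Dom A \<kappa>" "\<kappa> \<odot> u = h"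
      using is_kernel_lift[OF \<kappa>, of h] h m by auto
    then have "p' \<odot> u = s \<odot> h" "q \<odot> u = r \<odot> h" using B K m by (simp_all add: p'_def q_def assoc)
    then show ?thesis using rs u h ty by (auto simp: hom_iff intro!: bexI[of _ u])
  qed
  have pb: "is_pullback A p f p' q"
    unfolding is_pullback_def
  proof (intro conjI ballI impI)
    fix x y assume xy: "x \<in> Mor A" "y \<in> Mor A" "Dom A x = Dom A y" "Cod A x = Dom A f"
      "Cod A y = Dom A p" "p \<odot> y = f \<odot> x"
    obtain u where u: "u \<in> homset A (Dom A x) (Dom A p')" "p' \<odot> u = x" "q \<odot> u = y"
      using ex[OF xy] by blast
    show "\<exists>!u. u \<in> homset A (Dom A x) (Dom A p') \<and> p' \<odot> u = x \<and> q \<odot> u = y"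
    proof (rule ex1I[of _ u])
      fix v assume "v \<in> homset A (Dom A x) (Dom A p') \<and> p' \<odot> v = x \<and> q \<odot> v = y"
      then show "v = u" using mono_pq[of v u] u ty by (simp add: hom_iff)
    qed (use u in simp)
  qed (use p assms ty comm in simp_all)
  \<comment> \<open>If \<open>t p' = 0\<close>, then \<open>t s\<close> vanishes on
    \<open>\<kappa>\<close> and descends to \<open>t'\<close> along \<open>m\<close>. On the summand
    \<open>Dom p\<close> this reads \<open>t' p = 0\<close>, so \<open>t' = 0\<close>, and with it
    \<open>t s\<close> and \<open>t\<close> vanish.\<close>
  have epi: "epi_arrow A p'" unfolding epi_arrow_iff
  proof (intro conjI ballI impI)
    fix t assume t: "t \<in> Mor A" "Dom A t = Cod A p'" "t \<odot> p' = Zero A (Dom A p') (Cod A t)"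
    have ts: "t \<odot> s \<in> Mor A" "Dom A (t \<odot> s) = Cod A \<kappa>"
      "(t \<odot> s) \<odot> \<kappa> = Zero A (Dom A \<kappa>) (Cod A (t \<odot> s))"
      using t B K m ty by (simp_all add: p'_def assoc)
    obtain t' where
      t': "t' \<in> Mor A" "Dom A t' = Cod A m" "Cod A t' = Cod A (t \<odot> s)" "t' \<odot> m = t \<odot> s"
      by (rule is_cokernel_desc[OF cok ts])
    have "t' \<odot> p = (t \<odot> s) \<odot> i" using t' mi m B assoc[of i m t'] by simp
    also have "\<dots> = Zero A (Dom A p) (Cod A t')" using t B ty t' p by (simp add: assoc)
    finally have "t' = Zero A (Cod A p) (Cod A t')"
      using epi_zero[OF assms(1), of t'] t'(1,2) m by simp
    then have "t \<odot> s = Zero A B (Cod A t)" using t' m t B ty by (metis Cmp_Mor(3) Cod_Ob Zero_Cmp)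
    then have "(t \<odot> s) \<odot> j = Zero A (Dom A f) (Cod A t)" using t B by simp
    then show "t = Zero A (Cod A p') (Cod A t)" using t B(1-13) B(15) ty by (simp add: assoc)
  qed (rule ty)
  have ker: "\<exists>k'. is_kernel A k' p' \<and> q \<odot> k' = k" if k: "is_kernel A k p" for k
  proof -
    note K' = is_kernelD[OF k]
    obtain k' where k': "k' \<in> Mor A" "Dom A k' = Dom A k" "Cod A k' = Dom A p'"
      "p' \<odot> k' = Zero A (Dom A k) (Dom A f)" "q \<odot> k' = k"
      using ex[of "Zero A (Dom A k) (Dom A f)" k] K' assms p by (auto simp: hom_iff)
    have "is_kernel A k' p'"
    proof (rule is_kernelI)
      show "mono_arrow A k'"
        using mono_cancel[of q k'] k' ty is_kernel_mono[OF k] by simp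
      show "p' \<in> Mor A" "Cod A k' = Dom A p'" "p' \<odot> k' = Zero A (Dom A k') (Cod A p')"
        using ty k' by simp_all
      fix h assume h: "h \<in> Mor A" "Cod A h = Dom A p'" "p' \<odot> h = Zero A (Dom A h) (Cod A p')"
      have "p \<odot> (q \<odot> h) = f \<odot> (p' \<odot> h)"
        using comp_square[OF comm, of h] p ty h assms by simp
      also have "\<dots> = Zero A (Dom A (q \<odot> h)) (Cod A p)"
        unfolding h(3) using h(1,2) ty assms by simp
      finally have "p \<odot> (q \<odot> h) = Zero A (Dom A (q \<odot> h)) (Cod A p)" .
      then obtain v where v: "v \<in> Mor A" "Dom A v = Dom A h" "Cod A v = Dom A k" "k \<odot> v = q \<odot> h"
        using is_kernel_lift[OF k, of "q \<odot> h"] h ty by auto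
      have "k' \<odot> v = h"
      proof (rule mono_pq)
        show "p' \<odot> (k' \<odot> v) = p' \<odot> h" "q \<odot> (k' \<odot> v) = q \<odot> h"
          using comp_reassoc[OF k'(4), of v] comp_reassoc[OF k'(5), of v] k' v h ty K' assms
          by simp_all
      qed (use k' v h ty in simp_all)
      then show "\<exists>u \<in> homset A (Dom A h) (Dom A k'). k' \<odot> u = h"
        using v k' by (auto simp: hom_iff)
    qed
    then show ?thesis using k' by blast
  qed
  show ?thesis using that[OF pb epi ker] .
qed

end

section \<open>Presentations of functors\<close>

text \<open>
  By the Yoneda lemma a presentation of \<open>F\<close> by \<open>f\<close> is a generator \<open>e \<in> F (Cod f)\<close> whose relations are
  the arrows that factor through \<open>f\<close>.
\<close>

definition pres :: "('o, 'm) acat \<Rightarrow> 'm \<Rightarrow> ('o, 'm, 'g) afun \<Rightarrow> 'g \<Rightarrow> bool" where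
  "pres A f F e \<longleftrightarrow> f \<in> Mor A \<and> e \<in> carrier (FOb F (Cod A f)) \<and>
     (\<forall>W \<in> Ob A. \<forall>x \<in> carrier (FOb F W). \<exists>h \<in> homset A W (Cod A f). FMor F h e = x) \<and>
     (\<forall>h \<in> Mor A. Cod A h = Cod A f \<longrightarrow>
        (FMor F h e = \<one>\<^bsub>FOb F (Dom A h)\<^esub> \<longleftrightarrow> (\<exists>s \<in> homset A (Dom A h) (Dom A f). f \<cdot>\<^bsub>A\<^esub> s = h)))"

definition pointwise_surj ::
    "('o, 'm) acat \<Rightarrow> ('o, 'm, 'g) afun \<Rightarrow> ('o, 'm, 'h) afun \<Rightarrow> ('o \<Rightarrow> 'g \<Rightarrow> 'h) \<Rightarrow> bool" where
  "pointwise_surj A F G \<alpha> \<longleftrightarrow> (\<forall>W \<in> Ob A. \<forall>y \<in> carrier (FOb G W). \<exists>x \<in> carrier (FOb F W). \<alpha> W x = y)"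

text \<open>Kernels in \<open>modcat\<close> are identified with this exactness at every object by
  \<open>kernel_modcatI\<close> and \<open>kernel_modcatD\<close>, and surjectivity at every object
  plays the same part for epimorphisms. Later arguments about functors can therefore work with
  elements, without first making \<open>modcat\<close> an abelian category.\<close>

definition left_exact ::
    "('o, 'm) acat \<Rightarrow> ('o, 'm, 'g) afun \<Rightarrow> ('o, 'm, 'g) afun \<Rightarrow> ('o, 'm, 'g) afun \<Rightarrow>
     ('o \<Rightarrow> 'g \<Rightarrow> 'g) \<Rightarrow> ('o \<Rightarrow> 'g \<Rightarrow> 'g) \<Rightarrow> bool" where
  "left_exact A F G H \<alpha> \<beta> \<longleftrightarrow> nat_trans A F G \<alpha> \<and> nat_trans A G H \<beta> \<and>
     (\<forall>W \<in> Ob A. \<forall>x \<in> carrier (FOb F W). \<alpha> W x = \<one>\<^bsub>FOb G W\<^esub> \<longrightarrow> x = \<one>\<^bsub>FOb F W\<^esub>) \<and>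
     (\<forall>W \<in> Ob A. \<forall>y \<in> carrier (FOb G W).
        \<beta> W y = \<one>\<^bsub>FOb H W\<^esub> \<longleftrightarrow> (\<exists>x \<in> carrier (FOb F W). \<alpha> W x = y))"

lemma presD:
  assumes "pres A f F e"
  shows "f \<in> Mor A" "e \<in> carrier (FOb F (Cod A f))"
  using assms by (simp_all add: pres_def)

lemma pres_gen:
  assumes "pres A f F e" "W \<in> Ob A" "x \<in> carrier (FOb F W)"
  obtains h where "h \<in> Mor A" "Dom A h = W" "Cod A h = Cod A f" "FMor F h e = x"
proof -
  obtain h where "h \<in> homset A W (Cod A f)" "FMor F h e = x"
    using assms unfolding pres_def by blast
  then show ?thesis by (intro that[of h]) (simp_all add: hom_iff)
qed

lemma pres_rel:
  assumes "pres A f F e" "h \<in> Mor A" "Cod A h = Cod A f"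
  shows "FMor F h e = \<one>\<^bsub>FOb F (Dom A h)\<^esub> \<longleftrightarrow> (\<exists>s \<in> homset A (Dom A h) (Dom A f). f \<cdot>\<^bsub>A\<^esub> s = h)"
  using assms by (simp add: pres_def)

lemma pres_relE:
  assumes "pres A f F e" "h \<in> Mor A" "Cod A h = Cod A f" "FMor F h e = \<one>\<^bsub>FOb F (Dom A h)\<^esub>"
  obtains s where "s \<in> Mor A" "Dom A s = Dom A h" "Cod A s = Dom A f" "f \<cdot>\<^bsub>A\<^esub> s = h"
proof -
  obtain s where "s \<in> homset A (Dom A h) (Dom A f)" "f \<cdot>\<^bsub>A\<^esub> s = h"
    using assms(4) pres_rel[OF assms(1-3)] by blast
  then show ?thesis by (intro that[of s]) (simp_all add: hom_iff)
qed

lemma fp_additive: "finitely_presented A F \<Longrightarrow> additive_functor A F"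
  by (simp add: finitely_presented_def)

section \<open>Elementary calculus of additive functors, natural transformations and
  presentations\<close>

context preadditive_category
begin

lemma additive_functorD:
  assumes "additive_functor C F"
  shows "\<forall>X \<in> Ob C. comm_group (FOb F X)"
    "\<forall>f \<in> Mor C. FMor F f \<in> hom (FOb F (Cod C f)) (FOb F (Dom C f))"
    "\<forall>X \<in> Ob C. \<forall>x \<in> carrier (FOb F X). FMor F (Id C X) x = x"
    "\<forall>f \<in> Mor C. \<forall>g \<in> Mor C. Cod C f = Dom C g \<longrightarrow>
        (\<forall>x \<in> carrier (FOb F (Cod C g)). FMor F (g \<odot> f) x = FMor F f (FMor F g x))"
    "\<forall>f \<in> Mor C. \<forall>g \<in> Mor C. Dom C f = Dom C g \<longrightarrow> Cod C f = Cod C g \<longrightarrow>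
        (\<forall>x \<in> carrier (FOb F (Cod C f)).
           FMor F (f \<oplus> g) x = FMor F f x \<otimes>\<^bsub>FOb F (Dom C f)\<^esub> FMor F g x)"
  by (rule assms[unfolded additive_functor_def, THEN conjunct1]
      assms[unfolded additive_functor_def, THEN conjunct2, THEN conjunct1]
      assms[unfolded additive_functor_def, THEN conjunct2, THEN conjunct2, THEN conjunct1]
      assms[unfolded additive_functor_def, THEN conjunct2, THEN conjunct2, THEN conjunct2, THEN conjunct1]
      assms[unfolded additive_functor_def, THEN conjunct2, THEN conjunct2, THEN conjunct2, THEN conjunct2])+

lemma af_comm_group: "additive_functor C F \<Longrightarrow> X \<in> Ob C \<Longrightarrow> comm_group (FOb F X)"
  by (rule bspec[OF additive_functorD(1)])

lemma af_group: "additive_functor C F \<Longrightarrow> X \<in> Ob C \<Longrightarrow> group (FOb F X)"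
  by (rule comm_group.axioms(2)[OF af_comm_group])

lemma af_monoid: "additive_functor C F \<Longrightarrow> X \<in> Ob C \<Longrightarrow> monoid (FOb F X)"
  by (rule group.is_monoid[OF af_group])

lemma af_one_closed: "additive_functor C F \<Longrightarrow> X \<in> Ob C \<Longrightarrow> \<one>\<^bsub>FOb F X\<^esub> \<in> carrier (FOb F X)"
  by (rule monoid.one_closed[OF af_monoid])

lemma af_m_closed: "additive_functor C F \<Longrightarrow> X \<in> Ob C \<Longrightarrow> x \<in> carrier (FOb F X) \<Longrightarrow>
    y \<in> carrier (FOb F X) \<Longrightarrow> x \<otimes>\<^bsub>FOb F X\<^esub> y \<in> carrier (FOb F X)"
  by (rule monoid.m_closed[OF af_monoid])

lemma af_hom: "additive_functor C F \<Longrightarrow> f \<in> Mor C \<Longrightarrow> FMor F f \<in> hom (FOb F (Cod C f)) (FOb F (Dom C f))"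
  by (rule bspec[OF additive_functorD(2)])

lemma af_closed:
  assumes "additive_functor C F" "f \<in> Mor C" "Dom C f = X" "x \<in> carrier (FOb F (Cod C f))"
  shows "FMor F f x \<in> carrier (FOb F X)"
  using hom_in_carrier[OF af_hom[OF assms(1,2)] assms(4)] assms(3) by simp

lemma af_mult: "additive_functor C F \<Longrightarrow> f \<in> Mor C \<Longrightarrow> x \<in> carrier (FOb F (Cod C f)) \<Longrightarrow>
    y \<in> carrier (FOb F (Cod C f)) \<Longrightarrow>
    FMor F f (x \<otimes>\<^bsub>FOb F (Cod C f)\<^esub> y) = FMor F f x \<otimes>\<^bsub>FOb F (Dom C f)\<^esub> FMor F f y"
  by (rule hom_mult[OF af_hom])

lemma af_one:
  assumes "additive_functor C F" "f \<in> Mor C"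
  shows "FMor F f \<one>\<^bsub>FOb F (Cod C f)\<^esub> = \<one>\<^bsub>FOb F (Dom C f)\<^esub>"
  by (rule hom_one[OF af_hom[OF assms] af_group[OF assms(1)] af_group[OF assms(1)]])
    (simp_all add: assms(2))

lemma af_Id: "additive_functor C F \<Longrightarrow> X \<in> Ob C \<Longrightarrow> x \<in> carrier (FOb F X) \<Longrightarrow> FMor F (Id C X) x = x"
  by (rule bspec[OF bspec[OF additive_functorD(3)]])

lemma af_Cmp:
  assumes "additive_functor C F" "f \<in> Mor C" "g \<in> Mor C" "Cod C f = Dom C g"
    "x \<in> carrier (FOb F (Cod C g))"
  shows "FMor F (g \<odot> f) x = FMor F f (FMor F g x)"
  using additive_functorD(4)[OF assms(1), THEN bspec, OF assms(2), THEN bspec, OF assms(3)] assms(4,5)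
  by blast

lemma af_Add:
  assumes "additive_functor C F" "f \<in> Mor C" "g \<in> Mor C" "Dom C f = Dom C g"
    "Cod C f = Cod C g" "x \<in> carrier (FOb F (Cod C g))"
  shows "FMor F (f \<oplus> g) x = FMor F f x \<otimes>\<^bsub>FOb F (Dom C g)\<^esub> FMor F g x"
  using additive_functorD(5)[OF assms(1), THEN bspec, OF assms(2), THEN bspec, OF assms(3)] assms(4-6)
  by simp

lemma af_Zero:
  assumes "additive_functor C F" "X \<in> Ob C" "Y \<in> Ob C" "x \<in> carrier (FOb F Y)"
  shows "FMor F (Zero C X Y) x = \<one>\<^bsub>FOb F X\<^esub>"
proof -
  interpret G: group "FOb F X" using assms af_group by blast
  have c: "FMor F (Zero C X Y) x \<in> carrier (FOb F X)" using assms by (simp add: af_closed)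
  have "FMor F (Zero C X Y \<oplus> Zero C X Y) x = FMor F (Zero C X Y) x \<otimes>\<^bsub>FOb F X\<^esub> FMor F (Zero C X Y) x"
    using assms by (subst af_Add) simp_all
  then show ?thesis using c assms(2,3) by simp
qed

lemma af_neg:
  assumes "additive_functor C F" "f \<in> Mor C" "x \<in> carrier (FOb F (Cod C f))"
  shows "FMor F (neg C f) x = inv\<^bsub>FOb F (Dom C f)\<^esub> FMor F f x"
proof -
  interpret G: group "FOb F (Dom C f)" using af_group[OF assms(1)] assms(2) by simp
  have "FMor F (neg C f \<oplus> f) x = FMor F (neg C f) x \<otimes>\<^bsub>FOb F (Dom C f)\<^esub> FMor F f x"
    using assms by (subst af_Add) simp_all
  then have "FMor F (neg C f) x \<otimes>\<^bsub>FOb F (Dom C f)\<^esub> FMor F f x = \<one>\<^bsub>FOb F (Dom C f)\<^esub>"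
    using assms by (simp add: af_Zero)
  then show ?thesis using assms by (intro G.inv_equality[symmetric]) (simp_all add: af_closed)
qed

lemma hom_functor_simps [simp]:
  "FOb (hom_functor C Y) X = homgrp C X Y" "FMor (hom_functor C Y) f g = g \<odot> f"
  "carrier (homgrp C X Y) = homset C X Y" "\<one>\<^bsub>homgrp C X Y\<^esub> = Zero C X Y"
  "f \<otimes>\<^bsub>homgrp C X Y\<^esub> g = f \<oplus> g"
  by (simp_all add: hom_functor_def homgrp_def)

lemma additive_hom_functor:
  assumes "Y \<in> Ob C" shows "additive_functor C (hom_functor C Y)"
  unfolding additive_functor_def
  using assms by (auto simp: hom_iff hom_group assoc intro!: homI)

lemma nt_hom: "nat_trans C F G \<alpha> \<Longrightarrow> X \<in> Ob C \<Longrightarrow> \<alpha> X \<in> hom (FOb F X) (FOb G X)"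
  by (simp only: nat_trans_def)

lemma nt_closed: "nat_trans C F G \<alpha> \<Longrightarrow> X \<in> Ob C \<Longrightarrow> x \<in> carrier (FOb F X) \<Longrightarrow> \<alpha> X x \<in> carrier (FOb G X)"
  by (rule hom_in_carrier[OF nt_hom])

lemma nt_mult: "nat_trans C F G \<alpha> \<Longrightarrow> X \<in> Ob C \<Longrightarrow> x \<in> carrier (FOb F X) \<Longrightarrow> y \<in> carrier (FOb F X) \<Longrightarrow>
   \<alpha> X (x \<otimes>\<^bsub>FOb F X\<^esub> y) = \<alpha> X x \<otimes>\<^bsub>FOb G X\<^esub> \<alpha> X y"
  by (rule hom_mult[OF nt_hom])

lemma nt_one:
  "nat_trans C F G \<alpha> \<Longrightarrow> additive_functor C F \<Longrightarrow> additive_functor C G \<Longrightarrow> X \<in> Ob C \<Longrightarrow>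
   \<alpha> X \<one>\<^bsub>FOb F X\<^esub> = \<one>\<^bsub>FOb G X\<^esub>"
  by (rule hom_one[OF nt_hom af_group af_group])

lemma nt_nat: "nat_trans C F G \<alpha> \<Longrightarrow> f \<in> Mor C \<Longrightarrow> Dom C f = X \<Longrightarrow>
   x \<in> carrier (FOb F (Cod C f)) \<Longrightarrow> \<alpha> X (FMor F f x) = FMor G f (\<alpha> (Cod C f) x)"
  by (simp only: nat_trans_def) blast

lemma nat_transI:
  assumes "\<And>X x. X \<in> Ob C \<Longrightarrow> x \<in> carrier (FOb F X) \<Longrightarrow> \<alpha> X x \<in> carrier (FOb G X)"
    and "\<And>X x y. X \<in> Ob C \<Longrightarrow> x \<in> carrier (FOb F X) \<Longrightarrow> y \<in> carrier (FOb F X) \<Longrightarrow>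
      \<alpha> X (x \<otimes>\<^bsub>FOb F X\<^esub> y) = \<alpha> X x \<otimes>\<^bsub>FOb G X\<^esub> \<alpha> X y"
    and "\<And>f x. f \<in> Mor C \<Longrightarrow> x \<in> carrier (FOb F (Cod C f)) \<Longrightarrow>
      \<alpha> (Dom C f) (FMor F f x) = FMor G f (\<alpha> (Cod C f) x)"
  shows "nat_trans C F G \<alpha>"
  unfolding nat_trans_def using assms by (auto intro!: homI)

lemma nat_trans_comp:
  assumes "nat_trans C F G \<alpha>" "nat_trans C G H \<beta>"
  shows "nat_trans C F H (\<lambda>X x. \<beta> X (\<alpha> X x))"
  by (rule nat_transI)
    (use assms in \<open>simp_all add: nt_closed nt_mult nt_nat[OF assms(1)] nt_nat[OF assms(2)]\<close>)

lemma nat_trans_ident: "nat_trans C F F (\<lambda>X x. x)"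
  by (rule nat_transI) simp_all

lemma nat_trans_one:
  assumes "additive_functor C G" shows "nat_trans C F G (\<lambda>X x. \<one>\<^bsub>FOb G X\<^esub>)"
  by (rule nat_transI)
    (use assms in \<open>simp_all add: af_one af_one_closed af_monoid monoid.r_one\<close>)

lemma nat_trans_mult:
  assumes "additive_functor C G" "nat_trans C F G \<alpha>" "nat_trans C F G \<beta>"
  shows "nat_trans C F G (\<lambda>X x. \<alpha> X x \<otimes>\<^bsub>FOb G X\<^esub> \<beta> X x)"
proof (rule nat_transI)
  fix X x y assume *: "X \<in> Ob C" "x \<in> carrier (FOb F X)" "y \<in> carrier (FOb F X)"
  interpret G: comm_group "FOb G X" using * assms af_comm_group by blast
  note [simp] = nt_closed[OF assms(2)] nt_closed[OF assms(3)]
  show "\<alpha> X (x \<otimes>\<^bsub>FOb F X\<^esub> y) \<otimes>\<^bsub>FOb G X\<^esub> \<beta> X (x \<otimes>\<^bsub>FOb F X\<^esub> y) =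
     \<alpha> X x \<otimes>\<^bsub>FOb G X\<^esub> \<beta> X x \<otimes>\<^bsub>FOb G X\<^esub> (\<alpha> X y \<otimes>\<^bsub>FOb G X\<^esub> \<beta> X y)"
    using * by (simp add: nt_mult[OF assms(2)] nt_mult[OF assms(3)] G.m_ac)
next
  fix f x assume *: "f \<in> Mor C" "x \<in> carrier (FOb F (Cod C f))"
  show "\<alpha> (Dom C f) (FMor F f x) \<otimes>\<^bsub>FOb G (Dom C f)\<^esub> \<beta> (Dom C f) (FMor F f x) =
     FMor G f (\<alpha> (Cod C f) x \<otimes>\<^bsub>FOb G (Cod C f)\<^esub> \<beta> (Cod C f) x)"
    using * assms(1)
    by (simp add: nt_nat[OF assms(2)] nt_nat[OF assms(3)] nt_closed[OF assms(2)]
        nt_closed[OF assms(3)] af_mult)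
qed (use assms in \<open>simp add: nt_closed af_m_closed\<close>)

text \<open>The difference of \<open>h\<close> and \<open>h'\<close> is a relation, hence a multiple
  of \<open>f\<close>.\<close>

lemma pres_eqE:
  assumes "additive_functor C F" "pres C f F e" "h \<in> Mor C" "h' \<in> Mor C" "Dom C h = Dom C h'"
    "Cod C h = Cod C f" "Cod C h' = Cod C f" "FMor F h e = FMor F h' e"
  obtains s where "s \<in> Mor C" "Dom C s = Dom C h'" "Cod C s = Dom C f" "h = h' \<oplus> f \<odot> s"
proof -
  note P = presD[OF assms(2)]
  interpret G: group "FOb F (Dom C h')" using af_group[OF assms(1)] assms(4) by simp
  have "FMor F (neg C h' \<oplus> h) e = FMor F (neg C h') e \<otimes>\<^bsub>FOb F (Dom C h')\<^esub> FMor F h e"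
    using assms P by (subst af_Add) simp_all
  also have "\<dots> = \<one>\<^bsub>FOb F (Dom C h')\<^esub>"
    using assms P by (simp add: af_neg af_closed)
  finally obtain s where s: "s \<in> Mor C" "Dom C s = Dom C h'" "Cod C s = Dom C f" "f \<odot> s = neg C h' \<oplus> h"
    using pres_relE[OF assms(2), of "neg C h' \<oplus> h"] assms by auto
  moreover have "h = h' \<oplus> (neg C h' \<oplus> h)" using assms by simp
  ultimately show ?thesis using that[OF s(1-3)] by simp
qed

lemma pres_Cmp:
  assumes "additive_functor C F" "pres C f F e" "s \<in> Mor C" "Cod C s = Dom C f"
  shows "FMor F (f \<odot> s) e = \<one>\<^bsub>FOb F (Dom C s)\<^esub>"
  using pres_rel[OF assms(2), of "f \<odot> s"] presD[OF assms(2)] assms(3,4) by (auto simp: hom_iff)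

lemma pres_zero:
  assumes "additive_functor C F" "pres C f F e"
  shows "FMor F f e = \<one>\<^bsub>FOb F (Dom C f)\<^esub>"
  using pres_Cmp[OF assms, of "Id C (Dom C f)"] presD[OF assms(2)] by simp

text \<open>This is the universal property of a cokernel. Each element of \<open>F\<close> is
  \<open>F(h)(e)\<close> for some \<open>h\<close> and is sent to \<open>G(h)(y)\<close>; two
  choices of \<open>h\<close> differ by a multiple of \<open>f\<close>, which acts trivially on
  \<open>y\<close>.\<close>

lemma induced_nat_trans:
  assumes F: "additive_functor C F" and G: "additive_functor C G" and p: "pres C f F e"
    and y: "y \<in> carrier (FOb G (Cod C f))" "FMor G f y = \<one>\<^bsub>FOb G (Dom C f)\<^esub>"
  obtains \<alpha> where "nat_trans C F G \<alpha>" "\<alpha> (Cod C f) e = y"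
proof -
  note P = presD[OF p]
  define \<alpha> where "\<alpha> W x = FMor G (SOME h. h \<in> Mor C \<and> Dom C h = W \<and> Cod C h = Cod C f \<and> FMor F h e = x) y"
    for W x
  have wd: "FMor G h y = FMor G h' y"
    if h: "h \<in> Mor C" "h' \<in> Mor C" "Dom C h = Dom C h'" "Cod C h = Cod C f" "Cod C h' = Cod C f"
      "FMor F h e = FMor F h' e" for h h'
  proof -
    interpret G: group "FOb G (Dom C h')" using h af_group[OF G] by simp
    obtain s where s: "s \<in> Mor C" "Dom C s = Dom C h'" "Cod C s = Dom C f" "h = h' \<oplus> f \<odot> s"
      by (rule pres_eqE[OF F p h])
    have "FMor G (f \<odot> s) y = \<one>\<^bsub>FOb G (Dom C h')\<^esub>"
      using s y P af_one[OF G s(1)] by (simp add: af_Cmp[OF G])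
    then show ?thesis unfolding s(4) using s(1-3) h(1-5) P y by (simp add: af_Add[OF G] af_closed[OF G])
  qed
  have \<alpha>: "\<alpha> (Dom C h) (FMor F h e) = FMor G h y" if "h \<in> Mor C" "Cod C h = Cod C f" for h
    unfolding \<alpha>_def
  proof (rule someI2[of _ h])
    fix k assume "k \<in> Mor C \<and> Dom C k = Dom C h \<and> Cod C k = Cod C f \<and> FMor F k e = FMor F h e"
    then show "FMor G k y = FMor G h y" using that wd[of k h] by blast
  qed (use that in simp)
  have "nat_trans C F G \<alpha>"
  proof (rule nat_transI)
    fix X x assume X: "X \<in> Ob C" "x \<in> carrier (FOb F X)"
    obtain h where h: "h \<in> Mor C" "Dom C h = X" "Cod C h = Cod C f" "FMor F h e = x"
      by (rule pres_gen[OF p X])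
    show "\<alpha> X x \<in> carrier (FOb G X)" using \<alpha>[of h] h y by (simp add: af_closed[OF G])
    fix x' assume X': "x' \<in> carrier (FOb F X)"
    obtain h' where h': "h' \<in> Mor C" "Dom C h' = X" "Cod C h' = Cod C f" "FMor F h' e = x'"
      by (rule pres_gen[OF p X(1) X'])
    have "FMor F (h \<oplus> h') e = x \<otimes>\<^bsub>FOb F X\<^esub> x'" using h h' P by (simp add: af_Add[OF F])
    then show "\<alpha> X (x \<otimes>\<^bsub>FOb F X\<^esub> x') = \<alpha> X x \<otimes>\<^bsub>FOb G X\<^esub> \<alpha> X x'"
      using \<alpha>[of h] \<alpha>[of h'] \<alpha>[of "h \<oplus> h'"] h h' y by (simp add: af_Add[OF G])
  next
    fix g x assume g: "g \<in> Mor C" "x \<in> carrier (FOb F (Cod C g))"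
    obtain h where h: "h \<in> Mor C" "Dom C h = Cod C g" "Cod C h = Cod C f" "FMor F h e = x"
      by (rule pres_gen[OF p _ g(2)]) (use g in auto)
    have "FMor F (h \<odot> g) e = FMor F g x" using h g P by (simp add: af_Cmp[OF F])
    then show "\<alpha> (Dom C g) (FMor F g x) = FMor G g (\<alpha> (Cod C g) x)"
      using \<alpha>[of h] \<alpha>[of "h \<odot> g"] h g y by (simp add: af_Cmp[OF G])
  qed
  moreover have "\<alpha> (Cod C f) e = y"
    using \<alpha>[of "Id C (Cod C f)"] P y by (simp add: af_Id[OF F] af_Id[OF G])
  ultimately show ?thesis by (rule that)
qed

text \<open>Since \<open>e\<close> generates \<open>F\<close>, naturality leaves no freedom beyond
  the value there. Identities between maps of functors are checked in this way throughout.\<close>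

lemma nat_trans_eqI:
  assumes "pres C f F e" "nat_trans C F G \<alpha>" "nat_trans C F G \<beta>" "\<alpha> (Cod C f) e = \<beta> (Cod C f) e"
    "W \<in> Ob C" "x \<in> carrier (FOb F W)"
  shows "\<alpha> W x = \<beta> W x"
proof -
  obtain h where h: "h \<in> Mor C" "Dom C h = W" "Cod C h = Cod C f" "FMor F h e = x"
    by (rule pres_gen[OF assms(1,5,6)])
  show ?thesis unfolding h(4)[symmetric]
    using h(1-3) presD[OF assms(1)] assms(4) by (simp add: nt_nat[OF assms(2)] nt_nat[OF assms(3)])
qed

lemma pres_hom_functor:
  assumes "nat_trans C (hom_functor C Y) F \<pi>" "h \<in> Mor C" "Cod C h = Y"
  shows "\<pi> (Dom C h) h = FMor F h (\<pi> Y (Id C Y))"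
  using nt_nat[OF assms(1), of h "Dom C h" "Id C Y"] assms by (auto simp: hom_iff)

lemma nat_trans_element:
  assumes F: "additive_functor C F" and e: "e \<in> carrier (FOb F Y)" and Y: "Y \<in> Ob C"
  shows "nat_trans C (hom_functor C Y) F (\<lambda>W h. FMor F h e)"
  by (rule nat_transI) (use F e Y in \<open>auto simp: hom_iff af_closed af_Add af_Cmp\<close>)

text \<open>By Yoneda \<open>\<pi>\<close> is evaluation at \<open>e = \<pi>(Id)\<close>; the
  statements about its image and its kernel then become the two conditions of
  \<open>pres\<close>.\<close>

lemma presents_iff:
  assumes F: "additive_functor C F"
  shows "presents C f F \<longleftrightarrow> (\<exists>e. pres C f F e)"
proof
  assume "presents C f F"
  then obtain \<pi> where f: "f \<in> Mor C" and \<pi>: "nat_trans C (hom_functor C (Cod C f)) F \<pi>"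
    and "\<forall>W \<in> Ob C. \<pi> W ` homset C W (Cod C f) = carrier (FOb F W) \<and>
        {g \<in> homset C W (Cod C f). \<pi> W g = \<one>\<^bsub>FOb F W\<^esub>} = (\<lambda>h. f \<odot> h) ` homset C W (Dom C f)"
    unfolding presents_def by (elim conjE exE)
  then have im: "\<And>W. W \<in> Ob C \<Longrightarrow> \<pi> W ` homset C W (Cod C f) = carrier (FOb F W)"
    and ker: "\<And>W. W \<in> Ob C \<Longrightarrow> {g \<in> homset C W (Cod C f). \<pi> W g = \<one>\<^bsub>FOb F W\<^esub>} =
       (\<lambda>h. f \<odot> h) ` homset C W (Dom C f)"
    by simp_all
  define e where "e = \<pi> (Cod C f) (Id C (Cod C f))"
  have \<pi>e: "FMor F h e = \<pi> W h" if "h \<in> homset C W (Cod C f)" for h W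
    using pres_hom_functor[OF \<pi>, of h] that by (simp add: e_def hom_iff)
  have "pres C f F e" unfolding pres_def
  proof (intro conjI ballI impI f)
    show "e \<in> carrier (FOb F (Cod C f))"
      using nt_closed[OF \<pi>, of "Cod C f" "Id C (Cod C f)"] f by (simp add: e_def hom_iff)
    fix W x assume W: "W \<in> Ob C" "x \<in> carrier (FOb F W)"
    then have "x \<in> \<pi> W ` homset C W (Cod C f)" by (simp add: im)
    then obtain h where h: "x = \<pi> W h" "h \<in> homset C W (Cod C f)" by (rule imageE)
    then show "\<exists>h \<in> homset C W (Cod C f). FMor F h e = x" using \<pi>e[OF h(2)]
      by (intro bexI[of _ h]) simp_all
  next
    fix h assume h: "h \<in> Mor C" "Cod C h = Cod C f"
    then have h': "h \<in> homset C (Dom C h) (Cod C f)" "Dom C h \<in> Ob C" by (simp_all add: hom_iff)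
    show "FMor F h e = \<one>\<^bsub>FOb F (Dom C h)\<^esub> \<longleftrightarrow> (\<exists>s \<in> homset C (Dom C h) (Dom C f). f \<odot> s = h)"
    proof -
      have "h \<in> {g \<in> homset C (Dom C h) (Cod C f). \<pi> (Dom C h) g = \<one>\<^bsub>FOb F (Dom C h)\<^esub>} \<longleftrightarrow>
          h \<in> (\<lambda>s. f \<odot> s) ` homset C (Dom C h) (Dom C f)"
        by (simp only: ker[OF h'(2)])
      then show ?thesis using h'(1) \<pi>e[OF h'(1)] by (simp add: image_iff eq_commute[of h])
    qed
  qed
  then show "\<exists>e. pres C f F e" ..
next
  assume "\<exists>e. pres C f F e"
  then obtain e where e: "pres C f F e" ..
  note P = presD[OF e]
  show "presents C f F" unfolding presents_def
  proof (intro conjI exI ballI)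
    show "nat_trans C (hom_functor C (Cod C f)) F (\<lambda>W h. FMor F h e)"
      using nat_trans_element[OF F] P by simp
    fix W assume W: "W \<in> Ob C"
    show "(\<lambda>h. FMor F h e) ` homset C W (Cod C f) = carrier (FOb F W)"
    proof (intro equalityI subsetI)
      fix x assume "x \<in> carrier (FOb F W)"
      then obtain h where "h \<in> Mor C" "Dom C h = W" "Cod C h = Cod C f" "FMor F h e = x"
        using pres_gen[OF e W] by metis
      then show "x \<in> (\<lambda>h. FMor F h e) ` homset C W (Cod C f)"
        by (intro image_eqI[of _ _ h]) (simp_all add: hom_iff)
    next
      fix x assume "x \<in> (\<lambda>h. FMor F h e) ` homset C W (Cod C f)"
      then obtain h where "x = FMor F h e" "h \<in> homset C W (Cod C f)" by (rule imageE)
      then show "x \<in> carrier (FOb F W)" using P by (simp add: hom_iff af_closed[OF F])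
    qed
    show "{h \<in> homset C W (Cod C f). FMor F h e = \<one>\<^bsub>FOb F W\<^esub>} =
        (\<lambda>h. f \<odot> h) ` homset C W (Dom C f)"
    proof (intro equalityI subsetI)
      fix h assume "h \<in> {h \<in> homset C W (Cod C f). FMor F h e = \<one>\<^bsub>FOb F W\<^esub>}"
      then have h: "h \<in> Mor C" "Cod C h = Cod C f" "Dom C h = W" "FMor F h e = \<one>\<^bsub>FOb F (Dom C h)\<^esub>"
        by (simp_all add: hom_iff)
      obtain s where "s \<in> Mor C" "Dom C s = Dom C h" "Cod C s = Dom C f" "f \<odot> s = h"
        by (rule pres_relE[OF e h(1,2,4)])
      then show "h \<in> (\<lambda>h. f \<odot> h) ` homset C W (Dom C f)"
        using h(3) by (intro image_eqI[of _ _ s]) (simp_all add: hom_iff)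
    next
      fix h assume "h \<in> (\<lambda>h. f \<odot> h) ` homset C W (Dom C f)"
      then obtain s where s: "h = f \<odot> s" "s \<in> homset C W (Dom C f)" by (rule imageE)
      then have "s \<in> Mor C" "Cod C s = Dom C f" "Dom C s = W" by (simp_all add: hom_iff)
      then show "h \<in> {h \<in> homset C W (Cod C f). FMor F h e = \<one>\<^bsub>FOb F W\<^esub>}"
        unfolding s(1) using P pres_Cmp[OF F e, of s] by (simp add: hom_iff)
    qed
  qed (rule P)
qed

lemma fp_pres:
  assumes "finitely_presented C F"
  obtains f e where "pres C f F e"
proof -
  obtain f where "presents C f F" using assms by (auto simp: finitely_presented_def)
  then show ?thesis using presents_iff[OF fp_additive[OF assms], of f] that by blast
qed

lemma fpI: "additive_functor C F \<Longrightarrow> pres C f F e \<Longrightarrow> finitely_presented C F"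
  using presents_iff[of F f] unfolding finitely_presented_def by blast

end

text \<open>The functor presented by \<open>f\<close>, with chosen representatives of the cosets transported along \<open>\<iota>\<close>.\<close>

locale preadditive_universe = preadditive_category C for C :: "('o, 'm) acat" +
  fixes \<iota> :: "'m \<Rightarrow> 'g"
  assumes inj_\<iota>: "inj_on \<iota> (Mor C)"
begin

definition cls :: "'m \<Rightarrow> 'o \<Rightarrow> 'm \<Rightarrow> 'g" where
  "cls f W h = \<iota> (SOME h'. h' \<in> homset C W (Cod C f) \<and> (\<exists>s \<in> homset C W (Dom C f). h' = h \<oplus> f \<odot> s))"

definition rep :: "'g \<Rightarrow> 'm" where
  "rep u = inv_into (Mor C) \<iota> u"

definition coker_functor :: "'m \<Rightarrow> ('o, 'm, 'g) afun" where
  "coker_functor f = \<lparr>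
     FOb = (\<lambda>W. \<lparr>carrier = cls f W ` homset C W (Cod C f),
                 mult = (\<lambda>u v. cls f W (rep u \<oplus> rep v)),
                 one = cls f W (Zero C W (Cod C f))\<rparr>),
     FMor = (\<lambda>g u. cls f (Dom C g) (rep u \<odot> g))\<rparr>"

lemma rep_cls:
  assumes "f \<in> Mor C" "h \<in> homset C W (Cod C f)"
  obtains s where "rep (cls f W h) \<in> homset C W (Cod C f)" "s \<in> homset C W (Dom C f)"
    "rep (cls f W h) = h \<oplus> f \<odot> s"
proof -
  let ?P = "\<lambda>h'. h' \<in> homset C W (Cod C f) \<and> (\<exists>s \<in> homset C W (Dom C f). h' = h \<oplus> f \<odot> s)"
  have "?P h" using assms by (auto simp: hom_iff intro!: bexI[of _ "Zero C W (Dom C f)"])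
  then have *: "?P (Eps ?P)" by (rule someI)
  then have "rep (cls f W h) = Eps ?P"
    unfolding rep_def cls_def by (intro inv_into_f_f[OF inj_\<iota>]) (simp add: hom_iff)
  then show ?thesis using * that by auto
qed

text \<open>Both arrows span the same coset, so the choice operator in \<open>cls\<close> is applied
  to the same predicate. A coset is thus represented by one of its own elements, which keeps the
  values of the functor inside \<open>'g\<close>.\<close>

lemma cls_eqI:
  assumes "f \<in> Mor C" "h \<in> homset C W (Cod C f)" "s \<in> homset C W (Dom C f)" "h' = h \<oplus> f \<odot> s"
  shows "cls f W h' = cls f W h"
proof -
  have "(\<exists>t \<in> homset C W (Dom C f). k = h' \<oplus> f \<odot> t) \<longleftrightarrow> (\<exists>t \<in> homset C W (Dom C f). k = h \<oplus> f \<odot> t)" for k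
  proof
    assume "\<exists>t \<in> homset C W (Dom C f). k = h' \<oplus> f \<odot> t"
    then obtain t where "t \<in> homset C W (Dom C f)" "k = h' \<oplus> f \<odot> t" ..
    then show "\<exists>t \<in> homset C W (Dom C f). k = h \<oplus> f \<odot> t"
      using assms by (auto simp: hom_iff Add_assoc intro!: bexI[of _ "s \<oplus> t"])
  next
    assume "\<exists>t \<in> homset C W (Dom C f). k = h \<oplus> f \<odot> t"
    then obtain t where "t \<in> homset C W (Dom C f)" "k = h \<oplus> f \<odot> t" ..
    then show "\<exists>t \<in> homset C W (Dom C f). k = h' \<oplus> f \<odot> t"
      using assms by (auto simp: hom_iff Add_assoc intro!: bexI[of _ "neg C s \<oplus> t"])
  qed
  then show ?thesis by (simp add: cls_def)
qed

lemma cls_eqD: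
  assumes f: "f \<in> Mor C" and h: "h \<in> homset C W (Cod C f)" "h' \<in> homset C W (Cod C f)"
    and eq: "cls f W h' = cls f W h"
  obtains s where "s \<in> homset C W (Dom C f)" "h' = h \<oplus> f \<odot> s"
proof -
  obtain s where s: "s \<in> homset C W (Dom C f)" "rep (cls f W h) = h \<oplus> f \<odot> s"
    by (rule rep_cls[OF f h(1)])
  obtain t where t: "t \<in> homset C W (Dom C f)" "rep (cls f W h') = h' \<oplus> f \<odot> t"
    by (rule rep_cls[OF f h(2)])
  have "h' = (h' \<oplus> f \<odot> t) \<oplus> neg C (f \<odot> t)" using f h t by (simp add: hom_iff)
  also have "\<dots> = (h \<oplus> f \<odot> s) \<oplus> neg C (f \<odot> t)" using s(2) t(2) eq by simp
  also have "\<dots> = h \<oplus> f \<odot> (s \<oplus> neg C t)" using f h s(1) t(1) by (simp add: hom_iff Add_assoc)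
  finally show ?thesis using that[of "s \<oplus> neg C t"] s(1) t(1) by (simp add: hom_iff)
qed

lemma coker_functor_carrier [simp]:
  "carrier (FOb (coker_functor f) W) = cls f W ` homset C W (Cod C f)"
  "\<one>\<^bsub>FOb (coker_functor f) W\<^esub> = cls f W (Zero C W (Cod C f))"
  by (simp_all add: coker_functor_def)

lemma coker_functor_mult:
  assumes f: "f \<in> Mor C" and h: "h \<in> homset C W (Cod C f)" "k \<in> homset C W (Cod C f)"
  shows "cls f W h \<otimes>\<^bsub>FOb (coker_functor f) W\<^esub> cls f W k = cls f W (h \<oplus> k)"
proof -
  obtain s where s: "s \<in> homset C W (Dom C f)" "rep (cls f W h) = h \<oplus> f \<odot> s"
    by (rule rep_cls[OF f h(1)])
  obtain t where t: "t \<in> homset C W (Dom C f)" "rep (cls f W k) = k \<oplus> f \<odot> t"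
    by (rule rep_cls[OF f h(2)])
  show ?thesis unfolding coker_functor_def
    using f h s t cls_eqI[OF f, of "h \<oplus> k" W "s \<oplus> t"]
    by (simp add: hom_iff Add_assoc Add_left_comm[of k "f \<odot> s" "f \<odot> t"])
qed

lemma coker_functor_FMor:
  assumes f: "f \<in> Mor C" and h: "h \<in> homset C W (Cod C f)" and g: "g \<in> homset C V W"
  shows "FMor (coker_functor f) g (cls f W h) = cls f V (h \<odot> g)"
proof -
  obtain s where s: "s \<in> homset C W (Dom C f)" "rep (cls f W h) = h \<oplus> f \<odot> s"
    by (rule rep_cls[OF f h])
  show ?thesis unfolding coker_functor_def
    using f h s g cls_eqI[OF f, of "h \<odot> g" V "s \<odot> g"] by (simp add: hom_iff assoc)
qed

lemma additive_coker_functor: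
  assumes f: "f \<in> Mor C" shows "additive_functor C (coker_functor f)"
  unfolding additive_functor_def
proof (intro conjI ballI impI)
  let ?F = "coker_functor f"
  note M = coker_functor_mult[OF f]
  fix X assume X: "X \<in> Ob C"
  show "comm_group (FOb ?F X)"
  proof (rule comm_groupI)
    fix x assume "x \<in> carrier (FOb ?F X)"
    then obtain h where "h \<in> homset C X (Cod C f)" "x = cls f X h" by auto
    then show "\<exists>y \<in> carrier (FOb ?F X). y \<otimes>\<^bsub>FOb ?F X\<^esub> x = \<one>\<^bsub>FOb ?F X\<^esub>"
      using f X by (auto simp: M hom_iff intro!: bexI[of _ "neg C h"])
  qed (use f X in \<open>auto simp: M hom_iff Add_assoc intro!: imageI\<close>, metis Add_comm)
  fix x assume "x \<in> carrier (FOb ?F X)"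
  then show "FMor ?F (Id C X) x = x" using X
    by (auto simp: coker_functor_FMor[OF f, of _ X _ X] hom_iff)
next
  let ?F = "coker_functor f"
  note M = coker_functor_mult[OF f]
  fix g assume g: "g \<in> Mor C"
  have FM: "FMor ?F g (cls f (Cod C g) h) = cls f (Dom C g) (h \<odot> g)" if "h \<in> homset C (Cod C g) (Cod C f)" for h
    using coker_functor_FMor[OF f that, of g "Dom C g"] g by (simp add: hom_iff)
  show "FMor ?F g \<in> hom (FOb ?F (Cod C g)) (FOb ?F (Dom C g))"
  proof (rule homI)
    fix x assume "x \<in> carrier (FOb ?F (Cod C g))"
    then obtain h where h: "h \<in> homset C (Cod C g) (Cod C f)" "x = cls f (Cod C g) h" by auto
    then show "FMor ?F g x \<in> carrier (FOb ?F (Dom C g))" using g by (auto simp: FM hom_iff)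
    fix y assume "y \<in> carrier (FOb ?F (Cod C g))"
    then obtain k where k: "k \<in> homset C (Cod C g) (Cod C f)" "y = cls f (Cod C g) k" by auto
    have "h \<oplus> k \<in> homset C (Cod C g) (Cod C f)" "h \<odot> g \<in> homset C (Dom C g) (Cod C f)"
      "k \<odot> g \<in> homset C (Dom C g) (Cod C f)" "(h \<oplus> k) \<odot> g = h \<odot> g \<oplus> k \<odot> g"
      using h k g by (simp_all add: hom_iff)
    then show "FMor ?F g (x \<otimes>\<^bsub>FOb ?F (Cod C g)\<^esub> y) = FMor ?F g x \<otimes>\<^bsub>FOb ?F (Dom C g)\<^esub> FMor ?F g y"
      using h k by (simp add: M FM)
  qed
  fix g' assume g': "g' \<in> Mor C"
  { fix x assume c: "Cod C g = Dom C g'" and "x \<in> carrier (FOb ?F (Cod C g'))"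
    then obtain h where h: "h \<in> homset C (Cod C g') (Cod C f)" "x = cls f (Cod C g') h" by auto
    have "FMor ?F g' x = cls f (Dom C g') (h \<odot> g')"
      using coker_functor_FMor[OF f h(1), of g' "Dom C g'"] g' h by (simp add: hom_iff)
    moreover have "FMor ?F (g' \<odot> g) x = cls f (Dom C g) (h \<odot> (g' \<odot> g))"
      using coker_functor_FMor[OF f h(1), of "g' \<odot> g" "Dom C g"] g g' h c by (simp add: hom_iff)
    ultimately show "FMor ?F (g' \<odot> g) x = FMor ?F g (FMor ?F g' x)"
      using FM[of "h \<odot> g'"] g g' h c by (simp add: hom_iff assoc) }
  { fix x assume c: "Dom C g = Dom C g'" "Cod C g = Cod C g'" and "x \<in> carrier (FOb ?F (Cod C g))"
    then obtain h where h: "h \<in> homset C (Cod C g) (Cod C f)" "x = cls f (Cod C g) h" by auto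
    have "FMor ?F g' x = cls f (Dom C g) (h \<odot> g')"
      using coker_functor_FMor[OF f h(1), of g' "Dom C g"] g' h c by (simp add: hom_iff)
    moreover have "FMor ?F (g \<oplus> g') x = cls f (Dom C g) (h \<odot> g \<oplus> h \<odot> g')"
      using coker_functor_FMor[OF f h(1), of "g \<oplus> g'" "Dom C g"] g g' h c by (simp add: hom_iff)
    ultimately show "FMor ?F (g \<oplus> g') x = FMor ?F g x \<otimes>\<^bsub>FOb ?F (Dom C g)\<^esub> FMor ?F g' x"
      using FM[of h] g g' h c by (simp add: hom_iff M) }
qed

lemma pres_coker_functor:
  assumes f: "f \<in> Mor C" shows "pres C f (coker_functor f) (cls f (Cod C f) (Id C (Cod C f)))"
  unfolding pres_def
proof (intro conjI ballI impI f)
  let ?F = "coker_functor f" and ?e = "cls f (Cod C f) (Id C (Cod C f))"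
  have e: "FMor ?F h ?e = cls f (Dom C h) h" if "h \<in> Mor C" "Cod C h = Cod C f" for h
    using coker_functor_FMor[OF f, of "Id C (Cod C f)" "Cod C f" h "Dom C h"] that f by (simp add: hom_iff)
  show "?e \<in> carrier (FOb ?F (Cod C f))" using f by (simp add: hom_iff)
  { fix W x assume "W \<in> Ob C" "x \<in> carrier (FOb ?F W)"
    then show "\<exists>h \<in> homset C W (Cod C f). FMor ?F h ?e = x" using e by (force simp: hom_iff) }
  fix h assume h: "h \<in> Mor C" "Cod C h = Cod C f"
  let ?Z = "Zero C (Dom C h) (Cod C f)"
  show "FMor ?F h ?e = \<one>\<^bsub>FOb ?F (Dom C h)\<^esub> \<longleftrightarrow> (\<exists>s \<in> homset C (Dom C h) (Dom C f). f \<odot> s = h)"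
    (is "?L \<longleftrightarrow> ?R")
  proof
    assume ?L
    then have "cls f (Dom C h) h = cls f (Dom C h) ?Z" using e h by simp
    then obtain s where s: "s \<in> homset C (Dom C h) (Dom C f)" "h = ?Z \<oplus> f \<odot> s"
      by (rule cls_eqD[OF f, of ?Z "Dom C h" h, rotated 2]) (use f h in \<open>simp_all add: hom_iff\<close>)
    have "f \<odot> s = ?Z \<oplus> f \<odot> s" using s(1) f h by (simp add: hom_iff)
    also have "\<dots> = h" by (rule s(2)[symmetric])
    finally show ?R using s(1) by blast
  next
    assume ?R
    then obtain s where "s \<in> homset C (Dom C h) (Dom C f)" "f \<odot> s = h" ..
    then show ?L using cls_eqI[OF f, of ?Z "Dom C h" s h] e h f by (auto simp: hom_iff)
  qed
qed

lemma ex_presented: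
  assumes "f \<in> Mor C"
  obtains F :: "('o, 'm, 'g) afun" and e where "finitely_presented C F" "additive_functor C F" "pres C f F e"
  by (rule that[OF fpI additive_coker_functor pres_coker_functor])
    (rule assms additive_coker_functor pres_coker_functor)+

end

section \<open>Exactness in the category of finitely presented functors\<close>

text \<open>The restriction is built in, so arbitrary families \<open>\<alpha>\<close> may be used;
  equality of arrows then means agreement on the carriers, as stated in
  \<open>arr_eq_iff\<close>.\<close>

definition arr ::
  "('o, 'm) acat \<Rightarrow> ('o, 'm, 'g) afun \<Rightarrow> ('o, 'm, 'g) afun \<Rightarrow> ('o \<Rightarrow> 'g \<Rightarrow> 'g) \<Rightarrow> ('o, 'm, 'g) ftrans" where
  "arr A F G \<alpha> = (F, G, ext_trans A F \<alpha>)"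

lemma (in group) eq_if_div_one:
  assumes "x \<in> carrier G" "y \<in> carrier G" "x \<otimes> inv y = \<one>" shows "x = y"
proof -
  have "x = (x \<otimes> inv y) \<otimes> y" using assms(1,2) by (simp add: m_assoc)
  then show ?thesis using assms by simp
qed

lemma ext_trans_eq_iff:
  "ext_trans A F \<alpha> = ext_trans A F \<beta> \<longleftrightarrow> (\<forall>X \<in> Ob A. \<forall>x \<in> carrier (FOb F X). \<alpha> X x = \<beta> X x)"
proof
  assume *: "ext_trans A F \<alpha> = ext_trans A F \<beta>"
  show "\<forall>X \<in> Ob A. \<forall>x \<in> carrier (FOb F X). \<alpha> X x = \<beta> X x"
  proof (intro ballI)
    fix X x assume "X \<in> Ob A" "x \<in> carrier (FOb F X)"
    then show "\<alpha> X x = \<beta> X x" using fun_cong[OF fun_cong[OF *, of X], of x] by (simp add: ext_trans_def)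
  qed
next
  assume "\<forall>X \<in> Ob A. \<forall>x \<in> carrier (FOb F X). \<alpha> X x = \<beta> X x"
  then show "ext_trans A F \<alpha> = ext_trans A F \<beta>"
    by (auto simp: ext_trans_def fun_eq_iff restrict_def)
qed

lemma ext_trans_apply: "X \<in> Ob A \<Longrightarrow> x \<in> carrier (FOb F X) \<Longrightarrow> ext_trans A F \<alpha> X x = \<alpha> X x"
  by (simp add: ext_trans_def)

lemma ext_trans_idem: "ext_trans A F (ext_trans A F \<alpha>) = ext_trans A F \<alpha>"
  by (simp add: ext_trans_eq_iff ext_trans_apply)

lemma arr_eq_iff:
  "arr A F G \<alpha> = arr A F G \<beta> \<longleftrightarrow> (\<forall>X \<in> Ob A. \<forall>x \<in> carrier (FOb F X). \<alpha> X x = \<beta> X x)"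
  by (simp add: arr_def ext_trans_eq_iff)

lemma modcat_Ob [simp]: "F \<in> Ob (modcat A) \<longleftrightarrow> finitely_presented A F"
  by (simp add: modcat_def)

lemma arr_Dom_Cod [simp]: "Dom (modcat A) (arr A F G \<alpha>) = F" "Cod (modcat A) (arr A F G \<alpha>) = G"
  by (simp_all add: modcat_def arr_def)

lemma arr_Id: "Id (modcat A) F = arr A F F (\<lambda>X x. x)"
  and arr_Zero: "Zero (modcat A) F G = arr A F G (\<lambda>X x. \<one>\<^bsub>FOb G X\<^esub>)"
  by (simp_all add: modcat_def arr_def)

lemma arr_Add: "Add (modcat A) (arr A F G \<alpha>) (arr A F G \<beta>) = arr A F G (\<lambda>X x. \<alpha> X x \<otimes>\<^bsub>FOb G X\<^esub> \<beta> X x)"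
  by (simp add: modcat_def arr_def ext_trans_eq_iff ext_trans_apply)

section \<open>Kernels, cokernels and epimorphisms of functors from exactness at every
  object\<close>

context preadditive_category
begin

lemma nat_trans_cong:
  assumes "additive_functor C F" "nat_trans C F G \<alpha>"
    "\<And>X x. X \<in> Ob C \<Longrightarrow> x \<in> carrier (FOb F X) \<Longrightarrow> \<beta> X x = \<alpha> X x"
  shows "nat_trans C F G \<beta>"
  by (rule nat_transI)
    (use assms in \<open>simp_all add: nt_closed nt_mult af_m_closed af_closed nt_nat[OF assms(2)]\<close>)

lemma arr_Mor [simp]:
  assumes "finitely_presented C F" "finitely_presented C G" "nat_trans C F G \<alpha>"
  shows "arr C F G \<alpha> \<in> Mor (modcat C)"
  using assms nat_trans_cong[OF fp_additive[OF assms(1)] assms(3), of "ext_trans C F \<alpha>"]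
  by (simp add: modcat_def arr_def ext_trans_idem ext_trans_apply)

lemma modcat_MorE:
  assumes "u \<in> Mor (modcat C)"
  obtains F G \<alpha> where "u = arr C F G \<alpha>" "finitely_presented C F" "finitely_presented C G"
    "nat_trans C F G \<alpha>"
  using assms that unfolding modcat_def arr_def by auto

lemma modcat_homE:
  assumes "u \<in> homset (modcat C) F G"
  obtains \<alpha> where "u = arr C F G \<alpha>" "finitely_presented C F" "finitely_presented C G"
    "nat_trans C F G \<alpha>"
proof -
  have u: "u \<in> Mor (modcat C)" "Dom (modcat C) u = F" "Cod (modcat C) u = G"
    using assms by (simp_all add: hom_iff)
  obtain F' G' \<alpha> where *: "u = arr C F' G' \<alpha>" "finitely_presented C F'" "finitely_presented C G'"
    "nat_trans C F' G' \<alpha>"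
    by (rule modcat_MorE[OF u(1)])
  have "F' = F" "G' = G" using u(2,3) *(1) by simp_all
  then show ?thesis using * that by simp
qed

lemma arr_hom: "finitely_presented C F \<Longrightarrow> finitely_presented C G \<Longrightarrow> nat_trans C F G \<alpha> \<Longrightarrow>
    arr C F G \<alpha> \<in> homset (modcat C) F G"
  by (simp add: hom_iff)

lemma arr_Cmp:
  "nat_trans C F G \<alpha> \<Longrightarrow> arr C G H \<beta> \<cdot>\<^bsub>modcat C\<^esub> arr C F G \<alpha> = arr C F H (\<lambda>X x. \<beta> X (\<alpha> X x))"
  by (simp add: modcat_def arr_def ext_trans_eq_iff ext_trans_apply nt_closed)

text \<open>The groups are written multiplicatively, so the quotient stands for the difference of
  \<open>x\<close> and \<open>y\<close>. It mediates between equality of values and the conditions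
  on trivial elements in \<open>left_exact\<close>.\<close>

lemma nt_eq_if_div:
  assumes "additive_functor C F" "additive_functor C G" "nat_trans C F G \<alpha>" "W \<in> Ob C"
    "x \<in> carrier (FOb F W)" "y \<in> carrier (FOb F W)"
  shows "\<alpha> W x = \<alpha> W y \<longleftrightarrow> \<alpha> W (x \<otimes>\<^bsub>FOb F W\<^esub> inv\<^bsub>FOb F W\<^esub> y) = \<one>\<^bsub>FOb G W\<^esub>"
proof -
  interpret G: group "FOb G W" by (rule af_group[OF assms(2,4)])
  interpret F: group "FOb F W" by (rule af_group[OF assms(1,4)])
  interpret h: group_hom "FOb F W" "FOb G W" "\<alpha> W"
    by unfold_locales (rule nt_hom[OF assms(3,4)])
  have "\<alpha> W (x \<otimes>\<^bsub>FOb F W\<^esub> inv\<^bsub>FOb F W\<^esub> y) = \<alpha> W x \<otimes>\<^bsub>FOb G W\<^esub> inv\<^bsub>FOb G W\<^esub> (\<alpha> W y)"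
    using assms by simp
  then show ?thesis using G.eq_if_div_one[of "\<alpha> W x" "\<alpha> W y"] assms by auto
qed

lemma div_closed:
  assumes "additive_functor C F" "W \<in> Ob C" "x \<in> carrier (FOb F W)" "y \<in> carrier (FOb F W)"
  shows "x \<otimes>\<^bsub>FOb F W\<^esub> inv\<^bsub>FOb F W\<^esub> y \<in> carrier (FOb F W)"
proof -
  interpret F: group "FOb F W" by (rule af_group[OF assms(1,2)])
  show ?thesis using assms by simp
qed

lemma left_exactD:
  assumes "left_exact C F G H \<alpha> \<beta>"
  shows "nat_trans C F G \<alpha>" "nat_trans C G H \<beta>"
    "\<And>W x. W \<in> Ob C \<Longrightarrow> x \<in> carrier (FOb F W) \<Longrightarrow> \<alpha> W x = \<one>\<^bsub>FOb G W\<^esub> \<Longrightarrow> x = \<one>\<^bsub>FOb F W\<^esub>"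
    "\<And>W y. W \<in> Ob C \<Longrightarrow> y \<in> carrier (FOb G W) \<Longrightarrow> \<beta> W y = \<one>\<^bsub>FOb H W\<^esub> \<Longrightarrow>
      \<exists>x \<in> carrier (FOb F W). \<alpha> W x = y"
    "\<And>W x. W \<in> Ob C \<Longrightarrow> x \<in> carrier (FOb F W) \<Longrightarrow> \<beta> W (\<alpha> W x) = \<one>\<^bsub>FOb H W\<^esub>"
proof -
  show 1: "nat_trans C F G \<alpha>" "nat_trans C G H \<beta>" using assms by (simp_all add: left_exact_def)
  show "x = \<one>\<^bsub>FOb F W\<^esub>" if "W \<in> Ob C" "x \<in> carrier (FOb F W)" "\<alpha> W x = \<one>\<^bsub>FOb G W\<^esub>" for W x
    using assms that unfolding left_exact_def by blast
  show "\<exists>x \<in> carrier (FOb F W). \<alpha> W x = y"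
    if "W \<in> Ob C" "y \<in> carrier (FOb G W)" "\<beta> W y = \<one>\<^bsub>FOb H W\<^esub>" for W y
    using assms that unfolding left_exact_def by blast
  show "\<beta> W (\<alpha> W x) = \<one>\<^bsub>FOb H W\<^esub>" if "W \<in> Ob C" "x \<in> carrier (FOb F W)" for W x
    using assms that nt_closed[OF 1(1) that] unfolding left_exact_def by blast
qed

text \<open>The lift is chosen element by element. Exactness makes \<open>\<alpha>\<close>
  injective, and the laws of a natural transformation hold for the chosen values because they hold
  after applying \<open>\<alpha>\<close>.\<close>

lemma kernel_modcatI:
  assumes fp: "finitely_presented C F" "finitely_presented C G" "finitely_presented C H"
    and ex: "left_exact C F G H \<alpha> \<beta>"
  shows "is_kernel (modcat C) (arr C F G \<alpha>) (arr C G H \<beta>)"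
proof -
  note L = left_exactD[OF ex]
  note ad = fp_additive[OF fp(1)] fp_additive[OF fp(2)] fp_additive[OF fp(3)]
  have inj: "x = y" if "W \<in> Ob C" "x \<in> carrier (FOb F W)" "y \<in> carrier (FOb F W)" "\<alpha> W x = \<alpha> W y" for W x y
  proof -
    interpret F: group "FOb F W" by (rule af_group[OF ad(1) that(1)])
    have "x \<otimes>\<^bsub>FOb F W\<^esub> inv\<^bsub>FOb F W\<^esub> y = \<one>\<^bsub>FOb F W\<^esub>"
      by (rule L(3)[OF that(1) div_closed[OF ad(1) that(1-3)]
            iffD1[OF nt_eq_if_div[OF ad(1,2) L(1) that(1-3)] that(4)]])
    then show ?thesis by (rule F.eq_if_div_one[OF that(2,3)])
  qed
  show ?thesis unfolding is_kernel_def
  proof (intro conjI ballI impI)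
    show "arr C G H \<beta> \<cdot>\<^bsub>modcat C\<^esub> arr C F G \<alpha> =
        Zero (modcat C) (Dom (modcat C) (arr C F G \<alpha>)) (Cod (modcat C) (arr C G H \<beta>))"
      using L(5) by (simp add: arr_Cmp[OF L(1)] arr_Zero arr_eq_iff)
    fix h assume h: "h \<in> Mor (modcat C)" "Cod (modcat C) h = Dom (modcat C) (arr C G H \<beta>)"
      "arr C G H \<beta> \<cdot>\<^bsub>modcat C\<^esub> h = Zero (modcat C) (Dom (modcat C) h) (Cod (modcat C) (arr C G H \<beta>))"
    obtain E G' \<gamma> where "h = arr C E G' \<gamma>" and E: "finitely_presented C E" "nat_trans C E G' \<gamma>"
      by (rule modcat_MorE[OF h(1)])
    moreover from this h(2) have "G' = G" by simp
    ultimately have hE: "h = arr C E G \<gamma>" and \<gamma>: "nat_trans C E G \<gamma>" by simp_all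
    note adE = fp_additive[OF E(1)]
    have "\<beta> W (\<gamma> W x) = \<one>\<^bsub>FOb H W\<^esub>" if "W \<in> Ob C" "x \<in> carrier (FOb E W)" for W x
      using h(3) that unfolding hE by (simp add: arr_Cmp[OF \<gamma>] arr_Zero arr_eq_iff)
    then have ex1: "\<exists>z. z \<in> carrier (FOb F W) \<and> \<alpha> W z = \<gamma> W x" if "W \<in> Ob C" "x \<in> carrier (FOb E W)" for W x
      using L(4)[OF that(1) nt_closed[OF \<gamma> that]] that by blast
    define \<delta> where "\<delta> W x = (SOME z. z \<in> carrier (FOb F W) \<and> \<alpha> W z = \<gamma> W x)" for W x
    have \<delta>: "\<delta> W x \<in> carrier (FOb F W)" "\<alpha> W (\<delta> W x) = \<gamma> W x" if "W \<in> Ob C" "x \<in> carrier (FOb E W)" for W x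
      using someI_ex[OF ex1[OF that]] unfolding \<delta>_def by simp_all
    have nt: "nat_trans C E F \<delta>"
    proof (rule nat_transI)
      fix X x y assume *: "X \<in> Ob C" "x \<in> carrier (FOb E X)" "y \<in> carrier (FOb E X)"
      show "\<delta> X (x \<otimes>\<^bsub>FOb E X\<^esub> y) = \<delta> X x \<otimes>\<^bsub>FOb F X\<^esub> \<delta> X y"
        by (rule inj[OF *(1)])
          (use * in \<open>simp_all add: \<delta> af_m_closed[OF adE] af_m_closed[OF ad(1)] nt_mult[OF \<gamma>] nt_mult[OF L(1)]\<close>)
    next
      fix g x assume *: "g \<in> Mor C" "x \<in> carrier (FOb E (Cod C g))"
      show "\<delta> (Dom C g) (FMor E g x) = FMor F g (\<delta> (Cod C g) x)"
        by (rule inj[of "Dom C g"])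
          (use * in \<open>simp_all add: \<delta> af_closed[OF adE] af_closed[OF ad(1)] nt_nat[OF \<gamma>] nt_nat[OF L(1)]\<close>)
    qed (rule \<delta>)
    show "\<exists>!u. u \<in> homset (modcat C) (Dom (modcat C) h) (Dom (modcat C) (arr C F G \<alpha>)) \<and>
        arr C F G \<alpha> \<cdot>\<^bsub>modcat C\<^esub> u = h"
    proof (rule ex1I[of _ "arr C E F \<delta>"])
      show "arr C E F \<delta> \<in> homset (modcat C) (Dom (modcat C) h) (Dom (modcat C) (arr C F G \<alpha>)) \<and>
        arr C F G \<alpha> \<cdot>\<^bsub>modcat C\<^esub> arr C E F \<delta> = h"
        using arr_hom[OF E(1) fp(1) nt] \<delta> by (simp add: hE arr_Cmp[OF nt] arr_eq_iff)
      fix u assume u: "u \<in> homset (modcat C) (Dom (modcat C) h) (Dom (modcat C) (arr C F G \<alpha>)) \<and>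
        arr C F G \<alpha> \<cdot>\<^bsub>modcat C\<^esub> u = h"
      then have "u \<in> homset (modcat C) E F" by (simp add: hE)
      then obtain \<epsilon> where \<epsilon>: "u = arr C E F \<epsilon>" "nat_trans C E F \<epsilon>" by (rule modcat_homE)
      have "\<alpha> W (\<epsilon> W x) = \<alpha> W (\<delta> W x)" if "W \<in> Ob C" "x \<in> carrier (FOb E W)" for W x
        using u that unfolding \<epsilon>(1) hE by (simp add: arr_Cmp[OF \<epsilon>(2)] arr_eq_iff \<delta>)
      then show "u = arr C E F \<delta>" unfolding \<epsilon>(1) arr_eq_iff
        using inj \<delta> nt_closed[OF \<epsilon>(2)] by blast
    qed
  qed (use fp L in simp_all)
qed

text \<open>A map \<open>\<gamma>\<close> out of \<open>G\<close> descends by evaluating it at a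
  preimage under \<open>\<beta>\<close>: preimages exist by surjectivity, and two of them differ by
  an element from \<open>F\<close>, where \<open>\<gamma>\<close> is trivial.\<close>

lemma cokernel_modcatI:
  assumes fp: "finitely_presented C F" "finitely_presented C G" "finitely_presented C H"
    and ex: "left_exact C F G H \<alpha> \<beta>" and surj: "pointwise_surj C G H \<beta>"
  shows "is_cokernel (modcat C) (arr C G H \<beta>) (arr C F G \<alpha>)"
proof -
  note L = left_exactD[OF ex]
  note ad = fp_additive[OF fp(1)] fp_additive[OF fp(2)] fp_additive[OF fp(3)]
  show ?thesis unfolding is_cokernel_def is_kernel_def opcat_simps homset_opcat
  proof (intro conjI ballI impI)
    show "arr C G H \<beta> \<cdot>\<^bsub>modcat C\<^esub> arr C F G \<alpha> =
        Zero (modcat C) (Dom (modcat C) (arr C F G \<alpha>)) (Cod (modcat C) (arr C G H \<beta>))"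
      using L(5) by (simp add: arr_Cmp[OF L(1)] arr_Zero arr_eq_iff)
    fix h assume h: "h \<in> Mor (modcat C)" "Dom (modcat C) h = Cod (modcat C) (arr C F G \<alpha>)"
      "h \<cdot>\<^bsub>modcat C\<^esub> arr C F G \<alpha> = Zero (modcat C) (Dom (modcat C) (arr C F G \<alpha>)) (Cod (modcat C) h)"
    obtain G' E \<gamma> where "h = arr C G' E \<gamma>" and E: "finitely_presented C E" "nat_trans C G' E \<gamma>"
      by (rule modcat_MorE[OF h(1)])
    moreover from this h(2) have "G' = G" by simp
    ultimately have hE: "h = arr C G E \<gamma>" and \<gamma>: "nat_trans C G E \<gamma>" by simp_all
    note adE = fp_additive[OF E(1)]
    have \<gamma>\<alpha>: "\<gamma> W (\<alpha> W x) = \<one>\<^bsub>FOb E W\<^esub>" if "W \<in> Ob C" "x \<in> carrier (FOb F W)" for W x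
      using h(3) that unfolding hE by (simp add: arr_Cmp[OF L(1)] arr_Zero arr_eq_iff)
    have wd: "\<gamma> W x = \<gamma> W y"
      if xy: "W \<in> Ob C" "x \<in> carrier (FOb G W)" "y \<in> carrier (FOb G W)" "\<beta> W x = \<beta> W y" for W x y
    proof -
      have "\<beta> W (x \<otimes>\<^bsub>FOb G W\<^esub> inv\<^bsub>FOb G W\<^esub> y) = \<one>\<^bsub>FOb H W\<^esub>"
        by (rule iffD1[OF nt_eq_if_div[OF ad(2,3) L(2) xy(1-3)] xy(4)])
      then obtain z where "z \<in> carrier (FOb F W)" "\<alpha> W z = x \<otimes>\<^bsub>FOb G W\<^esub> inv\<^bsub>FOb G W\<^esub> y"
        using L(4)[OF xy(1) div_closed[OF ad(2) xy(1-3)]] by blast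
      then have "\<gamma> W (x \<otimes>\<^bsub>FOb G W\<^esub> inv\<^bsub>FOb G W\<^esub> y) = \<one>\<^bsub>FOb E W\<^esub>"
        using \<gamma>\<alpha>[OF xy(1), of z] by simp
      then show ?thesis by (rule iffD2[OF nt_eq_if_div[OF ad(2) adE \<gamma> xy(1-3)]])
    qed
    define \<delta> where "\<delta> W y = \<gamma> W (SOME x. x \<in> carrier (FOb G W) \<and> \<beta> W x = y)" for W y
    have \<delta>: "\<delta> W (\<beta> W x) = \<gamma> W x" if "W \<in> Ob C" "x \<in> carrier (FOb G W)" for W x
      unfolding \<delta>_def
    proof (rule someI2[of _ x])
      fix y assume "y \<in> carrier (FOb G W) \<and> \<beta> W y = \<beta> W x"
      then show "\<gamma> W y = \<gamma> W x" using wd[OF that(1), of y x] that(2) by blast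
    qed (use that in simp)
    have sj: "\<exists>x \<in> carrier (FOb G W). \<beta> W x = y" if "W \<in> Ob C" "y \<in> carrier (FOb H W)" for W y
      using surj that unfolding pointwise_surj_def by blast
    have nt: "nat_trans C H E \<delta>"
    proof (rule nat_transI)
      fix X x assume X: "X \<in> Ob C" "x \<in> carrier (FOb H X)"
      obtain x' where x': "x' \<in> carrier (FOb G X)" "\<beta> X x' = x" using sj[OF X] by blast
      show "\<delta> X x \<in> carrier (FOb E X)"
        unfolding x'(2)[symmetric] \<delta>[OF X(1) x'(1)] by (rule nt_closed[OF \<gamma> X(1) x'(1)])
      fix y assume y: "y \<in> carrier (FOb H X)"
      obtain y' where y': "y' \<in> carrier (FOb G X)" "\<beta> X y' = y" using sj[OF X(1) y] by blast
      have "\<delta> X (\<beta> X (x' \<otimes>\<^bsub>FOb G X\<^esub> y')) = \<gamma> X x' \<otimes>\<^bsub>FOb E X\<^esub> \<gamma> X y'"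
        using X(1) x'(1) y'(1) by (simp add: \<delta> af_m_closed[OF ad(2)] nt_mult[OF \<gamma>])
      then show "\<delta> X (x \<otimes>\<^bsub>FOb H X\<^esub> y) = \<delta> X x \<otimes>\<^bsub>FOb E X\<^esub> \<delta> X y"
        using nt_mult[OF L(2) X(1) x'(1) y'(1)] \<delta>[OF X(1) x'(1)] \<delta>[OF X(1) y'(1)] x'(2) y'(2) by simp
    next
      fix g x assume g: "g \<in> Mor C" "x \<in> carrier (FOb H (Cod C g))"
      then have Ob: "Dom C g \<in> Ob C" "Cod C g \<in> Ob C" by simp_all
      obtain x' where x': "x' \<in> carrier (FOb G (Cod C g))" "\<beta> (Cod C g) x' = x"
        using sj[OF Ob(2) g(2)] by blast
      have "\<delta> (Dom C g) (\<beta> (Dom C g) (FMor G g x')) = FMor E g (\<gamma> (Cod C g) x')"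
        using g x' Ob by (simp add: \<delta> af_closed[OF ad(2)] nt_nat[OF \<gamma>])
      then show "\<delta> (Dom C g) (FMor H g x) = FMor E g (\<delta> (Cod C g) x)"
        using \<delta>[OF Ob(2) x'(1)] x' g(1) by (simp add: nt_nat[OF L(2)])
    qed
    show "\<exists>!u. u \<in> homset (modcat C) (Cod (modcat C) (arr C G H \<beta>)) (Cod (modcat C) h) \<and>
        u \<cdot>\<^bsub>modcat C\<^esub> arr C G H \<beta> = h"
    proof (rule ex1I[of _ "arr C H E \<delta>"])
      show "arr C H E \<delta> \<in> homset (modcat C) (Cod (modcat C) (arr C G H \<beta>)) (Cod (modcat C) h) \<and>
        arr C H E \<delta> \<cdot>\<^bsub>modcat C\<^esub> arr C G H \<beta> = h"
        using arr_hom[OF fp(3) E(1) nt] \<delta> by (simp add: hE arr_Cmp[OF L(2)] arr_eq_iff)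
      fix u assume u: "u \<in> homset (modcat C) (Cod (modcat C) (arr C G H \<beta>)) (Cod (modcat C) h) \<and>
        u \<cdot>\<^bsub>modcat C\<^esub> arr C G H \<beta> = h"
      then have "u \<in> homset (modcat C) H E" by (simp add: hE)
      then obtain \<epsilon> where \<epsilon>: "u = arr C H E \<epsilon>" "nat_trans C H E \<epsilon>" by (rule modcat_homE)
      have *: "\<epsilon> W (\<beta> W x) = \<gamma> W x" if "W \<in> Ob C" "x \<in> carrier (FOb G W)" for W x
        using u that unfolding \<epsilon>(1) hE by (simp add: arr_Cmp[OF L(2)] arr_eq_iff)
      show "u = arr C H E \<delta>" unfolding \<epsilon>(1) arr_eq_iff
      proof (intro ballI)
        fix W y assume y: "W \<in> Ob C" "y \<in> carrier (FOb H W)"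
        obtain x where x: "x \<in> carrier (FOb G W)" "\<beta> W x = y" using sj[OF y] by blast
        show "\<epsilon> W y = \<delta> W y" using *[OF y(1) x(1)] \<delta>[OF y(1) x(1)] x(2) by simp
      qed
    qed
  qed (use fp L in simp_all)
qed

lemma conflation_modcatI:
  assumes "finitely_presented C F" "finitely_presented C G" "finitely_presented C H"
    "left_exact C F G H \<alpha> \<beta>" "pointwise_surj C G H \<beta>"
  shows "kernel_cokernel_pair (modcat C) (arr C F G \<alpha>) (arr C G H \<beta>)"
  unfolding kernel_cokernel_pair_def
  using kernel_modcatI[OF assms(1-4)] cokernel_modcatI[OF assms] by blast

lemma epi_modcatI:
  assumes fp: "finitely_presented C G" "finitely_presented C H" "nat_trans C G H \<beta>"
    and surj: "pointwise_surj C G H \<beta>"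
  shows "epi_arrow (modcat C) (arr C G H \<beta>)"
  unfolding epi_arrow_def mono_arrow_def opcat_simps
proof (intro conjI ballI impI)
  fix u v assume u: "u \<in> Mor (modcat C)" "v \<in> Mor (modcat C)" "Cod (modcat C) u = Cod (modcat C) v"
    "Dom (modcat C) u = Cod (modcat C) (arr C G H \<beta>)" "Dom (modcat C) v = Cod (modcat C) (arr C G H \<beta>)"
    "u \<cdot>\<^bsub>modcat C\<^esub> arr C G H \<beta> = v \<cdot>\<^bsub>modcat C\<^esub> arr C G H \<beta>"
  define E where "E = Cod (modcat C) v"
  have "u \<in> homset (modcat C) H E" "v \<in> homset (modcat C) H E" using u by (simp_all add: hom_iff E_def)
  then obtain \<gamma> \<delta> where *: "u = arr C H E \<gamma>" "v = arr C H E \<delta>"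
    by (elim modcat_homE) blast
  have eq: "\<gamma> W (\<beta> W x) = \<delta> W (\<beta> W x)" if "W \<in> Ob C" "x \<in> carrier (FOb G W)" for W x
    using u(6) that unfolding * by (simp add: arr_Cmp[OF fp(3)] arr_eq_iff)
  show "u = v" unfolding * arr_eq_iff
  proof (intro ballI)
    fix W y assume "W \<in> Ob C" "y \<in> carrier (FOb H W)"
    moreover from this obtain x where "x \<in> carrier (FOb G W)" "\<beta> W x = y"
      using surj unfolding pointwise_surj_def by blast
    ultimately show "\<gamma> W y = \<delta> W y" using eq by blast
  qed
qed (use fp in simp)

end

section \<open>Exactness at every object recovered from kernels and epimorphisms of functors\<close>

context preadditive_universe
begin

text \<open>The zero endomorphism of \<open>W\<close> imposes no relations, so what it presents is a
  copy of \<open>Hom(-, W)\<close> with values in \<open>'g\<close>. It serves as the test object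
  for elements over \<open>W\<close>.\<close>

lemma ex_representing:
  assumes "W \<in> Ob C"
  obtains R :: "('o, 'm, 'g) afun" and r where "finitely_presented C R" "additive_functor C R"
    "pres C (Zero C W W) R r"
  using ex_presented[of "Zero C W W"] assms by (metis Zero_Mor(1))

lemma yoneda:
  assumes "W \<in> Ob C" "additive_functor C R" "pres C (Zero C W W) R r" "additive_functor C G"
    "y \<in> carrier (FOb G W)"
  obtains \<gamma> where "nat_trans C R G \<gamma>" "\<gamma> W r = y"
proof -
  obtain \<gamma> where "nat_trans C R G \<gamma>" "\<gamma> (Cod C (Zero C W W)) r = y"
    by (rule induced_nat_trans[OF assms(2,4,3), of y]) (use assms in \<open>simp_all add: af_Zero\<close>)
  then show ?thesis using assms(1) by (intro that[of \<gamma>]) simp_all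
qed

text \<open>By Yoneda an element over \<open>W\<close> is a map from the functor \<open>R\<close>
  that represents \<open>W\<close>. Uniqueness of lifts from \<open>R\<close> is therefore
  injectivity of \<open>\<alpha>\<close> at \<open>W\<close>, and their existence is exactness in
  the middle.\<close>

lemma kernel_modcatD:
  fixes k p :: "('o, 'm, 'g) ftrans"
  assumes ker: "is_kernel (modcat C) k p"
  obtains F G H \<alpha> \<beta> where "k = arr C F G \<alpha>" "p = arr C G H \<beta>" "finitely_presented C F"
    "finitely_presented C G" "finitely_presented C H" "left_exact C F G H \<alpha> \<beta>"
proof -
  have kp: "k \<in> Mor (modcat C)" "p \<in> Mor (modcat C)" "Cod (modcat C) k = Dom (modcat C) p"
    "p \<cdot>\<^bsub>modcat C\<^esub> k = Zero (modcat C) (Dom (modcat C) k) (Cod (modcat C) p)"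
    using ker by (simp_all add: is_kernel_def)
  have lift: "\<exists>!u. u \<in> homset (modcat C) (Dom (modcat C) h) (Dom (modcat C) k) \<and> k \<cdot>\<^bsub>modcat C\<^esub> u = h"
    if "h \<in> Mor (modcat C)" "Cod (modcat C) h = Dom (modcat C) p"
      "p \<cdot>\<^bsub>modcat C\<^esub> h = Zero (modcat C) (Dom (modcat C) h) (Cod (modcat C) p)" for h
    using ker that unfolding is_kernel_def by blast
  obtain F G \<alpha> where k: "k = arr C F G \<alpha>" and F: "finitely_presented C F" and G: "finitely_presented C G"
    and \<alpha>: "nat_trans C F G \<alpha>" by (rule modcat_MorE[OF kp(1)])
  obtain G' H \<beta> where p: "p = arr C G' H \<beta>" and H: "finitely_presented C H" and \<beta>: "nat_trans C G' H \<beta>"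
    by (rule modcat_MorE[OF kp(2)])
  have [simp]: "G' = G" using kp(3) k p by simp
  note ad = fp_additive[OF F] fp_additive[OF G] fp_additive[OF H]
  have \<beta>\<alpha>: "\<beta> W (\<alpha> W x) = \<one>\<^bsub>FOb H W\<^esub>" if "W \<in> Ob C" "x \<in> carrier (FOb F W)" for W x
    using kp(4) that unfolding k p by (simp add: arr_Cmp[OF \<alpha>] arr_Zero arr_eq_iff)
  have "left_exact C F G H \<alpha> \<beta>" unfolding left_exact_def
  proof (intro conjI ballI impI \<alpha> iffI)
    show "nat_trans C G H \<beta>" using \<beta> by simp
    { fix W x assume W: "W \<in> Ob C" and x: "x \<in> carrier (FOb F W)" "\<alpha> W x = \<one>\<^bsub>FOb G W\<^esub>"
      obtain R :: "('o, 'm, 'g) afun" and r where R: "finitely_presented C R" "additive_functor C R"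
        "pres C (Zero C W W) R r" by (rule ex_representing[OF W])
      obtain \<gamma> where \<gamma>: "nat_trans C R F \<gamma>" "\<gamma> W r = x" by (rule yoneda[OF W R(2,3) ad(1) x(1)])
      have r: "r \<in> carrier (FOb R W)" using presD(2)[OF R(3)] W by simp
      define z where "z = Zero (modcat C) R G"
      have z: "z = arr C R G (\<lambda>X x. \<one>\<^bsub>FOb G X\<^esub>)" by (simp add: z_def arr_Zero)
      note n1 = nat_trans_one[OF ad(2), of R] and n2 = nat_trans_one[OF ad(1), of R]
      have "\<exists>!u. u \<in> homset (modcat C) (Dom (modcat C) z) (Dom (modcat C) k) \<and> k \<cdot>\<^bsub>modcat C\<^esub> u = z"
      \<comment> \<open>The zero map \<open>z\<close> from \<open>R\<close> has the zero lift; the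
        map \<open>\<gamma>\<close> that picks out \<open>x\<close> is another lift, so both agree
        and \<open>x\<close> is trivial.\<close>
      proof (rule lift)
        show "z \<in> Mor (modcat C)" "Cod (modcat C) z = Dom (modcat C) p" using R G n1 by (simp_all add: z p)
        show "p \<cdot>\<^bsub>modcat C\<^esub> z = Zero (modcat C) (Dom (modcat C) z) (Cod (modcat C) p)"
          unfolding z p using nt_one[OF \<beta>] ad by (simp add: arr_Cmp[OF n1] arr_Zero arr_eq_iff)
      qed
      moreover have "arr C R F \<gamma> \<in> homset (modcat C) (Dom (modcat C) z) (Dom (modcat C) k)"
        "arr C R F (\<lambda>X x. \<one>\<^bsub>FOb F X\<^esub>) \<in> homset (modcat C) (Dom (modcat C) z) (Dom (modcat C) k)"
        using arr_hom R F \<gamma> n2 by (simp_all add: z k)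
      moreover have "k \<cdot>\<^bsub>modcat C\<^esub> arr C R F (\<lambda>X x. \<one>\<^bsub>FOb F X\<^esub>) = z"
        unfolding z k using nt_one[OF \<alpha> ad(1,2)] by (simp add: arr_Cmp[OF n2] arr_eq_iff)
      moreover have "k \<cdot>\<^bsub>modcat C\<^esub> arr C R F \<gamma> = z"
        unfolding z k arr_Cmp[OF \<gamma>(1)] arr_eq_iff
      proof (intro ballI)
        fix X y assume "X \<in> Ob C" "y \<in> carrier (FOb R X)"
        then show "\<alpha> X (\<gamma> X y) = \<one>\<^bsub>FOb G X\<^esub>"
          by (rule nat_trans_eqI[OF R(3) nat_trans_comp[OF \<gamma>(1) \<alpha>] n1, rotated]) (use W x \<gamma> in simp)
      qed
      ultimately have "arr C R F \<gamma> = arr C R F (\<lambda>X x. \<one>\<^bsub>FOb F X\<^esub>)" by blast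
      then show "x = \<one>\<^bsub>FOb F W\<^esub>" using W r \<gamma>(2) unfolding arr_eq_iff by blast }
    { fix W y assume W: "W \<in> Ob C" and y: "y \<in> carrier (FOb G W)" "\<beta> W y = \<one>\<^bsub>FOb H W\<^esub>"
      obtain R :: "('o, 'm, 'g) afun" and r where R: "finitely_presented C R" "additive_functor C R"
        "pres C (Zero C W W) R r" by (rule ex_representing[OF W])
      obtain \<gamma> where \<gamma>: "nat_trans C R G \<gamma>" "\<gamma> W r = y" by (rule yoneda[OF W R(2,3) ad(2) y(1)])
      have r: "r \<in> carrier (FOb R W)" using presD(2)[OF R(3)] W by simp
      define h where "h = arr C R G \<gamma>"
      have "\<exists>!u. u \<in> homset (modcat C) (Dom (modcat C) h) (Dom (modcat C) k) \<and> k \<cdot>\<^bsub>modcat C\<^esub> u = h"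
      proof (rule lift)
        show "h \<in> Mor (modcat C)" "Cod (modcat C) h = Dom (modcat C) p" using R G \<gamma> by (simp_all add: h_def p)
        have "\<beta> X (\<gamma> X x) = \<one>\<^bsub>FOb H X\<^esub>" if "X \<in> Ob C" "x \<in> carrier (FOb R X)" for X x
          by (rule nat_trans_eqI[OF R(3) nat_trans_comp[OF \<gamma>(1)] nat_trans_one[OF ad(3)] _ that])
            (use \<beta> W y \<gamma> in simp_all)
        then show "p \<cdot>\<^bsub>modcat C\<^esub> h = Zero (modcat C) (Dom (modcat C) h) (Cod (modcat C) p)"
          unfolding h_def p by (simp add: arr_Cmp[OF \<gamma>(1)] arr_Zero arr_eq_iff)
      qed
      then obtain u where u: "u \<in> homset (modcat C) R F" "k \<cdot>\<^bsub>modcat C\<^esub> u = h"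
        unfolding h_def k by auto
      obtain \<delta> where \<delta>: "u = arr C R F \<delta>" "nat_trans C R F \<delta>" by (rule modcat_homE[OF u(1)])
      have "\<alpha> W (\<delta> W r) = y"
        using u(2) W r \<gamma>(2) unfolding \<delta>(1) k h_def arr_Cmp[OF \<delta>(2)] arr_eq_iff by simp
      then show "\<exists>x \<in> carrier (FOb F W). \<alpha> W x = y" using nt_closed[OF \<delta>(2) W r] by blast }
    fix W y assume "W \<in> Ob C" "\<exists>x \<in> carrier (FOb F W). \<alpha> W x = y"
    then show "\<beta> W y = \<one>\<^bsub>FOb H W\<^esub>" using \<beta>\<alpha> by blast
  qed
  then show ?thesis using that k p F G H by simp
qed

end

lemma modcat_retractE:
  assumes "preadditive_category C" "is_biproduct (modcat C) F H G"
  obtains \<sigma> \<rho> where "finitely_presented C F" "finitely_presented C G" "nat_trans C F G \<sigma>" "nat_trans C G F \<rho>"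
    "\<And>W x. W \<in> Ob C \<Longrightarrow> x \<in> carrier (FOb F W) \<Longrightarrow> \<rho> W (\<sigma> W x) = x"
proof -
  interpret preadditive_category C by fact
  from assms(2) obtain i p where i: "i \<in> homset (modcat C) F G" and p: "p \<in> homset (modcat C) G F"
    and pi: "p \<cdot>\<^bsub>modcat C\<^esub> i = Id (modcat C) F"
    unfolding is_biproduct_def by blast
  obtain \<sigma> where \<sigma>: "i = arr C F G \<sigma>" "finitely_presented C F" "finitely_presented C G" "nat_trans C F G \<sigma>"
    by (rule modcat_homE[OF i])
  obtain \<rho> where \<rho>: "p = arr C G F \<rho>" "nat_trans C G F \<rho>"
    by (rule modcat_homE[OF p])
  have "\<rho> W (\<sigma> W x) = x" if "W \<in> Ob C" "x \<in> carrier (FOb F W)" for W x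
    using pi that unfolding \<sigma>(1) \<rho>(1) by (simp add: arr_Cmp[OF \<sigma>(4)] arr_Id arr_eq_iff)
  then show ?thesis using that \<sigma> \<rho> by blast
qed

lemma modcat_isomorphicE:
  assumes "preadditive_category C" "isomorphic (modcat C) G F"
  obtains \<sigma> \<rho> where "finitely_presented C F" "finitely_presented C G" "nat_trans C F G \<sigma>" "nat_trans C G F \<rho>"
    "\<And>W x. W \<in> Ob C \<Longrightarrow> x \<in> carrier (FOb F W) \<Longrightarrow> \<rho> W (\<sigma> W x) = x"
    "\<And>W x. W \<in> Ob C \<Longrightarrow> x \<in> carrier (FOb G W) \<Longrightarrow> \<sigma> W (\<rho> W x) = x"
proof -
  interpret preadditive_category C by fact
  obtain p where p: "p \<in> homset (modcat C) G F" "iso_arrow (modcat C) p"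
    using assms(2) unfolding isomorphic_def by blast
  obtain \<rho> where \<rho>: "p = arr C G F \<rho>" "finitely_presented C G" "finitely_presented C F" "nat_trans C G F \<rho>"
    by (rule modcat_homE[OF p(1)])
  from p(2) obtain i where i: "i \<in> homset (modcat C) F G" and pi: "p \<cdot>\<^bsub>modcat C\<^esub> i = Id (modcat C) F"
    "i \<cdot>\<^bsub>modcat C\<^esub> p = Id (modcat C) G"
    unfolding iso_arrow_def \<rho>(1) arr_Dom_Cod by blast
  obtain \<sigma> where \<sigma>: "i = arr C F G \<sigma>" "nat_trans C F G \<sigma>"
    by (rule modcat_homE[OF i])
  have "\<rho> W (\<sigma> W x) = x" if "W \<in> Ob C" "x \<in> carrier (FOb F W)" for W x
    using pi(1) that unfolding \<sigma>(1) \<rho>(1) by (simp add: arr_Cmp[OF \<sigma>(2)] arr_Id arr_eq_iff)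
  moreover have "\<sigma> W (\<rho> W x) = x" if "W \<in> Ob C" "x \<in> carrier (FOb G W)" for W x
    using pi(2) that unfolding \<sigma>(1) \<rho>(1) by (simp add: arr_Cmp[OF \<rho>(4)] arr_Id arr_eq_iff)
  ultimately show ?thesis using that \<sigma> \<rho> by blast
qed

locale abelian_universe = abelian_category A for A :: "('o, 'm) acat" +
  fixes \<iota> :: "'m \<Rightarrow> 'g"
  assumes inj_\<iota>: "inj_on \<iota> (Mor A)"

sublocale abelian_universe \<subseteq> preadditive_universe A \<iota>
  by unfold_locales (rule inj_\<iota>)

context abelian_universe
begin

lemma abelian_universe_opcat: "abelian_universe (opcat A) \<iota>"
  using abelian_opcat inj_\<iota> by (simp add: abelian_universe_def abelian_universe_axioms_def)

text \<open>The pointwise cokernel of \<open>\<beta>\<close> is finitely presented, so it can serve as the test object \<open>Q\<close>.\<close>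

lemma pointwise_surjI:
  fixes G H :: "('o, 'm, 'g) afun"
  assumes fp: "finitely_presented A G" "finitely_presented A H" and \<beta>: "nat_trans A G H \<beta>"
    and epi: "\<And>(Q :: ('o, 'm, 'g) afun) q. finitely_presented A Q \<Longrightarrow> nat_trans A H Q q \<Longrightarrow>
      \<forall>W \<in> Ob A. \<forall>x \<in> carrier (FOb G W). q W (\<beta> W x) = \<one>\<^bsub>FOb Q W\<^esub> \<Longrightarrow>
      \<forall>W \<in> Ob A. \<forall>y \<in> carrier (FOb H W). q W y = \<one>\<^bsub>FOb Q W\<^esub>"
  shows "pointwise_surj A G H \<beta>"
proof -
  note ad = fp_additive[OF fp(1)] fp_additive[OF fp(2)]
  obtain g eG where G: "pres A g G eG" by (rule fp_pres[OF fp(1)])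
  obtain h eH where H: "pres A h H eH" by (rule fp_pres[OF fp(2)])
  note PG = presD[OF G] and PH = presD[OF H]
  have "\<beta> (Cod A g) eG \<in> carrier (FOb H (Cod A g))" using nt_closed[OF \<beta>] PG by simp
  then obtain b where b: "b \<in> Mor A" "Dom A b = Cod A g" "Cod A b = Cod A h" "FMor H b eH = \<beta> (Cod A g) eG"
    using pres_gen[OF H, of "Cod A g"] PG by (metis Cod_Ob)
  obtain B where "is_biproduct A (Dom A h) (Dom A b) B"
    using biproducts[OF Dom_Ob[OF PH(1)] Dom_Ob[OF b(1)]] by blast
  then obtain i j r s where B: "B \<in> Ob A" "i \<in> Mor A" "Dom A i = Dom A h" "Cod A i = B"
      "j \<in> Mor A" "Dom A j = Dom A b" "Cod A j = B" "r \<in> Mor A" "Dom A r = B" "Cod A r = Dom A h"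
      "s \<in> Mor A" "Dom A s = B" "Cod A s = Dom A b"
      "r \<odot> i = Id A (Dom A h)" "s \<odot> j = Id A (Dom A b)" "r \<odot> j = Zero A (Dom A b) (Dom A h)"
      "s \<odot> i = Zero A (Dom A h) (Dom A b)" "(i \<odot> r) \<oplus> (j \<odot> s) = Id A B"
    by (rule biproductE)
  \<comment> \<open>With components \<open>h\<close> and \<open>b\<close>, the arrow
    \<open>m\<close> adds to the relations \<open>h\<close> of \<open>H\<close> the image
    \<open>b\<close> of the generator of \<open>G\<close>. Hence \<open>Q\<close> is the cokernel of
    \<open>\<beta>\<close>.\<close>
  define m where "m = h \<odot> r \<oplus> b \<odot> s"
  have m: "m \<in> Mor A" "Dom A m = B" "Cod A m = Cod A h" using B b PH by (simp_all add: m_def)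
  have mi: "m \<odot> i = h" "m \<odot> j = b" using B b PH PG by (simp_all add: m_def assoc)
  obtain Q :: "('o, 'm, 'g) afun" and eQ where Q: "finitely_presented A Q" "additive_functor A Q" "pres A m Q eQ"
    by (rule ex_presented[OF m(1)])
  note PQ = presD[OF Q(3)]
  have e0: "FMor Q h eQ = \<one>\<^bsub>FOb Q (Dom A h)\<^esub>" "FMor Q b eQ = \<one>\<^bsub>FOb Q (Dom A b)\<^esub>"
    using pres_Cmp[OF Q(2,3), of i] pres_Cmp[OF Q(2,3), of j] B m mi by simp_all
  obtain q where q: "nat_trans A H Q q" "q (Cod A h) eH = eQ"
    by (rule induced_nat_trans[OF ad(2) Q(2) H, of eQ]) (use PQ m e0 in simp_all)
  have "\<forall>W \<in> Ob A. \<forall>x \<in> carrier (FOb G W). q W (\<beta> W x) = \<one>\<^bsub>FOb Q W\<^esub>"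
  proof (intro ballI)
    fix W x assume W: "W \<in> Ob A" "x \<in> carrier (FOb G W)"
    have "q (Cod A g) (\<beta> (Cod A g) eG) = FMor Q b eQ"
      unfolding b(4)[symmetric] using nt_nat[OF q(1) b(1,2), of eH] PH q(2) b(3) by simp
    then show "q W (\<beta> W x) = \<one>\<^bsub>FOb Q W\<^esub>"
      using nat_trans_eqI[OF G nat_trans_comp[OF \<beta> q(1)] nat_trans_one[OF Q(2)] _ W] e0 b(2) by simp
  qed
  from epi[OF Q(1) q(1) this] have "eQ = \<one>\<^bsub>FOb Q (Cod A h)\<^esub>"
    using PH q(2) by (metis Cod_Ob)
  \<comment> \<open>The generator of \<open>Q\<close> vanishes, so the identity factors through
    \<open>m\<close>. Splitting this factorization shows that the generator of \<open>H\<close> is,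
    up to a relation, a multiple of \<open>b\<close> and so in the image of
    \<open>\<beta>\<close>.\<close>
  then have "FMor Q (Id A (Cod A h)) eQ = \<one>\<^bsub>FOb Q (Dom A (Id A (Cod A h)))\<^esub>"
    using PQ PH m by (simp add: af_Id[OF Q(2)] af_one_closed[OF Q(2)])
  then obtain t where t: "t \<in> Mor A" "Dom A t = Cod A h" "Cod A t = B" "m \<odot> t = Id A (Cod A h)"
    using pres_relE[OF Q(3), of "Id A (Cod A h)"] m PH by (metis Cod_Ob Id_Mor)
  have mt: "h \<odot> (r \<odot> t) \<oplus> b \<odot> (s \<odot> t) = Id A (Cod A h)"
    using t m_def B(1-13) PH b(1-3) by (simp add: assoc)
  have key: "eH = FMor H (s \<odot> t) (\<beta> (Cod A g) eG)"
  proof -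
    have "eH = FMor H (h \<odot> (r \<odot> t) \<oplus> b \<odot> (s \<odot> t)) eH" unfolding mt using PH by (simp add: af_Id[OF ad(2)])
    also have "\<dots> = FMor H (h \<odot> (r \<odot> t)) eH \<otimes>\<^bsub>FOb H (Cod A h)\<^esub> FMor H (b \<odot> (s \<odot> t)) eH"
      using PH b(1-3) B(1-13) t(1-3) by (subst af_Add[OF ad(2)]) simp_all
    also have "\<dots> = FMor H (s \<odot> t) (\<beta> (Cod A g) eG)"
      using PH b B(1-13) t(1-3) nt_closed[OF \<beta>, of "Cod A g" eG] PG
      by (simp add: pres_Cmp[OF ad(2) H] af_Cmp[OF ad(2), of "s \<odot> t" b] af_closed[OF ad(2)]
          monoid.l_one[OF af_monoid[OF ad(2)]])
    finally show ?thesis .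
  qed
  show ?thesis unfolding pointwise_surj_def
  proof (intro ballI)
    fix W y assume W: "W \<in> Ob A" "y \<in> carrier (FOb H W)"
    obtain k where k: "k \<in> Mor A" "Dom A k = W" "Cod A k = Cod A h" "FMor H k eH = y"
      by (rule pres_gen[OF H W])
    have ty: "(s \<odot> t) \<odot> k \<in> Mor A" "Dom A ((s \<odot> t) \<odot> k) = W" "Cod A ((s \<odot> t) \<odot> k) = Cod A g"
      using k(1-3) t B(1-13) b(1-3) by simp_all
    have "\<beta> W (FMor G ((s \<odot> t) \<odot> k) eG) = FMor H ((s \<odot> t) \<odot> k) (\<beta> (Cod A g) eG)"
      using nt_nat[OF \<beta> ty(1,2)] ty(3) PG by simp
    also have "\<dots> = FMor H k (FMor H (s \<odot> t) (\<beta> (Cod A g) eG))"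
      using k(1-3) t(1-3) B(1-13) b(1-3) nt_closed[OF \<beta>, of "Cod A g" eG] PG
      by (intro af_Cmp[OF ad(2)]) simp_all
    also have "\<dots> = y" using key k(4) by simp
    finally show "\<exists>x \<in> carrier (FOb G W). \<beta> W x = y"
      using af_closed[OF ad(1) ty(1,2), of eG] ty(3) PG by auto
  qed
qed

lemma epi_modcatD:
  fixes G H :: "('o, 'm, 'g) afun"
  assumes fp: "finitely_presented A G" "finitely_presented A H" and \<beta>: "nat_trans A G H \<beta>"
    and epi: "epi_arrow (modcat A) (arr A G H \<beta>)"
  shows "pointwise_surj A G H \<beta>"
proof (rule pointwise_surjI[OF fp \<beta>])
  fix Q :: "('o, 'm, 'g) afun" and q
  assume Q: "finitely_presented A Q" "nat_trans A H Q q"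
    "\<forall>W \<in> Ob A. \<forall>x \<in> carrier (FOb G W). q W (\<beta> W x) = \<one>\<^bsub>FOb Q W\<^esub>"
  note n = nat_trans_one[OF fp_additive[OF Q(1)], of H]
  have "arr A H Q q \<cdot>\<^bsub>modcat A\<^esub> arr A G H \<beta> = arr A H Q (\<lambda>X x. \<one>\<^bsub>FOb Q X\<^esub>) \<cdot>\<^bsub>modcat A\<^esub> arr A G H \<beta>"
    using Q(3) by (simp add: arr_Cmp[OF \<beta>] arr_eq_iff)
  moreover have "arr A H Q q \<in> Mor (modcat A)" "arr A H Q (\<lambda>X x. \<one>\<^bsub>FOb Q X\<^esub>) \<in> Mor (modcat A)"
    using fp Q n by simp_all
  ultimately have "arr A H Q q = arr A H Q (\<lambda>X x. \<one>\<^bsub>FOb Q X\<^esub>)"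
    using epi unfolding epi_arrow_def mono_arrow_def opcat_simps by (metis arr_Dom_Cod)
  then show "\<forall>W \<in> Ob A. \<forall>y \<in> carrier (FOb H W). q W y = \<one>\<^bsub>FOb Q W\<^esub>" by (simp add: arr_eq_iff)
qed

text \<open>The zero map descends along a cokernel in one way only, so a map \<open>q\<close> with
  \<open>q \<beta> = 0\<close> is zero. The general fact that cokernels are epi was derived for
  preadditive categories and is here repeated for \<open>modcat\<close>.\<close>

lemma cokernel_modcat_epi:
  fixes G H :: "('o, 'm, 'g) afun"
  assumes fp: "finitely_presented A F" "finitely_presented A G" "finitely_presented A H"
    and \<alpha>: "nat_trans A F G \<alpha>" and \<beta>: "nat_trans A G H \<beta>"
    and cok: "is_cokernel (modcat A) (arr A G H \<beta>) (arr A F G \<alpha>)"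
  shows "pointwise_surj A G H \<beta>"
proof (rule pointwise_surjI[OF fp(2,3) \<beta>])
  fix Q :: "('o, 'm, 'g) afun" and q
  assume Q: "finitely_presented A Q" "nat_trans A H Q q"
    "\<forall>W \<in> Ob A. \<forall>x \<in> carrier (FOb G W). q W (\<beta> W x) = \<one>\<^bsub>FOb Q W\<^esub>"
  note adQ = fp_additive[OF Q(1)]
  note n = nat_trans_one[OF adQ, of H] and n' = nat_trans_one[OF adQ, of G]
  let ?z = "arr A G Q (\<lambda>X x. \<one>\<^bsub>FOb Q X\<^esub>)"
  have "?z \<in> Mor (modcat A)" "?z \<cdot>\<^bsub>modcat A\<^esub> arr A F G \<alpha> = Zero (modcat A) F Q"
    using fp Q n' by (simp_all add: arr_Cmp[OF \<alpha>] arr_Zero arr_eq_iff)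
  then have "\<exists>!u. u \<in> homset (modcat A) H Q \<and> u \<cdot>\<^bsub>modcat A\<^esub> arr A G H \<beta> = ?z"
    using cok unfolding is_cokernel_def is_kernel_def opcat_simps homset_opcat arr_Dom_Cod
    by (metis arr_Dom_Cod)
  moreover have "arr A H Q q \<in> homset (modcat A) H Q"
    "arr A H Q (\<lambda>X x. \<one>\<^bsub>FOb Q X\<^esub>) \<in> homset (modcat A) H Q"
    using fp Q n by (simp_all add: arr_hom)
  moreover have "arr A H Q q \<cdot>\<^bsub>modcat A\<^esub> arr A G H \<beta> = ?z"
    "arr A H Q (\<lambda>X x. \<one>\<^bsub>FOb Q X\<^esub>) \<cdot>\<^bsub>modcat A\<^esub> arr A G H \<beta> = ?z"
    using Q(3) by (simp_all add: arr_Cmp[OF \<beta>] arr_eq_iff)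
  ultimately have "arr A H Q q = arr A H Q (\<lambda>X x. \<one>\<^bsub>FOb Q X\<^esub>)" by blast
  then show "\<forall>W \<in> Ob A. \<forall>y \<in> carrier (FOb H W). q W y = \<one>\<^bsub>FOb Q W\<^esub>" by (simp add: arr_eq_iff)
qed

end

section \<open>Locally representable functors\<close>

definition coverage :: "('o, 'm) acat \<Rightarrow> 'm set \<Rightarrow> bool" where
  "coverage A D \<longleftrightarrow> (\<forall>p \<in> D. epi_arrow A p) \<and>
     (\<forall>p \<in> D. \<forall>q \<in> D. Cod A p = Dom A q \<longrightarrow> q \<cdot>\<^bsub>A\<^esub> p \<in> D) \<and>
     (\<forall>p \<in> D. \<forall>f \<in> Mor A. Cod A f = Cod A p \<longrightarrow>
        (\<exists>d \<in> D. \<exists>u \<in> homset A (Dom A d) (Dom A p). Cod A d = Dom A f \<and> p \<cdot>\<^bsub>A\<^esub> u = f \<cdot>\<^bsub>A\<^esub> d))"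

text \<open>
  The maps in \<open>D\<close> are the covers of a topology for which representable functors are sheaves;
  \<open>local_iso\<close> says that \<open>Hom(-, Y)\<close> is the sheafification of \<open>F\<close>.
\<close>

definition local_iso ::
    "('o, 'm) acat \<Rightarrow> 'm set \<Rightarrow> ('o, 'm, 'g) afun \<Rightarrow> 'o \<Rightarrow> ('o \<Rightarrow> 'g \<Rightarrow> 'm) \<Rightarrow> bool" where
  "local_iso A D F Y \<eta> \<longleftrightarrow> Y \<in> Ob A \<and> nat_trans A F (hom_functor A Y) \<eta> \<and>
     (\<forall>W \<in> Ob A. \<forall>x \<in> carrier (FOb F W). \<eta> W x = Zero A W Y \<longrightarrow>
        (\<exists>d \<in> D. Cod A d = W \<and> FMor F d x = \<one>\<^bsub>FOb F (Dom A d)\<^esub>)) \<and>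
     (\<forall>y \<in> Mor A. Cod A y = Y \<longrightarrow>
        (\<exists>d \<in> D. Cod A d = Dom A y \<and> (\<exists>x \<in> carrier (FOb F (Dom A d)). \<eta> (Dom A d) x = y \<cdot>\<^bsub>A\<^esub> d)))"

text \<open>This is the existence half of the universal property of sheafification, restricted to
  representable sheaves; it turns maps of functors into arrows between representing objects. As
  \<open>D\<close> does not occur in it, a map found for all epimorphisms as covers can be kept
  while \<open>local_iso\<close> is sharpened to smaller \<open>D\<close>.\<close>

definition universal_to_hom ::
    "('o, 'm) acat \<Rightarrow> ('o, 'm, 'g) afun \<Rightarrow> 'o \<Rightarrow> ('o \<Rightarrow> 'g \<Rightarrow> 'm) \<Rightarrow> bool" where
  "universal_to_hom A F Y \<eta> \<longleftrightarrow> (\<forall>T \<in> Ob A. \<forall>\<beta>. nat_trans A F (hom_functor A T) \<beta> \<longrightarrow>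
     (\<exists>a \<in> homset A Y T. \<forall>W \<in> Ob A. \<forall>x \<in> carrier (FOb F W). \<beta> W x = a \<cdot>\<^bsub>A\<^esub> \<eta> W x))"

definition locally_representable :: "('o, 'm) acat \<Rightarrow> 'm set \<Rightarrow> ('o, 'm, 'g) afun set" where
  "locally_representable A D = {F. finitely_presented A F \<and>
     (\<exists>Y \<eta>. local_iso A D F Y \<eta> \<and> universal_to_hom A F Y \<eta>)}"

lemma coverageD:
  assumes "coverage A D"
  shows "p \<in> D \<Longrightarrow> epi_arrow A p"
    "p \<in> D \<Longrightarrow> q \<in> D \<Longrightarrow> Cod A p = Dom A q \<Longrightarrow> q \<cdot>\<^bsub>A\<^esub> p \<in> D"
  using assms by (simp_all add: coverage_def)

lemma coverage_pullbackE:
  assumes "coverage A D" "p \<in> D" "f \<in> Mor A" "Cod A f = Cod A p"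
  obtains d u where "d \<in> D" "u \<in> Mor A" "Dom A u = Dom A d" "Cod A u = Dom A p" "Cod A d = Dom A f"
    "p \<cdot>\<^bsub>A\<^esub> u = f \<cdot>\<^bsub>A\<^esub> d"
proof -
  obtain d u where "d \<in> D" "u \<in> homset A (Dom A d) (Dom A p)" "Cod A d = Dom A f" "p \<cdot>\<^bsub>A\<^esub> u = f \<cdot>\<^bsub>A\<^esub> d"
    using assms unfolding coverage_def by blast
  then show ?thesis by (intro that[of d u]) (simp_all add: hom_iff)
qed

context preadditive_category
begin

lemma local_isoD:
  assumes "local_iso C D F Y \<eta>"
  shows "Y \<in> Ob C" "nat_trans C F (hom_functor C Y) \<eta>"
  using assms by (simp_all add: local_iso_def)

lemma local_iso_kerE:
  assumes "local_iso C D F Y \<eta>" "W \<in> Ob C" "x \<in> carrier (FOb F W)" "\<eta> W x = Zero C W Y"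
  obtains d where "d \<in> D" "Cod C d = W" "FMor F d x = \<one>\<^bsub>FOb F (Dom C d)\<^esub>"
  using assms unfolding local_iso_def by blast

lemma local_iso_liftE:
  assumes "local_iso C D F Y \<eta>" "y \<in> Mor C" "Cod C y = Y"
  obtains d x where "d \<in> D" "Cod C d = Dom C y" "x \<in> carrier (FOb F (Dom C d))" "\<eta> (Dom C d) x = y \<odot> d"
  using assms unfolding local_iso_def by blast

lemma hom_nt:
  assumes "nat_trans C F (hom_functor C Y) \<eta>" "W \<in> Ob C" "x \<in> carrier (FOb F W)"
  shows "\<eta> W x \<in> Mor C" "Dom C (\<eta> W x) = W" "Cod C (\<eta> W x) = Y"
  using nt_closed[OF assms] by (simp_all add: hom_iff)

lemma hom_nt_nat:
  assumes "nat_trans C F (hom_functor C Y) \<eta>" "f \<in> Mor C" "Dom C f = W" "x \<in> carrier (FOb F (Cod C f))"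
  shows "\<eta> W (FMor F f x) = \<eta> (Cod C f) x \<odot> f"
  using nt_nat[OF assms(1-4)] by simp

end

section \<open>Comparison with representable functors, and closure properties of the locally
  representable ones\<close>

context abelian_category
begin

text \<open>This is the largest possible choice of covers. For it every finitely presented functor
  has a comparison map, which supplies the candidate for \<open>Y\<close> when covers in a smaller
  class are wanted.\<close>

lemma coverage_epis: "coverage A {p. epi_arrow A p}"
  unfolding coverage_def
proof (intro conjI ballI impI)
  fix p q assume "p \<in> {p. epi_arrow A p}" "q \<in> {p. epi_arrow A p}" "Cod A p = Dom A q"
  then show "q \<odot> p \<in> {p. epi_arrow A p}" using epi_comp[of q p] by simp
next
  fix p f assume *: "p \<in> {p. epi_arrow A p}" "f \<in> Mor A" "Cod A f = Cod A p"
  obtain p' q where p': "is_pullback A p f p' q" "epi_arrow A p'"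
    by (rule epi_pullback[of p f]) (use * in simp_all)
  then show "\<exists>d \<in> {p. epi_arrow A p}. \<exists>u \<in> homset A (Dom A d) (Dom A p). Cod A d = Dom A f \<and> p \<odot> u = f \<odot> d"
    by (intro bexI[of _ p'] bexI[of _ q]) (simp_all add: is_pullback_def hom_iff)
qed simp

text \<open>The comparison map sends the generator \<open>e\<close> to \<open>c\<close>, so
  \<open>Y\<close> is the cokernel of \<open>i\<close>. The two hypotheses on covers serve one half
  each: \<open>p\<close> in \<open>D\<close> gives local injectivity, \<open>c\<close> in
  \<open>D\<close> gives local surjectivity.\<close>

lemma local_iso_of_presentation:
  assumes D: "coverage A D" and F: "additive_functor A F" and f: "pres A (i \<odot> p) F e"
    and ip: "mono_arrow A i" "p \<in> D" "Cod A p = Dom A i" and c: "is_cokernel A c i" "c \<in> D"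
  obtains \<eta> where "local_iso A D F (Cod A c) \<eta>" "universal_to_hom A F (Cod A c) \<eta>"
proof -
  note C = is_cokernelD[OF c(1)]
  have epi: "epi_arrow A p" using coverageD(1)[OF D ip(2)] .
  have ty: "i \<in> Mor A" "p \<in> Mor A" using ip(1) epi by (simp_all add: mono_arrow_def epi_arrow_iff)
  have ker: "is_kernel A i c" by (rule mono_kernel_cokernel[OF ip(1) c(1)])
  have e: "e \<in> carrier (FOb F (Cod A i))" using presD[OF f] ty ip by simp
  have ch: "additive_functor A (hom_functor A (Cod A c))" using additive_hom_functor C(1) by simp
  have "FMor (hom_functor A (Cod A c)) (i \<odot> p) c = \<one>\<^bsub>FOb (hom_functor A (Cod A c)) (Dom A (i \<odot> p))\<^esub>"
    using Cmp_eq_Zero[OF C(4) ty(1) C(1) ty(2)] C(3) ip(3) ty C by simp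
  then obtain \<eta> where \<eta>: "nat_trans A F (hom_functor A (Cod A c)) \<eta>" "\<eta> (Cod A (i \<odot> p)) e = c"
    by (rule induced_nat_trans[OF F ch f, rotated]) (use C ty ip in \<open>simp_all add: hom_iff\<close>)
  have \<eta>e: "\<eta> (Cod A i) e = c" using \<eta>(2) ty ip by simp
  have \<eta>h: "\<eta> (Dom A h) (FMor F h e) = c \<odot> h" if "h \<in> Mor A" "Cod A h = Cod A i" for h
    using hom_nt_nat[OF \<eta>(1) that(1) refl, of e] that e \<eta>e by simp
  have "local_iso A D F (Cod A c) \<eta>" unfolding local_iso_def
  proof (intro conjI ballI impI \<eta>)
    show "Cod A c \<in> Ob A" using C(1) by simp
    fix W x assume x: "W \<in> Ob A" "x \<in> carrier (FOb F W)" "\<eta> W x = Zero A W (Cod A c)"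
    obtain h where h: "h \<in> Mor A" "Dom A h = W" "Cod A h = Cod A (i \<odot> p)" "FMor F h e = x"
      by (rule pres_gen[OF f x(1,2)])
    have ch: "Cod A h = Cod A i" using h(3) ty ip by simp
    have "c \<odot> h = Zero A (Dom A h) (Cod A c)" using \<eta>h[OF h(1) ch] h x(3) by simp
    \<comment> \<open>The kernel of \<open>c\<close> is \<open>i\<close>, so an element with trivial
      image comes from an arrow \<open>u\<close> into \<open>Dom i\<close>. Over a cover
      \<open>u\<close> lifts along \<open>p\<close>, which makes the element a relation.\<close>
    then obtain u where u: "u \<in> Mor A" "Dom A u = Dom A h" "Cod A u = Dom A i" "i \<odot> u = h"
      using is_kernel_lift[OF ker h(1)] ch C(3) by metis
    obtain d s where d: "d \<in> D" "s \<in> Mor A" "Dom A s = Dom A d" "Cod A s = Dom A p" "Cod A d = Dom A u"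
      "p \<odot> s = u \<odot> d"
      by (rule coverage_pullbackE[OF D ip(2) u(1)]) (use u ip in simp)
    have dM: "d \<in> Mor A" using coverageD(1)[OF D d(1)] by (simp add: epi_arrow_iff)
    have "(i \<odot> p) \<odot> s = h \<odot> d"
      using comp_reassoc[OF u(4) u(1) ty(1) dM u(3)] d ty ip u by (simp add: assoc)
    then have "FMor F (h \<odot> d) e = \<one>\<^bsub>FOb F (Dom A d)\<^esub>"
      using pres_Cmp[OF F f d(2)] d ty ip by simp
    then have "FMor F d x = \<one>\<^bsub>FOb F (Dom A d)\<^esub>"
      using af_Cmp[OF F dM h(1), of e] h d u ch e by simp
    then show "\<exists>d \<in> D. Cod A d = W \<and> FMor F d x = \<one>\<^bsub>FOb F (Dom A d)\<^esub>"
      using d u h by (intro bexI[of _ d]) simp_all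
  next
    fix y assume y: "y \<in> Mor A" "Cod A y = Cod A c"
    obtain d s where d: "d \<in> D" "s \<in> Mor A" "Dom A s = Dom A d" "Cod A s = Dom A c" "Cod A d = Dom A y"
      "c \<odot> s = y \<odot> d"
      by (rule coverage_pullbackE[OF D c(2) y])
    have "\<eta> (Dom A d) (FMor F s e) = y \<odot> d" using \<eta>h[of s] d C(3) by simp
    moreover have "FMor F s e \<in> carrier (FOb F (Dom A d))"
      using d C(3) e by (intro af_closed[OF F]) simp_all
    ultimately show "\<exists>d \<in> D. Cod A d = Dom A y \<and> (\<exists>x \<in> carrier (FOb F (Dom A d)). \<eta> (Dom A d) x = y \<odot> d)"
      using d by blast
  qed
  moreover have "universal_to_hom A F (Cod A c) \<eta>" unfolding universal_to_hom_def
  proof (intro ballI allI impI)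
    fix T \<beta> assume T: "T \<in> Ob A" and \<beta>: "nat_trans A F (hom_functor A T) \<beta>"
    have Ob: "Cod A i \<in> Ob A" using ty by simp
    define b where "b = \<beta> (Cod A i) e"
    have b: "b \<in> Mor A" "Dom A b = Cod A i" "Cod A b = T" using hom_nt[OF \<beta> Ob e] by (simp_all add: b_def)
    have \<beta>h: "\<beta> (Dom A h) (FMor F h e) = b \<odot> h" if "h \<in> Mor A" "Cod A h = Cod A i" for h
      using hom_nt_nat[OF \<beta> that(1) refl, of e] that e by (simp add: b_def)
    have "b \<odot> (i \<odot> p) = \<beta> (Dom A p) \<one>\<^bsub>FOb F (Dom A p)\<^esub>"
      using \<beta>h[of "i \<odot> p"] pres_zero[OF F f] ty ip by simp
    also have "\<dots> = Zero A (Dom A p) T"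
      using nt_one[OF \<beta> F additive_hom_functor[OF T], of "Dom A p"] ty by simp
    finally have z: "(b \<odot> i) \<odot> p = Zero A (Dom A p) (Cod A (b \<odot> i))" using b ty ip by (simp add: assoc)
    have "b \<odot> i = Zero A (Cod A p) (Cod A (b \<odot> i))"
      \<comment> \<open>\<open>\<beta>\<close> is trivial on the relation \<open>i p\<close>, and
        \<open>p\<close> is epi, so \<open>b\<close> vanishes on \<open>i\<close> and descends along
        its cokernel \<open>c\<close>.\<close>
      by (rule epi_zero[OF epi _ _ z]) (use b ty ip in simp_all)
    then have "b \<odot> i = Zero A (Dom A i) (Cod A b)" using b ty ip by simp
    then obtain a where a: "a \<in> homset A (Cod A c) T" "a \<odot> c = b"
      using is_cokernel_ex[OF c(1) b(1,2)] b(3) by auto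
    have "\<beta> W x = a \<odot> \<eta> W x" if x: "W \<in> Ob A" "x \<in> carrier (FOb F W)" for W x
    proof -
      obtain h where h: "h \<in> Mor A" "Dom A h = W" "Cod A h = Cod A (i \<odot> p)" "FMor F h e = x"
        by (rule pres_gen[OF f x])
      have ch: "Cod A h = Cod A i" using h(3) ty ip by simp
      have "\<beta> W x = b \<odot> h" "\<eta> W x = c \<odot> h" using \<beta>h[OF h(1) ch] \<eta>h[OF h(1) ch] h by simp_all
      then show ?thesis using comp_reassoc[OF a(2), of h] a(1) h(1) ch C by (simp add: hom_iff)
    qed
    then show "\<exists>a \<in> homset A (Cod A c) T. \<forall>W \<in> Ob A. \<forall>x \<in> carrier (FOb F W). \<beta> W x = a \<odot> \<eta> W x"
      using a(1) by blast
  qed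
  ultimately show ?thesis by (rule that)
qed

text \<open>Here \<open>c\<close> is recovered as the image of the generator. Local surjectivity and
  local injectivity only produce composites that are covers, and \<open>cancel\<close> extracts
  \<open>c\<close> and \<open>p\<close> from them.\<close>

lemma presentation_of_local_iso:
  assumes D: "coverage A D"
    and cancel: "\<And>g h. g \<in> Mor A \<Longrightarrow> h \<in> Mor A \<Longrightarrow> Cod A h = Dom A g \<Longrightarrow> g \<odot> h \<in> D \<Longrightarrow> g \<in> D"
    and F: "additive_functor A F" and f: "pres A (i \<odot> p) F e"
    and ip: "mono_arrow A i" "epi_arrow A p" "Cod A p = Dom A i" and \<eta>: "local_iso A D F Y \<eta>"
  obtains c where "p \<in> D" "c \<in> D" "is_kernel A i c"
proof -
  note L = local_isoD[OF \<eta>]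
  have ty: "i \<in> Mor A" "p \<in> Mor A" using ip by (simp_all add: mono_arrow_def epi_arrow_iff)
  have e: "e \<in> carrier (FOb F (Cod A i))" using presD[OF f] ty ip by simp
  have DM: "d \<in> Mor A" if "d \<in> D" for d using coverageD(1)[OF D that] by (simp add: epi_arrow_iff)
  define c where "c = \<eta> (Cod A i) e"
  have c: "c \<in> Mor A" "Dom A c = Cod A i" "Cod A c = Y"
    using hom_nt[OF L(2) _ e] ty by (simp_all add: c_def)
  have \<eta>h: "\<eta> (Dom A h) (FMor F h e) = c \<odot> h" if "h \<in> Mor A" "Cod A h = Cod A i" for h
    using hom_nt_nat[OF L(2) that(1) refl, of e] that e by (simp add: c_def)
  have "c \<in> D"
  proof -
    \<comment> \<open>The identity of \<open>Y\<close> lifts over a cover \<open>d\<close>. The lift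
      is \<open>F(h)(e)\<close> for some \<open>h\<close>, which means
      \<open>d = c h\<close>.\<close>
    obtain d x where d: "d \<in> D" "Cod A d = Dom A (Id A Y)" "x \<in> carrier (FOb F (Dom A d))"
      "\<eta> (Dom A d) x = Id A Y \<odot> d"
      by (rule local_iso_liftE[OF \<eta>, of "Id A Y"]) (use L(1) in simp_all)
    obtain h where h: "h \<in> Mor A" "Dom A h = Dom A d" "Cod A h = Cod A (i \<odot> p)" "FMor F h e = x"
      by (rule pres_gen[OF f _ d(3)]) (use DM[OF d(1)] in simp)
    have "c \<odot> h = d" using \<eta>h[OF h(1)] h d L(1) DM[OF d(1)] ty ip by simp
    then show ?thesis using cancel[of c h] c h d(1) ty ip by simp
  qed
  have ci: "c \<odot> i = Zero A (Dom A i) (Cod A c)"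
  proof -
    have "c \<odot> (i \<odot> p) = \<eta> (Dom A p) \<one>\<^bsub>FOb F (Dom A p)\<^esub>"
      using \<eta>h[of "i \<odot> p"] pres_zero[OF F f] ty ip by simp
    also have "\<dots> = Zero A (Dom A p) Y"
      using nt_one[OF L(2) F additive_hom_functor[OF L(1)], of "Dom A p"] ty by simp
    finally have z: "(c \<odot> i) \<odot> p = Zero A (Dom A p) (Cod A (c \<odot> i))" using c ty ip by (simp add: assoc)
    have "c \<odot> i = Zero A (Cod A p) (Cod A (c \<odot> i))"
      by (rule epi_zero[OF ip(2) _ _ z]) (use c ty ip in simp_all)
    then show ?thesis using c ty ip by simp
  qed
  \<comment> \<open>Local injectivity in terms of arrows: what \<open>c\<close> kills factors
    through \<open>i p\<close> after passing to a cover.\<close>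
  have fac: "\<exists>d \<in> D. \<exists>s \<in> Mor A. Cod A d = Dom A h \<and> Dom A s = Dom A d \<and> Cod A s = Dom A p \<and> i \<odot> (p \<odot> s) = h \<odot> d"
    if h: "h \<in> Mor A" "Cod A h = Cod A i" "c \<odot> h = Zero A (Dom A h) (Cod A c)" for h
  proof -
    have x: "FMor F h e \<in> carrier (FOb F (Dom A h))" using af_closed[OF F h(1) refl, of e] h e by simp
    have "\<eta> (Dom A h) (FMor F h e) = Zero A (Dom A h) Y" using \<eta>h[OF h(1,2)] h(3) c by simp
    then obtain d where d: "d \<in> D" "Cod A d = Dom A h" "FMor F d (FMor F h e) = \<one>\<^bsub>FOb F (Dom A d)\<^esub>"
      using local_iso_kerE[OF \<eta> Dom_Ob[OF h(1)] x] by metis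
    have "FMor F (h \<odot> d) e = \<one>\<^bsub>FOb F (Dom A (h \<odot> d))\<^esub>"
      using d DM[OF d(1)] h e by (simp add: af_Cmp[OF F])
    then obtain s where s: "s \<in> Mor A" "Dom A s = Dom A (h \<odot> d)" "Cod A s = Dom A (i \<odot> p)"
      "(i \<odot> p) \<odot> s = h \<odot> d"
      using pres_relE[OF f, of "h \<odot> d"] d DM[OF d(1)] h ty ip by (metis Cmp_Mor)
    have "Dom A s = Dom A d" "Cod A s = Dom A p" "i \<odot> (p \<odot> s) = h \<odot> d"
      using s d(2) DM[OF d(1)] h(1) ty ip by (simp_all add: assoc)
    then show ?thesis using s(1) d by blast
  qed
  have "is_kernel A i c"
  proof (rule is_kernelI[OF ip(1) c(1) c(2)[symmetric] ci])
    fix h assume h: "h \<in> Mor A" "Cod A h = Dom A c" "c \<odot> h = Zero A (Dom A h) (Cod A c)"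
    have hi: "Cod A h = Cod A i" using h(2) c(2) by simp
    obtain d s where d: "d \<in> D" "s \<in> Mor A" "Cod A d = Dom A h" "Dom A s = Dom A d" "Cod A s = Dom A p"
      "i \<odot> (p \<odot> s) = h \<odot> d"
      using fac[OF h(1) hi h(3)] by blast
    \<comment> \<open>The factorization through \<open>i\<close> is available only over the cover
      \<open>d\<close>. What descends along the epimorphism \<open>d\<close> is the vanishing of
      \<open>q h\<close>, and \<open>i\<close> is the kernel of its cokernel
      \<open>q\<close>.\<close>
    obtain q where q: "is_cokernel A q i" using cokernels ty by blast
    note Q = is_cokernelD[OF q]
    have ps: "p \<odot> s \<in> Mor A" "Cod A (p \<odot> s) = Dom A i" "Dom A (p \<odot> s) = Dom A d"
      using d(2,4,5) ty ip by simp_all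
    have "q \<odot> (i \<odot> (p \<odot> s)) = Zero A (Dom A d) (Cod A q)"
      using Cmp_eq_Zero[OF Q(4) ty(1) Q(1) ps(1)] Q(3) ps by simp
    then have "(q \<odot> h) \<odot> d = Zero A (Dom A d) (Cod A (q \<odot> h))"
      unfolding d(6) using Q hi h(1) d(3) DM[OF d(1)] by (simp add: assoc)
    then have "q \<odot> h = Zero A (Cod A d) (Cod A (q \<odot> h))"
      using epi_zero[OF coverageD(1)[OF D d(1)], of "q \<odot> h"] Q hi h(1) d(3) by simp
    then have "q \<odot> h = Zero A (Dom A h) (Cod A q)" using Q hi h(1) d(3) by simp
    then show "\<exists>u \<in> homset A (Dom A h) (Dom A i). i \<odot> u = h"
      using is_kernel_ex[OF mono_kernel_cokernel[OF ip(1) q] h(1)] hi Q(3) by simp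
  qed
  moreover have "p \<in> D"
  proof -
    \<comment> \<open>Applied to \<open>i\<close> itself, and after cancelling the mono
      \<open>i\<close>, the local factorization reads \<open>p s = d\<close>.\<close>
    obtain d s where d: "d \<in> D" "s \<in> Mor A" "Cod A d = Dom A i" "Dom A s = Dom A d" "Cod A s = Dom A p"
      "i \<odot> (p \<odot> s) = i \<odot> d"
      using fac[OF ty(1) refl ci] by blast
    have "p \<odot> s = d" using monoD[OF ip(1), of "p \<odot> s" d] d ty ip DM[OF d(1)] by simp
    then show ?thesis using cancel[of p s] d ty by simp
  qed
  ultimately show ?thesis using that \<open>c \<in> D\<close> by blast
qed

text \<open>In the image factorization of a presentation both \<open>p\<close> and the cokernel of
  \<open>i\<close> are epimorphisms, hence covers for this coverage.\<close>

lemma ex_epi_local_iso: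
  assumes "finitely_presented A F"
  obtains Y \<eta> where "local_iso A {p. epi_arrow A p} F Y \<eta>" "universal_to_hom A F Y \<eta>"
proof -
  obtain f e where f: "pres A f F e" by (rule fp_pres[OF assms])
  obtain p i where ip: "epi_arrow A p" "mono_arrow A i" "Cod A p = Dom A i" "f = i \<odot> p"
    by (rule image_factorization[OF presD(1)[OF f]])
  have "i \<in> Mor A" using ip(2) by (simp add: mono_arrow_def)
  then obtain c where c: "is_cokernel A c i" using cokernels by blast
  show ?thesis
    by (rule local_iso_of_presentation[OF coverage_epis fp_additive[OF assms] f[unfolded ip(4)] ip(2) _ ip(3) c])
      (use ip(1) is_cokernel_epi[OF c] that in auto)
qed

lemma local_iso_mono:
  assumes "local_iso A D F Y \<eta>" "D \<subseteq> D'" shows "local_iso A D' F Y \<eta>"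
  using assms unfolding local_iso_def by blast

text \<open>Up to a cover the identity of \<open>Y\<close> is in the image of \<open>\<eta>\<close>,
  and covers can be cancelled since they are epi.\<close>

lemma local_section_eq:
  assumes \<eta>: "local_iso A {p. epi_arrow A p} F Y \<eta>"
    and a: "a \<in> Mor A" "Dom A a = Y" "b \<in> Mor A" "Dom A b = Y" "Cod A a = Cod A b"
    and eq: "\<And>W x. W \<in> Ob A \<Longrightarrow> x \<in> carrier (FOb F W) \<Longrightarrow> a \<odot> \<eta> W x = b \<odot> \<eta> W x"
  shows "a = b"
proof -
  note L = local_isoD[OF \<eta>]
  obtain d x where d: "d \<in> {p. epi_arrow A p}" "Cod A d = Dom A (Id A Y)" "x \<in> carrier (FOb F (Dom A d))"
    "\<eta> (Dom A d) x = Id A Y \<odot> d"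
    by (rule local_iso_liftE[OF \<eta>, of "Id A Y"]) (use L(1) in simp_all)
  have dM: "d \<in> Mor A" using d(1) by (simp add: epi_arrow_iff)
  have "a \<odot> d = b \<odot> d" using eq[OF Dom_Ob[OF dM] d(3)] d(2,4) L(1) dM by simp
  then show ?thesis using epiD[of d a b] d(1,2) a L(1) by simp
qed

text \<open>Sheafification preserves monomorphisms: a section killed by \<open>a\<close> lifts to
  \<open>F\<close> over a cover, its image in \<open>G\<close> vanishes over a further one, and
  injectivity of \<open>\<alpha>\<close> brings this back to \<open>F\<close>.\<close>

lemma local_mono:
  assumes F: "additive_functor A F" and G: "additive_functor A G"
    and \<eta>: "local_iso A {p. epi_arrow A p} F Y \<eta>" and \<theta>: "local_iso A {p. epi_arrow A p} G Z \<theta>"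
    and \<alpha>: "nat_trans A F G \<alpha>"
    and inj: "\<And>W x. W \<in> Ob A \<Longrightarrow> x \<in> carrier (FOb F W) \<Longrightarrow> \<alpha> W x = \<one>\<^bsub>FOb G W\<^esub> \<Longrightarrow> x = \<one>\<^bsub>FOb F W\<^esub>"
    and a: "a \<in> Mor A" "Dom A a = Y" "Cod A a = Z"
    and comm: "\<And>W x. W \<in> Ob A \<Longrightarrow> x \<in> carrier (FOb F W) \<Longrightarrow> \<theta> W (\<alpha> W x) = a \<odot> \<eta> W x"
  shows "mono_arrow A a"
  unfolding mono_arrow_iff
proof (intro conjI ballI impI a)
  note L = local_isoD[OF \<eta>] and M = local_isoD[OF \<theta>]
  fix y assume y: "y \<in> Mor A" "Cod A y = Dom A a" "a \<odot> y = Zero A (Dom A y) (Cod A a)"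
  obtain d x where d: "d \<in> {p. epi_arrow A p}" "Cod A d = Dom A y" "x \<in> carrier (FOb F (Dom A d))"
    "\<eta> (Dom A d) x = y \<odot> d"
    by (rule local_iso_liftE[OF \<eta> y(1)]) (use y(2) a(2) in simp)
  have dM: "d \<in> Mor A" using d(1) by (simp add: epi_arrow_iff)
  have Ob: "Dom A d \<in> Ob A" using dM by simp
  have "\<theta> (Dom A d) (\<alpha> (Dom A d) x) = (a \<odot> y) \<odot> d"
    using comm[OF Ob d(3)] d y(1,2) a dM by (simp add: assoc)
  then have "\<theta> (Dom A d) (\<alpha> (Dom A d) x) = Zero A (Dom A d) Z"
    unfolding y(3) using d(2) y(1) dM a M(1) by simp
  then obtain d' where d': "d' \<in> {p. epi_arrow A p}" "Cod A d' = Dom A d"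
    "FMor G d' (\<alpha> (Dom A d) x) = \<one>\<^bsub>FOb G (Dom A d')\<^esub>"
    by (rule local_iso_kerE[OF \<theta> Ob nt_closed[OF \<alpha> Ob d(3)]])
  have dM': "d' \<in> Mor A" using d'(1) by (simp add: epi_arrow_iff)
  have x': "x \<in> carrier (FOb F (Cod A d'))" using d(3) d'(2) by simp
  have "FMor F d' x = \<one>\<^bsub>FOb F (Dom A d')\<^esub>"
    using inj[OF Dom_Ob[OF dM'] af_closed[OF F dM' refl x']] nt_nat[OF \<alpha> dM' refl x'] d'(2,3) by simp
  then have "\<eta> (Cod A d') x \<odot> d' = Zero A (Dom A d') Y"
    using hom_nt_nat[OF L(2) dM' refl x'] nt_one[OF L(2) F additive_hom_functor[OF L(1)] Dom_Ob[OF dM']]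
    by simp
  then have "(y \<odot> d) \<odot> d' = Zero A (Dom A d') (Cod A (y \<odot> d))" using d d'(2) y(1,2) a dM by simp
  then have "y \<odot> d = Zero A (Cod A d') (Cod A (y \<odot> d))"
    using epi_zero[of d' "y \<odot> d"] d'(1,2) d(2) y(1) dM by simp
  then have "y \<odot> d = Zero A (Dom A d) (Cod A y)" using d'(2) d(2) y(1) dM by simp
  then show "y = Zero A (Dom A y) (Dom A a)" using epi_zero[of d y] d(1,2) y(1,2) by simp
qed

text \<open>The universal properties turn \<open>\<alpha>\<close> and \<open>\<beta>\<close> into
  \<open>a\<close> from \<open>Y\<close> to \<open>Z\<close> and \<open>b\<close> from
  \<open>Z\<close> to \<open>T\<close>, with \<open>a\<close> mono and \<open>b a = 0\<close>. The
  comparison map for \<open>F\<close> is at first only good for all epimorphisms as covers;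
  \<open>G\<close> and \<open>H\<close> then supply covers in \<open>D\<close>.\<close>

lemma locally_representable_kernel:
  assumes D: "coverage A D" and fp: "finitely_presented A F" and ex: "left_exact A F G H \<alpha> \<beta>"
    and GH: "G \<in> locally_representable A D" "H \<in> locally_representable A D"
  shows "F \<in> locally_representable A D"
proof -
  have De: "D \<subseteq> {p. epi_arrow A p}" using coverageD(1)[OF D] by blast
  have DM: "d \<in> Mor A" if "d \<in> D" for d using coverageD(1)[OF D that] by (simp add: epi_arrow_iff)
  note LE = left_exactD[OF ex]
  obtain Z \<theta> where G: "finitely_presented A G" and \<theta>: "local_iso A D G Z \<theta>" "universal_to_hom A G Z \<theta>"
    using GH(1) unfolding locally_representable_def by blast
  obtain T \<tau> where H: "finitely_presented A H" and \<tau>: "local_iso A D H T \<tau>"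
    using GH(2) unfolding locally_representable_def by blast
  obtain Y \<eta> where \<eta>: "local_iso A {p. epi_arrow A p} F Y \<eta>" "universal_to_hom A F Y \<eta>"
    by (rule ex_epi_local_iso[OF fp])
  note ad = fp_additive[OF fp] fp_additive[OF G] fp_additive[OF H]
  note L = local_isoD[OF \<eta>(1)] and M = local_isoD[OF \<theta>(1)] and N = local_isoD[OF \<tau>]
  obtain a where a': "a \<in> homset A Y Z" and a: "\<And>W x. W \<in> Ob A \<Longrightarrow> x \<in> carrier (FOb F W) \<Longrightarrow>
      \<theta> W (\<alpha> W x) = a \<odot> \<eta> W x"
    using \<eta>(2)[unfolded universal_to_hom_def, rule_format, OF M(1) nat_trans_comp[OF LE(1) M(2)]] by blast
  obtain b where b': "b \<in> homset A Z T" and b: "\<And>W x. W \<in> Ob A \<Longrightarrow> x \<in> carrier (FOb G W) \<Longrightarrow>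
      \<tau> W (\<beta> W x) = b \<odot> \<theta> W x"
    using \<theta>(2)[unfolded universal_to_hom_def, rule_format, OF N(1) nat_trans_comp[OF LE(2) N(2)]] by blast
  have ty: "a \<in> Mor A" "Dom A a = Y" "Cod A a = Z" "b \<in> Mor A" "Dom A b = Z" "Cod A b = T"
    using a' b' by (simp_all add: hom_iff)
  have mono: "mono_arrow A a"
    by (rule local_mono[OF ad(1,2) \<eta>(1) local_iso_mono[OF \<theta>(1) De] LE(1,3) ty(1-3) a])
  have ba: "b \<odot> a = Zero A Y T"
  proof (rule local_section_eq[OF \<eta>(1)])
    fix W x assume x: "W \<in> Ob A" "x \<in> carrier (FOb F W)"
    have "(b \<odot> a) \<odot> \<eta> W x = b \<odot> \<theta> W (\<alpha> W x)"
      using a[OF x] hom_nt[OF L(2) x] ty by (simp add: assoc)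
    also have "\<dots> = \<tau> W \<one>\<^bsub>FOb H W\<^esub>" using b[OF x(1) nt_closed[OF LE(1) x]] LE(5)[OF x] by simp
    also have "\<dots> = Zero A Y T \<odot> \<eta> W x"
      using nt_one[OF N(2) ad(3) additive_hom_functor[OF N(1)] x(1)] hom_nt[OF L(2) x] L(1) N(1) by simp
    finally show "(b \<odot> a) \<odot> \<eta> W x = Zero A Y T \<odot> \<eta> W x" .
  qed (use ty L(1) N(1) in simp_all)
  have "local_iso A D F Y \<eta>" unfolding local_iso_def
  proof (intro conjI ballI impI L)
    fix W x assume x: "W \<in> Ob A" "x \<in> carrier (FOb F W)" "\<eta> W x = Zero A W Y"
    have "\<theta> W (\<alpha> W x) = Zero A W Z" using a[OF x(1,2)] x(1,3) ty L(1) by simp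
    then obtain d where d: "d \<in> D" "Cod A d = W" "FMor G d (\<alpha> W x) = \<one>\<^bsub>FOb G (Dom A d)\<^esub>"
      by (rule local_iso_kerE[OF \<theta>(1) x(1) nt_closed[OF LE(1) x(1,2)]])
    have x': "x \<in> carrier (FOb F (Cod A d))" using x(2) d(2) by simp
    have "FMor F d x = \<one>\<^bsub>FOb F (Dom A d)\<^esub>"
      using LE(3)[OF Dom_Ob[OF DM[OF d(1)]] af_closed[OF ad(1) DM[OF d(1)] refl x']]
        nt_nat[OF LE(1) DM[OF d(1)] refl x'] d(2,3) by simp
    then show "\<exists>d \<in> D. Cod A d = W \<and> FMor F d x = \<one>\<^bsub>FOb F (Dom A d)\<^esub>" using d by blast
  next
    fix y assume y: "y \<in> Mor A" "Cod A y = Y"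
    \<comment> \<open>The section \<open>y\<close> is handled through \<open>a y\<close>: this lifts
      to some \<open>g\<close> in \<open>G\<close> over a cover, \<open>\<beta> g\<close> vanishes
      over a further cover, and there \<open>g\<close> comes from \<open>F\<close>. Cancelling the
      mono \<open>a\<close> shows that the result lifts \<open>y\<close>.\<close>
    obtain d g where d: "d \<in> D" "Cod A d = Dom A (a \<odot> y)" "g \<in> carrier (FOb G (Dom A d))"
      "\<theta> (Dom A d) g = (a \<odot> y) \<odot> d"
      by (rule local_iso_liftE[OF \<theta>(1), of "a \<odot> y"]) (use y ty in simp_all)
    have dM: "d \<in> Mor A" using DM d(1) by blast
    have Ob: "Dom A d \<in> Ob A" using dM by simp
    have dy: "Cod A d = Dom A y" using d(2) y ty by simp
    have "\<tau> (Dom A d) (\<beta> (Dom A d) g) = b \<odot> ((a \<odot> y) \<odot> d)" using b[OF Ob d(3)] d(4) by simp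
    also have "\<dots> = (b \<odot> a) \<odot> (y \<odot> d)" using ty y dy dM by (simp add: assoc)
    also have "\<dots> = Zero A (Dom A d) T" unfolding ba using y dy dM L(1) N(1) by simp
    finally obtain d' where d': "d' \<in> D" "Cod A d' = Dom A d"
      "FMor H d' (\<beta> (Dom A d) g) = \<one>\<^bsub>FOb H (Dom A d')\<^esub>"
      by (rule local_iso_kerE[OF \<tau> Ob nt_closed[OF LE(2) Ob d(3)]])
    have dM': "d' \<in> Mor A" using DM d'(1) by blast
    have Ob': "Dom A d' \<in> Ob A" using dM' by simp
    have g': "g \<in> carrier (FOb G (Cod A d'))" using d(3) d'(2) by simp
    have gc: "FMor G d' g \<in> carrier (FOb G (Dom A d'))" by (rule af_closed[OF ad(2) dM' refl g'])
    have "\<beta> (Dom A d') (FMor G d' g) = \<one>\<^bsub>FOb H (Dom A d')\<^esub>"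
      using nt_nat[OF LE(2) dM' refl g'] d'(2,3) by simp
    then obtain x where x: "x \<in> carrier (FOb F (Dom A d'))" "\<alpha> (Dom A d') x = FMor G d' g"
      using LE(4)[OF Ob' gc] by blast
    have "a \<odot> \<eta> (Dom A d') x = \<theta> (Dom A d) g \<odot> d'"
      using a[OF Ob' x(1)] x(2) hom_nt_nat[OF M(2) dM' refl g'] d'(2) by simp
    also have "\<dots> = a \<odot> (y \<odot> (d \<odot> d'))"
      unfolding d(4) using ty(1-3) y dy dM dM' d'(2) by (simp add: assoc)
    finally have "\<eta> (Dom A d') x = y \<odot> (d \<odot> d')"
      using monoD[OF mono, of "\<eta> (Dom A d') x" "y \<odot> (d \<odot> d')"] hom_nt[OF L(2) Ob' x(1)] ty(1-3) y dy dM dM' d'(2)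
      by simp
    moreover have "d \<odot> d' \<in> D" using coverageD(2)[OF D d'(1) d(1)] d'(2) by simp
    ultimately show "\<exists>d \<in> D. Cod A d = Dom A y \<and> (\<exists>x \<in> carrier (FOb F (Dom A d)). \<eta> (Dom A d) x = y \<odot> d)"
      using x(1) dM dM' d'(2) dy by (intro bexI[of _ "d \<odot> d'"]) (simp_all, blast)
  qed
  then show ?thesis using fp \<eta>(2) unfolding locally_representable_def by blast
qed

text \<open>Now the middle term starts with all epimorphisms as covers. A lift is first taken in
  \<open>H\<close> and then corrected by an element of \<open>F\<close>, in the manner of the five
  lemma.\<close>

lemma locally_representable_extension:
  assumes D: "coverage A D" and fp: "finitely_presented A G" and ex: "left_exact A F G H \<alpha> \<beta>"
    and surj: "pointwise_surj A G H \<beta>"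
    and FH: "F \<in> locally_representable A D" "H \<in> locally_representable A D"
  shows "G \<in> locally_representable A D"
proof -
  have De: "D \<subseteq> {p. epi_arrow A p}" using coverageD(1)[OF D] by blast
  have DM: "d \<in> Mor A" if "d \<in> D" for d using coverageD(1)[OF D that] by (simp add: epi_arrow_iff)
  note LE = left_exactD[OF ex]
  obtain Y \<eta> where F: "finitely_presented A F" and \<eta>: "local_iso A D F Y \<eta>" "universal_to_hom A F Y \<eta>"
    using FH(1) unfolding locally_representable_def by blast
  obtain T \<tau> where H: "finitely_presented A H" and \<tau>: "local_iso A D H T \<tau>"
    using FH(2) unfolding locally_representable_def by blast
  obtain Z \<theta> where \<theta>: "local_iso A {p. epi_arrow A p} G Z \<theta>" "universal_to_hom A G Z \<theta>"
    by (rule ex_epi_local_iso[OF fp])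
  note ad = fp_additive[OF F] fp_additive[OF fp] fp_additive[OF H]
  note L = local_isoD[OF \<eta>(1)] and M = local_isoD[OF \<theta>(1)] and N = local_isoD[OF \<tau>]
  obtain a where a': "a \<in> homset A Y Z" and a: "\<And>W x. W \<in> Ob A \<Longrightarrow> x \<in> carrier (FOb F W) \<Longrightarrow>
      \<theta> W (\<alpha> W x) = a \<odot> \<eta> W x"
    using \<eta>(2)[unfolded universal_to_hom_def, rule_format, OF M(1) nat_trans_comp[OF LE(1) M(2)]] by blast
  obtain b where b': "b \<in> homset A Z T" and b: "\<And>W x. W \<in> Ob A \<Longrightarrow> x \<in> carrier (FOb G W) \<Longrightarrow>
      \<tau> W (\<beta> W x) = b \<odot> \<theta> W x"
    using \<theta>(2)[unfolded universal_to_hom_def, rule_format, OF N(1) nat_trans_comp[OF LE(2) N(2)]] by blast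
  have ty: "a \<in> Mor A" "Dom A a = Y" "Cod A a = Z" "b \<in> Mor A" "Dom A b = Z" "Cod A b = T"
    using a' b' by (simp_all add: hom_iff)
  have mono: "mono_arrow A a"
    by (rule local_mono[OF ad(1,2) local_iso_mono[OF \<eta>(1) De] \<theta>(1) LE(1,3) ty(1-3) a])
  \<comment> \<open>Only local injectivity for \<open>H\<close> enters, so the cover lies in
    \<open>D\<close> even when the section \<open>g\<close> itself was found over an arbitrary
    epimorphism.\<close>
  have lift: "\<exists>d \<in> D. Cod A d = W \<and> (\<exists>x \<in> carrier (FOb F (Dom A d)). \<alpha> (Dom A d) x = FMor G d g)"
    if W: "W \<in> Ob A" and g: "g \<in> carrier (FOb G W)" and z: "b \<odot> \<theta> W g = Zero A W T" for W g
  proof -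
    have "\<tau> W (\<beta> W g) = Zero A W T" using b[OF W g] z by simp
    then obtain d where d: "d \<in> D" "Cod A d = W" "FMor H d (\<beta> W g) = \<one>\<^bsub>FOb H (Dom A d)\<^esub>"
      by (rule local_iso_kerE[OF \<tau> W nt_closed[OF LE(2) W g]])
    have dM: "d \<in> Mor A" using DM d(1) by blast
    have g': "g \<in> carrier (FOb G (Cod A d))" using g d(2) by simp
    have "\<beta> (Dom A d) (FMor G d g) = \<one>\<^bsub>FOb H (Dom A d)\<^esub>"
      using nt_nat[OF LE(2) dM refl g'] d(2,3) by simp
    then show ?thesis using LE(4)[OF Dom_Ob[OF dM] af_closed[OF ad(2) dM refl g']] d by blast
  qed
  obtain q where q: "is_cokernel A q a" using cokernels ty(1) by blast
  note Q = is_cokernelD[OF q]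
  \<comment> \<open>Arbitrary epimorphisms occur as covers here, which does no harm: the resulting
    factorization through \<open>a\<close> no longer mentions a cover.\<close>
  have ker: "\<exists>u \<in> homset A (Dom A y) Y. a \<odot> u = y"
    if y: "y \<in> Mor A" "Cod A y = Z" "b \<odot> y = Zero A (Dom A y) T" for y
  proof -
    obtain d g where d: "d \<in> {p. epi_arrow A p}" "Cod A d = Dom A y" "g \<in> carrier (FOb G (Dom A d))"
      "\<theta> (Dom A d) g = y \<odot> d"
      by (rule local_iso_liftE[OF \<theta>(1) y(1,2)])
    have dM: "d \<in> Mor A" using d(1) by (simp add: epi_arrow_iff)
    have "b \<odot> \<theta> (Dom A d) g = (b \<odot> y) \<odot> d" unfolding d(4) using ty y(1,2) dM d(2) by (simp add: assoc)
    also have "\<dots> = Zero A (Dom A d) T" unfolding y(3) using y(1) dM d(2) N(1) by simp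
    finally obtain d' x where d': "d' \<in> D" "Cod A d' = Dom A d" "x \<in> carrier (FOb F (Dom A d'))"
        "\<alpha> (Dom A d') x = FMor G d' g"
      using lift[OF Dom_Ob[OF dM] d(3)] by blast
    have dM': "d' \<in> Mor A" using DM d'(1) by blast
    have Ob': "Dom A d' \<in> Ob A" using dM' by simp
    have g': "g \<in> carrier (FOb G (Cod A d'))" using d(3) d'(2) by simp
    have "(y \<odot> d) \<odot> d' = a \<odot> \<eta> (Dom A d') x"
      using a[OF Ob' d'(3)] d'(4) hom_nt_nat[OF M(2) dM' refl g'] d'(2) d(4) by simp
    then have "q \<odot> ((y \<odot> d) \<odot> d') = Zero A (Dom A d') (Cod A q)"
      using Cmp_eq_Zero[OF Q(4) ty(1) Q(1), of "\<eta> (Dom A d') x"] hom_nt[OF L(2) Ob' d'(3)] ty(2,3) Q(3) by simp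
    then have "(q \<odot> y) \<odot> (d \<odot> d') = Zero A (Dom A (d \<odot> d')) (Cod A (q \<odot> y))"
      using Q(1,3) y dM dM' d(2) d'(2) ty(3) by (simp add: assoc)
    moreover have "epi_arrow A (d \<odot> d')"
      using epi_comp[of d d'] d(1) coverageD(1)[OF D d'(1)] d'(2) by simp
    ultimately have "q \<odot> y = Zero A (Cod A (d \<odot> d')) (Cod A (q \<odot> y))"
      using epi_zero[of "d \<odot> d'" "q \<odot> y"] Q(1,3) y ty(3) dM dM' d(2) d'(2) by simp
    then have "q \<odot> y = Zero A (Dom A y) (Cod A q)"
      using Q(1,3) y ty(3) dM dM' d(2) d'(2) by simp
    then show ?thesis
      using is_kernel_ex[OF mono_kernel_cokernel[OF mono q] y(1)] y(2) Q(3) ty(2,3) by simp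
  qed
  have "local_iso A D G Z \<theta>" unfolding local_iso_def
  proof (intro conjI ballI impI M)
    fix W g assume g: "W \<in> Ob A" "g \<in> carrier (FOb G W)" "\<theta> W g = Zero A W Z"
    have "b \<odot> \<theta> W g = Zero A W T" unfolding g(3) using ty g(1) M(1) by simp
    then obtain d x where d: "d \<in> D" "Cod A d = W" "x \<in> carrier (FOb F (Dom A d))"
        "\<alpha> (Dom A d) x = FMor G d g"
      using lift[OF g(1,2)] by blast
    have dM: "d \<in> Mor A" using DM d(1) by blast
    have Ob: "Dom A d \<in> Ob A" using dM by simp
    have g': "g \<in> carrier (FOb G (Cod A d))" using g d(2) by simp
    have "a \<odot> \<eta> (Dom A d) x = \<theta> W g \<odot> d"
      using a[OF Ob d(3)] d(4) hom_nt_nat[OF M(2) dM refl g'] d(2) by simp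
    also have "\<dots> = Zero A (Dom A d) Z" unfolding g(3) using dM d(2) g(1) M(1) by simp
    finally have "\<eta> (Dom A d) x = Zero A (Dom A d) Y"
      using mono_zero[OF mono, of "\<eta> (Dom A d) x"] hom_nt[OF L(2) Ob d(3)] ty(2,3) by simp
    then obtain d' where d': "d' \<in> D" "Cod A d' = Dom A d" "FMor F d' x = \<one>\<^bsub>FOb F (Dom A d')\<^esub>"
      by (rule local_iso_kerE[OF \<eta>(1) Ob d(3)])
    have dM': "d' \<in> Mor A" using DM d'(1) by blast
    have x': "x \<in> carrier (FOb F (Cod A d'))" using d(3) d'(2) by simp
    have "FMor G (d \<odot> d') g = FMor G d' (\<alpha> (Dom A d) x)"
      using af_Cmp[OF ad(2) dM' dM d'(2) g'] d(4) by simp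
    also have "\<dots> = \<one>\<^bsub>FOb G (Dom A d')\<^esub>"
      using nt_nat[OF LE(1) dM' refl x'] d'(2,3) nt_one[OF LE(1) ad(1,2) Dom_Ob[OF dM']] by simp
    finally show "\<exists>d \<in> D. Cod A d = W \<and> FMor G d g = \<one>\<^bsub>FOb G (Dom A d)\<^esub>"
      using coverageD(2)[OF D d'(1) d(1) d'(2)] dM dM' d(2) d'(2)
      by (intro bexI[of _ "d \<odot> d'"]) simp_all
  next
    fix y assume y: "y \<in> Mor A" "Cod A y = Z"
    obtain d h where d: "d \<in> D" "Cod A d = Dom A (b \<odot> y)" "h \<in> carrier (FOb H (Dom A d))"
      "\<tau> (Dom A d) h = (b \<odot> y) \<odot> d"
      by (rule local_iso_liftE[OF \<tau>, of "b \<odot> y"]) (use y ty in simp_all)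
    have dM: "d \<in> Mor A" using DM d(1) by blast
    have Ob: "Dom A d \<in> Ob A" using dM by simp
    have dy: "Cod A d = Dom A y" using d(2) y ty by simp
    obtain g where g: "g \<in> carrier (FOb G (Dom A d))" "\<beta> (Dom A d) g = h"
      using surj Ob d(3) unfolding pointwise_surj_def by blast
    note tg = hom_nt[OF M(2) Ob g(1)]
    \<comment> \<open>The element \<open>g\<close> lifts \<open>y\<close> only up to the kernel of
      \<open>b\<close>. The error \<open>y'\<close> factors through \<open>a\<close>, and a lift of
      that factor to \<open>F\<close> corrects \<open>g\<close> over one more cover.\<close>
    define y' where "y' = y \<odot> d \<oplus> neg A (\<theta> (Dom A d) g)"
    have y': "y' \<in> Mor A" "Dom A y' = Dom A d" "Cod A y' = Z" using y dy dM tg by (simp_all add: y'_def)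
    have "b \<odot> \<theta> (Dom A d) g = b \<odot> (y \<odot> d)"
      using b[OF Ob g(1)] g(2) d(4) ty y dy dM by (simp add: assoc)
    then have "b \<odot> y' = Zero A (Dom A y') T"
      using ty(4-6) y dy dM tg N(1) by (simp add: y'_def)
    then obtain u where u': "u \<in> homset A (Dom A y') Y" "a \<odot> u = y'" using ker[OF y'(1,3)] by blast
    then have u: "u \<in> Mor A" "Dom A u = Dom A d" "Cod A u = Y" using y' by (simp_all add: hom_iff)
    obtain d' x where d': "d' \<in> D" "Cod A d' = Dom A u" "x \<in> carrier (FOb F (Dom A d'))"
      "\<eta> (Dom A d') x = u \<odot> d'"
      by (rule local_iso_liftE[OF \<eta>(1) u(1,3)])
    have dM': "d' \<in> Mor A" using DM d'(1) by blast
    have Ob': "Dom A d' \<in> Ob A" using dM' by simp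
    have cd': "Cod A d' = Dom A d" using d'(2) u(2) by simp
    have g': "g \<in> carrier (FOb G (Cod A d'))" using g(1) cd' by simp
    have gc: "FMor G d' g \<in> carrier (FOb G (Dom A d'))" by (rule af_closed[OF ad(2) dM' refl g'])
    have ac: "\<alpha> (Dom A d') x \<in> carrier (FOb G (Dom A d'))" by (rule nt_closed[OF LE(1) Ob' d'(3)])
    have "\<theta> (Dom A d') (\<alpha> (Dom A d') x \<otimes>\<^bsub>FOb G (Dom A d')\<^esub> FMor G d' g) =
        \<theta> (Dom A d') (\<alpha> (Dom A d') x) \<oplus> \<theta> (Dom A d') (FMor G d' g)"
      using nt_mult[OF M(2) Ob' ac gc] by simp
    also have "\<theta> (Dom A d') (\<alpha> (Dom A d') x) = y' \<odot> d'"
      using a[OF Ob' d'(3)] d'(4) comp_reassoc[OF u'(2) u(1) ty(1) dM'] u ty cd' by simp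
    also have "\<theta> (Dom A d') (FMor G d' g) = \<theta> (Dom A d) g \<odot> d'"
      using hom_nt_nat[OF M(2) dM' refl g'] cd' by simp
    also have "y' \<odot> d' \<oplus> \<theta> (Dom A d) g \<odot> d' = (y' \<oplus> \<theta> (Dom A d) g) \<odot> d'"
      using y' tg dM' cd' by simp
    also have "y' \<oplus> \<theta> (Dom A d) g = y \<odot> d" using y dy dM tg by (simp add: y'_def)
    also have "(y \<odot> d) \<odot> d' = y \<odot> (d \<odot> d')" using y dy dM dM' cd' by (simp add: assoc)
    finally show "\<exists>d \<in> D. Cod A d = Dom A y \<and> (\<exists>x \<in> carrier (FOb G (Dom A d)). \<theta> (Dom A d) x = y \<odot> d)"
      using coverageD(2)[OF D d'(1) d(1) cd'] af_m_closed[OF ad(2) Ob' ac gc] dM dM' cd' dy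
      by (intro bexI[of _ "d \<odot> d'"]) auto
  qed
  then show ?thesis using fp \<theta>(2) unfolding locally_representable_def by blast
qed

text \<open>The universal properties make \<open>Y\<close> a retract of \<open>Z\<close> through
  \<open>a\<close> and \<open>b\<close>, and the local statements for \<open>G\<close> are carried
  along \<open>\<sigma>\<close> and \<open>\<rho>\<close>.\<close>

lemma locally_representable_retract:
  assumes D: "coverage A D" and fp: "finitely_presented A F" and G: "G \<in> locally_representable A D"
    and \<sigma>: "nat_trans A F G \<sigma>" and \<rho>: "nat_trans A G F \<rho>"
    and \<rho>\<sigma>: "\<And>W x. W \<in> Ob A \<Longrightarrow> x \<in> carrier (FOb F W) \<Longrightarrow> \<rho> W (\<sigma> W x) = x"
  shows "F \<in> locally_representable A D"
proof -
  have DM: "d \<in> Mor A" if "d \<in> D" for d using coverageD(1)[OF D that] by (simp add: epi_arrow_iff)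
  obtain Z \<theta> where fG: "finitely_presented A G" and \<theta>: "local_iso A D G Z \<theta>" "universal_to_hom A G Z \<theta>"
    using G unfolding locally_representable_def by blast
  obtain Y \<eta> where \<eta>: "local_iso A {p. epi_arrow A p} F Y \<eta>" "universal_to_hom A F Y \<eta>"
    by (rule ex_epi_local_iso[OF fp])
  note ad = fp_additive[OF fp] fp_additive[OF fG]
  note L = local_isoD[OF \<eta>(1)] and M = local_isoD[OF \<theta>(1)]
  obtain a where a': "a \<in> homset A Y Z" and a: "\<And>W x. W \<in> Ob A \<Longrightarrow> x \<in> carrier (FOb F W) \<Longrightarrow>
      \<theta> W (\<sigma> W x) = a \<odot> \<eta> W x"
    using \<eta>(2)[unfolded universal_to_hom_def, rule_format, OF M(1) nat_trans_comp[OF \<sigma> M(2)]] by blast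
  obtain b where b': "b \<in> homset A Z Y" and b: "\<And>W x. W \<in> Ob A \<Longrightarrow> x \<in> carrier (FOb G W) \<Longrightarrow>
      \<eta> W (\<rho> W x) = b \<odot> \<theta> W x"
    using \<theta>(2)[unfolded universal_to_hom_def, rule_format, OF L(1) nat_trans_comp[OF \<rho> L(2)]] by blast
  have ty: "a \<in> Mor A" "Dom A a = Y" "Cod A a = Z" "b \<in> Mor A" "Dom A b = Z" "Cod A b = Y"
    using a' b' by (simp_all add: hom_iff)
  have ba: "b \<odot> a = Id A Y"
  proof (rule local_section_eq[OF \<eta>(1)])
    fix W x assume x: "W \<in> Ob A" "x \<in> carrier (FOb F W)"
    have "(b \<odot> a) \<odot> \<eta> W x = b \<odot> \<theta> W (\<sigma> W x)"
      using a[OF x] hom_nt[OF L(2) x] ty by (simp add: assoc)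
    also have "\<dots> = Id A Y \<odot> \<eta> W x"
      using b[OF x(1) nt_closed[OF \<sigma> x]] \<rho>\<sigma>[OF x] hom_nt[OF L(2) x] by simp
    finally show "(b \<odot> a) \<odot> \<eta> W x = Id A Y \<odot> \<eta> W x" .
  qed (use ty L(1) in simp_all)
  have "local_iso A D F Y \<eta>" unfolding local_iso_def
  proof (intro conjI ballI impI L)
    fix W x assume x: "W \<in> Ob A" "x \<in> carrier (FOb F W)" "\<eta> W x = Zero A W Y"
    have "\<theta> W (\<sigma> W x) = Zero A W Z" using a[OF x(1,2)] x(1,3) ty L(1) by simp
    then obtain d where d: "d \<in> D" "Cod A d = W" "FMor G d (\<sigma> W x) = \<one>\<^bsub>FOb G (Dom A d)\<^esub>"
      by (rule local_iso_kerE[OF \<theta>(1) x(1) nt_closed[OF \<sigma> x(1,2)]])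
    have dM: "d \<in> Mor A" using DM d(1) by blast
    have x': "x \<in> carrier (FOb F (Cod A d))" using x(2) d(2) by simp
    have "FMor F d x = \<rho> (Dom A d) (\<sigma> (Dom A d) (FMor F d x))"
      using \<rho>\<sigma>[OF Dom_Ob[OF dM] af_closed[OF ad(1) dM refl x']] by simp
    also have "\<dots> = \<one>\<^bsub>FOb F (Dom A d)\<^esub>"
      using nt_nat[OF \<sigma> dM refl x'] d(2,3) nt_one[OF \<rho> ad(2,1) Dom_Ob[OF dM]] by simp
    finally show "\<exists>d \<in> D. Cod A d = W \<and> FMor F d x = \<one>\<^bsub>FOb F (Dom A d)\<^esub>" using d by blast
  next
    fix y assume y: "y \<in> Mor A" "Cod A y = Y"
    obtain d g where d: "d \<in> D" "Cod A d = Dom A (a \<odot> y)" "g \<in> carrier (FOb G (Dom A d))"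
      "\<theta> (Dom A d) g = (a \<odot> y) \<odot> d"
      by (rule local_iso_liftE[OF \<theta>(1), of "a \<odot> y"]) (use y ty in simp_all)
    have dM: "d \<in> Mor A" using DM d(1) by blast
    have Ob: "Dom A d \<in> Ob A" using dM by simp
    have dy: "Cod A d = Dom A y" using d(2) y ty by simp
    have "\<eta> (Dom A d) (\<rho> (Dom A d) g) = (b \<odot> a) \<odot> (y \<odot> d)"
      using b[OF Ob d(3)] d(4) ty y dy dM by (simp add: assoc)
    then have "\<eta> (Dom A d) (\<rho> (Dom A d) g) = y \<odot> d" unfolding ba using y dy dM by simp
    then show "\<exists>d \<in> D. Cod A d = Dom A y \<and> (\<exists>x \<in> carrier (FOb F (Dom A d)). \<eta> (Dom A d) x = y \<odot> d)"
      using nt_closed[OF \<rho> Ob d(3)] d(1) dy by blast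
  qed
  then show ?thesis using fp \<eta>(2) unfolding locally_representable_def by blast
qed

end

section \<open>Functors presented by admissible arrows\<close>

definition deflations :: "('m \<times> 'm) set \<Rightarrow> 'm set" where
  "deflations E = {p. admissible_epi E p}"

definition admissible_functors :: "('o, 'm) acat \<Rightarrow> ('m \<times> 'm) set \<Rightarrow> ('o, 'm, 'g) afun set" where
  "admissible_functors A E = locally_representable A (deflations E)"

lemma admissible_converse [simp]:
  "admissible_mono (E\<inverse>) i \<longleftrightarrow> admissible_epi E i" "admissible_epi (E\<inverse>) p \<longleftrightarrow> admissible_mono E p"
  by (simp_all add: admissible_mono_def admissible_epi_def)

lemma exact_pair:
  assumes "exact_structure C E" "(i, p) \<in> E" shows "kernel_cokernel_pair C i p"
  using assms(1)[unfolded exact_structure_def, THEN conjunct1] assms(2) by blast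

lemma exact_iso:
  assumes "exact_structure C E" "(i, p) \<in> E" "i' \<in> Mor C" "p' \<in> Mor C" "Cod C i' = Dom C p'"
    "a \<in> homset C (Dom C i) (Dom C i')" "b \<in> homset C (Cod C i) (Cod C i')"
    "c \<in> homset C (Cod C p) (Cod C p')" "iso_arrow C a" "iso_arrow C b" "iso_arrow C c"
    "b \<cdot>\<^bsub>C\<^esub> i = i' \<cdot>\<^bsub>C\<^esub> a" "c \<cdot>\<^bsub>C\<^esub> p = p' \<cdot>\<^bsub>C\<^esub> b"
  shows "(i', p') \<in> E"
proof -
  have "\<forall>i' \<in> Mor C. \<forall>p' \<in> Mor C. \<forall>a b c.
        Cod C i' = Dom C p' \<longrightarrow>
        a \<in> homset C (Dom C i) (Dom C i') \<longrightarrow> b \<in> homset C (Cod C i) (Cod C i') \<longrightarrow>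
        c \<in> homset C (Cod C p) (Cod C p') \<longrightarrow>
        iso_arrow C a \<longrightarrow> iso_arrow C b \<longrightarrow> iso_arrow C c \<longrightarrow>
        b \<cdot>\<^bsub>C\<^esub> i = i' \<cdot>\<^bsub>C\<^esub> a \<longrightarrow> c \<cdot>\<^bsub>C\<^esub> p = p' \<cdot>\<^bsub>C\<^esub> b \<longrightarrow> (i', p') \<in> E"
    using bspec[OF assms(1)[unfolded exact_structure_def, THEN conjunct2, THEN conjunct1] assms(2)]
    unfolding prod.case .
  then show ?thesis using assms(3-) by blast
qed

lemma exact_Id:
  assumes "exact_structure C E" "X \<in> Ob C"
  shows "admissible_mono E (Id C X)" "admissible_epi E (Id C X)"
  using assms(1)[unfolded exact_structure_def, THEN conjunct2, THEN conjunct2, THEN conjunct1]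
    assms(1)[unfolded exact_structure_def, THEN conjunct2, THEN conjunct2, THEN conjunct2, THEN conjunct1]
    assms(2) by blast+

lemma exact_comp:
  assumes "exact_structure C E"
  shows "admissible_mono E i \<Longrightarrow> admissible_mono E j \<Longrightarrow> Cod C i = Dom C j \<Longrightarrow> admissible_mono E (j \<cdot>\<^bsub>C\<^esub> i)"
    "admissible_epi E p \<Longrightarrow> admissible_epi E q \<Longrightarrow> Cod C p = Dom C q \<Longrightarrow> admissible_epi E (q \<cdot>\<^bsub>C\<^esub> p)"
  using assms[unfolded exact_structure_def, THEN conjunct2, THEN conjunct2, THEN conjunct2, THEN conjunct2,
      THEN conjunct1]
    assms[unfolded exact_structure_def, THEN conjunct2, THEN conjunct2, THEN conjunct2, THEN conjunct2,
      THEN conjunct2, THEN conjunct1] by blast+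

lemma exact_pushout:
  assumes "exact_structure C E" "admissible_mono E i" "f \<in> Mor C" "Dom C f = Dom C i"
  obtains i' f' where "is_pushout C i f i' f'" "admissible_mono E i'"
  using assms(1)[unfolded exact_structure_def, THEN conjunct2, THEN conjunct2, THEN conjunct2, THEN conjunct2,
      THEN conjunct2, THEN conjunct2, THEN conjunct1] assms(2-) by blast

lemma exact_pullback:
  assumes "exact_structure C E" "admissible_epi E p" "f \<in> Mor C" "Cod C f = Cod C p"
  obtains p' f' where "is_pullback C p f p' f'" "admissible_epi E p'"
  using assms(1)[unfolded exact_structure_def, THEN conjunct2, THEN conjunct2, THEN conjunct2, THEN conjunct2,
      THEN conjunct2, THEN conjunct2, THEN conjunct2] assms(2-) by blast

section \<open>Duality of exact structures, uniqueness of kernels, and pushouts\<close>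

context preadditive_category
begin

lemma iso_square:
  assumes "i \<odot> c = b \<odot> i'" "b' \<odot> b = Id C (Dom C b)" "c \<odot> c' = Id C (Dom C i)"
    "i \<in> Mor C" "i' \<in> Mor C" "b \<in> Mor C" "b' \<in> Mor C" "c \<in> Mor C" "c' \<in> Mor C"
    "Cod C c = Dom C i" "Cod C i' = Dom C b" "Dom C b' = Cod C b" "Dom C c = Dom C i'" "Cod C c' = Dom C c"
    "Cod C i = Cod C b"
  shows "b' \<odot> i = i' \<odot> c'"
proof -
  have "b' \<odot> i = b' \<odot> (i \<odot> (c \<odot> c'))" using assms(3,4) by simp
  also have "i \<odot> (c \<odot> c') = b \<odot> (i' \<odot> c')" using comp_square[OF assms(1), of c'] assms(4-) by simp
  also have "b' \<odot> \<dots> = (b' \<odot> b) \<odot> (i' \<odot> c')" using assms(4-) by (simp add: assoc)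
  also have "\<dots> = i' \<odot> c'" unfolding assms(2) using assms(4-) by simp
  finally show ?thesis .
qed

text \<open>Passing to the opposite category reverses the three isomorphisms in the axiom of closure
  under isomorphism, so that axiom is applied to their inverses. The other axioms are exchanged in
  pairs.\<close>

lemma exact_structure_opcat:
  assumes E: "exact_structure C E" shows "exact_structure (opcat C) (E\<inverse>)"
  unfolding exact_structure_def
proof (intro conjI ballI impI allI)
  fix x assume "x \<in> E\<inverse>"
  then obtain i p where x: "x = (p, i)" "(i, p) \<in> E" by auto
  show "case x of (i, p) \<Rightarrow> kernel_cokernel_pair (opcat C) i p" using exact_pair[OF E x(2)] x(1) by simp
  have "(i', p') \<in> E"
    if "p' \<in> Mor C" "i' \<in> Mor C" "Cod (opcat C) p' = Dom (opcat C) i'"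
      "a \<in> homset (opcat C) (Dom (opcat C) p) (Dom (opcat C) p')"
      "b \<in> homset (opcat C) (Cod (opcat C) p) (Cod (opcat C) p')"
      "c \<in> homset (opcat C) (Cod (opcat C) i) (Cod (opcat C) i')"
      "iso_arrow (opcat C) a" "iso_arrow (opcat C) b" "iso_arrow (opcat C) c"
      "b \<cdot>\<^bsub>opcat C\<^esub> p = p' \<cdot>\<^bsub>opcat C\<^esub> a" "c \<cdot>\<^bsub>opcat C\<^esub> i = i' \<cdot>\<^bsub>opcat C\<^esub> b" for p' i' a b c
  proof -
    have KC: "i \<in> Mor C" "p \<in> Mor C" "Cod C i = Dom C p"
      using exact_pair[OF E x(2)] by (simp_all add: kernel_cokernel_pair_def is_kernel_def)
    have ty: "a \<in> Mor C" "Dom C a = Cod C p'" "Cod C a = Cod C p" "b \<in> Mor C" "Dom C b = Dom C p'"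
      "Cod C b = Dom C p" "c \<in> Mor C" "Dom C c = Dom C i'" "Cod C c = Dom C i" "Cod C i' = Dom C p'"
      using that(3-6) by (simp_all add: hom_iff)
    have isos: "iso_arrow C a" "iso_arrow C b" "iso_arrow C c" using that(7-9) by simp_all
    obtain a' where a': "a' \<in> homset C (Cod C a) (Dom C a)" "a' \<odot> a = Id C (Dom C a)" "a \<odot> a' = Id C (Cod C a)"
      using isos(1) unfolding iso_arrow_def by blast
    obtain b' where b': "b' \<in> homset C (Cod C b) (Dom C b)" "b' \<odot> b = Id C (Dom C b)" "b \<odot> b' = Id C (Cod C b)"
      using isos(2) unfolding iso_arrow_def by blast
    obtain c' where c': "c' \<in> homset C (Cod C c) (Dom C c)" "c' \<odot> c = Id C (Dom C c)" "c \<odot> c' = Id C (Cod C c)"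
      using isos(3) unfolding iso_arrow_def by blast
    have inv: "iso_arrow C a'" "iso_arrow C b'" "iso_arrow C c'"
      unfolding iso_arrow_def using a' b' c' ty(1,4,7)
      by (auto simp: hom_iff intro: bexI[of _ a] bexI[of _ b] bexI[of _ c])
    have sq1: "b' \<odot> i = i' \<odot> c'"
      by (rule iso_square[of i c b i']) (use that(2,11) b' c' ty KC in \<open>simp_all add: hom_iff\<close>)
    have sq2: "a' \<odot> p = p' \<odot> b'"
      by (rule iso_square[of p b a p']) (use that(1,10) a' b' ty KC in \<open>simp_all add: hom_iff\<close>)
    show ?thesis
      by (rule exact_iso[OF E x(2) that(2,1), of c' b' a'])
        (use a' b' c' inv sq1 sq2 ty KC in \<open>simp_all add: hom_iff\<close>)
  qed
  then show "case x of (i, p) \<Rightarrow> \<forall>i'\<in>Mor (opcat C). \<forall>p'\<in>Mor (opcat C). \<forall>a b c.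
        Cod (opcat C) i' = Dom (opcat C) p' \<longrightarrow>
        a \<in> homset (opcat C) (Dom (opcat C) i) (Dom (opcat C) i') \<longrightarrow>
        b \<in> homset (opcat C) (Cod (opcat C) i) (Cod (opcat C) i') \<longrightarrow>
        c \<in> homset (opcat C) (Cod (opcat C) p) (Cod (opcat C) p') \<longrightarrow>
        iso_arrow (opcat C) a \<longrightarrow> iso_arrow (opcat C) b \<longrightarrow> iso_arrow (opcat C) c \<longrightarrow>
        b \<cdot>\<^bsub>opcat C\<^esub> i = i' \<cdot>\<^bsub>opcat C\<^esub> a \<longrightarrow> c \<cdot>\<^bsub>opcat C\<^esub> p = p' \<cdot>\<^bsub>opcat C\<^esub> b \<longrightarrow> (i', p') \<in> E\<inverse>"
    unfolding x(1) prod.case opcat_simps(2) converse_iff by blast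
next
  fix i f assume "f \<in> Mor (opcat C)" "admissible_mono (E\<inverse>) i" "Dom (opcat C) f = Dom (opcat C) i"
  then show "\<exists>i' f'. is_pushout (opcat C) i f i' f' \<and> admissible_mono (E\<inverse>) i'"
    using exact_pullback[OF E, of i f] by (simp, metis)
next
  fix p f assume "f \<in> Mor (opcat C)" "admissible_epi (E\<inverse>) p" "Cod (opcat C) f = Cod (opcat C) p"
  then show "\<exists>p' f'. is_pullback (opcat C) p f p' f' \<and> admissible_epi (E\<inverse>) p'"
    using exact_pushout[OF E, of p f] by (simp, metis)
qed (use exact_Id[OF E] exact_comp[OF E] in simp_all)

lemma kernel_unique:
  assumes "is_kernel C k p" "is_kernel C i p"
  obtains a where "a \<in> Mor C" "Dom C a = Dom C i" "Cod C a = Dom C k" "k \<odot> a = i" "iso_arrow C a"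
proof -
  note K = is_kernelD[OF assms(1)] and I = is_kernelD[OF assms(2)]
  obtain a where a: "a \<in> Mor C" "Dom C a = Dom C i" "Cod C a = Dom C k" "k \<odot> a = i"
    by (rule is_kernel_lift[OF assms(1) I(1,3,4)])
  obtain b where b: "b \<in> Mor C" "Dom C b = Dom C k" "Cod C b = Dom C i" "i \<odot> b = k"
    by (rule is_kernel_lift[OF assms(2) K(1,3,4)])
  have "k \<odot> (a \<odot> b) = k \<odot> Id C (Dom C k)" using comp_reassoc[OF a(4), of b] a(1-3) b K by simp
  then have "a \<odot> b = Id C (Dom C k)"
    using monoD[OF is_kernel_mono[OF assms(1)], of "a \<odot> b" "Id C (Dom C k)"] a(1-3) b(1-3) K(1) by simp
  moreover have "i \<odot> (b \<odot> a) = i \<odot> Id C (Dom C i)" using comp_reassoc[OF b(4), of a] b(1-3) a I by simp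
  then have "b \<odot> a = Id C (Dom C i)"
    using monoD[OF is_kernel_mono[OF assms(2)], of "b \<odot> a" "Id C (Dom C i)"] a(1-3) b(1-3) I(1) by simp
  ultimately have "iso_arrow C a"
    unfolding iso_arrow_def using a(1-3) b(1-3) by (auto simp: hom_iff intro!: bexI[of _ b])
  then show ?thesis using that a by blast
qed

text \<open>Two kernels of \<open>p\<close> differ by an isomorphism of their domains. An exact
  structure is thereby determined by its deflations.\<close>

lemma exact_kernel:
  assumes E: "exact_structure C E" and ip: "(i, p) \<in> E" and k: "is_kernel C k p"
  shows "(k, p) \<in> E"
proof -
  have i: "is_kernel C i p" using exact_pair[OF E ip] by (simp add: kernel_cokernel_pair_def)
  note K = is_kernelD[OF k] and I = is_kernelD[OF i]
  obtain a where a: "a \<in> Mor C" "Dom C a = Dom C i" "Cod C a = Dom C k" "k \<odot> a = i" "iso_arrow C a"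
    by (rule kernel_unique[OF k i])
  show ?thesis
    by (rule exact_iso[OF E ip K(1,2,3), of a "Id C (Dom C p)" "Id C (Cod C p)"])
      (use a K I in \<open>simp_all add: hom_iff\<close>)
qed

lemma is_pushoutD:
  assumes "is_pushout C f g p q"
  shows "f \<in> Mor C" "g \<in> Mor C" "p \<in> Mor C" "q \<in> Mor C" "Dom C f = Dom C g" "Cod C p = Cod C q"
    "Dom C p = Cod C g" "Dom C q = Cod C f" "q \<odot> f = p \<odot> g"
  using assms by (simp_all add: is_pushout_def is_pullback_def)

lemma is_pushout_desc:
  assumes "is_pushout C f g p q" "s \<in> Mor C" "t \<in> Mor C" "Cod C s = Cod C t" "Dom C s = Cod C g"
    "Dom C t = Cod C f" "t \<odot> f = s \<odot> g"
  obtains u where "u \<in> Mor C" "Dom C u = Cod C p" "Cod C u = Cod C s" "u \<odot> p = s" "u \<odot> q = t"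
proof -
  have "\<exists>u. u \<in> homset C (Cod C p) (Cod C s) \<and> u \<odot> p = s \<and> u \<odot> q = t"
    using assms unfolding is_pushout_def is_pullback_def opcat_simps homset_opcat by blast
  then obtain u where "u \<in> homset C (Cod C p) (Cod C s)" "u \<odot> p = s" "u \<odot> q = t" by blast
  then show ?thesis by (intro that[of u]) (simp_all add: hom_iff)
qed

lemma is_pushout_unique:
  assumes P: "is_pushout C f g p q" and u: "u \<in> Mor C" "v \<in> Mor C" "Dom C u = Cod C p" "Dom C v = Cod C p"
    "Cod C u = Cod C v" "u \<odot> p = v \<odot> p" "u \<odot> q = v \<odot> q"
  shows "u = v"
proof -
  note D = is_pushoutD[OF P]
  have "(v \<odot> q) \<odot> f = (v \<odot> p) \<odot> g" using D u by (simp add: assoc)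
  moreover have "v \<odot> p \<in> Mor C" "v \<odot> q \<in> Mor C" "Cod C (v \<odot> p) = Cod C (v \<odot> q)"
    "Dom C (v \<odot> p) = Cod C g" "Dom C (v \<odot> q) = Cod C f"
    using D u by simp_all
  ultimately have "\<exists>!w. w \<in> homset C (Cod C p) (Cod C (v \<odot> p)) \<and> w \<odot> p = v \<odot> p \<and> w \<odot> q = v \<odot> q"
    using P unfolding is_pushout_def is_pullback_def opcat_simps homset_opcat by blast
  moreover have "u \<in> homset C (Cod C p) (Cod C (v \<odot> p))" "v \<in> homset C (Cod C p) (Cod C (v \<odot> p))"
    using D u by (simp_all add: hom_iff)
  ultimately show ?thesis using u(6,7) by blast
qed

end

context abelian_category
begin

text \<open>
  Quillen's obscure axiom: the pushout of \<open>ker (g h)\<close> along the induced map to \<open>ker g\<close> is the kernel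
  of \<open>g\<close>, by the short five lemma.
\<close>

lemma exact_right_cancel:
  assumes E: "exact_structure A E" and g: "g \<in> Mor A" and h: "h \<in> Mor A" "Cod A h = Dom A g"
    and gh: "admissible_epi E (g \<odot> h)"
  shows "admissible_epi E g"
proof -
  obtain i where ip: "(i, g \<odot> h) \<in> E" using gh by (auto simp: admissible_epi_def)
  have i: "is_kernel A i (g \<odot> h)" and p: "is_cokernel A (g \<odot> h) i"
    using exact_pair[OF E ip] by (simp_all add: kernel_cokernel_pair_def)
  note I = is_kernelD[OF i]
  note epi_gh = is_cokernel_epi[OF p]
  have epi_g: "epi_arrow A g" using epi_cancel[OF epi_gh] g h by simp
  obtain k where k: "is_kernel A k g" using kernels g by blast
  note K = is_kernelD[OF k]
  have ci: "Cod A i = Dom A h" using I(3) g h by simp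
  have "g \<odot> (h \<odot> i) = Zero A (Dom A (h \<odot> i)) (Cod A g)" using I(1,4) ci g h by (simp add: assoc)
  \<comment> \<open>This is the restriction of \<open>h\<close> to the kernels of \<open>g h\<close>
    and of \<open>g\<close>.\<close>
  then obtain h' where h': "h' \<in> Mor A" "Dom A h' = Dom A i" "Cod A h' = Dom A k" "k \<odot> h' = h \<odot> i"
    using is_kernel_lift[OF k, of "h \<odot> i"] I(1) ci g h by auto
  obtain j f where po: "is_pushout A i h' j f" and j: "admissible_mono E j"
    using exact_pushout[OF E, of i h'] ip h' by (auto simp: admissible_mono_def)
  note P = is_pushoutD[OF po]
  obtain w where w: "w \<in> Mor A" "Dom A w = Cod A j" "Cod A w = Cod A k" "w \<odot> j = k" "w \<odot> f = h"
    by (rule is_pushout_desc[OF po, of k h]) (use K h h' ci in simp_all)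
  obtain q where jq: "(j, q) \<in> E" using j by (auto simp: admissible_mono_def)
  have q: "is_cokernel A q j" using exact_pair[OF E jq] by (simp add: kernel_cokernel_pair_def)
  note Q = is_cokernelD[OF q]
  \<comment> \<open>Since \<open>c\<close> vanishes on \<open>j\<close> and restricts to
    \<open>g h\<close> along \<open>f\<close>, it should be a cokernel of \<open>j\<close>. It is
    compared with the given cokernel \<open>q\<close> by \<open>z\<close>, and the inverse
    \<open>z'\<close> is induced by \<open>q f\<close>, which vanishes on \<open>i\<close>.\<close>
  define c where "c = g \<odot> w"
  have c: "c \<in> Mor A" "Dom A c = Cod A j" "Cod A c = Cod A g" using g w K by (simp_all add: c_def)
  have cj: "c \<odot> j = Zero A (Dom A j) (Cod A c)" using g w K P h' by (simp add: c_def assoc)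
  have cf: "c \<odot> f = g \<odot> h" using g w K P by (simp add: c_def assoc)
  obtain z where z: "z \<in> Mor A" "Dom A z = Cod A q" "Cod A z = Cod A c" "z \<odot> q = c"
    by (rule is_cokernel_desc[OF q c(1,2) cj])
  have qf: "q \<odot> f \<in> Mor A" "Dom A (q \<odot> f) = Cod A i" using Q(1,3) P(4,6,8) by simp_all
  have "(q \<odot> f) \<odot> i = (q \<odot> j) \<odot> h'" using Q(1,3) P by (simp add: assoc)
  also have "\<dots> = Zero A (Dom A i) (Cod A (q \<odot> f))" unfolding Q(4) using Q(1,3) P h' by simp
  finally obtain z' where z': "z' \<in> Mor A" "Dom A z' = Cod A (g \<odot> h)" "Cod A z' = Cod A (q \<odot> f)"
    "z' \<odot> (g \<odot> h) = q \<odot> f"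
    by (rule is_cokernel_desc[OF p qf])
  have tz: "Dom A z' = Cod A g" "Cod A z' = Cod A q" "Cod A z = Cod A g"
    using z' z(3) c(3) g h Q(1,3) P(4,6) by simp_all
  have "(z \<odot> z') \<odot> (g \<odot> h) = Id A (Cod A g) \<odot> (g \<odot> h)"
  proof -
    have "(z \<odot> z') \<odot> (g \<odot> h) = z \<odot> (q \<odot> f)"
      using assoc[of "g \<odot> h" z' z] z' z(1,2) tz g h by simp
    also have "\<dots> = c \<odot> f" using comp_reassoc[OF z(4), of f] z Q P by simp
    finally show ?thesis using cf g h by simp
  qed
  then have zz': "z \<odot> z' = Id A (Cod A g)"
    using epiD[OF epi_gh, of "z \<odot> z'" "Id A (Cod A g)"] z z' tz g h by simp
  have "z' \<odot> c = q"
  proof (rule is_pushout_unique[OF po])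
    have "(z' \<odot> c) \<odot> j = z' \<odot> (c \<odot> j)" using assoc[of j c z'] z'(1) tz c P(3) by simp
    also have "\<dots> = q \<odot> j" unfolding cj Q(4) using z'(1) tz c P(3) by simp
    finally show "(z' \<odot> c) \<odot> j = q \<odot> j" .
    have "(z' \<odot> c) \<odot> f = z' \<odot> (c \<odot> f)" using assoc[of f c z'] z'(1) tz c P by simp
    then show "(z' \<odot> c) \<odot> f = q \<odot> f" using cf z'(4) by simp
  qed (use z'(1) tz c Q in simp_all)
  then have "(z' \<odot> z) \<odot> q = Id A (Cod A q) \<odot> q"
    using assoc[of q z z'] z z'(1) tz Q(1) by simp
  then have "z' \<odot> z = Id A (Cod A q)"
    using epiD[OF is_cokernel_epi[OF q], of "z' \<odot> z" "Id A (Cod A q)"] z(1,2) z'(1) tz Q(1) by simp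
  then have "iso_arrow A z"
    unfolding iso_arrow_def using z(1,2) z'(1) tz zz' by (auto simp: hom_iff intro!: bexI[of _ z'])
  then have jc: "(j, c) \<in> E"
    by (intro exact_iso[OF E jq, of j c "Id A (Dom A j)" "Id A (Cod A j)" z])
      (use z c P Q in \<open>simp_all add: hom_iff\<close>)
  have kc: "is_kernel A j c" "is_cokernel A c j"
    using exact_pair[OF E jc] by (simp_all add: kernel_cokernel_pair_def)
  \<comment> \<open>The arrow \<open>w\<close> compares the conflation \<open>(j, c)\<close> with
    the kernel \<open>k\<close> of \<open>g\<close> and is the identity on both ends; the short five
    lemma is carried out by hand for mono and epi.\<close>
  have "mono_arrow A w" unfolding mono_arrow_iff
  proof (intro conjI ballI impI w)
    fix t assume t: "t \<in> Mor A" "Cod A t = Dom A w" "w \<odot> t = Zero A (Dom A t) (Cod A w)"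
    have "c \<odot> t = g \<odot> (w \<odot> t)" using t(1,2) w(1-3) g K(3) by (simp add: c_def assoc)
    also have "\<dots> = Zero A (Dom A t) (Cod A c)" unfolding t(3) using t(1) w(1-3) g K(3) c by simp
    finally obtain t' where t': "t' \<in> Mor A" "Dom A t' = Dom A t" "Cod A t' = Dom A j" "j \<odot> t' = t"
      using is_kernel_lift[OF kc(1) t(1)] t(2) w(2) c(2) by metis
    have "k \<odot> t' = Zero A (Dom A t') (Cod A k)"
      using comp_reassoc[OF w(4), of t'] w t t' P(3) by simp
    then have t0: "t' = Zero A (Dom A t') (Dom A k)"
      using mono_zero[OF is_kernel_mono[OF k], of t'] t'(1,3) P(7) h'(3) by simp
    have "t = j \<odot> t'" using t'(4) by simp
    also have "\<dots> = j \<odot> Zero A (Dom A t') (Dom A k)" using t0 by (rule arg_cong)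
    also have "\<dots> = Zero A (Dom A t) (Dom A w)" using P(3,7) h'(3) t'(1,2) w(2) t(1) by simp
    finally show "t = Zero A (Dom A t) (Dom A w)" .
  qed
  moreover have "epi_arrow A w" unfolding epi_arrow_iff
  proof (intro conjI ballI impI w)
    fix t assume t: "t \<in> Mor A" "Dom A t = Cod A w" "t \<odot> w = Zero A (Dom A w) (Cod A t)"
    have tk: "t \<odot> k = Zero A (Dom A k) (Cod A t)"
      using Cmp_eq_Zero[OF t(3) w(1) t(1) P(3)] t(2) w P(7) h'(3) by simp
    obtain t' where t': "t' \<in> Mor A" "Dom A t' = Cod A g" "Cod A t' = Cod A t" "t' \<odot> g = t"
      by (rule is_cokernel_desc[OF epi_cokernel_kernel[OF epi_g k] t(1) _ tk]) (use t(2) w(3) in simp)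
    have "t' \<odot> c = Zero A (Dom A c) (Cod A t')"
      using comp_reassoc[OF t'(4), of w] t(3) t' g w(1-3) K(3) c(2) by (simp add: c_def)
    then have "t' = Zero A (Cod A c) (Cod A t')"
      using epi_zero[OF is_cokernel_epi[OF kc(2)], of t'] t' c by simp
    then have "t' \<odot> g = Zero A (Cod A c) (Cod A t') \<odot> g" by (rule arg_cong)
    also have "\<dots> = Zero A (Cod A w) (Cod A t)" using g c t(1) t'(1,3) w(3) K(3) by simp
    finally show "t = Zero A (Cod A w) (Cod A t)" using t'(4) by simp
  qed
  ultimately have iso: "iso_arrow A w" by (rule balanced)
  have "(k, g) \<in> E"
    by (rule exact_iso[OF E jc K(1,2,3), of "Id A (Dom A k)" w "Id A (Cod A g)"])
      (use iso w c K P h' g in \<open>simp_all add: hom_iff c_def\<close>)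
  then show ?thesis by (auto simp: admissible_epi_def)
qed

lemma admissible_epi_epi:
  "exact_structure A E \<Longrightarrow> admissible_epi E p \<Longrightarrow> epi_arrow A p"
  unfolding admissible_epi_def using exact_pair is_cokernel_epi
  by (fastforce simp: kernel_cokernel_pair_def)

lemma coverage_deflations:
  assumes E: "exact_structure A E" shows "coverage A (deflations E)"
  unfolding coverage_def deflations_def
proof (intro conjI ballI impI)
  fix p assume "p \<in> {p. admissible_epi E p}"
  then show "epi_arrow A p" using admissible_epi_epi[OF E] by simp
  fix q assume "q \<in> {p. admissible_epi E p}" "Cod A p = Dom A q"
  then show "q \<odot> p \<in> {p. admissible_epi E p}"
    using \<open>p \<in> {p. admissible_epi E p}\<close> exact_comp(2)[OF E] by simp
next
  fix p f assume p: "p \<in> {p. admissible_epi E p}" and f: "f \<in> Mor A" "Cod A f = Cod A p"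
  obtain p' q where "is_pullback A p f p' q" "admissible_epi E p'"
    by (rule exact_pullback[OF E _ f]) (use p in simp)
  then show "\<exists>d \<in> {p. admissible_epi E p}. \<exists>u \<in> homset A (Dom A d) (Dom A p). Cod A d = Dom A f \<and> p \<odot> u = f \<odot> d"
    by (intro bexI[of _ p'] bexI[of _ q]) (simp_all add: is_pullback_def hom_iff)
qed

text \<open>From left to right, \<open>exact_right_cancel\<close> supplies the cancellation demanded
  by \<open>presentation_of_local_iso\<close>, and the deflation \<open>c\<close> found there makes
  \<open>i\<close> an inflation. The criterion treats \<open>p\<close> and \<open>i\<close>
  symmetrically, which is the source of its compatibility with the transpose.\<close>

lemma admissible_functor_iff:
  assumes E: "exact_structure A E" and F: "finitely_presented A F" and f: "pres A (i \<odot> p) F e"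
    and ip: "mono_arrow A i" "epi_arrow A p" "Cod A p = Dom A i"
  shows "F \<in> admissible_functors A E \<longleftrightarrow> admissible_epi E p \<and> admissible_mono E i"
proof
  assume "F \<in> admissible_functors A E"
  then obtain Y \<eta> where \<eta>: "local_iso A (deflations E) F Y \<eta>"
    unfolding admissible_functors_def locally_representable_def by blast
  obtain c where c: "p \<in> deflations E" "c \<in> deflations E" "is_kernel A i c"
    by (rule presentation_of_local_iso[OF coverage_deflations[OF E] _ fp_additive[OF F] f ip \<eta>])
      (use exact_right_cancel[OF E] in \<open>simp_all add: deflations_def\<close>)
  obtain i' where "(i', c) \<in> E" using c(2) by (auto simp: deflations_def admissible_epi_def)
  then have "(i, c) \<in> E" by (rule exact_kernel[OF E _ c(3)])
  then show "admissible_epi E p \<and> admissible_mono E i"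
    using c(1) by (auto simp: deflations_def admissible_mono_def)
next
  assume *: "admissible_epi E p \<and> admissible_mono E i"
  then obtain c where c: "(i, c) \<in> E" by (auto simp: admissible_mono_def)
  then have cok: "is_cokernel A c i" using exact_pair[OF E c] by (simp add: kernel_cokernel_pair_def)
  obtain \<eta> where "local_iso A (deflations E) F (Cod A c) \<eta>" "universal_to_hom A F (Cod A c) \<eta>"
    by (rule local_iso_of_presentation[OF coverage_deflations[OF E] fp_additive[OF F] f ip(1) _ ip(3) cok])
      (use * c in \<open>auto simp: deflations_def admissible_epi_def\<close>)
  then show "F \<in> admissible_functors A E"
    using F unfolding admissible_functors_def locally_representable_def by blast
qed

text \<open>In this case \<open>\<eta>\<close> is an isomorphism of functors, so identities suffice
  as covers.\<close>

lemma representing_locally_representable: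
  assumes R: "finitely_presented A R" and r: "pres A (Zero A W W) R r" and W: "W \<in> Ob A"
    and D: "\<And>X. X \<in> Ob A \<Longrightarrow> Id A X \<in> D"
  shows "R \<in> locally_representable A D"
proof -
  note ad = fp_additive[OF R]
  have r': "r \<in> carrier (FOb R W)" using presD(2)[OF r] W by simp
  have c0: "Cod A (Zero A W W) = W" "Dom A (Zero A W W) = W" using W by simp_all
  obtain \<eta> where \<eta>0: "nat_trans A R (hom_functor A W) \<eta>" "\<eta> (Cod A (Zero A W W)) r = Id A W"
    by (rule induced_nat_trans[OF ad additive_hom_functor[OF W] r, of "Id A W"])
      (use W in \<open>simp_all add: hom_iff\<close>)
  have \<eta>r: "\<eta> W r = Id A W" using \<eta>0(2) c0 by simp
  have \<eta>h: "\<eta> (Dom A h) (FMor R h r) = h" if "h \<in> Mor A" "Cod A h = W" for h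
    using hom_nt_nat[OF \<eta>0(1) that(1) refl, of r] r' that \<eta>r by simp
  have "local_iso A D R W \<eta>" unfolding local_iso_def
  proof (intro conjI ballI impI W \<eta>0)
    fix X x assume x: "X \<in> Ob A" "x \<in> carrier (FOb R X)" "\<eta> X x = Zero A X W"
    obtain h where h: "h \<in> Mor A" "Dom A h = X" "Cod A h = Cod A (Zero A W W)" "FMor R h r = x"
      by (rule pres_gen[OF r x(1,2)])
    have "h = Zero A X W" using \<eta>h[OF h(1)] h(2-4) x(3) c0 by simp
    then have "x = \<one>\<^bsub>FOb R X\<^esub>" using h(4) af_Zero[OF ad x(1) W r'] by simp
    then show "\<exists>d \<in> D. Cod A d = X \<and> FMor R d x = \<one>\<^bsub>FOb R (Dom A d)\<^esub>"
      using D[OF x(1)] x(1,2) by (intro bexI[of _ "Id A X"]) (simp_all add: af_Id[OF ad] af_one_closed[OF ad])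
  next
    fix y assume y: "y \<in> Mor A" "Cod A y = W"
    have "\<eta> (Dom A y) (FMor R y r) = y" by (rule \<eta>h[OF y])
    moreover have "FMor R y r \<in> carrier (FOb R (Dom A y))" using af_closed[OF ad y(1) refl, of r] y r' by simp
    ultimately show "\<exists>d \<in> D. Cod A d = Dom A y \<and> (\<exists>x \<in> carrier (FOb R (Dom A d)). \<eta> (Dom A d) x = y \<odot> d)"
      using D[of "Dom A y"] y by (intro bexI[of _ "Id A (Dom A y)"]) auto
  qed
  moreover have "universal_to_hom A R W \<eta>" unfolding universal_to_hom_def
  proof (intro ballI allI impI)
    fix T \<beta> assume T: "T \<in> Ob A" and \<beta>: "nat_trans A R (hom_functor A T) \<beta>"
    have b: "\<beta> W r \<in> homset A W T" using nt_closed[OF \<beta> W r'] by simp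
    have "\<beta> X x = \<beta> W r \<odot> \<eta> X x" if x: "X \<in> Ob A" "x \<in> carrier (FOb R X)" for X x
    proof -
      obtain h where h: "h \<in> Mor A" "Dom A h = X" "Cod A h = Cod A (Zero A W W)" "FMor R h r = x"
        by (rule pres_gen[OF r x])
      then show ?thesis using hom_nt_nat[OF \<beta> h(1) refl, of r] \<eta>h[OF h(1)] r' c0 by simp
    qed
    then show "\<exists>a \<in> homset A W T. \<forall>X \<in> Ob A. \<forall>x \<in> carrier (FOb R X). \<beta> X x = a \<odot> \<eta> X x"
      using b by blast
  qed
  ultimately show ?thesis using R unfolding locally_representable_def by blast
qed

end

section \<open>From an exact structure to a resolving subcategory\<close>

context abelian_universe
begin

lemma ex_representing_epi:
  fixes F :: "('o, 'm, 'g) afun"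
  assumes F: "finitely_presented A F"
  obtains W and R :: "('o, 'm, 'g) afun" and r \<pi> where "W \<in> Ob A" "finitely_presented A R" "pres A (Zero A W W) R r"
    "nat_trans A R F \<pi>" "pointwise_surj A R F \<pi>"
proof -
  note ad = fp_additive[OF F]
  obtain f e where f: "pres A f F e" by (rule fp_pres[OF F])
  note P = presD[OF f]
  have W: "Cod A f \<in> Ob A" using P by simp
  obtain R :: "('o, 'm, 'g) afun" and r where R: "finitely_presented A R" "additive_functor A R"
    "pres A (Zero A (Cod A f) (Cod A f)) R r" by (rule ex_representing[OF W])
  obtain \<pi> where \<pi>: "nat_trans A R F \<pi>" "\<pi> (Cod A f) r = e" by (rule yoneda[OF W R(2,3) ad P(2)])
  have r: "r \<in> carrier (FOb R (Cod A f))" using presD(2)[OF R(3)] W by simp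
  have "pointwise_surj A R F \<pi>" unfolding pointwise_surj_def
  proof (intro ballI)
    fix X y assume y: "X \<in> Ob A" "y \<in> carrier (FOb F X)"
    obtain h where h: "h \<in> Mor A" "Dom A h = X" "Cod A h = Cod A f" "FMor F h e = y"
      by (rule pres_gen[OF f y])
    show "\<exists>x \<in> carrier (FOb R X). \<pi> X x = y"
      using nt_nat[OF \<pi>(1) h(1,2), of r] af_closed[OF R(2) h(1,2), of r] h r \<pi>(2)
      by (intro bexI[of _ "FMor R h r"]) simp_all
  qed
  then show ?thesis by (rule that[OF W R(1,3) \<pi>(1)])
qed

lemma resolving_admissible_functors:
  assumes E: "exact_structure A E"
  shows "resolving (modcat A) (admissible_functors A E :: ('o, 'm, 'g) afun set)"
proof -
  let ?X = "admissible_functors A E :: ('o, 'm, 'g) afun set"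
  note D = coverage_deflations[OF E]
  have retract: "F \<in> ?X" if "G \<in> ?X" "finitely_presented A F" "nat_trans A F G \<sigma>" "nat_trans A G F \<rho>"
    "\<And>W x. W \<in> Ob A \<Longrightarrow> x \<in> carrier (FOb F W) \<Longrightarrow> \<rho> W (\<sigma> W x) = x" for F G \<sigma> \<rho>
    using locally_representable_retract[OF D that(2) _ that(3-5)] that(1)
    unfolding admissible_functors_def by blast
  have fp: "finitely_presented A F" if "F \<in> ?X" for F
    using that unfolding admissible_functors_def locally_representable_def by blast
  show ?thesis unfolding resolving_def subcategory_def
  proof (intro conjI allI ballI impI)
    show "?X \<subseteq> Ob (modcat A)" using fp by auto
    { fix X Y assume "X \<in> ?X" "isomorphic (modcat A) X Y"
      then show "Y \<in> ?X"
        using modcat_isomorphicE[OF preadditive_category_axioms \<open>isomorphic (modcat A) X Y\<close>] retract by metis }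
    { fix i p :: "('o, 'm, 'g) ftrans"
      assume kc: "kernel_cokernel_pair (modcat A) i p" and X: "Dom (modcat A) i \<in> ?X" "Cod (modcat A) p \<in> ?X"
      have ker: "is_kernel (modcat A) i p" using kc by (simp add: kernel_cokernel_pair_def)
      obtain F G H \<alpha> \<beta> where *: "i = arr A F G \<alpha>" "p = arr A G H \<beta>" "finitely_presented A F"
        "finitely_presented A G" "finitely_presented A H" "left_exact A F G H \<alpha> \<beta>"
        by (rule kernel_modcatD[OF ker])
      have "pointwise_surj A G H \<beta>"
        by (rule cokernel_modcat_epi[OF *(3-5) left_exactD(1,2)[OF *(6)]])
          (use kc in \<open>simp add: kernel_cokernel_pair_def *(1,2)\<close>)
      then show "Cod (modcat A) i \<in> ?X"
        using locally_representable_extension[OF D *(4,6)] X unfolding *(1,2) admissible_functors_def by simp }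
    { fix X Y P assume "is_biproduct (modcat A) X Y P" "P \<in> ?X"
      then show "X \<in> ?X"
        using modcat_retractE[OF preadditive_category_axioms \<open>is_biproduct (modcat A) X Y P\<close>] retract by metis }
    { fix k p :: "('o, 'm, 'g) ftrans"
      assume X: "Dom (modcat A) p \<in> ?X" "Cod (modcat A) p \<in> ?X" and ker: "is_kernel (modcat A) k p"
      obtain F G H \<alpha> \<beta> where *: "k = arr A F G \<alpha>" "p = arr A G H \<beta>" "finitely_presented A F"
        "finitely_presented A G" "finitely_presented A H" "left_exact A F G H \<alpha> \<beta>"
        by (rule kernel_modcatD[OF ker])
      show "Dom (modcat A) k \<in> ?X"
        using locally_representable_kernel[OF D *(3,6)] X unfolding *(1,2) admissible_functors_def by simp }
    { fix F assume "F \<in> Ob (modcat A :: (('o, 'm, 'g) afun, _) acat)"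
      then have F: "finitely_presented A F" by simp
      obtain W and R :: "('o, 'm, 'g) afun" and r \<pi> where R: "W \<in> Ob A" "finitely_presented A R" "pres A (Zero A W W) R r"
        "nat_trans A R F \<pi>" "pointwise_surj A R F \<pi>"
        by (rule ex_representing_epi[OF F])
      have "R \<in> ?X" unfolding admissible_functors_def
        by (rule representing_locally_representable[OF R(2,3,1)])
          (use exact_Id(2)[OF E] in \<open>simp add: deflations_def\<close>)
      then show "\<exists>p. epi_arrow (modcat A) p \<and> Dom (modcat A) p \<in> ?X \<and> Cod (modcat A) p = F"
        using epi_modcatI[OF R(2) F R(4,5)] by (intro exI[of _ "arr A R F \<pi>"]) simp }
  qed
qed

text \<open>For a conflation \<open>(i, p)\<close> take the functor presented by \<open>p\<close>.
  The mono part of its image factorization is an identity, so membership says exactly that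
  \<open>p\<close> is a deflation, and a deflation determines its kernel.\<close>

lemma admissible_functors_subset:
  assumes E: "exact_structure A E" "exact_structure A E'"
    and X: "(admissible_functors A E :: ('o, 'm, 'g) afun set) = admissible_functors A E'"
  shows "E \<subseteq> E'"
proof
  fix x assume "x \<in> E"
  then obtain i p where x: "x = (i, p)" "(i, p) \<in> E" by (cases x) auto
  have kc: "is_kernel A i p" "is_cokernel A p i"
    using exact_pair[OF E(1) x(2)] by (simp_all add: kernel_cokernel_pair_def)
  note P = is_cokernelD[OF kc(2)]
  obtain F :: "('o, 'm, 'g) afun" and e where F: "finitely_presented A F" "additive_functor A F" "pres A p F e"
    by (rule ex_presented[OF P(1)])
  have f: "pres A (Id A (Cod A p) \<odot> p) F e" using F(3) P(1) by simp
  have m: "mono_arrow A (Id A (Cod A p))" using iso_mono P(1) by simp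
  note iff = admissible_functor_iff[OF _ F(1) f m is_cokernel_epi[OF kc(2)]]
  have "F \<in> admissible_functors A E"
    using iff[OF E(1)] exact_Id(1)[OF E(1)] x(2) P(1) by (auto simp: admissible_epi_def)
  then have "F \<in> admissible_functors A E'" using X by simp
  then obtain i' where "(i', p) \<in> E'" using iff[OF E(2)] P(1) by (auto simp: admissible_epi_def)
  then show "x \<in> E'" using exact_kernel[OF E(2) _ kc(1)] x(1) by blast
qed

end

section \<open>Arrows of a resolving subcategory\<close>

text \<open>The cokernels \<open>M\<^sub>f, M\<^sub>g, M\<^sub>h\<close> of \<open>Hom(-, f), Hom(-, g), Hom(-, h)\<close> form a short exact sequence,
  with maps induced by \<open>u\<close> and \<open>v\<close>.\<close>

definition ses_arrows :: "('o, 'm) acat \<Rightarrow> 'm \<Rightarrow> 'm \<Rightarrow> 'm \<Rightarrow> 'm \<Rightarrow> 'm \<Rightarrow> bool" where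
  "ses_arrows A f g h u v \<longleftrightarrow> f \<in> Mor A \<and> g \<in> Mor A \<and> h \<in> Mor A \<and>
     u \<in> homset A (Cod A f) (Cod A g) \<and> v \<in> homset A (Cod A g) (Cod A h) \<and>
     (\<exists>t \<in> homset A (Dom A f) (Dom A g). u \<cdot>\<^bsub>A\<^esub> f = g \<cdot>\<^bsub>A\<^esub> t) \<and>
     (\<exists>t \<in> homset A (Dom A g) (Dom A h). v \<cdot>\<^bsub>A\<^esub> g = h \<cdot>\<^bsub>A\<^esub> t) \<and>
     (\<exists>t \<in> homset A (Cod A f) (Dom A h). v \<cdot>\<^bsub>A\<^esub> u = h \<cdot>\<^bsub>A\<^esub> t) \<and>
     (\<forall>x \<in> Mor A. Cod A x = Cod A f \<longrightarrow> (\<forall>s \<in> homset A (Dom A x) (Dom A g). u \<cdot>\<^bsub>A\<^esub> x = g \<cdot>\<^bsub>A\<^esub> s \<longrightarrow>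
        (\<exists>t \<in> homset A (Dom A x) (Dom A f). f \<cdot>\<^bsub>A\<^esub> t = x))) \<and>
     (\<forall>x \<in> Mor A. Cod A x = Cod A g \<longrightarrow> (\<forall>s \<in> homset A (Dom A x) (Dom A h). v \<cdot>\<^bsub>A\<^esub> x = h \<cdot>\<^bsub>A\<^esub> s \<longrightarrow>
        (\<exists>y \<in> homset A (Dom A x) (Cod A f). \<exists>t \<in> homset A (Dom A x) (Dom A g).
           x = Add A (u \<cdot>\<^bsub>A\<^esub> y) (g \<cdot>\<^bsub>A\<^esub> t)))) \<and>
     (\<exists>w \<in> homset A (Cod A h) (Cod A g). \<exists>t \<in> homset A (Cod A h) (Dom A h).
        Add A (v \<cdot>\<^bsub>A\<^esub> w) (h \<cdot>\<^bsub>A\<^esub> t) = Id A (Cod A h))"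

text \<open>\<open>M\<^sub>f\<close> is a retract of \<open>M\<^sub>g\<close> in the stable category; this condition is visibly self-dual.\<close>

definition stable_retract :: "('o, 'm) acat \<Rightarrow> 'm \<Rightarrow> 'm \<Rightarrow> bool" where
  "stable_retract A f g \<longleftrightarrow>
     (\<exists>a \<in> homset A (Dom A f) (Dom A g). \<exists>b \<in> homset A (Cod A f) (Cod A g).
      \<exists>a' \<in> homset A (Dom A g) (Dom A f). \<exists>b' \<in> homset A (Cod A g) (Cod A f).
      \<exists>s \<in> homset A (Cod A f) (Dom A f).
        b \<cdot>\<^bsub>A\<^esub> f = g \<cdot>\<^bsub>A\<^esub> a \<and> b' \<cdot>\<^bsub>A\<^esub> g = f \<cdot>\<^bsub>A\<^esub> a' \<and>
        b' \<cdot>\<^bsub>A\<^esub> (b \<cdot>\<^bsub>A\<^esub> f) = Add A f (f \<cdot>\<^bsub>A\<^esub> (s \<cdot>\<^bsub>A\<^esub> f)))"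

section \<open>Stable retracts and short exact sequences in terms of arrows\<close>

context preadditive_category
begin

lemma stable_retractI:
  assumes "a \<in> Mor C" "Dom C a = Dom C f" "Cod C a = Dom C g" "b \<in> Mor C" "Dom C b = Cod C f" "Cod C b = Cod C g"
    "a' \<in> Mor C" "Dom C a' = Dom C g" "Cod C a' = Dom C f" "b' \<in> Mor C" "Dom C b' = Cod C g" "Cod C b' = Cod C f"
    "s \<in> Mor C" "Dom C s = Cod C f" "Cod C s = Dom C f"
    "b \<odot> f = g \<odot> a" "b' \<odot> g = f \<odot> a'" "b' \<odot> (b \<odot> f) = f \<oplus> f \<odot> (s \<odot> f)"
  shows "stable_retract C f g"
  unfolding stable_retract_def
  by (rule bexI[of _ a], rule bexI[of _ b], rule bexI[of _ a'], rule bexI[of _ b'], rule bexI[of _ s])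
    (use assms in \<open>simp_all add: hom_iff\<close>)

lemma stable_retractE:
  assumes "stable_retract C f g"
  obtains a b a' b' s where
    "a \<in> Mor C" "Dom C a = Dom C f" "Cod C a = Dom C g" "b \<in> Mor C" "Dom C b = Cod C f" "Cod C b = Cod C g"
    "a' \<in> Mor C" "Dom C a' = Dom C g" "Cod C a' = Dom C f" "b' \<in> Mor C" "Dom C b' = Cod C g" "Cod C b' = Cod C f"
    "s \<in> Mor C" "Dom C s = Cod C f" "Cod C s = Dom C f"
    "b \<odot> f = g \<odot> a" "b' \<odot> g = f \<odot> a'" "b' \<odot> (b \<odot> f) = f \<oplus> f \<odot> (s \<odot> f)"
  using assms unfolding stable_retract_def hom_iff Bex_def by (elim conjE exE) (rule that; assumption)

lemma stable_retract_refl: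
  assumes "f \<in> Mor C" shows "stable_retract C f f"
  by (rule stable_retractI[of "Id C (Dom C f)" _ _ "Id C (Cod C f)" "Id C (Dom C f)" "Id C (Cod C f)"
        "Zero C (Cod C f) (Dom C f)"])
    (use assms in simp_all)

text \<open>The dual data are \<open>b'\<close>, \<open>a'\<close>, \<open>b\<close>,
  \<open>a\<close> with the same \<open>s\<close>. Because \<open>b' b f = b' g a = f a' a\<close>,
  the last equation can be read from either side.\<close>

lemma stable_retract_opcat:
  assumes "stable_retract C f g" "f \<in> Mor C" "g \<in> Mor C" shows "stable_retract (opcat C) f g"
proof -
  interpret op: preadditive_category "opcat C" by (rule preadditive_opcat)
  obtain a b a' b' s where *:
    "a \<in> Mor C" "Dom C a = Dom C f" "Cod C a = Dom C g" "b \<in> Mor C" "Dom C b = Cod C f" "Cod C b = Cod C g"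
    "a' \<in> Mor C" "Dom C a' = Dom C g" "Cod C a' = Dom C f" "b' \<in> Mor C" "Dom C b' = Cod C g" "Cod C b' = Cod C f"
    "s \<in> Mor C" "Dom C s = Cod C f" "Cod C s = Dom C f"
    "b \<odot> f = g \<odot> a" "b' \<odot> g = f \<odot> a'" "b' \<odot> (b \<odot> f) = f \<oplus> f \<odot> (s \<odot> f)"
    by (rule stable_retractE[OF assms(1)])
  have "(f \<odot> a') \<odot> a = b' \<odot> (b \<odot> f)"
    using comp_reassoc[OF *(17), of a] *(1-16) assms(2,3) by simp
  then have "(f \<odot> a') \<odot> a = f \<oplus> (f \<odot> s) \<odot> f" using *(18) *(13-15) assms(2) by (simp add: assoc)
  then show ?thesis
    by (intro op.stable_retractI[of b' f g a' b a s]) (use * assms in simp_all)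
qed

lemma ses_of_arrows:
  assumes ses: "ses_arrows C f g h u v"
    and F: "additive_functor C F" "pres C f F eF" and G: "additive_functor C G" "pres C g G eG"
    and H: "additive_functor C H" "pres C h H eH"
  obtains \<alpha> \<beta> where "left_exact C F G H \<alpha> \<beta>" "pointwise_surj C G H \<beta>"
proof -
  from ses have fgh: "f \<in> Mor C" "g \<in> Mor C" "h \<in> Mor C"
    and u: "u \<in> Mor C" "Dom C u = Cod C f" "Cod C u = Cod C g"
    and v: "v \<in> Mor C" "Dom C v = Cod C g" "Cod C v = Cod C h"
    by (simp_all add: ses_arrows_def hom_iff)
  from ses obtain t1 where t1: "t1 \<in> homset C (Dom C f) (Dom C g)" "u \<odot> f = g \<odot> t1"
    unfolding ses_arrows_def by blast
  from ses obtain t2 where t2: "t2 \<in> homset C (Dom C g) (Dom C h)" "v \<odot> g = h \<odot> t2"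
    unfolding ses_arrows_def by blast
  from ses obtain t3 where t3: "t3 \<in> homset C (Cod C f) (Dom C h)" "v \<odot> u = h \<odot> t3"
    unfolding ses_arrows_def by blast
  have inj: "\<exists>t \<in> homset C (Dom C x) (Dom C f). f \<odot> t = x"
    if "x \<in> Mor C" "Cod C x = Cod C f" "s \<in> homset C (Dom C x) (Dom C g)" "u \<odot> x = g \<odot> s" for x s
    using ses that unfolding ses_arrows_def by blast
  have mid: "\<exists>y \<in> homset C (Dom C x) (Cod C f). \<exists>t \<in> homset C (Dom C x) (Dom C g). x = u \<odot> y \<oplus> g \<odot> t"
    if "x \<in> Mor C" "Cod C x = Cod C g" "s \<in> homset C (Dom C x) (Dom C h)" "v \<odot> x = h \<odot> s" for x s
    using ses that unfolding ses_arrows_def by blast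
  from ses obtain w t where w: "w \<in> homset C (Cod C h) (Cod C g)" "t \<in> homset C (Cod C h) (Dom C h)"
    "v \<odot> w \<oplus> h \<odot> t = Id C (Cod C h)"
    unfolding ses_arrows_def by blast
  note eF = presD(2)[OF F(2)] and eG = presD(2)[OF G(2)] and eH = presD(2)[OF H(2)]
  have "FMor G f (FMor G u eG) = FMor G (u \<odot> f) eG" using fgh u eG by (simp add: af_Cmp[OF G(1)])
  also have "\<dots> = \<one>\<^bsub>FOb G (Dom C f)\<^esub>"
    unfolding t1(2) using pres_Cmp[OF G, of t1] t1(1) by (simp add: hom_iff)
  finally obtain \<alpha> where \<alpha>: "nat_trans C F G \<alpha>" "\<alpha> (Cod C f) eF = FMor G u eG"
    by (rule induced_nat_trans[OF F(1) G(1) F(2), rotated]) (use u eG in \<open>simp_all add: af_closed[OF G(1)]\<close>)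
  have "FMor H g (FMor H v eH) = FMor H (v \<odot> g) eH" using fgh v eH by (simp add: af_Cmp[OF H(1)])
  also have "\<dots> = \<one>\<^bsub>FOb H (Dom C g)\<^esub>"
    unfolding t2(2) using pres_Cmp[OF H, of t2] t2(1) by (simp add: hom_iff)
  finally obtain \<beta> where \<beta>: "nat_trans C G H \<beta>" "\<beta> (Cod C g) eG = FMor H v eH"
    by (rule induced_nat_trans[OF G(1) H(1) G(2), rotated]) (use v eH in \<open>simp_all add: af_closed[OF H(1)]\<close>)
  have \<alpha>x: "\<alpha> (Dom C x) (FMor F x eF) = FMor G (u \<odot> x) eG" if "x \<in> Mor C" "Cod C x = Cod C f" for x
    using nt_nat[OF \<alpha>(1) that(1) refl, of eF] that \<alpha>(2) eF eG u by (simp add: af_Cmp[OF G(1)])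
  have \<beta>x: "\<beta> (Dom C x) (FMor G x eG) = FMor H (v \<odot> x) eH" if "x \<in> Mor C" "Cod C x = Cod C g" for x
    using nt_nat[OF \<beta>(1) that(1) refl, of eG] that \<beta>(2) eG eH v by (simp add: af_Cmp[OF H(1)])
  have "left_exact C F G H \<alpha> \<beta>" unfolding left_exact_def
  proof (intro conjI ballI impI \<alpha> \<beta> iffI)
    fix W z assume z: "W \<in> Ob C" "z \<in> carrier (FOb F W)" "\<alpha> W z = \<one>\<^bsub>FOb G W\<^esub>"
    obtain x where x: "x \<in> Mor C" "Dom C x = W" "Cod C x = Cod C f" "FMor F x eF = z"
      by (rule pres_gen[OF F(2) z(1,2)])
    have "FMor G (u \<odot> x) eG = \<one>\<^bsub>FOb G (Dom C (u \<odot> x))\<^esub>" using \<alpha>x[OF x(1,3)] x z(3) u by simp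
    then obtain s where s: "s \<in> Mor C" "Dom C s = Dom C (u \<odot> x)" "Cod C s = Dom C g" "g \<odot> s = u \<odot> x"
      by (rule pres_relE[OF G(2), rotated 2]) (use x u in simp_all)
    have "s \<in> homset C (Dom C x) (Dom C g)" using s x u by (simp add: hom_iff)
    then obtain t where t: "t \<in> homset C (Dom C x) (Dom C f)" "f \<odot> t = x"
      using inj[OF x(1,3) _ s(4)[symmetric]] by blast
    have "FMor F (f \<odot> t) eF = \<one>\<^bsub>FOb F (Dom C t)\<^esub>" using pres_Cmp[OF F, of t] t(1) by (simp add: hom_iff)
    then show "z = \<one>\<^bsub>FOb F W\<^esub>" using t x by (simp add: hom_iff)
  next
    fix W z assume z: "W \<in> Ob C" "z \<in> carrier (FOb G W)" "\<beta> W z = \<one>\<^bsub>FOb H W\<^esub>"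
    obtain x where x: "x \<in> Mor C" "Dom C x = W" "Cod C x = Cod C g" "FMor G x eG = z"
      by (rule pres_gen[OF G(2) z(1,2)])
    have "FMor H (v \<odot> x) eH = \<one>\<^bsub>FOb H (Dom C (v \<odot> x))\<^esub>" using \<beta>x[OF x(1,3)] x z(3) v by simp
    then obtain s where s: "s \<in> Mor C" "Dom C s = Dom C (v \<odot> x)" "Cod C s = Dom C h" "h \<odot> s = v \<odot> x"
      by (rule pres_relE[OF H(2), rotated 2]) (use x v in simp_all)
    have "s \<in> homset C (Dom C x) (Dom C h)" using s x v by (simp add: hom_iff)
    then obtain y t' where yt: "y \<in> homset C (Dom C x) (Cod C f)" "t' \<in> homset C (Dom C x) (Dom C g)"
      "x = u \<odot> y \<oplus> g \<odot> t'"
      using mid[OF x(1,3) _ s(4)[symmetric]] by blast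
    have y: "y \<in> Mor C" "Dom C y = W" "Cod C y = Cod C f" and t': "t' \<in> Mor C" "Dom C t' = W" "Cod C t' = Dom C g"
      using yt(1,2) x(2) by (simp_all add: hom_iff)
    have "z = FMor G (u \<odot> y \<oplus> g \<odot> t') eG" using yt(3) x(4) by simp
    also have "\<dots> = FMor G (u \<odot> y) eG \<otimes>\<^bsub>FOb G W\<^esub> FMor G (g \<odot> t') eG"
      using y t' u fgh eG by (subst af_Add[OF G(1)]) simp_all
    also have "\<dots> = FMor G (u \<odot> y) eG"
      using pres_Cmp[OF G t'(1,3)] t'(2) y u eG z(1)
      by (simp add: monoid.r_one[OF af_monoid[OF G(1)]] af_closed[OF G(1)])
    finally have "\<alpha> W (FMor F y eF) = z" using \<alpha>x[OF y(1,3)] y by simp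
    moreover have "FMor F y eF \<in> carrier (FOb F W)" using y eF by (simp add: af_closed[OF F(1)])
    ultimately show "\<exists>x \<in> carrier (FOb F W). \<alpha> W x = z" by blast
  next
    fix W z assume z: "W \<in> Ob C" "z \<in> carrier (FOb G W)" "\<exists>x \<in> carrier (FOb F W). \<alpha> W x = z"
    then obtain z' where z': "z' \<in> carrier (FOb F W)" "\<alpha> W z' = z" by blast
    obtain x where x: "x \<in> Mor C" "Dom C x = W" "Cod C x = Cod C f" "FMor F x eF = z'"
      by (rule pres_gen[OF F(2) z(1) z'(1)])
    have t3': "t3 \<in> Mor C" "Dom C t3 = Cod C f" "Cod C t3 = Dom C h" using t3(1) by (simp_all add: hom_iff)
    have "\<beta> W z = FMor H (v \<odot> (u \<odot> x)) eH"
      using \<beta>x[of "u \<odot> x"] \<alpha>x[OF x(1,3)] x z' u by simp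
    also have "v \<odot> (u \<odot> x) = h \<odot> (t3 \<odot> x)"
      using comp_square[OF t3(2), of x] x u v fgh t3' by simp
    also have "FMor H (h \<odot> (t3 \<odot> x)) eH = \<one>\<^bsub>FOb H W\<^esub>"
      using pres_Cmp[OF H, of "t3 \<odot> x"] t3' x by simp
    finally show "\<beta> W z = \<one>\<^bsub>FOb H W\<^esub>" .
  qed
  moreover have "pointwise_surj C G H \<beta>" unfolding pointwise_surj_def
  proof (intro ballI)
    fix W z assume z: "W \<in> Ob C" "z \<in> carrier (FOb H W)"
    obtain x where x: "x \<in> Mor C" "Dom C x = W" "Cod C x = Cod C h" "FMor H x eH = z"
      by (rule pres_gen[OF H(2) z])
    have wt: "w \<in> Mor C" "Dom C w = Cod C h" "Cod C w = Cod C g" "t \<in> Mor C" "Dom C t = Cod C h" "Cod C t = Dom C h"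
      using w(1,2) by (simp_all add: hom_iff)
    have "x = (v \<odot> w \<oplus> h \<odot> t) \<odot> x" unfolding w(3) using x by simp
    also have "\<dots> = v \<odot> (w \<odot> x) \<oplus> h \<odot> (t \<odot> x)" using wt v fgh x by (simp add: assoc)
    finally have xe: "x = v \<odot> (w \<odot> x) \<oplus> h \<odot> (t \<odot> x)" .
    have "z = FMor H (v \<odot> (w \<odot> x) \<oplus> h \<odot> (t \<odot> x)) eH" using x(4) xe by simp
    also have "\<dots> = FMor H (v \<odot> (w \<odot> x)) eH \<otimes>\<^bsub>FOb H W\<^esub> FMor H (h \<odot> (t \<odot> x)) eH"
      using wt x(1-3) v fgh eH by (subst af_Add[OF H(1)]) simp_all
    also have "\<dots> = FMor H (v \<odot> (w \<odot> x)) eH"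
      using pres_Cmp[OF H, of "t \<odot> x"] wt x(1-3) v eH z(1)
      by (simp add: monoid.r_one[OF af_monoid[OF H(1)]] af_closed[OF H(1)])
    also have "\<dots> = \<beta> W (FMor G (w \<odot> x) eG)" using \<beta>x[of "w \<odot> x"] wt x(1-3) by simp
    finally have "\<beta> W (FMor G (w \<odot> x) eG) = z" ..
    moreover have "FMor G (w \<odot> x) eG \<in> carrier (FOb G W)" using wt x(1-3) eG by (simp add: af_closed[OF G(1)])
    ultimately show "\<exists>y \<in> carrier (FOb G W). \<beta> W y = z" by blast
  qed
  ultimately show ?thesis by (rule that)
qed

lemma nat_trans_inv:
  assumes "additive_functor C G" "nat_trans C F G \<alpha>"
  shows "nat_trans C F G (\<lambda>X x. inv\<^bsub>FOb G X\<^esub> \<alpha> X x)"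
proof (rule nat_transI)
  fix X x y assume *: "X \<in> Ob C" "x \<in> carrier (FOb F X)" "y \<in> carrier (FOb F X)"
  interpret G: comm_group "FOb G X" by (rule af_comm_group[OF assms(1) *(1)])
  show "inv\<^bsub>FOb G X\<^esub> \<alpha> X x \<in> carrier (FOb G X)" using nt_closed[OF assms(2) *(1,2)] by simp
  show "inv\<^bsub>FOb G X\<^esub> \<alpha> X (x \<otimes>\<^bsub>FOb F X\<^esub> y) = inv\<^bsub>FOb G X\<^esub> \<alpha> X x \<otimes>\<^bsub>FOb G X\<^esub> inv\<^bsub>FOb G X\<^esub> \<alpha> X y"
    using * nt_closed[OF assms(2) *(1)] by (simp add: nt_mult[OF assms(2)] G.inv_mult)
next
  fix f x assume *: "f \<in> Mor C" "x \<in> carrier (FOb F (Cod C f))"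
  have a: "\<alpha> (Cod C f) x \<in> carrier (FOb G (Cod C f))" using nt_closed[OF assms(2)] * by simp
  interpret h: group_hom "FOb G (Cod C f)" "FOb G (Dom C f)" "FMor G f"
    by (intro group_hom.intro group_hom_axioms.intro af_group[OF assms(1)] af_hom[OF assms(1)]) (use * in simp_all)
  show "inv\<^bsub>FOb G (Dom C f)\<^esub> \<alpha> (Dom C f) (FMor F f x) = FMor G f (inv\<^bsub>FOb G (Cod C f)\<^esub> \<alpha> (Cod C f) x)"
    using * a by (simp add: nt_nat[OF assms(2)])
qed

end

context abelian_universe
begin

text \<open>The complement of a retract of \<open>M\<^sub>f\<close> given by an idempotent that lifts to \<open>\<theta>\<close> is \<open>M\<close> of \<open>(f, \<theta>)\<close>.\<close>

lemma retract_is_summand: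
  fixes G S :: "('o, 'm, 'g) afun"
  assumes fp: "finitely_presented A G" "finitely_presented A S"
    and \<sigma>: "nat_trans A G S \<sigma>" and \<rho>: "nat_trans A S G \<rho>"
    and \<rho>\<sigma>: "\<And>W x. W \<in> Ob A \<Longrightarrow> x \<in> carrier (FOb G W) \<Longrightarrow> \<rho> W (\<sigma> W x) = x"
  obtains Q where "is_biproduct (modcat A) G Q S"
proof -
  note ad = fp_additive[OF fp(1)] fp_additive[OF fp(2)]
  obtain f e where S: "pres A f S e" by (rule fp_pres[OF fp(2)])
  note P = presD[OF S]
  note \<sigma>\<rho> = nat_trans_comp[OF \<rho> \<sigma>]
  have Ob: "Cod A f \<in> Ob A" using P by simp
  \<comment> \<open>\<open>\<theta>\<close> lifts the idempotent \<open>\<sigma> \<rho>\<close> of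
    \<open>S\<close> to the presentation. Adding it to the relations divides \<open>S\<close> by the
    image of \<open>\<sigma>\<close>.\<close>
  obtain \<theta> where \<theta>: "\<theta> \<in> Mor A" "Dom A \<theta> = Cod A f" "Cod A \<theta> = Cod A f"
    "FMor S \<theta> e = \<sigma> (Cod A f) (\<rho> (Cod A f) e)"
    by (rule pres_gen[OF S Ob nt_closed[OF \<sigma>\<rho> Ob P(2)]])
  obtain B where "is_biproduct A (Dom A f) (Cod A f) B" using biproducts[OF Dom_Ob[OF P(1)] Ob] by blast
  then obtain i j r s where B: "B \<in> Ob A" "i \<in> Mor A" "Dom A i = Dom A f" "Cod A i = B"
      "j \<in> Mor A" "Dom A j = Cod A f" "Cod A j = B" "r \<in> Mor A" "Dom A r = B" "Cod A r = Dom A f"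
      "s \<in> Mor A" "Dom A s = B" "Cod A s = Cod A f"
      "r \<odot> i = Id A (Dom A f)" "s \<odot> j = Id A (Cod A f)" "r \<odot> j = Zero A (Cod A f) (Dom A f)"
      "s \<odot> i = Zero A (Dom A f) (Cod A f)" "(i \<odot> r) \<oplus> (j \<odot> s) = Id A B"
    by (rule biproductE)
  define m where "m = f \<odot> r \<oplus> \<theta> \<odot> s"
  have m: "m \<in> Mor A" "Dom A m = B" "Cod A m = Cod A f" using B \<theta> P by (simp_all add: m_def)
  have mi: "m \<odot> i = f" "m \<odot> j = \<theta>" using B \<theta> P by (simp_all add: m_def assoc)
  obtain Q :: "('o, 'm, 'g) afun" and eQ where Q: "finitely_presented A Q" "additive_functor A Q" "pres A m Q eQ"
    by (rule ex_presented[OF m(1)])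
  have eQ: "eQ \<in> carrier (FOb Q (Cod A f))" using presD(2)[OF Q(3)] m by simp
  have e0: "FMor Q f eQ = \<one>\<^bsub>FOb Q (Dom A f)\<^esub>" "FMor Q \<theta> eQ = \<one>\<^bsub>FOb Q (Cod A f)\<^esub>"
    using pres_Cmp[OF Q(2,3), of i] pres_Cmp[OF Q(2,3), of j] B m mi by simp_all
  \<comment> \<open>This is the complementary idempotent. It is trivial on the additional relation
    as well, so it descends to the inclusion \<open>j'\<close> of \<open>Q\<close> into
    \<open>S\<close>.\<close>
  define \<kappa> where "\<kappa> X x = x \<otimes>\<^bsub>FOb S X\<^esub> inv\<^bsub>FOb S X\<^esub> \<sigma> X (\<rho> X x)" for X x
  have \<kappa>: "nat_trans A S S \<kappa>"
    unfolding \<kappa>_def by (rule nat_trans_mult[OF ad(2) nat_trans_ident nat_trans_inv[OF ad(2) \<sigma>\<rho>]])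
  have \<kappa>\<sigma>: "\<kappa> X (\<sigma> X x) = \<one>\<^bsub>FOb S X\<^esub>" if "X \<in> Ob A" "x \<in> carrier (FOb G X)" for X x
    using \<rho>\<sigma>[OF that] nt_closed[OF \<sigma> that] group.r_inv[OF af_group[OF ad(2) that(1)]] by (simp add: \<kappa>_def)
  have \<rho>\<kappa>: "\<rho> X (\<kappa> X x) = \<one>\<^bsub>FOb G X\<^esub>" if x: "X \<in> Ob A" "x \<in> carrier (FOb S X)" for X x
    unfolding \<kappa>_def
    by (rule iffD1[OF nt_eq_if_div[OF ad(2,1) \<rho> x nt_closed[OF \<sigma>\<rho> x]]])
      (use \<rho>\<sigma>[OF x(1) nt_closed[OF \<rho> x]] in simp)
  have sum: "\<sigma> X (\<rho> X x) \<otimes>\<^bsub>FOb S X\<^esub> \<kappa> X x = x" if x: "X \<in> Ob A" "x \<in> carrier (FOb S X)" for X x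
  proof -
    interpret S: comm_group "FOb S X" by (rule af_comm_group[OF ad(2) x(1)])
    have "\<sigma> X (\<rho> X x) \<in> carrier (FOb S X)" by (rule nt_closed[OF \<sigma>\<rho> x])
    then show ?thesis using x by (simp add: \<kappa>_def S.m_lcomm)
  qed
  define y where "y = \<kappa> (Cod A f) e"
  have y: "y \<in> carrier (FOb S (Cod A f))" using nt_closed[OF \<kappa> Ob P(2)] by (simp add: y_def)
  have Sy: "FMor S h y = \<kappa> (Dom A h) (FMor S h e)" if "h \<in> Mor A" "Cod A h = Cod A f" for h
    using nt_nat[OF \<kappa> that(1) refl, of e] that P by (simp add: y_def)
  have yf: "FMor S f y = \<one>\<^bsub>FOb S (Dom A f)\<^esub>"
    using Sy[OF P(1) refl] pres_zero[OF ad(2) S] nt_one[OF \<kappa> ad(2,2), of "Dom A f"] P by simp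
  have y\<theta>: "FMor S \<theta> y = \<one>\<^bsub>FOb S (Cod A f)\<^esub>"
    using Sy[OF \<theta>(1,3)] \<theta> \<kappa>\<sigma>[OF Ob nt_closed[OF \<rho> Ob P(2)]] by simp
  have "FMor S m y = FMor S (f \<odot> r) y \<otimes>\<^bsub>FOb S B\<^esub> FMor S (\<theta> \<odot> s) y"
    unfolding m_def using B(1-13) P(1) \<theta>(1-3) y by (subst af_Add[OF ad(2)]) simp_all
  also have "\<dots> = \<one>\<^bsub>FOb S B\<^esub> \<otimes>\<^bsub>FOb S B\<^esub> \<one>\<^bsub>FOb S B\<^esub>"
    using B(1-13) P(1) \<theta>(1-3) y yf y\<theta> af_one[OF ad(2) B(8)] af_one[OF ad(2) B(11)]
    by (simp add: af_Cmp[OF ad(2)])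
  finally have my: "FMor S m y = \<one>\<^bsub>FOb S (Dom A m)\<^esub>"
    using m af_one_closed[OF ad(2) B(1)] by (simp add: monoid.l_one[OF af_monoid[OF ad(2)]] B(1))
  obtain q where q: "nat_trans A S Q q" "q (Cod A f) e = eQ"
    by (rule induced_nat_trans[OF ad(2) Q(2) S eQ e0(1)])
  have y': "y \<in> carrier (FOb S (Cod A m))" using y m by simp
  obtain j' where j0: "nat_trans A Q S j'" "j' (Cod A m) eQ = y"
    by (rule induced_nat_trans[OF Q(2) ad(2) Q(3) y' my])
  have j': "j' (Cod A f) eQ = y" using j0(2) m by simp
  have qh: "q (Dom A h) (FMor S h e) = FMor Q h eQ" if "h \<in> Mor A" "Cod A h = Cod A f" for h
    using nt_nat[OF q(1) that(1) refl, of e] that P q(2) by simp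
  have q\<sigma>\<rho>: "q X (\<sigma> X (\<rho> X x)) = \<one>\<^bsub>FOb Q X\<^esub>" if "X \<in> Ob A" "x \<in> carrier (FOb S X)" for X x
    by (rule nat_trans_eqI[OF S nat_trans_comp[OF \<sigma>\<rho> q(1)] nat_trans_one[OF Q(2)] _ that])
      (use qh[OF \<theta>(1,3)] \<theta> e0 in simp)
  have q\<sigma>: "q X (\<sigma> X x) = \<one>\<^bsub>FOb Q X\<^esub>" if "X \<in> Ob A" "x \<in> carrier (FOb G X)" for X x
    using q\<sigma>\<rho>[OF that(1) nt_closed[OF \<sigma> that]] \<rho>\<sigma>[OF that] by simp
  have j'q: "j' X (q X x) = \<kappa> X x" if "X \<in> Ob A" "x \<in> carrier (FOb S X)" for X x
    by (rule nat_trans_eqI[OF S nat_trans_comp[OF q(1) j0(1)] \<kappa> _ that]) (use q(2) j' y_def in simp)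
  have q\<kappa>: "q X (\<kappa> X x) = q X x" if x: "X \<in> Ob A" "x \<in> carrier (FOb S X)" for X x
  proof -
    have "q X x = q X (\<sigma> X (\<rho> X x) \<otimes>\<^bsub>FOb S X\<^esub> \<kappa> X x)" using sum[OF x] by simp
    also have "\<dots> = \<one>\<^bsub>FOb Q X\<^esub> \<otimes>\<^bsub>FOb Q X\<^esub> q X (\<kappa> X x)"
      using nt_mult[OF q(1) x(1) nt_closed[OF \<sigma>\<rho> x] nt_closed[OF \<kappa> x]] q\<sigma>\<rho>[OF x] by simp
    also have "\<dots> = q X (\<kappa> X x)"
      by (rule monoid.l_one[OF af_monoid[OF Q(2) x(1)] nt_closed[OF q(1) x(1) nt_closed[OF \<kappa> x]]])
    finally show ?thesis by simp
  qed
  have qj': "q X (j' X x) = x" if "X \<in> Ob A" "x \<in> carrier (FOb Q X)" for X x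
    by (rule nat_trans_eqI[OF Q(3) nat_trans_comp[OF j0(1) q(1)] nat_trans_ident _ that])
      (use q\<kappa>[OF Ob P(2)] j' y_def q(2) m in simp)
  have \<rho>j': "\<rho> X (j' X x) = \<one>\<^bsub>FOb G X\<^esub>" if "X \<in> Ob A" "x \<in> carrier (FOb Q X)" for X x
    by (rule nat_trans_eqI[OF Q(3) nat_trans_comp[OF j0(1) \<rho>] nat_trans_one[OF ad(1)] _ that])
      (use \<rho>\<kappa>[OF Ob P(2)] j' y_def m in simp)
  have "is_biproduct (modcat A) G Q S"
    unfolding is_biproduct_def
  proof (intro conjI bexI)
    show "arr A S G \<rho> \<cdot>\<^bsub>modcat A\<^esub> arr A G S \<sigma> = Id (modcat A) G"
      by (simp add: arr_Cmp[OF \<sigma>] arr_Id arr_eq_iff \<rho>\<sigma>)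
    show "arr A S Q q \<cdot>\<^bsub>modcat A\<^esub> arr A Q S j' = Id (modcat A) Q"
      by (simp add: arr_Cmp[OF j0(1)] arr_Id arr_eq_iff qj')
    show "arr A S G \<rho> \<cdot>\<^bsub>modcat A\<^esub> arr A Q S j' = Zero (modcat A) Q G"
      by (simp add: arr_Cmp[OF j0(1)] arr_Zero arr_eq_iff \<rho>j')
    show "arr A S Q q \<cdot>\<^bsub>modcat A\<^esub> arr A G S \<sigma> = Zero (modcat A) G Q"
      by (simp add: arr_Cmp[OF \<sigma>] arr_Zero arr_eq_iff q\<sigma>)
    show "Add (modcat A) (arr A G S \<sigma> \<cdot>\<^bsub>modcat A\<^esub> arr A S G \<rho>) (arr A Q S j' \<cdot>\<^bsub>modcat A\<^esub> arr A S Q q) =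
        Id (modcat A) S"
      by (simp add: arr_Cmp[OF \<rho>] arr_Cmp[OF q(1)] arr_Id arr_Add arr_eq_iff j'q sum)
  qed (use fp Q(1) \<sigma> \<rho> q(1) j0(1) in \<open>simp_all add: arr_hom\<close>)
  then show ?thesis by (rule that)
qed

end

locale resolving_subcategory = abelian_universe A \<iota>
  for A :: "('o, 'm) acat" and \<iota> :: "'m \<Rightarrow> 'g" +
  fixes \<X> :: "('o, 'm, 'g) afun set"
  assumes resolving: "resolving (modcat A) \<X>"
begin

text \<open>One functor in \<open>\<X>\<close> presented by \<open>f\<close> is enough; by
  \<open>fam_iff\<close> every other functor presented by \<open>f\<close> then belongs to
  \<open>\<X>\<close> too.\<close>

definition fam :: "'m set" where
  "fam = {f \<in> Mor A. \<exists>F \<in> \<X>. \<exists>e. pres A f F e}"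

lemma X_fp: "F \<in> \<X> \<Longrightarrow> finitely_presented A F"
  using resolving unfolding resolving_def subcategory_def by auto

lemma X_extension:
  assumes "left_exact A F G H \<alpha> \<beta>" "pointwise_surj A G H \<beta>" "finitely_presented A G" "F \<in> \<X>" "H \<in> \<X>"
  shows "G \<in> \<X>"
proof -
  have "\<forall>i p. kernel_cokernel_pair (modcat A) i p \<longrightarrow> Dom (modcat A) i \<in> \<X> \<longrightarrow> Cod (modcat A) p \<in> \<X> \<longrightarrow>
      Cod (modcat A) i \<in> \<X>"
    using resolving unfolding resolving_def by blast
  from this[rule_format, OF conflation_modcatI[OF X_fp[OF assms(4)] assms(3) X_fp[OF assms(5)] assms(1,2)]]
  show ?thesis using assms(4,5) by simp
qed

lemma X_kernel:
  assumes "left_exact A F G H \<alpha> \<beta>" "pointwise_surj A G H \<beta>" "finitely_presented A F" "G \<in> \<X>" "H \<in> \<X>"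
  shows "F \<in> \<X>"
proof -
  note fp = assms(3) X_fp[OF assms(4)] X_fp[OF assms(5)]
  have "\<forall>k p. epi_arrow (modcat A) p \<longrightarrow> Dom (modcat A) p \<in> \<X> \<longrightarrow> Cod (modcat A) p \<in> \<X> \<longrightarrow>
      is_kernel (modcat A) k p \<longrightarrow> Dom (modcat A) k \<in> \<X>"
    using resolving unfolding resolving_def by blast
  from this[rule_format, OF epi_modcatI[OF fp(2,3) left_exactD(2)[OF assms(1)] assms(2)] _ _
      kernel_modcatI[OF fp assms(1)]]
  show ?thesis using assms(4,5) by simp
qed

text \<open>The definition of \<open>resolving\<close> speaks of summands of biproducts, so a
  retract needs a complement, and \<open>retract_is_summand\<close> provides it.\<close>

lemma X_retract:
  assumes "finitely_presented A G" "S \<in> \<X>" "nat_trans A G S \<sigma>" "nat_trans A S G \<rho>"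
    "\<And>W x. W \<in> Ob A \<Longrightarrow> x \<in> carrier (FOb G W) \<Longrightarrow> \<rho> W (\<sigma> W x) = x"
  shows "G \<in> \<X>"
proof -
  obtain Q where Q: "is_biproduct (modcat A) G Q S"
    by (rule retract_is_summand[OF assms(1) X_fp[OF assms(2)] assms(3-5)])
  have "\<forall>X Y P. is_biproduct (modcat A) X Y P \<longrightarrow> P \<in> \<X> \<longrightarrow> X \<in> \<X>"
    using resolving unfolding resolving_def by blast
  then show ?thesis using Q assms(2) by blast
qed

text \<open>Representable functors are projective: some object of \<open>\<X>\<close> maps onto
  \<open>R\<close>, a preimage of the generator gives a section by Yoneda, and so \<open>R\<close>
  is a retract of that object.\<close>

lemma X_representing:
  assumes W: "W \<in> Ob A" and R: "finitely_presented A R" and r: "pres A (Zero A W W) R r"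
  shows "R \<in> \<X>"
proof -
  note ad = fp_additive[OF R]
  have "\<forall>Y \<in> Ob (modcat A). \<exists>p. epi_arrow (modcat A) p \<and> Dom (modcat A) p \<in> \<X> \<and> Cod (modcat A) p = Y"
    using resolving unfolding resolving_def by blast
  then obtain p where p: "epi_arrow (modcat A) p" "Dom (modcat A) p \<in> \<X>" "Cod (modcat A) p = R"
    using R by (metis modcat_Ob)
  define G where "G = Dom (modcat A) p"
  have "p \<in> homset (modcat A) G R" using p by (simp add: hom_iff G_def epi_arrow_def mono_arrow_def)
  then obtain \<pi> where \<pi>: "p = arr A G R \<pi>" "finitely_presented A G" "nat_trans A G R \<pi>"
    by (rule modcat_homE)
  have surj: "pointwise_surj A G R \<pi>" using epi_modcatD[OF \<pi>(2) R \<pi>(3)] p(1) \<pi>(1) by simp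
  have r': "r \<in> carrier (FOb R W)" using presD(2)[OF r] W by simp
  obtain y where y: "y \<in> carrier (FOb G W)" "\<pi> W y = r"
    using surj W r' unfolding pointwise_surj_def by blast
  obtain \<sigma> where \<sigma>: "nat_trans A R G \<sigma>" "\<sigma> W r = y"
    by (rule yoneda[OF W ad r fp_additive[OF \<pi>(2)] y(1)])
  have eq: "\<pi> X (\<sigma> X x) = x" if "X \<in> Ob A" "x \<in> carrier (FOb R X)" for X x
    by (rule nat_trans_eqI[OF r nat_trans_comp[OF \<sigma>(1) \<pi>(3)] nat_trans_ident _ that])
      (use W \<sigma>(2) y(2) in simp)
  show ?thesis by (rule X_retract[OF R _ \<sigma>(1) \<pi>(3) eq]) (use p(2) G_def in simp_all)
qed

lemma famD: "f \<in> fam \<Longrightarrow> f \<in> Mor A"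
  by (simp add: fam_def)

lemma famE:
  assumes "f \<in> fam"
  obtains F e where "F \<in> \<X>" "finitely_presented A F" "additive_functor A F" "pres A f F e"
proof -
  obtain F e where "F \<in> \<X>" "pres A f F e" using assms unfolding fam_def by blast
  then show ?thesis using that X_fp fp_additive by metis
qed

lemma fam_Zero:
  assumes "W \<in> Ob A" shows "Zero A W W \<in> fam"
proof -
  obtain R :: "('o, 'm, 'g) afun" and r where R: "finitely_presented A R" "additive_functor A R"
    "pres A (Zero A W W) R r" by (rule ex_representing[OF assms])
  then show ?thesis using X_representing[OF assms R(1,3)] assms unfolding fam_def by auto
qed

lemma fam_extension:
  assumes ses: "ses_arrows A f g h u v" and "f \<in> fam" "h \<in> fam"
  shows "g \<in> fam"
proof -
  obtain F eF where F: "F \<in> \<X>" "finitely_presented A F" "additive_functor A F" "pres A f F eF"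
    by (rule famE[OF assms(2)])
  obtain H eH where H: "H \<in> \<X>" "finitely_presented A H" "additive_functor A H" "pres A h H eH"
    by (rule famE[OF assms(3)])
  have g: "g \<in> Mor A" using ses by (simp add: ses_arrows_def)
  obtain G :: "('o, 'm, 'g) afun" and eG where G: "finitely_presented A G" "additive_functor A G" "pres A g G eG"
    by (rule ex_presented[OF g])
  obtain \<alpha> \<beta> where "left_exact A F G H \<alpha> \<beta>" "pointwise_surj A G H \<beta>"
    by (rule ses_of_arrows[OF ses F(3,4) G(2,3) H(3,4)])
  then have "G \<in> \<X>" using X_extension G(1) F(1) H(1) by blast
  then show ?thesis using g G(3) unfolding fam_def by blast
qed

lemma fam_kernel:
  assumes ses: "ses_arrows A f g h u v" and "g \<in> fam" "h \<in> fam"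
  shows "f \<in> fam"
proof -
  obtain G eG where G: "G \<in> \<X>" "finitely_presented A G" "additive_functor A G" "pres A g G eG"
    by (rule famE[OF assms(2)])
  obtain H eH where H: "H \<in> \<X>" "finitely_presented A H" "additive_functor A H" "pres A h H eH"
    by (rule famE[OF assms(3)])
  have f: "f \<in> Mor A" using ses by (simp add: ses_arrows_def)
  obtain F :: "('o, 'm, 'g) afun" and eF where F: "finitely_presented A F" "additive_functor A F" "pres A f F eF"
    by (rule ex_presented[OF f])
  obtain \<alpha> \<beta> where "left_exact A F G H \<alpha> \<beta>" "pointwise_surj A G H \<beta>"
    by (rule ses_of_arrows[OF ses F(2,3) G(3,4) H(3,4)])
  then have "F \<in> \<X>" using X_kernel F(1) G(1) H(1) by blast
  then show ?thesis using f F(3) unfolding fam_def by blast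
qed

text \<open>\<open>M\<^sub>f\<close> is a retract of \<open>M\<^sub>g \<oplus> Hom(-, Cod f)\<close>.\<close>

lemma X_stable_retract:
  assumes sr: "stable_retract A f g" and g: "g \<in> fam" and G: "finitely_presented A G" "pres A f G eG"
  shows "G \<in> \<X>"
proof -
  have f: "f \<in> Mor A" by (rule presD(1)[OF G(2)])
  have gM: "g \<in> Mor A" by (rule famD[OF g])
  note adG = fp_additive[OF G(1)] and eG = presD(2)[OF G(2)]
  obtain a b a' b' s where *:
    "a \<in> Mor A" "Dom A a = Dom A f" "Cod A a = Dom A g" "b \<in> Mor A" "Dom A b = Cod A f" "Cod A b = Cod A g"
    "a' \<in> Mor A" "Dom A a' = Dom A g" "Cod A a' = Dom A f" "b' \<in> Mor A" "Dom A b' = Cod A g" "Cod A b' = Cod A f"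
    "s \<in> Mor A" "Dom A s = Cod A f" "Cod A s = Dom A f"
    "b \<odot> f = g \<odot> a" "b' \<odot> g = f \<odot> a'" "b' \<odot> (b \<odot> f) = f \<oplus> f \<odot> (s \<odot> f)"
    by (rule stable_retractE[OF sr])
  obtain B where "is_biproduct A (Cod A g) (Cod A f) B" using biproducts[OF Cod_Ob[OF gM] Cod_Ob[OF f]] by blast
  then obtain i j p q where B: "B \<in> Ob A" "i \<in> Mor A" "Dom A i = Cod A g" "Cod A i = B"
      "j \<in> Mor A" "Dom A j = Cod A f" "Cod A j = B" "p \<in> Mor A" "Dom A p = B" "Cod A p = Cod A g"
      "q \<in> Mor A" "Dom A q = B" "Cod A q = Cod A f"
      "p \<odot> i = Id A (Cod A g)" "q \<odot> j = Id A (Cod A f)" "p \<odot> j = Zero A (Cod A f) (Cod A g)"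
      "q \<odot> i = Zero A (Cod A g) (Cod A f)" "(i \<odot> p) \<oplus> (j \<odot> q) = Id A B"
    by (rule biproductE)
  let ?Y = "Cod A f"
  have Y: "?Y \<in> Ob A" using f by simp
  have ig: "i \<odot> g \<in> Mor A" "Dom A (i \<odot> g) = Dom A g" "Cod A (i \<odot> g) = B" using B gM by simp_all
  \<comment> \<open>Since \<open>i\<close> is the inclusion of a summand, \<open>i g\<close>
    presents the direct sum of the functor of \<open>g\<close> and \<open>Hom(-, Cod f)\<close>. The
    sequence is the split one, with the zero arrow presenting the representable summand.\<close>
  have "ses_arrows A g (i \<odot> g) (Zero A ?Y ?Y) i q"
    unfolding ses_arrows_def
  proof (intro conjI ballI impI)
    show "\<exists>t \<in> homset A (Dom A g) (Dom A (i \<odot> g)). i \<odot> g = (i \<odot> g) \<odot> t"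
      using ig gM by (intro bexI[of _ "Id A (Dom A g)"]) (simp_all add: hom_iff)
    show "\<exists>t \<in> homset A (Dom A (i \<odot> g)) (Dom A (Zero A ?Y ?Y)). q \<odot> (i \<odot> g) = Zero A ?Y ?Y \<odot> t"
      using ig gM Y B(2,3,4) comp_reassoc[OF B(17), of g] B(11,12)
      by (intro bexI[of _ "Zero A (Dom A g) ?Y"]) (simp_all add: hom_iff)
    show "\<exists>t \<in> homset A (Cod A g) (Dom A (Zero A ?Y ?Y)). q \<odot> i = Zero A ?Y ?Y \<odot> t"
      using gM Y B(17) by (intro bexI[of _ "Zero A (Cod A g) ?Y"]) (simp_all add: hom_iff)
    fix x t assume x: "x \<in> Mor A" "Cod A x = Cod A g" "t \<in> homset A (Dom A x) (Dom A (i \<odot> g))"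
      "i \<odot> x = (i \<odot> g) \<odot> t"
    have t: "t \<in> Mor A" "Dom A t = Dom A x" "Cod A t = Dom A g" using x(3) ig by (simp_all add: hom_iff)
    have "p \<odot> (i \<odot> x) = p \<odot> (i \<odot> (g \<odot> t))" using x(4) t gM B(2-4) by (simp add: assoc)
    then have "g \<odot> t = x"
      using comp_reassoc[OF B(14), of x] comp_reassoc[OF B(14), of "g \<odot> t"] x(1,2) t gM B(2-4,8-10) by simp
    then show "\<exists>t \<in> homset A (Dom A x) (Dom A g). g \<odot> t = x" using t by (auto simp: hom_iff)
  next
    fix x t assume x: "x \<in> Mor A" "Cod A x = Cod A (i \<odot> g)" "t \<in> homset A (Dom A x) (Dom A (Zero A ?Y ?Y))"
      "q \<odot> x = Zero A ?Y ?Y \<odot> t"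
    have cx: "Cod A x = B" using x(2) ig by simp
    have qx: "q \<odot> x = Zero A (Dom A x) ?Y" unfolding x(4) using x(3) Y by (simp add: hom_iff)
    have "x = (i \<odot> p \<oplus> j \<odot> q) \<odot> x" unfolding B(18) using x(1) cx by simp
    also have "\<dots> = i \<odot> (p \<odot> x) \<oplus> j \<odot> (q \<odot> x)" using x(1) cx B(2-13) by (simp add: assoc)
    also have "\<dots> = i \<odot> (p \<odot> x) \<oplus> (i \<odot> g) \<odot> Zero A (Dom A x) (Dom A g)"
      unfolding qx using x(1) cx B(2-13) ig gM by simp
    finally show "\<exists>y \<in> homset A (Dom A x) (Cod A g). \<exists>t \<in> homset A (Dom A x) (Dom A (i \<odot> g)). x = i \<odot> y \<oplus> (i \<odot> g) \<odot> t"
      using x(1) cx B(8-10) ig gM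
      by (intro bexI[of _ "p \<odot> x"] bexI[of _ "Zero A (Dom A x) (Dom A g)"]) (simp_all add: hom_iff)
  next
    show "\<exists>w \<in> homset A (Cod A (Zero A ?Y ?Y)) (Cod A (i \<odot> g)).
        \<exists>t \<in> homset A (Cod A (Zero A ?Y ?Y)) (Dom A (Zero A ?Y ?Y)). q \<odot> w \<oplus> Zero A ?Y ?Y \<odot> t = Id A (Cod A (Zero A ?Y ?Y))"
      using B(5-7,15) ig Y by (intro bexI[of _ j] bexI[of _ "Zero A ?Y ?Y"]) (simp_all add: hom_iff)
  qed (use B gM ig Y in \<open>simp_all add: hom_iff\<close>)
  then have "i \<odot> g \<in> fam" using fam_extension g fam_Zero[OF Y] by blast
  then obtain S eS where S: "S \<in> \<X>" "finitely_presented A S" "additive_functor A S" "pres A (i \<odot> g) S eS"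
    by (rule famE)
  have eS: "eS \<in> carrier (FOb S B)" using presD(2)[OF S(4)] ig by simp
  \<comment> \<open>The defining equation of a stable retract says \<open>n f = 0\<close>. So
    \<open>n\<close> gives a map from the functor of \<open>f\<close> to
    \<open>Hom(-, Cod f)\<close>, and this map carries the difference between the identity and
    \<open>b' b\<close>.\<close>
  define n where "n = (Id A ?Y \<oplus> f \<odot> s) \<oplus> neg A (b' \<odot> b)"
  have n: "n \<in> Mor A" "Dom A n = ?Y" "Cod A n = ?Y" using * f by (simp_all add: n_def)
  have nf: "n \<odot> f = Zero A (Dom A f) ?Y"
  proof -
    have "n \<odot> f = (f \<oplus> f \<odot> (s \<odot> f)) \<oplus> neg A (b' \<odot> (b \<odot> f))"
      using *(1-15) f by (simp add: n_def assoc)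
    then show ?thesis unfolding *(18) using *(13-15) f by simp
  qed
  \<comment> \<open>As maps to and from the biproduct, \<open>k\<close> is the column
    \<open>(b, n)\<close> and \<open>l\<close> the row \<open>(b', 1)\<close>. Their composite
    \<open>b' b + n = 1 + f s\<close> acts as the identity on the functor presented by
    \<open>f\<close>.\<close>
  define k where "k = i \<odot> b \<oplus> j \<odot> n"
  define l where "l = b' \<odot> p \<oplus> q"
  have k: "k \<in> Mor A" "Dom A k = ?Y" "Cod A k = B" using * B n by (simp_all add: k_def)
  have l: "l \<in> Mor A" "Dom A l = B" "Cod A l = ?Y" using * B by (simp_all add: l_def)
  have kf: "k \<odot> f = (i \<odot> g) \<odot> a"
    using *(1-6,16) B(2-7) n nf f gM by (simp add: k_def assoc)
  have lig: "l \<odot> (i \<odot> g) = f \<odot> a'"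
  proof -
    have "l \<odot> (i \<odot> g) = b' \<odot> (p \<odot> (i \<odot> g)) \<oplus> q \<odot> (i \<odot> g)"
      using *(10-12) B(2-4,8-13) gM by (simp add: l_def assoc)
    also have "\<dots> = f \<odot> a'"
      using comp_reassoc[OF B(14), of g] comp_reassoc[OF B(17), of g] *(7-12,17) B(2-4,8-13) gM f by simp
    finally show ?thesis .
  qed
  have lk: "l \<odot> k = Id A ?Y \<oplus> f \<odot> s"
  proof -
    have pk: "p \<odot> k = b"
      using comp_reassoc[OF B(14), of b] comp_reassoc[OF B(16), of n] *(4-6) B(2-10) n gM by (simp add: k_def)
    have qk: "q \<odot> k = n"
      using comp_reassoc[OF B(17), of b] comp_reassoc[OF B(15), of n] *(4-6) B(2-7,11-13) n f by (simp add: k_def)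
    have "l \<odot> k = b' \<odot> (p \<odot> k) \<oplus> q \<odot> k" using *(10-12) B(8-13) k by (simp add: l_def assoc)
    also have "\<dots> = b' \<odot> b \<oplus> n" unfolding pk qk ..
    also have "\<dots> = n \<oplus> b' \<odot> b" by (rule Add_comm) (use *(4-6,10-12) n in simp_all)
    also have "\<dots> = Id A ?Y \<oplus> f \<odot> s" unfolding n_def using *(4-6,10-15) f by simp
    finally show ?thesis .
  qed
  have "FMor S f (FMor S k eS) = FMor S (k \<odot> f) eS" using k f eS by (simp add: af_Cmp[OF S(3)])
  also have "\<dots> = \<one>\<^bsub>FOb S (Dom A f)\<^esub>"
    unfolding kf using pres_Cmp[OF S(3,4), of a] *(1-3) ig by simp
  finally obtain \<sigma> where \<sigma>: "nat_trans A G S \<sigma>" "\<sigma> ?Y eG = FMor S k eS"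
    by (rule induced_nat_trans[OF adG S(3) G(2), rotated]) (use k eS in \<open>simp_all add: af_closed[OF S(3)]\<close>)
  have "FMor G (i \<odot> g) (FMor G l eG) = FMor G (l \<odot> (i \<odot> g)) eG" using l ig eG by (simp add: af_Cmp[OF adG])
  also have "\<dots> = \<one>\<^bsub>FOb G (Dom A (i \<odot> g))\<^esub>"
    unfolding lig ig(2) using pres_Cmp[OF adG G(2), of a'] *(7-9) by simp
  finally obtain \<rho> where \<rho>: "nat_trans A S G \<rho>" "\<rho> (Cod A (i \<odot> g)) eS = FMor G l eG"
    by (rule induced_nat_trans[OF S(3) adG S(4), rotated]) (use l ig eG in \<open>simp_all add: af_closed[OF adG]\<close>)
  have \<rho>e: "\<rho> B eS = FMor G l eG" using \<rho>(2) ig by simp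
  have "\<rho> ?Y (\<sigma> ?Y eG) = FMor G k (FMor G l eG)"
    using \<sigma>(2) nt_nat[OF \<rho>(1) k(1,2), of eS] k(3) eS \<rho>e by simp
  also have "\<dots> = FMor G (Id A ?Y \<oplus> f \<odot> s) eG" using k l eG af_Cmp[OF adG k(1) l(1), of eG] lk by simp
  also have "\<dots> = eG \<otimes>\<^bsub>FOb G ?Y\<^esub> \<one>\<^bsub>FOb G ?Y\<^esub>"
    using f *(13-15) eG Y pres_Cmp[OF adG G(2), of s] by (subst af_Add[OF adG]) (simp_all add: af_Id[OF adG])
  also have "\<dots> = eG" by (rule monoid.r_one[OF af_monoid[OF adG Y] eG])
  finally have "\<rho> ?Y (\<sigma> ?Y eG) = eG" .
  then have "\<rho> W (\<sigma> W x) = x" if "W \<in> Ob A" "x \<in> carrier (FOb G W)" for W x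
    using nat_trans_eqI[OF G(2) nat_trans_comp[OF \<sigma>(1) \<rho>(1)] nat_trans_ident _ that] by simp
  then show ?thesis by (rule X_retract[OF G(1) S(1) \<sigma>(1) \<rho>(1)])
qed

lemma fam_stable_retract:
  assumes "stable_retract A f g" "g \<in> fam" "f \<in> Mor A" shows "f \<in> fam"
proof -
  obtain G :: "('o, 'm, 'g) afun" and eG where G: "finitely_presented A G" "additive_functor A G" "pres A f G eG"
    by (rule ex_presented[OF assms(3)])
  then show ?thesis using X_stable_retract[OF assms(1,2) G(1,3)] assms(3) unfolding fam_def by blast
qed

lemma fam_iff:
  assumes "finitely_presented A F" "pres A f F e" shows "F \<in> \<X> \<longleftrightarrow> f \<in> fam"
  using X_stable_retract[OF stable_retract_refl _ assms] presD(1)[OF assms(2)] assms(2)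
  unfolding fam_def by blast

end

section \<open>Closure properties of the arrows of a resolving subcategory\<close>

context resolving_subcategory
begin

text \<open>The identity presents the zero functor, a retract of any other. With the four connecting
  maps zero the condition reads \<open>0 = f + f s f\<close> for \<open>f\<close> the identity,
  whence the choice \<open>s = -1\<close>.\<close>

lemma fam_Id: assumes "X \<in> Ob A" shows "Id A X \<in> fam"
proof (rule fam_stable_retract[OF _ fam_Zero[OF assms]])
  show "stable_retract A (Id A X) (Zero A X X)"
    by (rule stable_retractI[of "Zero A X X" _ _ "Zero A X X" "Zero A X X" "Zero A X X" "neg A (Id A X)"])
      (use assms in simp_all)
qed (use assms in simp)

text \<open>What \<open>k\<close> presents is the image of \<open>Hom(-, f)\<close>, that is, the
  first syzygy of the functor of \<open>f\<close>: the kernel of its projection from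
  \<open>Hom(-, Cod f)\<close>.\<close>

lemma fam_ker:
  assumes k: "is_kernel A k f" and f: "f \<in> fam" shows "k \<in> fam"
proof -
  note K = is_kernelD[OF k]
  let ?Y = "Cod A f"
  have Y: "?Y \<in> Ob A" using K by simp
  have "ses_arrows A k (Zero A ?Y ?Y) f f (Id A ?Y)" unfolding ses_arrows_def
  proof (intro conjI ballI impI)
    show "\<exists>t \<in> homset A (Dom A k) (Dom A (Zero A ?Y ?Y)). f \<odot> k = Zero A ?Y ?Y \<odot> t"
      using K Y by (intro bexI[of _ "Zero A (Dom A k) ?Y"]) (simp_all add: hom_iff)
    show "\<exists>t \<in> homset A (Dom A (Zero A ?Y ?Y)) (Dom A f). Id A ?Y \<odot> Zero A ?Y ?Y = f \<odot> t"
      using K Y by (intro bexI[of _ "Zero A ?Y (Dom A f)"]) (simp_all add: hom_iff)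
    show "\<exists>t \<in> homset A (Cod A k) (Dom A f). Id A ?Y \<odot> f = f \<odot> t"
      using K by (intro bexI[of _ "Id A (Dom A f)"]) (simp_all add: hom_iff)
    fix x s assume x: "x \<in> Mor A" "Cod A x = Cod A k" "s \<in> homset A (Dom A x) (Dom A (Zero A ?Y ?Y))"
      "f \<odot> x = Zero A ?Y ?Y \<odot> s"
    have "f \<odot> x = Zero A (Dom A x) ?Y" unfolding x(4) using x(3) Y by (simp add: hom_iff)
    then show "\<exists>t \<in> homset A (Dom A x) (Dom A k). k \<odot> t = x" using is_kernel_ex[OF k x(1)] x(2) K(3) by simp
  next
    fix x s assume x: "x \<in> Mor A" "Cod A x = Cod A (Zero A ?Y ?Y)" "s \<in> homset A (Dom A x) (Dom A f)"
      "Id A ?Y \<odot> x = f \<odot> s"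
    have s: "s \<in> Mor A" "Dom A s = Dom A x" "Cod A s = Dom A f" using x(3) by (simp_all add: hom_iff)
    have "f \<odot> s \<oplus> Zero A ?Y ?Y \<odot> Zero A (Dom A x) ?Y = f \<odot> s" using s K(2) Y x(1) by simp
    also have "\<dots> = x" unfolding x(4)[symmetric] using x(1,2) Y by simp
    finally have eq: "x = f \<odot> s \<oplus> Zero A ?Y ?Y \<odot> Zero A (Dom A x) ?Y" by (rule sym)
    show "\<exists>y \<in> homset A (Dom A x) (Cod A k). \<exists>t \<in> homset A (Dom A x) (Dom A (Zero A ?Y ?Y)).
        x = f \<odot> y \<oplus> Zero A ?Y ?Y \<odot> t"
      by (rule bexI, rule bexI, rule eq) (use s x(1) K Y in \<open>simp_all add: hom_iff\<close>)
  next
    show "\<exists>w \<in> homset A (Cod A f) (Cod A (Zero A ?Y ?Y)). \<exists>t \<in> homset A (Cod A f) (Dom A f).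
        Id A ?Y \<odot> w \<oplus> f \<odot> t = Id A (Cod A f)"
      using K Y by (intro bexI[of _ "Id A ?Y"] bexI[of _ "Zero A ?Y (Dom A f)"]) (simp_all add: hom_iff)
  qed (use K Y in \<open>simp_all add: hom_iff\<close>)
  then show ?thesis by (rule fam_kernel[OF _ fam_Zero[OF Y] f])
qed

text \<open>As \<open>Hom(-, i)\<close> is injective, its image modulo that of
  \<open>Hom(-, i p)\<close> is the functor of \<open>p\<close>. Hence the functor of
  \<open>i p\<close> is an extension of the functor of \<open>i\<close> by that of
  \<open>p\<close>.\<close>

lemma fam_comp:
  assumes p: "p \<in> fam" and i: "i \<in> fam" "mono_arrow A i" and pi: "Cod A p = Dom A i"
  shows "i \<odot> p \<in> fam"
proof -
  have ty: "p \<in> Mor A" "i \<in> Mor A" using p i famD by auto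
  have "ses_arrows A p (i \<odot> p) i i (Id A (Cod A i))" unfolding ses_arrows_def
  proof (intro conjI ballI impI)
    show "\<exists>t \<in> homset A (Dom A p) (Dom A (i \<odot> p)). i \<odot> p = (i \<odot> p) \<odot> t"
      using ty pi by (intro bexI[of _ "Id A (Dom A p)"]) (simp_all add: hom_iff)
    show "\<exists>t \<in> homset A (Dom A (i \<odot> p)) (Dom A i). Id A (Cod A i) \<odot> (i \<odot> p) = i \<odot> t"
      using ty pi by (intro bexI[of _ p]) (simp_all add: hom_iff)
    show "\<exists>t \<in> homset A (Cod A p) (Dom A i). Id A (Cod A i) \<odot> i = i \<odot> t"
      using ty pi by (intro bexI[of _ "Id A (Dom A i)"]) (simp_all add: hom_iff)
    fix x s assume x: "x \<in> Mor A" "Cod A x = Cod A p" "s \<in> homset A (Dom A x) (Dom A (i \<odot> p))"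
      "i \<odot> x = (i \<odot> p) \<odot> s"
    have s: "s \<in> Mor A" "Dom A s = Dom A x" "Cod A s = Dom A p" using x(3) ty pi by (simp_all add: hom_iff)
    have "p \<odot> s = x"
      using monoD[OF i(2), of "p \<odot> s" x] x(1,2,4) s ty pi by (simp add: assoc)
    then show "\<exists>t \<in> homset A (Dom A x) (Dom A p). p \<odot> t = x" using s by (auto simp: hom_iff)
  next
    fix x s assume x: "x \<in> Mor A" "Cod A x = Cod A (i \<odot> p)" "s \<in> homset A (Dom A x) (Dom A i)"
      "Id A (Cod A i) \<odot> x = i \<odot> s"
    have s: "s \<in> Mor A" "Dom A s = Dom A x" "Cod A s = Dom A i" using x(3) by (simp_all add: hom_iff)
    have "i \<odot> s \<oplus> (i \<odot> p) \<odot> Zero A (Dom A x) (Dom A p) = i \<odot> s" using s ty pi x(1) by simp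
    also have "\<dots> = x" unfolding x(4)[symmetric] using x(1,2) ty pi by simp
    finally have eq: "x = i \<odot> s \<oplus> (i \<odot> p) \<odot> Zero A (Dom A x) (Dom A p)" by (rule sym)
    show "\<exists>y \<in> homset A (Dom A x) (Cod A p). \<exists>t \<in> homset A (Dom A x) (Dom A (i \<odot> p)).
        x = i \<odot> y \<oplus> (i \<odot> p) \<odot> t"
      by (rule bexI, rule bexI, rule eq) (use s x(1) ty pi in \<open>simp_all add: hom_iff\<close>)
  next
    show "\<exists>w \<in> homset A (Cod A i) (Cod A (i \<odot> p)). \<exists>t \<in> homset A (Cod A i) (Dom A i).
        Id A (Cod A i) \<odot> w \<oplus> i \<odot> t = Id A (Cod A i)"
      using ty pi by (intro bexI[of _ "Id A (Cod A i)"] bexI[of _ "Zero A (Cod A i) (Dom A i)"])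
        (simp_all add: hom_iff)
  qed (use ty pi in \<open>simp_all add: hom_iff\<close>)
  then show ?thesis by (rule fam_extension[OF _ p i(1)])
qed

text \<open>\<open>M\<^sub>i\<close> is a retract of \<open>M\<close> of \<open>(i, j i)\<close>, which is an extension of \<open>M\<close> of \<open>j i\<close> by a
  representable functor.\<close>

lemma fam_left_cancel:
  assumes ij: "i \<in> Mor A" "j \<in> Mor A" "Cod A i = Dom A j" and mono: "mono_arrow A (j \<odot> i)" and ji: "j \<odot> i \<in> fam"
  shows "i \<in> fam"
proof -
  let ?Y = "Cod A i" and ?Z = "Cod A j"
  have Ob: "?Y \<in> Ob A" "?Z \<in> Ob A" "Dom A i \<in> Ob A" using ij by simp_all
  obtain B where "is_biproduct A ?Y ?Z B" using biproducts[OF Ob(1,2)] by blast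
  then obtain k l p q where B: "B \<in> Ob A" "k \<in> Mor A" "Dom A k = ?Y" "Cod A k = B"
      "l \<in> Mor A" "Dom A l = ?Z" "Cod A l = B" "p \<in> Mor A" "Dom A p = B" "Cod A p = ?Y"
      "q \<in> Mor A" "Dom A q = B" "Cod A q = ?Z"
      "p \<odot> k = Id A ?Y" "q \<odot> l = Id A ?Z" "p \<odot> l = Zero A ?Z ?Y"
      "q \<odot> k = Zero A ?Y ?Z" "(k \<odot> p) \<oplus> (l \<odot> q) = Id A B"
    by (rule biproductE)
  \<comment> \<open>With components \<open>1\<close> and \<open>j\<close>, this \<open>b\<close>
    makes \<open>g = b i\<close> the arrow with components \<open>i\<close> and \<open>j i\<close>.
    The projection \<open>p\<close> splits \<open>b\<close>, and this is how the functor of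
    \<open>i\<close> becomes a retract of that of \<open>g\<close>.\<close>
  define b where "b = k \<oplus> l \<odot> j"
  define g where "g = b \<odot> i"
  have b: "b \<in> Mor A" "Dom A b = ?Y" "Cod A b = B" using B ij by (simp_all add: b_def)
  have g: "g \<in> Mor A" "Dom A g = Dom A i" "Cod A g = B" using b ij by (simp_all add: g_def)
  have pb: "p \<odot> b = Id A ?Y"
    using comp_reassoc[OF B(16), of j] B(2-10,14) ij by (simp add: b_def)
  have qb: "q \<odot> b = j"
    using comp_reassoc[OF B(15), of j] B(2-7,11-13,17) ij by (simp add: b_def)
  have pg: "p \<odot> g = i" using comp_reassoc[OF pb, of i] b B(8-10) ij by (simp add: g_def)
  have qg: "q \<odot> g = j \<odot> i" using comp_reassoc[OF qb, of i] b B(11-13) ij by (simp add: g_def)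
  have dec: "x = k \<odot> (p \<odot> x) \<oplus> l \<odot> (q \<odot> x)" if "x \<in> Mor A" "Cod A x = B" for x
  proof -
    have "x = (k \<odot> p \<oplus> l \<odot> q) \<odot> x" unfolding B(18) using that by simp
    also have "\<dots> = k \<odot> (p \<odot> x) \<oplus> l \<odot> (q \<odot> x)" using that B(2-13) by (simp add: assoc)
    finally show ?thesis .
  qed
  have "ses_arrows A (Zero A ?Y ?Y) g (j \<odot> i) k q" unfolding ses_arrows_def
  proof (intro conjI ballI impI)
    show "\<exists>t \<in> homset A (Dom A (Zero A ?Y ?Y)) (Dom A g). k \<odot> Zero A ?Y ?Y = g \<odot> t"
      using B(2-4) g Ob by (intro bexI[of _ "Zero A ?Y (Dom A i)"]) (simp_all add: hom_iff)
    show "\<exists>t \<in> homset A (Dom A g) (Dom A (j \<odot> i)). q \<odot> g = (j \<odot> i) \<odot> t"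
      using qg g ij by (intro bexI[of _ "Id A (Dom A i)"]) (simp_all add: hom_iff)
    show "\<exists>t \<in> homset A (Cod A (Zero A ?Y ?Y)) (Dom A (j \<odot> i)). q \<odot> k = (j \<odot> i) \<odot> t"
      using B(17) ij Ob by (intro bexI[of _ "Zero A ?Y (Dom A i)"]) (simp_all add: hom_iff)
    fix x s assume x: "x \<in> Mor A" "Cod A x = Cod A (Zero A ?Y ?Y)" "s \<in> homset A (Dom A x) (Dom A g)"
      "k \<odot> x = g \<odot> s"
    have s: "s \<in> Mor A" "Dom A s = Dom A x" "Cod A s = Dom A i" using x(3) g by (simp_all add: hom_iff)
    have cx: "Cod A x = ?Y" using x(2) Ob by simp
    have "(j \<odot> i) \<odot> s = q \<odot> (g \<odot> s)" using comp_reassoc[OF qg, of s] s g B(11-13) by simp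
    also have "\<dots> = q \<odot> (k \<odot> x)" using x(4) by simp
    also have "\<dots> = Zero A (Dom A s) ?Z"
      using comp_reassoc[OF B(17), of x] x(1) cx B(2-4,11-13) s Ob by simp
    \<comment> \<open>Here it matters that \<open>j i\<close> is mono: an element of the
      representable subfunctor that equals a relation \<open>g s\<close> satisfies
      \<open>j i s = 0\<close>, so \<open>s = 0\<close>.\<close>
    finally have s0: "s = Zero A (Dom A s) (Dom A (j \<odot> i))"
      using mono_zero[OF mono, of s] s ij by simp
    have "k \<odot> x = g \<odot> Zero A (Dom A x) (Dom A i)" unfolding x(4) using s0 s ij by simp
    then have "k \<odot> x = Zero A (Dom A x) B" using g x(1) by simp
    then have "p \<odot> (k \<odot> x) = Zero A (Dom A x) ?Y" using B(8-10) x(1) by simp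
    then have "x = Zero A (Dom A x) ?Y" using comp_reassoc[OF B(14), of x] x(1) cx B(2-4,8-10) by simp
    moreover have "Zero A ?Y ?Y \<odot> Zero A (Dom A x) ?Y = Zero A (Dom A x) ?Y" using Ob x(1) by simp
    ultimately have "Zero A ?Y ?Y \<odot> Zero A (Dom A x) ?Y = x" by (rule trans[rotated, OF sym])
    then show "\<exists>t \<in> homset A (Dom A x) (Dom A (Zero A ?Y ?Y)). Zero A ?Y ?Y \<odot> t = x"
      by (rule bexI) (use Ob x(1) in \<open>simp add: hom_iff\<close>)
  next
    fix x s assume x: "x \<in> Mor A" "Cod A x = Cod A g" "s \<in> homset A (Dom A x) (Dom A (j \<odot> i))"
      "q \<odot> x = (j \<odot> i) \<odot> s"
    have s: "s \<in> Mor A" "Dom A s = Dom A x" "Cod A s = Dom A i" using x(3) ij by (simp_all add: hom_iff)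
    have cx: "Cod A x = B" using x(2) g by simp
    have gs: "g \<odot> s = k \<odot> (i \<odot> s) \<oplus> l \<odot> (q \<odot> x)"
    proof -
      have "g \<odot> s = k \<odot> (p \<odot> (g \<odot> s)) \<oplus> l \<odot> (q \<odot> (g \<odot> s))" by (rule dec) (use s g in simp_all)
      moreover have "p \<odot> (g \<odot> s) = i \<odot> s" "q \<odot> (g \<odot> s) = q \<odot> x"
        using comp_reassoc[OF pg, of s] comp_reassoc[OF qg, of s] x(4) s g B(8-13) by simp_all
      ultimately show ?thesis by simp
    qed
    \<comment> \<open>In the second component \<open>x\<close> and \<open>g s\<close> agree, so
      their difference lies in the first summand, where it is \<open>y\<close>.\<close>
    define y where "y = p \<odot> x \<oplus> neg A (i \<odot> s)"
    have y: "y \<in> Mor A" "Dom A y = Dom A x" "Cod A y = ?Y" using s ij x(1) cx B(8-10) by (simp_all add: y_def)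
    have "k \<odot> y \<oplus> g \<odot> s = (k \<odot> y \<oplus> k \<odot> (i \<odot> s)) \<oplus> l \<odot> (q \<odot> x)"
      unfolding gs using y s ij x(1) cx B(2-13) by (simp add: Add_assoc)
    also have "k \<odot> y \<oplus> k \<odot> (i \<odot> s) = k \<odot> (p \<odot> x)"
      using s ij x(1) cx B(2-10) by (simp add: y_def)
    also have "k \<odot> (p \<odot> x) \<oplus> l \<odot> (q \<odot> x) = x" by (rule dec[OF x(1) cx, symmetric])
    finally have eq: "x = k \<odot> y \<oplus> g \<odot> s" by (rule sym)
    show "\<exists>y \<in> homset A (Dom A x) (Cod A (Zero A ?Y ?Y)). \<exists>t \<in> homset A (Dom A x) (Dom A g). x = k \<odot> y \<oplus> g \<odot> t"
      by (rule bexI, rule bexI, rule eq) (use y s g Ob in \<open>simp_all add: hom_iff\<close>)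
  next
    show "\<exists>w \<in> homset A (Cod A (j \<odot> i)) (Cod A g). \<exists>t \<in> homset A (Cod A (j \<odot> i)) (Dom A (j \<odot> i)).
        q \<odot> w \<oplus> (j \<odot> i) \<odot> t = Id A (Cod A (j \<odot> i))"
      using B(5-7,15) g ij Ob by (intro bexI[of _ l] bexI[of _ "Zero A ?Z (Dom A i)"]) (simp_all add: hom_iff)
  qed (use B g ij Ob in \<open>simp_all add: hom_iff\<close>)
  then have "g \<in> fam" by (rule fam_extension[OF _ fam_Zero[OF Ob(1)] ji])
  moreover have "stable_retract A i g"
    by (rule stable_retractI[of "Id A (Dom A i)" _ _ b "Id A (Dom A i)" p "Zero A ?Y (Dom A i)"])
      (use b g B(8-10) ij Ob pg in \<open>simp_all add: g_def[symmetric]\<close>)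
  ultimately show ?thesis using fam_stable_retract ij(1) by blast
qed

text \<open>The kernel of \<open>M\<close> of \<open>q p\<close> onto \<open>M\<^sub>q\<close> is \<open>M\<close> of \<open>(p, ker q)\<close>.\<close>

lemma fam_comp_epi:
  assumes cancel: "\<And>g h. g \<in> Mor A \<Longrightarrow> h \<in> Mor A \<Longrightarrow> Cod A h = Dom A g \<Longrightarrow> epi_arrow A (g \<odot> h) \<Longrightarrow>
      g \<odot> h \<in> fam \<Longrightarrow> g \<in> fam"
    and p: "p \<in> fam" "epi_arrow A p" and q: "q \<in> fam" and pq: "Cod A p = Dom A q"
  shows "q \<odot> p \<in> fam"
proof -
  have ty: "p \<in> Mor A" "q \<in> Mor A" using p q famD by auto
  obtain k where k: "is_kernel A k q" using kernels ty by blast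
  note K = is_kernelD[OF k]
  obtain B where "is_biproduct A (Dom A p) (Dom A k) B" using biproducts ty K(1) Dom_Ob by metis
  then obtain i j r s where B: "B \<in> Ob A" "i \<in> Mor A" "Dom A i = Dom A p" "Cod A i = B"
      "j \<in> Mor A" "Dom A j = Dom A k" "Cod A j = B" "r \<in> Mor A" "Dom A r = B" "Cod A r = Dom A p"
      "s \<in> Mor A" "Dom A s = B" "Cod A s = Dom A k"
      "r \<odot> i = Id A (Dom A p)" "s \<odot> j = Id A (Dom A k)" "r \<odot> j = Zero A (Dom A k) (Dom A p)"
      "s \<odot> i = Zero A (Dom A p) (Dom A k)" "(i \<odot> r) \<oplus> (j \<odot> s) = Id A B"
    by (rule biproductE)
  define m where "m = p \<odot> r \<oplus> k \<odot> s"
  have m: "m \<in> Mor A" "Dom A m = B" "Cod A m = Cod A p" using B ty K pq by (simp_all add: m_def)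
  have mi: "m \<odot> i = p" "m \<odot> j = k" using B ty K pq by (simp_all add: m_def assoc)
  \<comment> \<open>The arrow \<open>p = m i\<close> is epi and lies in \<open>fam\<close>. Right
    cancellation is taken as a hypothesis because it is the dual of \<open>fam_left_cancel\<close>
    and has to come from the opposite category.\<close>
  have "m \<in> fam" using cancel[of m i] mi(1) m B(2-4) p by simp
  moreover have "ses_arrows A m (q \<odot> p) q q (Id A (Cod A q))" unfolding ses_arrows_def
  proof (intro conjI ballI impI)
    have "q \<odot> m = (q \<odot> p) \<odot> r"
      using comp_reassoc[OF K(4), of s] ty K pq B(8-13) by (simp add: m_def assoc)
    then show "\<exists>t \<in> homset A (Dom A m) (Dom A (q \<odot> p)). q \<odot> m = (q \<odot> p) \<odot> t"
      using ty pq m B(8-10) by (intro bexI[of _ r]) (simp_all add: hom_iff)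
    show "\<exists>t \<in> homset A (Dom A (q \<odot> p)) (Dom A q). Id A (Cod A q) \<odot> (q \<odot> p) = q \<odot> t"
      using ty pq by (intro bexI[of _ p]) (simp_all add: hom_iff)
    show "\<exists>t \<in> homset A (Cod A m) (Dom A q). Id A (Cod A q) \<odot> q = q \<odot> t"
      using ty pq m by (intro bexI[of _ "Id A (Dom A q)"]) (simp_all add: hom_iff)
    fix x t assume x: "x \<in> Mor A" "Cod A x = Cod A m" "t \<in> homset A (Dom A x) (Dom A (q \<odot> p))"
      "q \<odot> x = (q \<odot> p) \<odot> t"
    have t: "t \<in> Mor A" "Dom A t = Dom A x" "Cod A t = Dom A p" using x(3) ty pq by (simp_all add: hom_iff)
    have cx: "Cod A x = Cod A p" using x(2) m by simp
    \<comment> \<open>The difference of \<open>x\<close> and \<open>p t\<close> is killed by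
      \<open>q\<close>, so it comes from the kernel \<open>k\<close>; together with \<open>t\<close>
      this gives a factorization of \<open>x\<close> through \<open>m\<close>.\<close>
    define y where "y = x \<oplus> neg A (p \<odot> t)"
    have y: "y \<in> Mor A" "Dom A y = Dom A x" "Cod A y = Dom A q" using x(1) cx t ty pq by (simp_all add: y_def)
    have "q \<odot> y = q \<odot> x \<oplus> neg A ((q \<odot> p) \<odot> t)" using x(1) cx t ty pq by (simp add: y_def assoc)
    also have "\<dots> = Zero A (Dom A y) (Cod A q)" unfolding x(4) using t ty pq y(2) by simp
    finally obtain z where z: "z \<in> Mor A" "Dom A z = Dom A y" "Cod A z = Dom A k" "k \<odot> z = y"
      by (rule is_kernel_lift[OF k y(1,3)])
    have "m \<odot> (i \<odot> t \<oplus> j \<odot> z) = p \<odot> t \<oplus> y"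
      using comp_reassoc[OF mi(1), of t] comp_reassoc[OF mi(2), of z] m B(2-7) t z y(2) by simp
    also have "\<dots> = y \<oplus> p \<odot> t" by (rule Add_comm) (use y t ty pq in simp_all)
    also have "\<dots> = x" using x(1) cx t ty pq by (simp add: y_def)
    finally show "\<exists>t \<in> homset A (Dom A x) (Dom A m). m \<odot> t = x"
      using m B(2-7) t z y(2) by (intro bexI[of _ "i \<odot> t \<oplus> j \<odot> z"]) (simp_all add: hom_iff)
  next
    fix x t assume x: "x \<in> Mor A" "Cod A x = Cod A (q \<odot> p)" "t \<in> homset A (Dom A x) (Dom A q)"
      "Id A (Cod A q) \<odot> x = q \<odot> t"
    have t: "t \<in> Mor A" "Dom A t = Dom A x" "Cod A t = Dom A q" using x(3) by (simp_all add: hom_iff)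
    have "q \<odot> t \<oplus> (q \<odot> p) \<odot> Zero A (Dom A x) (Dom A p) = q \<odot> t" using t ty pq x(1) by simp
    also have "\<dots> = x" unfolding x(4)[symmetric] using x(1,2) ty pq by simp
    finally have eq: "x = q \<odot> t \<oplus> (q \<odot> p) \<odot> Zero A (Dom A x) (Dom A p)" by (rule sym)
    show "\<exists>y \<in> homset A (Dom A x) (Cod A m). \<exists>t \<in> homset A (Dom A x) (Dom A (q \<odot> p)).
        x = q \<odot> y \<oplus> (q \<odot> p) \<odot> t"
      by (rule bexI, rule bexI, rule eq) (use t x(1) ty pq m in \<open>simp_all add: hom_iff\<close>)
  next
    show "\<exists>w \<in> homset A (Cod A q) (Cod A (q \<odot> p)). \<exists>t \<in> homset A (Cod A q) (Dom A q).
        Id A (Cod A q) \<odot> w \<oplus> q \<odot> t = Id A (Cod A q)"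
      using ty pq by (intro bexI[of _ "Id A (Cod A q)"] bexI[of _ "Zero A (Cod A q) (Dom A q)"])
        (simp_all add: hom_iff)
  qed (use ty pq m in \<open>simp_all add: hom_iff\<close>)
  ultimately show ?thesis using fam_extension q by blast
qed

end

lemma (in preadditive_category) iso_inverseE:
  assumes "iso_arrow C a"
  obtains a' where "a' \<in> Mor C" "Dom C a' = Cod C a" "Cod C a' = Dom C a" "a' \<odot> a = Id C (Dom C a)"
    "a \<odot> a' = Id C (Cod C a)" "iso_arrow C a'"
proof -
  obtain a' where *: "a' \<in> homset C (Cod C a) (Dom C a)" "a' \<odot> a = Id C (Dom C a)" "a \<odot> a' = Id C (Cod C a)"
    and "a \<in> Mor C" using assms unfolding iso_arrow_def by blast
  then have "iso_arrow C a'" unfolding iso_arrow_def by (intro conjI bexI[of _ a]) (simp_all add: hom_iff)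
  then show ?thesis by (intro that[of a']) (use * in \<open>simp_all add: hom_iff\<close>)
qed

section \<open>Exact structures from classes of arrows\<close>

text \<open>The conditions are self-dual or come in dual pairs, so \<open>\<F>\<close> satisfies
  them in \<open>opcat A\<close> as well and only one half of the axioms of an exact structure needs
  an argument.\<close>

locale exact_class = abelian_category A for A :: "('o, 'm) acat" +
  fixes \<F> :: "'m set"
  assumes F_Mor: "f \<in> \<F> \<Longrightarrow> f \<in> Mor A"
    and F_stable_retract: "stable_retract A f g \<Longrightarrow> g \<in> \<F> \<Longrightarrow> f \<in> Mor A \<Longrightarrow> f \<in> \<F>"
    and F_Id: "X \<in> Ob A \<Longrightarrow> Id A X \<in> \<F>"
    and F_ker: "is_kernel A k f \<Longrightarrow> f \<in> \<F> \<Longrightarrow> k \<in> \<F>"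
    and F_coker: "is_cokernel A c f \<Longrightarrow> f \<in> \<F> \<Longrightarrow> c \<in> \<F>"
    and F_left_cancel: "i \<in> Mor A \<Longrightarrow> j \<in> Mor A \<Longrightarrow> Cod A i = Dom A j \<Longrightarrow> mono_arrow A (j \<cdot>\<^bsub>A\<^esub> i) \<Longrightarrow>
      j \<cdot>\<^bsub>A\<^esub> i \<in> \<F> \<Longrightarrow> i \<in> \<F>"
    and F_right_cancel: "g \<in> Mor A \<Longrightarrow> h \<in> Mor A \<Longrightarrow> Cod A h = Dom A g \<Longrightarrow> epi_arrow A (g \<cdot>\<^bsub>A\<^esub> h) \<Longrightarrow>
      g \<cdot>\<^bsub>A\<^esub> h \<in> \<F> \<Longrightarrow> g \<in> \<F>"
    and F_comp_epi: "p \<in> \<F> \<Longrightarrow> epi_arrow A p \<Longrightarrow> q \<in> \<F> \<Longrightarrow> epi_arrow A q \<Longrightarrow> Cod A p = Dom A q \<Longrightarrow>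
      q \<cdot>\<^bsub>A\<^esub> p \<in> \<F>"
    and F_comp_mono: "i \<in> \<F> \<Longrightarrow> mono_arrow A i \<Longrightarrow> j \<in> \<F> \<Longrightarrow> mono_arrow A j \<Longrightarrow> Cod A i = Dom A j \<Longrightarrow>
      j \<cdot>\<^bsub>A\<^esub> i \<in> \<F>"
begin

text \<open>Asking for \<open>p\<close> alone is not a choice of side: closure under kernels and
  cokernels makes it equivalent to \<open>i\<close> lying in \<open>\<F>\<close>, by
  \<open>conflations_iff\<close>.\<close>

definition conflations :: "('m \<times> 'm) set" where
  "conflations = {(i, p). kernel_cokernel_pair A i p \<and> p \<in> \<F>}"

lemma exact_class_opcat: "exact_class (opcat A) \<F>"
proof (intro exact_class.intro exact_class_axioms.intro abelian_opcat)
  fix f g assume "stable_retract (opcat A) f g" "g \<in> \<F>" "f \<in> Mor (opcat A)"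
  then show "f \<in> \<F>"
    using preadditive_category.stable_retract_opcat[OF preadditive_opcat, of f g] F_stable_retract F_Mor by simp
next
  fix i j assume "i \<in> Mor (opcat A)" "j \<in> Mor (opcat A)" "Cod (opcat A) i = Dom (opcat A) j"
    "mono_arrow (opcat A) (j \<cdot>\<^bsub>opcat A\<^esub> i)" "j \<cdot>\<^bsub>opcat A\<^esub> i \<in> \<F>"
  then show "i \<in> \<F>" using F_right_cancel[of i j] by simp
next
  fix g h assume "g \<in> Mor (opcat A)" "h \<in> Mor (opcat A)" "Cod (opcat A) h = Dom (opcat A) g"
    "epi_arrow (opcat A) (g \<cdot>\<^bsub>opcat A\<^esub> h)" "g \<cdot>\<^bsub>opcat A\<^esub> h \<in> \<F>"
  then show "g \<in> \<F>" using F_left_cancel[of g h] by simp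
next
  fix p q assume "p \<in> \<F>" "epi_arrow (opcat A) p" "q \<in> \<F>" "epi_arrow (opcat A) q"
    "Cod (opcat A) p = Dom (opcat A) q"
  then show "q \<cdot>\<^bsub>opcat A\<^esub> p \<in> \<F>" using F_comp_mono[of q p] by simp
next
  fix i j assume "i \<in> \<F>" "mono_arrow (opcat A) i" "j \<in> \<F>" "mono_arrow (opcat A) j"
    "Cod (opcat A) i = Dom (opcat A) j"
  then show "j \<cdot>\<^bsub>opcat A\<^esub> i \<in> \<F>" using F_comp_epi[of j i] by simp
next
  fix k f assume "is_kernel (opcat A) k f" "f \<in> \<F>"
  then show "k \<in> \<F>" using F_coker[of k f] by simp
next
  fix k f assume "is_cokernel (opcat A) k f" "f \<in> \<F>"
  then show "k \<in> \<F>" using F_ker[of k f] by simp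
qed (simp_all add: F_Mor F_Id)

lemma conflations_iff:
  assumes "kernel_cokernel_pair A i p"
  shows "(i, p) \<in> conflations \<longleftrightarrow> p \<in> \<F>" "(i, p) \<in> conflations \<longleftrightarrow> i \<in> \<F>"
proof -
  have "is_kernel A i p" "is_cokernel A p i" using assms by (simp_all add: kernel_cokernel_pair_def)
  then have "p \<in> \<F> \<longleftrightarrow> i \<in> \<F>" using F_ker[of i p] F_coker[of p i] by blast
  then show "(i, p) \<in> conflations \<longleftrightarrow> p \<in> \<F>" "(i, p) \<in> conflations \<longleftrightarrow> i \<in> \<F>"
    using assms by (simp_all add: conflations_def)
qed

lemma conflations_opcat: "exact_class.conflations (opcat A) \<F> = conflations\<inverse>"
proof -
  have "(p, i) \<in> exact_class.conflations (opcat A) \<F> \<longleftrightarrow> (i, p) \<in> conflations" for i p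
    using conflations_iff[of i p]
    unfolding exact_class.conflations_def[OF exact_class_opcat] by (auto simp: conflations_def)
  then show ?thesis by auto
qed

lemma admissible_epi_iff: "admissible_epi conflations p \<longleftrightarrow> epi_arrow A p \<and> p \<in> \<F>"
proof
  assume "admissible_epi conflations p"
  then show "epi_arrow A p \<and> p \<in> \<F>"
    using is_cokernel_epi by (auto simp: admissible_epi_def conflations_def kernel_cokernel_pair_def)
next
  assume p: "epi_arrow A p \<and> p \<in> \<F>"
  then obtain k where "is_kernel A k p" using kernels F_Mor by blast
  then show "admissible_epi conflations p"
    using kernel_pair_epi p by (auto simp: admissible_epi_def conflations_def)
qed

lemma admissible_mono_iff: "admissible_mono conflations i \<longleftrightarrow> mono_arrow A i \<and> i \<in> \<F>"
  using exact_class.admissible_epi_iff[OF exact_class_opcat, of i] by (simp add: conflations_opcat)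

lemma is_kernel_iso:
  assumes ip: "is_kernel A i p" and i': "i' \<in> Mor A" "p' \<in> Mor A" "Cod A i' = Dom A p'"
    and a: "iso_arrow A a" "a \<in> homset A (Dom A i) (Dom A i')" and b: "iso_arrow A b" "b \<in> homset A (Cod A i) (Cod A i')"
    and c: "iso_arrow A c" "c \<in> homset A (Cod A p) (Cod A p')"
    and sq: "b \<odot> i = i' \<odot> a" "c \<odot> p = p' \<odot> b"
  shows "is_kernel A i' p'"
proof -
  note I = is_kernelD[OF ip]
  have ty: "a \<in> Mor A" "Dom A a = Dom A i" "Cod A a = Dom A i'" "b \<in> Mor A" "Dom A b = Cod A i"
    "Cod A b = Cod A i'" "c \<in> Mor A" "Dom A c = Cod A p" "Cod A c = Cod A p'"
    using a b c by (simp_all add: hom_iff)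
  obtain b' where b': "b' \<in> homset A (Cod A b) (Dom A b)" "b' \<odot> b = Id A (Dom A b)" "b \<odot> b' = Id A (Cod A b)"
    using b(1) unfolding iso_arrow_def by blast
  have tb: "b' \<in> Mor A" "Dom A b' = Cod A i'" "Cod A b' = Cod A i" using b'(1) ty by (simp_all add: hom_iff)
  have bb: "b \<odot> b' = Id A (Cod A i')" using b'(3) ty by simp
  show ?thesis
  proof (rule is_kernelI[OF _ i'(2,3)])
    have m: "mono_arrow A (i' \<odot> a)"
      unfolding sq(1)[symmetric] by (rule mono_comp[OF is_kernel_mono[OF ip] iso_mono[OF b(1)]]) (use ty in simp)
    obtain a' where a': "a' \<in> Mor A" "Dom A a' = Cod A a" "Cod A a' = Dom A a" "a' \<odot> a = Id A (Dom A a)"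
      "a \<odot> a' = Id A (Cod A a)" "iso_arrow A a'"
      by (rule iso_inverseE[OF a(1)])
    have "mono_arrow A ((i' \<odot> a) \<odot> a')"
      by (rule mono_comp[OF iso_mono[OF a'(6)] m]) (use a' ty i' in simp)
    then show "mono_arrow A i'" using a'(1-3,5) ty i' by (simp add: assoc)
    have "(p' \<odot> i') \<odot> a = p' \<odot> (b \<odot> i)" using sq(1) i' ty by (simp add: assoc)
    also have "\<dots> = c \<odot> (p \<odot> i)" using comp_square[OF sq(2), of i] I(1-3) i' ty by simp
    also have "\<dots> = Zero A (Dom A a) (Cod A (p' \<odot> i'))" unfolding I(4) using I(1-3) ty i' by simp
    finally have z: "(p' \<odot> i') \<odot> a = Zero A (Dom A a) (Cod A (p' \<odot> i'))" .
    have "p' \<odot> i' = Zero A (Cod A a) (Cod A (p' \<odot> i'))"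
      by (rule epi_zero[OF iso_epi[OF a(1)] _ _ z]) (use ty i' in simp_all)
    then show "p' \<odot> i' = Zero A (Dom A i') (Cod A p')" using ty i' by simp
    fix h assume h: "h \<in> Mor A" "Cod A h = Dom A p'" "p' \<odot> h = Zero A (Dom A h) (Cod A p')"
    have bh: "b \<odot> (b' \<odot> h) = h" using comp_reassoc[OF bb, of h] h(1,2) tb ty i' by simp
    have "c \<odot> (p \<odot> (b' \<odot> h)) = p' \<odot> (b \<odot> (b' \<odot> h))"
      using comp_square[OF sq(2), of "b' \<odot> h"] h(1,2) tb ty i' I(1-3) by simp
    then have "c \<odot> (p \<odot> (b' \<odot> h)) = Zero A (Dom A (p \<odot> (b' \<odot> h))) (Cod A c)"
      using bh h tb ty i' I(1-3) by simp
    then have "p \<odot> (b' \<odot> h) = Zero A (Dom A (p \<odot> (b' \<odot> h))) (Dom A c)"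
      by (rule mono_zero[OF iso_mono[OF c(1)], rotated 2]) (use h(1,2) tb ty i' I(1-3) in simp_all)
    then have z: "p \<odot> (b' \<odot> h) = Zero A (Dom A (b' \<odot> h)) (Cod A p)"
      using h(1,2) tb ty i' I(1-3) by simp
    obtain u where u: "u \<in> Mor A" "Dom A u = Dom A (b' \<odot> h)" "Cod A u = Dom A i" "i \<odot> u = b' \<odot> h"
      by (rule is_kernel_lift[OF ip _ _ z]) (use h(1,2) tb i' I(3) in simp_all)
    have "i' \<odot> (a \<odot> u) = b \<odot> (i \<odot> u)" using comp_square[OF sq(1), of u] u(1-3) ty I(1-3) i' by simp
    also have "\<dots> = h" unfolding u(4) by (rule bh)
    finally show "\<exists>v \<in> homset A (Dom A h) (Dom A i'). i' \<odot> v = h"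
      using u(1-3) ty h(1,2) tb i' by (intro bexI[of _ "a \<odot> u"]) (simp_all add: hom_iff)
  qed
qed

text \<open>The kernel \<open>k'\<close> of \<open>p'\<close> becomes the kernel of \<open>p\<close>
  after \<open>q\<close>, so left cancellation puts \<open>k'\<close> into \<open>\<F>\<close>, and
  \<open>p'\<close> follows as its cokernel.\<close>

lemma conflations_pullback:
  assumes p: "admissible_epi conflations p" and f: "f \<in> Mor A" "Cod A f = Cod A p"
  obtains p' q where "is_pullback A p f p' q" "admissible_epi conflations p'"
proof -
  have p': "epi_arrow A p" "p \<in> \<F>" using p by (simp_all add: admissible_epi_iff)
  obtain p' q where *: "is_pullback A p f p' q" "epi_arrow A p'"
    "\<And>k. is_kernel A k p \<Longrightarrow> \<exists>k'. is_kernel A k' p' \<and> q \<odot> k' = k"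
    by (rule epi_pullback[OF p'(1) f]) blast
  obtain k where k: "is_kernel A k p" using kernels F_Mor[OF p'(2)] by blast
  obtain k' where k': "is_kernel A k' p'" "q \<odot> k' = k" using *(3)[OF k] by blast
  have "q \<in> Mor A" "Cod A k' = Dom A q" using *(1) is_kernelD[OF k'(1)] by (simp_all add: is_pullback_def)
  then have "k' \<in> \<F>"
    using F_left_cancel[of k' q] k' is_kernelD(1)[OF k'(1)] is_kernel_mono[OF k] F_ker[OF k p'(2)] by simp
  then have "p' \<in> \<F>" using F_coker[OF epi_cokernel_kernel[OF *(2) k'(1)]] by blast
  then show ?thesis using that[OF *(1)] *(2) by (simp add: admissible_epi_iff)
qed

lemma exact_structure_conflations: "exact_structure A conflations"
  unfolding exact_structure_def
proof (intro conjI ballI impI allI)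
  fix x assume x: "x \<in> conflations"
  then show "case x of (i, p) \<Rightarrow> kernel_cokernel_pair A i p" by (auto simp: conflations_def)
  obtain i p where ip: "x = (i, p)" "kernel_cokernel_pair A i p" "p \<in> \<F>" using x by (auto simp: conflations_def)
  have pI: "is_kernel A i p" "is_cokernel A p i" using ip(2) by (simp_all add: kernel_cokernel_pair_def)
  note P = is_kernelD[OF pI(1)]
  have "(i', p') \<in> conflations"
    if i': "i' \<in> Mor A" "p' \<in> Mor A" "Cod A i' = Dom A p'"
      and hom: "a \<in> homset A (Dom A i) (Dom A i')" "b \<in> homset A (Cod A i) (Cod A i')"
        "c \<in> homset A (Cod A p) (Cod A p')"
      and iso: "iso_arrow A a" "iso_arrow A b" "iso_arrow A c"
      and sq: "b \<odot> i = i' \<odot> a" "c \<odot> p = p' \<odot> b" for i' p' a b c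
  proof -
    have ker: "is_kernel A i' p'" by (rule is_kernel_iso[OF pI(1) i' iso(1) hom(1) iso(2) hom(2) iso(3) hom(3) sq])
    have ty: "b \<in> Mor A" "Dom A b = Dom A p" "Cod A b = Dom A p'" "c \<in> Mor A" "Dom A c = Cod A p" "Cod A c = Cod A p'"
      using hom i' P by (simp_all add: hom_iff)
    have "epi_arrow A (p' \<odot> b)"
      unfolding sq(2)[symmetric] by (rule epi_comp[OF iso_epi[OF iso(3)] is_cokernel_epi[OF pI(2)]]) (use ty in simp)
    then have "epi_arrow A p'" using epi_cancel[of p' b] ty i' by simp
    then have kc: "kernel_cokernel_pair A i' p'" using kernel_pair_epi ker by blast
    obtain b' where b': "b' \<in> homset A (Cod A b) (Dom A b)" "b' \<odot> b = Id A (Dom A b)" "b \<odot> b' = Id A (Cod A b)"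
      using iso(2) unfolding iso_arrow_def by blast
    obtain c' where c': "c' \<in> homset A (Cod A c) (Dom A c)" "c' \<odot> c = Id A (Dom A c)" "c \<odot> c' = Id A (Cod A c)"
      using iso(3) unfolding iso_arrow_def by blast
    have tb: "b' \<in> Mor A" "Dom A b' = Dom A p'" "Cod A b' = Dom A p"
      and tc: "c' \<in> Mor A" "Dom A c' = Cod A p'" "Cod A c' = Cod A p"
      using b'(1) c'(1) ty by (simp_all add: hom_iff)
    have cc: "c \<odot> c' = Id A (Cod A p')" using c'(3) ty by simp
    have bb: "b \<odot> b' = Id A (Dom A p')" using b'(3) ty by simp
    have "c' \<odot> p' = p \<odot> b'"
      by (rule iso_square[of p' b c p]) (use sq(2) bb c' ty tb tc i' P in simp_all)
    moreover have "c \<odot> (c' \<odot> p') = p'" using comp_reassoc[OF cc, of p'] ty tc i' by simp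
    \<comment> \<open>Isomorphic arrows are stable retracts of each other, with
      \<open>s = 0\<close>.\<close>
    ultimately have "stable_retract A p' p"
      by (intro stable_retractI[of b' _ _ c' b c "Zero A (Cod A p') (Dom A p')"])
        (use sq(2) ty tb tc i' P in simp_all)
    then have "p' \<in> \<F>" using F_stable_retract ip(3) i'(2) by blast
    then show ?thesis using kc by (simp add: conflations_def)
  qed
  then show "case x of (i, p) \<Rightarrow> \<forall>i'\<in>Mor A. \<forall>p'\<in>Mor A. \<forall>a b c. Cod A i' = Dom A p' \<longrightarrow>
        a \<in> homset A (Dom A i) (Dom A i') \<longrightarrow> b \<in> homset A (Cod A i) (Cod A i') \<longrightarrow>
        c \<in> homset A (Cod A p) (Cod A p') \<longrightarrow>
        iso_arrow A a \<longrightarrow> iso_arrow A b \<longrightarrow> iso_arrow A c \<longrightarrow>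
        b \<odot> i = i' \<odot> a \<longrightarrow> c \<odot> p = p' \<odot> b \<longrightarrow> (i', p') \<in> conflations"
    unfolding ip(1) prod.case by blast
next
  fix p f assume "f \<in> Mor A" "admissible_epi conflations p" "Cod A f = Cod A p"
  then show "\<exists>p' f'. is_pullback A p f p' f' \<and> admissible_epi conflations p'"
    using conflations_pullback by metis
next
  fix i f assume *: "f \<in> Mor A" "admissible_mono conflations i" "Dom A f = Dom A i"
  \<comment> \<open>A pushout of an inflation is a pullback of a deflation in the opposite category,
    where \<open>\<F>\<close> is again a class of this kind.\<close>
  obtain i' f' where "is_pullback (opcat A) i f i' f'"
    "admissible_epi (exact_class.conflations (opcat A) \<F>) i'"
    by (rule exact_class.conflations_pullback[OF exact_class_opcat, of i f])
      (use * in \<open>simp_all add: conflations_opcat\<close>)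
  then show "\<exists>i' f'. is_pushout A i f i' f' \<and> admissible_mono conflations i'"
    by (auto simp: conflations_opcat)
next
  fix X assume "X \<in> Ob A"
  then show "admissible_mono conflations (Id A X)" "admissible_epi conflations (Id A X)"
    by (simp_all add: admissible_mono_iff admissible_epi_iff F_Id iso_mono iso_epi)
next
  fix i j assume "admissible_mono conflations i" "admissible_mono conflations j" "Cod A i = Dom A j"
  then show "admissible_mono conflations (j \<odot> i)"
    using mono_comp[of i j] F_comp_mono[of i j] by (simp add: admissible_mono_iff)
next
  fix p q assume "admissible_epi conflations p" "admissible_epi conflations q" "Cod A p = Dom A q"
  then show "admissible_epi conflations (q \<odot> p)"
    using epi_comp[of q p] F_comp_epi[of p q] by (simp add: admissible_epi_iff)
qed

end

section \<open>The stable category and the transpose\<close>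

lemma quotcat_simps:
  "Ob (quotcat C I) = Ob C" "Mor (quotcat C I) = arrow_class C I ` Mor C"
  "Dom (quotcat C I) u = Dom C (SOME f. f \<in> u)" "Cod (quotcat C I) u = Cod C (SOME f. f \<in> u)"
  "Id (quotcat C I) X = arrow_class C I (Id C X)"
  "v \<cdot>\<^bsub>quotcat C I\<^esub> u = arrow_class C I ((SOME f. f \<in> v) \<cdot>\<^bsub>C\<^esub> (SOME f. f \<in> u))"
  by (simp_all add: quotcat_def Let_def)

definition repr_ideal :: "('o, 'm) acat \<Rightarrow> ('o, 'm, 'g) ftrans set" where
  "repr_ideal A = factors_through (modcat A) {P. representable A P}"

section \<open>The ideal of maps that factor through representable functors\<close>

context abelian_universe
begin

text \<open>The generator is the image of the identity of \<open>Y\<close>. Together with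
  \<open>pres_representable\<close> this replaces \<open>hom_functor\<close>, whose values lie in
  another type, by a presentation.\<close>

lemma representable_pres:
  assumes "representable A P"
  obtains Y r where "Y \<in> Ob A" "additive_functor A P" "pres A (Zero A Y Y) P r"
proof -
  obtain Y \<alpha> where Y: "Y \<in> Ob A" and P: "additive_functor A P" and \<alpha>: "nat_trans A (hom_functor A Y) P \<alpha>"
    and bij: "\<forall>X \<in> Ob A. bij_betw (\<alpha> X) (homset A X Y) (carrier (FOb P X))"
    using assms unfolding representable_def by blast
  define r where "r = \<alpha> Y (Id A Y)"
  have r: "r \<in> carrier (FOb P Y)" using nt_closed[OF \<alpha> Y, of "Id A Y"] Y by (simp add: r_def hom_iff)
  have \<alpha>h: "FMor P h r = \<alpha> (Dom A h) h" if "h \<in> Mor A" "Cod A h = Y" for h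
    using pres_hom_functor[OF \<alpha> that] by (simp add: r_def)
  have Z: "Dom A (Zero A Y Y) = Y" "Cod A (Zero A Y Y) = Y" "Zero A Y Y \<in> Mor A" using Y by simp_all
  have "pres A (Zero A Y Y) P r" unfolding pres_def Z
  proof (intro conjI ballI impI r)
    fix W x assume W: "W \<in> Ob A" "x \<in> carrier (FOb P W)"
    have "x \<in> \<alpha> W ` homset A W Y" using bspec[OF bij W(1)] W(2) by (simp add: bij_betw_def)
    then obtain h where "x = \<alpha> W h" "h \<in> homset A W Y" by (rule imageE)
    then show "\<exists>h \<in> homset A W Y. FMor P h r = x"
      using \<alpha>h[of h] by (intro bexI[of _ h]) (simp_all add: hom_iff)
  next
    fix h assume h: "h \<in> Mor A" "Cod A h = Y"
    have Ob: "Dom A h \<in> Ob A" using h by simp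
    have inj: "inj_on (\<alpha> (Dom A h)) (homset A (Dom A h) Y)" using bspec[OF bij Ob] by (simp add: bij_betw_def)
    have one: "\<alpha> (Dom A h) (Zero A (Dom A h) Y) = \<one>\<^bsub>FOb P (Dom A h)\<^esub>"
      using nt_one[OF \<alpha> additive_hom_functor[OF Y] P Ob] by simp
    show "FMor P h r = \<one>\<^bsub>FOb P (Dom A h)\<^esub> \<longleftrightarrow> (\<exists>s \<in> homset A (Dom A h) Y. Zero A Y Y \<odot> s = h)" (is "?L \<longleftrightarrow> ?R")
    proof
      assume ?L
      then have "\<alpha> (Dom A h) h = \<alpha> (Dom A h) (Zero A (Dom A h) Y)" using \<alpha>h[OF h] one by simp
      then have h0: "h = Zero A (Dom A h) Y"
        by (rule inj_onD[OF inj]) (use h Ob Y in \<open>simp_all add: hom_iff\<close>)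
      have "Zero A Y Y \<odot> Zero A (Dom A h) Y = Zero A (Dom A h) Y" using Y Ob by simp
      also have "\<dots> = h" by (rule h0[symmetric])
      finally show ?R by (rule bexI) (use Y Ob in \<open>simp add: hom_iff\<close>)
    next
      assume ?R
      then obtain s where s: "s \<in> homset A (Dom A h) Y" "Zero A Y Y \<odot> s = h" by blast
      have "Zero A Y Y \<odot> s = Zero A (Dom A h) Y" using s(1) Y by (simp add: hom_iff)
      then have h0: "h = Zero A (Dom A h) Y" by (rule trans[OF s(2)[symmetric]])
      have "FMor P h r = \<alpha> (Dom A h) h" by (rule \<alpha>h[OF h])
      also have "\<dots> = \<alpha> (Dom A h) (Zero A (Dom A h) Y)" by (rule arg_cong[OF h0])
      finally show ?L using one by simp
    qed
  qed (rule Z)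
  then show ?thesis by (rule that[OF Y P])
qed

lemma pres_representable:
  assumes Y: "Y \<in> Ob A" and R: "additive_functor A R" "pres A (Zero A Y Y) R r"
  shows "representable A R"
proof -
  have r: "r \<in> carrier (FOb R Y)" using presD(2)[OF R(2)] Y by simp
  have cz: "Cod A (Zero A Y Y) = Y" using Y by simp
  have "bij_betw (\<lambda>h. FMor R h r) (homset A X Y) (carrier (FOb R X))" if X: "X \<in> Ob A" for X
    unfolding bij_betw_def
  proof (intro conjI inj_onI equalityI subsetI)
    fix h h' assume *: "h \<in> homset A X Y" "h' \<in> homset A X Y" "FMor R h r = FMor R h' r"
    obtain s where s: "s \<in> Mor A" "Dom A s = Dom A h'" "Cod A s = Dom A (Zero A Y Y)" "h = h' \<oplus> Zero A Y Y \<odot> s"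
      by (rule pres_eqE[OF R, of h h']) (use * Y in \<open>simp_all add: hom_iff\<close>)
    have "h' \<oplus> Zero A Y Y \<odot> s = h'" using s(1-3) *(2) Y by (simp add: hom_iff)
    then show "h = h'" using s(4) by simp
  next
    fix x assume "x \<in> (\<lambda>h. FMor R h r) ` homset A X Y"
    then obtain h where "x = FMor R h r" "h \<in> homset A X Y" by (rule imageE)
    then show "x \<in> carrier (FOb R X)" using r by (simp add: hom_iff af_closed[OF R(1)])
  next
    fix x assume "x \<in> carrier (FOb R X)"
    then obtain h where "h \<in> Mor A" "Dom A h = X" "Cod A h = Y" "FMor R h r = x"
      using pres_gen[OF R(2) X] cz by metis
    then show "x \<in> (\<lambda>h. FMor R h r) ` homset A X Y" by (intro image_eqI[of _ _ h]) (simp_all add: hom_iff)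
  qed
  then show ?thesis unfolding representable_def using R(1) Y nat_trans_element[OF R(1) r Y] by blast
qed

text \<open>The projection from \<open>Hom(-, Cod g)\<close> to \<open>G\<close> is onto and maps
  from representable functors lift along it, so a map that factors through some representable
  functor factors through this one. The first half of such a factorization is an arrow
  \<open>w\<close> that kills the relation \<open>f\<close>.\<close>

lemma repr_ideal_iff:
  fixes F G :: "('o, 'm, 'g) afun"
  assumes F: "finitely_presented A F" "pres A f F e" and G: "finitely_presented A G" "pres A g G e'"
    and \<alpha>: "nat_trans A F G \<alpha>"
  shows "arr A F G \<alpha> \<in> repr_ideal A \<longleftrightarrow>
    (\<exists>w \<in> homset A (Cod A f) (Cod A g). w \<odot> f = Zero A (Dom A f) (Cod A g) \<and> \<alpha> (Cod A f) e = FMor G w e')"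
    (is "?L \<longleftrightarrow> ?R")
proof
  note ad = fp_additive[OF F(1)] fp_additive[OF G(1)]
  note PF = presD[OF F(2)] and PG = presD[OF G(2)]
  have Ob: "Cod A f \<in> Ob A" "Cod A g \<in> Ob A" "Dom A f \<in> Ob A" using PF PG by simp_all
  { assume ?L
    then obtain P h k where P: "representable A P" and h: "h \<in> homset (modcat A) F P"
      and k: "k \<in> homset (modcat A) P G" and eq: "arr A F G \<alpha> = k \<cdot>\<^bsub>modcat A\<^esub> h"
      unfolding repr_ideal_def factors_through_def by auto
    obtain \<gamma> where \<gamma>: "h = arr A F P \<gamma>" "nat_trans A F P \<gamma>" by (rule modcat_homE[OF h])
    obtain \<delta> where \<delta>: "k = arr A P G \<delta>" "nat_trans A P G \<delta>" by (rule modcat_homE[OF k])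
    obtain Y r where Y: "Y \<in> Ob A" and adP: "additive_functor A P" and r: "pres A (Zero A Y Y) P r"
      by (rule representable_pres[OF P])
    have rY: "r \<in> carrier (FOb P Y)" using presD(2)[OF r] Y by simp
    have \<alpha>e: "\<alpha> (Cod A f) e = \<delta> (Cod A f) (\<gamma> (Cod A f) e)"
      using eq Ob(1) PF(2) unfolding \<gamma>(1) \<delta>(1) arr_Cmp[OF \<gamma>(2)] arr_eq_iff by blast
    obtain v where v: "v \<in> Mor A" "Dom A v = Cod A f" "Cod A v = Cod A (Zero A Y Y)" "FMor P v r = \<gamma> (Cod A f) e"
      by (rule pres_gen[OF r Ob(1) nt_closed[OF \<gamma>(2) Ob(1) PF(2)]])
    have cv: "Cod A v = Y" using v(3) Y by simp
    have "FMor P (v \<odot> f) r = FMor P f (\<gamma> (Cod A f) e)"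
      using v cv PF(1) rY by (simp add: af_Cmp[OF adP])
    also have "\<dots> = \<gamma> (Dom A f) (FMor F f e)" using nt_nat[OF \<gamma>(2) PF(1) refl PF(2)] by simp
    also have "\<dots> = \<one>\<^bsub>FOb P (Dom A (v \<odot> f))\<^esub>"
      using pres_zero[OF ad(1) F(2)] nt_one[OF \<gamma>(2) ad(1) adP Ob(3)] v PF(1) by simp
    finally obtain s where s: "s \<in> Mor A" "Dom A s = Dom A (v \<odot> f)" "Cod A s = Dom A (Zero A Y Y)"
      "Zero A Y Y \<odot> s = v \<odot> f"
      by (rule pres_relE[OF r, rotated 2]) (use v cv PF(1) Y in simp_all)
    have vf: "v \<odot> f = Zero A (Dom A f) Y" unfolding s(4)[symmetric] using s(1-3) v PF(1) Y by simp
    obtain z where z: "z \<in> Mor A" "Dom A z = Y" "Cod A z = Cod A g" "FMor G z e' = \<delta> Y r"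
      by (rule pres_gen[OF G(2) Y nt_closed[OF \<delta>(2) Y rY]])
    have "\<alpha> (Cod A f) e = FMor G v (\<delta> Y r)"
      unfolding \<alpha>e v(4)[symmetric] using nt_nat[OF \<delta>(2) v(1,2), of r] cv rY by simp
    also have "\<dots> = FMor G (z \<odot> v) e'" unfolding z(4)[symmetric] using z(1-3) v(1,2) cv PG by (simp add: af_Cmp[OF ad(2)])
    finally have "\<alpha> (Cod A f) e = FMor G (z \<odot> v) e'" .
    moreover have "(z \<odot> v) \<odot> f = Zero A (Dom A f) (Cod A g)"
      using vf z(1-3) v(1,2) cv PF(1) by (simp add: assoc)
    ultimately show ?R using z(1-3) v(1,2) cv by (intro bexI[of _ "z \<odot> v"]) (simp_all add: hom_iff) }
  { assume ?R
    then obtain w where w': "w \<in> homset A (Cod A f) (Cod A g)" "w \<odot> f = Zero A (Dom A f) (Cod A g)"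
      "\<alpha> (Cod A f) e = FMor G w e'" by blast
    then have w: "w \<in> Mor A" "Dom A w = Cod A f" "Cod A w = Cod A g" by (simp_all add: hom_iff)
    obtain R :: "('o, 'm, 'g) afun" and r where R: "finitely_presented A R" "additive_functor A R"
      "pres A (Zero A (Cod A g) (Cod A g)) R r" by (rule ex_representing[OF Ob(2)])
    have r: "r \<in> carrier (FOb R (Cod A g))" using presD(2)[OF R(3)] Ob by simp
    have "FMor R f (FMor R w r) = \<one>\<^bsub>FOb R (Dom A f)\<^esub>"
      using af_Cmp[OF R(2) PF(1) w(1), of r] w r w'(2) Ob by (simp add: af_Zero[OF R(2)])
    then obtain \<gamma> where \<gamma>: "nat_trans A F R \<gamma>" "\<gamma> (Cod A f) e = FMor R w r"
      by (rule induced_nat_trans[OF ad(1) R(2) F(2), rotated]) (use w r in \<open>simp_all add: af_closed[OF R(2)]\<close>)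
    obtain \<delta> where \<delta>: "nat_trans A R G \<delta>" "\<delta> (Cod A g) r = e'" by (rule yoneda[OF Ob(2) R(2,3) ad(2) PG(2)])
    have "\<alpha> X x = \<delta> X (\<gamma> X x)" if "X \<in> Ob A" "x \<in> carrier (FOb F X)" for X x
      by (rule nat_trans_eqI[OF F(2) \<alpha> nat_trans_comp[OF \<gamma>(1) \<delta>(1)] _ that])
        (use w'(3) \<gamma>(2) \<delta>(2) nt_nat[OF \<delta>(1) w(1,2), of r] w(3) r in simp)
    then have "arr A F G \<alpha> = arr A R G \<delta> \<cdot>\<^bsub>modcat A\<^esub> arr A F R \<gamma>"
      by (simp add: arr_Cmp[OF \<gamma>(1)] arr_eq_iff)
    moreover have "R \<in> {P. representable A P} \<inter> Ob (modcat A)"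
      using pres_representable[OF Ob(2) R(2,3)] R(1) by simp
    ultimately show ?L
      unfolding repr_ideal_def factors_through_def mem_Collect_eq arr_Dom_Cod
      using arr_hom[OF F(1) R(1) \<gamma>(1)] arr_hom[OF R(1) G(1) \<delta>(1)] F(1) G(1) \<alpha> by (intro conjI arr_Mor) blast+ }
qed

lemma arrow_class_iff:
  fixes F G :: "('o, 'm, 'g) afun"
  assumes fp: "finitely_presented A F" "finitely_presented A G"
  shows "u \<in> arrow_class (modcat A) I (arr A F G \<alpha>) \<longleftrightarrow>
    (\<exists>\<kappa>. nat_trans A F G \<kappa> \<and> arr A F G \<kappa> \<in> I \<and> u = arr A F G (\<lambda>X x. \<kappa> X x \<otimes>\<^bsub>FOb G X\<^esub> \<alpha> X x))" (is "?L \<longleftrightarrow> ?R")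
proof
  assume ?L
  then obtain h where h: "h \<in> I" "h \<in> homset (modcat A) F G" "u = Add (modcat A) h (arr A F G \<alpha>)"
    unfolding arrow_class_def by auto
  obtain \<kappa> where "h = arr A F G \<kappa>" "nat_trans A F G \<kappa>" by (rule modcat_homE[OF h(2)])
  then show ?R using h by (auto simp: arr_Add)
next
  assume ?R
  then obtain \<kappa> where \<kappa>: "nat_trans A F G \<kappa>" "arr A F G \<kappa> \<in> I"
    "u = Add (modcat A) (arr A F G \<kappa>) (arr A F G \<alpha>)" by (auto simp: arr_Add)
  then show ?L unfolding arrow_class_def arr_Dom_Cod using arr_hom[OF fp \<kappa>(1)] by blast
qed

lemma repr_ideal_subgroup:
  fixes F G :: "('o, 'm, 'g) afun"
  assumes fp: "finitely_presented A F" "finitely_presented A G"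
  shows "arr A F G (\<lambda>X x. \<one>\<^bsub>FOb G X\<^esub>) \<in> repr_ideal A"
    "nat_trans A F G \<alpha> \<Longrightarrow> nat_trans A F G \<beta> \<Longrightarrow> arr A F G \<alpha> \<in> repr_ideal A \<Longrightarrow> arr A F G \<beta> \<in> repr_ideal A \<Longrightarrow>
      arr A F G (\<lambda>X x. \<alpha> X x \<otimes>\<^bsub>FOb G X\<^esub> \<beta> X x) \<in> repr_ideal A"
    "nat_trans A F G \<alpha> \<Longrightarrow> arr A F G \<alpha> \<in> repr_ideal A \<Longrightarrow> arr A F G (\<lambda>X x. inv\<^bsub>FOb G X\<^esub> \<alpha> X x) \<in> repr_ideal A"
proof -
  note ad = fp_additive[OF fp(1)] fp_additive[OF fp(2)]
  obtain f e where F: "pres A f F e" by (rule fp_pres[OF fp(1)])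
  obtain g e' where G: "pres A g G e'" by (rule fp_pres[OF fp(2)])
  note PF = presD[OF F] and PG = presD[OF G]
  note iff = repr_ideal_iff[OF fp(1) F fp(2) G]
  have Ob: "Cod A f \<in> Ob A" "Cod A g \<in> Ob A" "Dom A f \<in> Ob A" using PF PG by simp_all
  show "arr A F G (\<lambda>X x. \<one>\<^bsub>FOb G X\<^esub>) \<in> repr_ideal A"
    unfolding iff[OF nat_trans_one[OF ad(2)]]
    by (rule bexI[of _ "Zero A (Cod A f) (Cod A g)"])
      (use Ob PF PG in \<open>simp_all add: hom_iff af_Zero[OF ad(2)]\<close>)
  assume \<alpha>: "nat_trans A F G \<alpha>" "arr A F G \<alpha> \<in> repr_ideal A"
  then obtain w where w: "w \<in> homset A (Cod A f) (Cod A g)" "w \<odot> f = Zero A (Dom A f) (Cod A g)"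
    "\<alpha> (Cod A f) e = FMor G w e'" unfolding iff[OF \<alpha>(1)] by blast
  have wt: "w \<in> Mor A" "Dom A w = Cod A f" "Cod A w = Cod A g" using w(1) by (simp_all add: hom_iff)
  show "arr A F G (\<lambda>X x. inv\<^bsub>FOb G X\<^esub> \<alpha> X x) \<in> repr_ideal A"
    unfolding iff[OF nat_trans_inv[OF ad(2) \<alpha>(1)]]
    by (rule bexI[of _ "neg A w"])
      (use w wt Ob PF PG in \<open>simp_all add: hom_iff af_neg[OF ad(2)]\<close>)
  assume \<beta>: "nat_trans A F G \<beta>" "arr A F G \<beta> \<in> repr_ideal A"
  then obtain w' where w': "w' \<in> homset A (Cod A f) (Cod A g)" "w' \<odot> f = Zero A (Dom A f) (Cod A g)"
    "\<beta> (Cod A f) e = FMor G w' e'" unfolding iff[OF \<beta>(1)] by blast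
  have wt': "w' \<in> Mor A" "Dom A w' = Cod A f" "Cod A w' = Cod A g" using w'(1) by (simp_all add: hom_iff)
  show "arr A F G (\<lambda>X x. \<alpha> X x \<otimes>\<^bsub>FOb G X\<^esub> \<beta> X x) \<in> repr_ideal A"
    unfolding iff[OF nat_trans_mult[OF ad(2) \<alpha>(1) \<beta>(1)]]
    by (rule bexI[of _ "w \<oplus> w'"])
      (use w w' wt wt' Ob PF PG in \<open>simp_all add: hom_iff af_Add[OF ad(2)]\<close>)
qed

lemma arrow_class_self:
  fixes F G :: "('o, 'm, 'g) afun"
  assumes "finitely_presented A F" "finitely_presented A G" "nat_trans A F G \<alpha>"
  shows "arr A F G \<alpha> \<in> arrow_class (modcat A) (repr_ideal A) (arr A F G \<alpha>)"
  unfolding arrow_class_iff[OF assms(1,2)] using fp_additive[OF assms(2)] nt_closed[OF assms(3)]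
  by (intro exI[of _ "\<lambda>X x. \<one>\<^bsub>FOb G X\<^esub>"])
    (simp add: nat_trans_one repr_ideal_subgroup[OF assms(1,2)] arr_eq_iff monoid.l_one[OF af_monoid])

text \<open>The operations of \<open>quotcat\<close> are computed on chosen representatives, so each
  calculation there starts by comparing the choice with a known arrow. The error
  \<open>\<kappa>\<close> lies in the ideal.\<close>

lemma arrow_class_some:
  fixes F G :: "('o, 'm, 'g) afun"
  assumes fp: "finitely_presented A F" "finitely_presented A G" and \<alpha>: "nat_trans A F G \<alpha>"
  obtains \<kappa> where "nat_trans A F G \<kappa>" "arr A F G \<kappa> \<in> repr_ideal A"
    "nat_trans A F G (\<lambda>X x. \<kappa> X x \<otimes>\<^bsub>FOb G X\<^esub> \<alpha> X x)"
    "(SOME u. u \<in> arrow_class (modcat A) (repr_ideal A) (arr A F G \<alpha>)) =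
       arr A F G (\<lambda>X x. \<kappa> X x \<otimes>\<^bsub>FOb G X\<^esub> \<alpha> X x)"
proof -
  have "(SOME u. u \<in> arrow_class (modcat A) (repr_ideal A) (arr A F G \<alpha>)) \<in>
      arrow_class (modcat A) (repr_ideal A) (arr A F G \<alpha>)"
    by (rule someI[where P = "\<lambda>u. u \<in> arrow_class (modcat A) (repr_ideal A) (arr A F G \<alpha>)"])
      (rule arrow_class_self[OF assms])
  then obtain \<kappa> where \<kappa>: "nat_trans A F G \<kappa>" "arr A F G \<kappa> \<in> repr_ideal A"
    "(SOME u. u \<in> arrow_class (modcat A) (repr_ideal A) (arr A F G \<alpha>)) =
       arr A F G (\<lambda>X x. \<kappa> X x \<otimes>\<^bsub>FOb G X\<^esub> \<alpha> X x)"
    by (subst (asm) (3) arrow_class_iff[OF fp]) (elim exE conjE)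
  show ?thesis by (rule that[OF \<kappa>(1,2) nat_trans_mult[OF fp_additive[OF fp(2)] \<kappa>(1) \<alpha>] \<kappa>(3)])
qed

lemma stable_isomorphicE:
  fixes G T :: "('o, 'm, 'g) afun"
  assumes "isomorphic (stable_modcat A) G T"
  obtains \<alpha> \<beta> \<kappa> where "finitely_presented A G" "finitely_presented A T" "nat_trans A G T \<alpha>" "nat_trans A T G \<beta>"
    "nat_trans A G G \<kappa>" "arr A G G \<kappa> \<in> repr_ideal A"
    "\<And>X x. X \<in> Ob A \<Longrightarrow> x \<in> carrier (FOb G X) \<Longrightarrow> \<beta> X (\<alpha> X x) = \<kappa> X x \<otimes>\<^bsub>FOb G X\<^esub> x"
proof -
  let ?I = "repr_ideal A :: ('o, 'm, 'g) ftrans set"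
  let ?Q = "quotcat (modcat A) ?I"
  have Q: "stable_modcat A = ?Q" by (simp add: stable_modcat_def repr_ideal_def)
  obtain u where u: "u \<in> homset ?Q G T" "iso_arrow ?Q u" using assms unfolding Q isomorphic_def by blast
  have some: "\<exists>\<alpha>. finitely_presented A F \<and> finitely_presented A H \<and> nat_trans A F H \<alpha> \<and>
      (SOME f. f \<in> u) = arr A F H \<alpha>"
    if u: "u \<in> homset ?Q F H" for u and F H :: "('o, 'm, 'g) afun"
  proof -
    have "u \<in> arrow_class (modcat A) ?I ` Mor (modcat A)" using u by (simp add: hom_iff quotcat_simps)
    then obtain v where v: "u = arrow_class (modcat A) ?I v" "v \<in> Mor (modcat A)" by (rule imageE)
    obtain F' H' \<alpha> where *: "v = arr A F' H' \<alpha>" "finitely_presented A F'" "finitely_presented A H'" "nat_trans A F' H' \<alpha>"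
      by (rule modcat_MorE[OF v(2)])
    obtain \<kappa> where \<kappa>: "nat_trans A F' H' (\<lambda>X x. \<kappa> X x \<otimes>\<^bsub>FOb H' X\<^esub> \<alpha> X x)"
      "(SOME f. f \<in> u) = arr A F' H' (\<lambda>X x. \<kappa> X x \<otimes>\<^bsub>FOb H' X\<^esub> \<alpha> X x)"
      unfolding v(1) *(1) by (rule arrow_class_some[OF *(2-4)])
    moreover have "F' = F" "H' = H" using u \<kappa>(2) by (simp_all add: hom_iff quotcat_simps)
    ultimately show ?thesis using *(2,3) by blast
  qed
  have DC: "Dom ?Q u = G" "Cod ?Q u = T" using u(1) by (simp_all add: hom_iff)
  obtain v where v: "v \<in> homset ?Q T G" "v \<cdot>\<^bsub>?Q\<^esub> u = Id ?Q G"
    using u(2) unfolding iso_arrow_def DC by blast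
  obtain \<alpha> where \<alpha>: "finitely_presented A G" "finitely_presented A T" "nat_trans A G T \<alpha>" "(SOME f. f \<in> u) = arr A G T \<alpha>"
    using some[OF u(1)] by blast
  obtain \<beta> where \<beta>: "nat_trans A T G \<beta>" "(SOME f. f \<in> v) = arr A T G \<beta>"
    using some[OF v(1)] by blast
  note c = nat_trans_comp[OF \<alpha>(3) \<beta>(1)]
  have "arrow_class (modcat A) ?I (arr A G G (\<lambda>X x. \<beta> X (\<alpha> X x))) = arrow_class (modcat A) ?I (arr A G G (\<lambda>X x. x))"
    using v(2) by (simp add: quotcat_simps \<alpha>(4) \<beta>(2) arr_Cmp[OF \<alpha>(3)] arr_Id)
  then have "arr A G G (\<lambda>X x. \<beta> X (\<alpha> X x)) \<in> arrow_class (modcat A) ?I (arr A G G (\<lambda>X x. x))"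
    using arrow_class_self[OF \<alpha>(1,1) c] by simp
  then obtain \<kappa> where \<kappa>: "nat_trans A G G \<kappa>" "arr A G G \<kappa> \<in> ?I"
    "arr A G G (\<lambda>X x. \<beta> X (\<alpha> X x)) = arr A G G (\<lambda>X x. \<kappa> X x \<otimes>\<^bsub>FOb G X\<^esub> x)"
    unfolding arrow_class_iff[OF \<alpha>(1,1)] by blast
  then have "\<beta> X (\<alpha> X x) = \<kappa> X x \<otimes>\<^bsub>FOb G X\<^esub> x" if "X \<in> Ob A" "x \<in> carrier (FOb G X)" for X x
    using that unfolding arr_eq_iff by blast
  then show ?thesis using that \<alpha>(1-3) \<beta>(1) \<kappa>(1,2) by blast
qed

text \<open>The maps between the functors lift to \<open>b\<close> and \<open>b'\<close> on
  generators, and \<open>a\<close>, \<open>a'\<close> exist because relations go to relations. The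
  error in the stable category is given by some \<open>w\<close> with \<open>w f = 0\<close>, so
  composing with \<open>f\<close> removes it.\<close>

lemma stable_isomorphic_retract:
  fixes G T :: "('o, 'm, 'g) afun"
  assumes iso: "isomorphic (stable_modcat A) G T" and f: "pres A f G e" and g: "pres A g T e'"
  shows "stable_retract A f g"
proof -
  obtain \<alpha> \<beta> \<kappa> where fp: "finitely_presented A G" "finitely_presented A T"
    and \<alpha>: "nat_trans A G T \<alpha>" and \<beta>: "nat_trans A T G \<beta>" and \<kappa>: "nat_trans A G G \<kappa>" "arr A G G \<kappa> \<in> repr_ideal A"
    and eq: "\<And>X x. X \<in> Ob A \<Longrightarrow> x \<in> carrier (FOb G X) \<Longrightarrow> \<beta> X (\<alpha> X x) = \<kappa> X x \<otimes>\<^bsub>FOb G X\<^esub> x"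
    by (rule stable_isomorphicE[OF iso]) blast
  note ad = fp_additive[OF fp(1)] fp_additive[OF fp(2)]
  note Pf = presD[OF f] and Pg = presD[OF g]
  have Ob: "Cod A f \<in> Ob A" "Cod A g \<in> Ob A" "Dom A f \<in> Ob A" "Dom A g \<in> Ob A" using Pf Pg by simp_all
  obtain b where b: "b \<in> Mor A" "Dom A b = Cod A f" "Cod A b = Cod A g" "FMor T b e' = \<alpha> (Cod A f) e"
    by (rule pres_gen[OF g Ob(1) nt_closed[OF \<alpha> Ob(1) Pf(2)]])
  obtain b' where b': "b' \<in> Mor A" "Dom A b' = Cod A g" "Cod A b' = Cod A f" "FMor G b' e = \<beta> (Cod A g) e'"
    by (rule pres_gen[OF f Ob(2) nt_closed[OF \<beta> Ob(2) Pg(2)]])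
  have "FMor T (b \<odot> f) e' = \<one>\<^bsub>FOb T (Dom A (b \<odot> f))\<^esub>"
    using b Pf Pg nt_nat[OF \<alpha> Pf(1) refl Pf(2)] pres_zero[OF ad(1) f] nt_one[OF \<alpha> ad Ob(3)]
    by (simp add: af_Cmp[OF ad(2)])
  then obtain a where a: "a \<in> Mor A" "Dom A a = Dom A (b \<odot> f)" "Cod A a = Dom A g" "g \<odot> a = b \<odot> f"
    by (rule pres_relE[OF g, rotated 2]) (use b Pf in simp_all)
  have "FMor G (b' \<odot> g) e = \<one>\<^bsub>FOb G (Dom A (b' \<odot> g))\<^esub>"
    using b' Pf Pg nt_nat[OF \<beta> Pg(1) refl Pg(2)] pres_zero[OF ad(2) g] nt_one[OF \<beta> ad(2,1) Ob(4)]
    by (simp add: af_Cmp[OF ad(1)])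
  then obtain a' where a': "a' \<in> Mor A" "Dom A a' = Dom A (b' \<odot> g)" "Cod A a' = Dom A f" "f \<odot> a' = b' \<odot> g"
    by (rule pres_relE[OF f, rotated 2]) (use b' Pg in simp_all)
  obtain w where w': "w \<in> homset A (Cod A f) (Cod A f)" "w \<odot> f = Zero A (Dom A f) (Cod A f)"
    "\<kappa> (Cod A f) e = FMor G w e"
    using \<kappa>(2) unfolding repr_ideal_iff[OF fp(1) f fp(1) f \<kappa>(1)] by blast
  have w: "w \<in> Mor A" "Dom A w = Cod A f" "Cod A w = Cod A f" using w'(1) by (simp_all add: hom_iff)
  have "FMor G (b' \<odot> b) e = \<beta> (Cod A f) (\<alpha> (Cod A f) e)"
    unfolding b(4)[symmetric] using nt_nat[OF \<beta> b(1,2), of e'] b(3) b' b(1,2) Pf Pg by (simp add: af_Cmp[OF ad(1)])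
  also have "\<dots> = FMor G (w \<oplus> Id A (Cod A f)) e"
    using eq[OF Ob(1) Pf(2)] w'(3) w Pf Ob by (simp add: af_Add[OF ad(1)] af_Id[OF ad(1)])
  finally obtain s where s: "s \<in> Mor A" "Dom A s = Dom A (w \<oplus> Id A (Cod A f))" "Cod A s = Dom A f"
    "b' \<odot> b = (w \<oplus> Id A (Cod A f)) \<oplus> f \<odot> s"
    by (rule pres_eqE[OF ad(1) f, rotated 5]) (use b b' w Ob in simp_all)
  have ds: "Dom A s = Cod A f" using s(2) w Ob by simp
  have "b' \<odot> (b \<odot> f) = ((w \<oplus> Id A (Cod A f)) \<oplus> f \<odot> s) \<odot> f"
    unfolding s(4)[symmetric] using b b' Pf by (simp add: assoc)
  also have "\<dots> = f \<oplus> f \<odot> (s \<odot> f)" using w'(2) w s(1,3) ds Pf Ob by (simp add: assoc)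
  finally have "b' \<odot> (b \<odot> f) = f \<oplus> f \<odot> (s \<odot> f)" .
  then show ?thesis
    by (intro stable_retractI[of a f g b a' b' s]) (use a a' b b' s(1,3) ds Pf Pg in simp_all)
qed

text \<open>The ideal is closed under products and inverses in each hom-group, so
  \<open>\<kappa>\<close> can be absorbed into the varying term of the coset.\<close>

lemma arrow_class_cong:
  fixes F G :: "('o, 'm, 'g) afun"
  assumes fp: "finitely_presented A F" "finitely_presented A G" and \<alpha>: "nat_trans A F G \<alpha>"
    and \<kappa>: "nat_trans A F G \<kappa>" "arr A F G \<kappa> \<in> repr_ideal A"
    and eq: "\<And>X x. X \<in> Ob A \<Longrightarrow> x \<in> carrier (FOb F X) \<Longrightarrow> \<beta> X x = \<kappa> X x \<otimes>\<^bsub>FOb G X\<^esub> \<alpha> X x"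
  shows "arrow_class (modcat A) (repr_ideal A) (arr A F G \<beta>) = arrow_class (modcat A) (repr_ideal A) (arr A F G \<alpha>)"
proof (intro equalityI subsetI)
  note ad = fp_additive[OF fp(1)] fp_additive[OF fp(2)]
  fix u assume "u \<in> arrow_class (modcat A) (repr_ideal A) (arr A F G \<beta>)"
  then obtain \<nu> where l: "nat_trans A F G \<nu>" "arr A F G \<nu> \<in> repr_ideal A"
    "u = arr A F G (\<lambda>X x. \<nu> X x \<otimes>\<^bsub>FOb G X\<^esub> \<beta> X x)" unfolding arrow_class_iff[OF fp] by blast
  have "\<nu> X x \<otimes>\<^bsub>FOb G X\<^esub> \<beta> X x = (\<nu> X x \<otimes>\<^bsub>FOb G X\<^esub> \<kappa> X x) \<otimes>\<^bsub>FOb G X\<^esub> \<alpha> X x"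
    if x: "X \<in> Ob A" "x \<in> carrier (FOb F X)" for X x
    unfolding eq[OF x]
    by (rule monoid.m_assoc[OF af_monoid[OF ad(2) x(1)] nt_closed[OF l(1) x] nt_closed[OF \<kappa>(1) x]
          nt_closed[OF \<alpha> x], symmetric])
  then have "u = arr A F G (\<lambda>X x. (\<nu> X x \<otimes>\<^bsub>FOb G X\<^esub> \<kappa> X x) \<otimes>\<^bsub>FOb G X\<^esub> \<alpha> X x)"
    unfolding l(3) arr_eq_iff by blast
  then show "u \<in> arrow_class (modcat A) (repr_ideal A) (arr A F G \<alpha>)"
    unfolding arrow_class_iff[OF fp]
    using nat_trans_mult[OF ad(2) l(1) \<kappa>(1)] repr_ideal_subgroup(2)[OF fp l(1) \<kappa>(1) l(2) \<kappa>(2)]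
    by (intro exI[of _ "\<lambda>X x. \<nu> X x \<otimes>\<^bsub>FOb G X\<^esub> \<kappa> X x"]) simp
next
  note ad = fp_additive[OF fp(1)] fp_additive[OF fp(2)]
  fix u assume "u \<in> arrow_class (modcat A) (repr_ideal A) (arr A F G \<alpha>)"
  then obtain \<nu> where l: "nat_trans A F G \<nu>" "arr A F G \<nu> \<in> repr_ideal A"
    "u = arr A F G (\<lambda>X x. \<nu> X x \<otimes>\<^bsub>FOb G X\<^esub> \<alpha> X x)" unfolding arrow_class_iff[OF fp] by blast
  note n = nat_trans_inv[OF ad(2) \<kappa>(1)]
  have "\<nu> X x \<otimes>\<^bsub>FOb G X\<^esub> \<alpha> X x = (\<nu> X x \<otimes>\<^bsub>FOb G X\<^esub> inv\<^bsub>FOb G X\<^esub> \<kappa> X x) \<otimes>\<^bsub>FOb G X\<^esub> \<beta> X x"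
    if x: "X \<in> Ob A" "x \<in> carrier (FOb F X)" for X x
  proof -
    interpret G: group "FOb G X" by (rule af_group[OF ad(2) x(1)])
    have c: "\<nu> X x \<in> carrier (FOb G X)" "\<kappa> X x \<in> carrier (FOb G X)" "\<alpha> X x \<in> carrier (FOb G X)"
      by (rule nt_closed[OF l(1) x] nt_closed[OF \<kappa>(1) x] nt_closed[OF \<alpha> x])+
    then have "inv\<^bsub>FOb G X\<^esub> \<kappa> X x \<otimes>\<^bsub>FOb G X\<^esub> (\<kappa> X x \<otimes>\<^bsub>FOb G X\<^esub> \<alpha> X x) = \<alpha> X x"
      by (simp flip: G.m_assoc)
    then show ?thesis unfolding eq[OF x] using c by (simp add: G.m_assoc)
  qed
  then have "u = arr A F G (\<lambda>X x. (\<nu> X x \<otimes>\<^bsub>FOb G X\<^esub> inv\<^bsub>FOb G X\<^esub> \<kappa> X x) \<otimes>\<^bsub>FOb G X\<^esub> \<beta> X x)"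
    unfolding l(3) arr_eq_iff by blast
  then show "u \<in> arrow_class (modcat A) (repr_ideal A) (arr A F G \<beta>)"
    unfolding arrow_class_iff[OF fp]
    using nat_trans_mult[OF ad(2) l(1) n]
      repr_ideal_subgroup(2)[OF fp l(1) n l(2) repr_ideal_subgroup(3)[OF fp \<kappa>]]
    by (intro exI[of _ "\<lambda>X x. \<nu> X x \<otimes>\<^bsub>FOb G X\<^esub> inv\<^bsub>FOb G X\<^esub> \<kappa> X x"]) simp
qed

text \<open>The representative \<open>\<alpha>\<close> chosen for the identity class
  \<open>u\<close> may differ from the identity, so \<open>u u\<close> has to be computed. On the
  generator \<open>\<alpha>\<close> acts by some \<open>z\<close> with \<open>z f = f\<close>; then
  \<open>(z z - 1) f = 0\<close>, which puts the difference of \<open>\<alpha> \<alpha>\<close> and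
  the identity into the ideal.\<close>

lemma stable_isomorphic_refl:
  fixes G :: "('o, 'm, 'g) afun"
  assumes fp: "finitely_presented A G" shows "isomorphic (stable_modcat A) G G"
proof -
  let ?I = "repr_ideal A :: ('o, 'm, 'g) ftrans set"
  let ?Q = "quotcat (modcat A) ?I"
  have Q: "stable_modcat A = ?Q" by (simp add: stable_modcat_def repr_ideal_def)
  note ad = fp_additive[OF fp]
  obtain f e where f: "pres A f G e" by (rule fp_pres[OF fp])
  note P = presD[OF f]
  have Ob: "Cod A f \<in> Ob A" "Dom A f \<in> Ob A" using P by simp_all
  define u where "u = arrow_class (modcat A) ?I (arr A G G (\<lambda>X x. x))"
  obtain \<kappa> where \<kappa>: "nat_trans A G G \<kappa>" "arr A G G \<kappa> \<in> ?I" "nat_trans A G G (\<lambda>X x. \<kappa> X x \<otimes>\<^bsub>FOb G X\<^esub> x)"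
    "(SOME f. f \<in> u) = arr A G G (\<lambda>X x. \<kappa> X x \<otimes>\<^bsub>FOb G X\<^esub> x)"
    unfolding u_def by (rule arrow_class_some[OF fp fp nat_trans_ident]) blast
  define \<alpha> where "\<alpha> = (\<lambda>X x. \<kappa> X x \<otimes>\<^bsub>FOb G X\<^esub> x)"
  have \<alpha>: "nat_trans A G G \<alpha>" "(SOME f. f \<in> u) = arr A G G \<alpha>" using \<kappa>(3,4) by (simp_all add: \<alpha>_def)
  note \<alpha>\<alpha> = nat_trans_comp[OF \<alpha>(1) \<alpha>(1)]
  define \<mu> where "\<mu> = (\<lambda>X x. \<alpha> X (\<alpha> X x) \<otimes>\<^bsub>FOb G X\<^esub> inv\<^bsub>FOb G X\<^esub> x)"
  have \<mu>: "nat_trans A G G \<mu>"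
    unfolding \<mu>_def by (rule nat_trans_mult[OF ad \<alpha>\<alpha> nat_trans_inv[OF ad nat_trans_ident]])
  obtain w where w': "w \<in> homset A (Cod A f) (Cod A f)" "w \<odot> f = Zero A (Dom A f) (Cod A f)"
    "\<kappa> (Cod A f) e = FMor G w e"
    using \<kappa>(2) unfolding repr_ideal_iff[OF fp f fp f \<kappa>(1)] by blast
  define z where "z = w \<oplus> Id A (Cod A f)"
  have w: "w \<in> Mor A" "Dom A w = Cod A f" "Cod A w = Cod A f" using w'(1) by (simp_all add: hom_iff)
  have z: "z \<in> Mor A" "Dom A z = Cod A f" "Cod A z = Cod A f" using w Ob by (simp_all add: z_def)
  have zf: "z \<odot> f = f" using w w'(2) P Ob by (simp add: z_def)
  have \<alpha>e: "\<alpha> (Cod A f) e = FMor G z e"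
    using w w'(3) P Ob by (simp add: \<alpha>_def z_def af_Add[OF ad] af_Id[OF ad])
  have \<alpha>\<alpha>e: "\<alpha> (Cod A f) (\<alpha> (Cod A f) e) = FMor G (z \<odot> z) e"
    using nt_nat[OF \<alpha>(1) z(1,2), of e] z \<alpha>e P by (simp add: af_Cmp[OF ad])
  have I: "arr A G G \<mu> \<in> ?I"
    unfolding repr_ideal_iff[OF fp f fp f \<mu>]
  proof (rule bexI[of _ "z \<odot> z \<oplus> neg A (Id A (Cod A f))"], rule conjI)
    show "z \<odot> z \<oplus> neg A (Id A (Cod A f)) \<in> homset A (Cod A f) (Cod A f)" using z Ob by (simp add: hom_iff)
    show "(z \<odot> z \<oplus> neg A (Id A (Cod A f))) \<odot> f = Zero A (Dom A f) (Cod A f)"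
      using z zf P Ob by (simp add: assoc)
    show "\<mu> (Cod A f) e = FMor G (z \<odot> z \<oplus> neg A (Id A (Cod A f))) e"
      using \<alpha>\<alpha>e z P Ob by (simp add: \<mu>_def af_Add[OF ad] af_neg[OF ad] af_Id[OF ad])
  qed
  have sq: "\<alpha> X (\<alpha> X x) = \<mu> X x \<otimes>\<^bsub>FOb G X\<^esub> x" if x: "X \<in> Ob A" "x \<in> carrier (FOb G X)" for X x
  proof -
    interpret G: group "FOb G X" by (rule af_group[OF ad x(1)])
    show ?thesis using nt_closed[OF \<alpha>\<alpha> x] x(2) by (simp add: \<mu>_def G.m_assoc)
  qed
  have "arrow_class (modcat A) ?I (arr A G G (\<lambda>X x. \<alpha> X (\<alpha> X x))) = u"
    unfolding u_def by (rule arrow_class_cong[OF fp fp nat_trans_ident \<mu> I sq])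
  then have uu: "u \<cdot>\<^bsub>?Q\<^esub> u = Id ?Q G"
    by (simp add: quotcat_simps \<alpha>(2) arr_Cmp[OF \<alpha>(1)] u_def[symmetric] arr_Id)
  have "u \<in> Mor ?Q" unfolding u_def quotcat_simps using fp nat_trans_ident by (intro imageI arr_Mor)
  moreover have "Dom ?Q u = G" "Cod ?Q u = G" by (simp_all add: quotcat_simps \<alpha>(2))
  ultimately show ?thesis unfolding Q isomorphic_def iso_arrow_def homset_def
    using uu by (intro bexI[of _ u] conjI) simp_all
qed

end

section \<open>The transpose in terms of arrows\<close>

context resolving_subcategory
begin

text \<open>A stable isomorphism in \<open>opcat A\<close> gives a stable retract of presenting
  arrows, which may be read in \<open>A\<close>, where \<open>fam\<close> is closed under such
  retracts. Conversely \<open>G\<close> is itself a transpose of any functor in \<open>\<X>\<close>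
  that \<open>f\<close> presents.\<close>

lemma Tr_iff:
  fixes G :: "('o, 'm, 'g) afun"
  assumes G: "finitely_presented (opcat A) G" "pres (opcat A) f G e"
  shows "G \<in> Tr A \<X> \<longleftrightarrow> f \<in> fam"
proof
  interpret op: abelian_universe "opcat A" \<iota> by (rule abelian_universe_opcat)
  have f: "f \<in> Mor A" using presD(1)[OF G(2)] by simp
  { assume "G \<in> Tr A \<X>"
    then obtain F T g where F: "F \<in> \<X>" and T: "finitely_presented (opcat A) T"
      and g: "presents A g F" "presents (opcat A) g T" and iso: "isomorphic (stable_modcat (opcat A)) G T"
      unfolding Tr_def is_transpose_def by auto
    obtain eF where eF: "pres A g F eF" using g(1) presents_iff[OF fp_additive[OF X_fp[OF F]]] by blast
    obtain eT where eT: "pres (opcat A) g T eT" using g(2) op.presents_iff[OF fp_additive[OF T]] by blast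
    have "stable_retract (opcat A) f g" by (rule op.stable_isomorphic_retract[OF iso G(2) eT])
    then have "stable_retract A f g"
      using op.stable_retract_opcat[of f g] f presD(1)[OF eF] by simp
    moreover have "g \<in> fam" using fam_iff[OF X_fp[OF F] eF] F by blast
    ultimately show "f \<in> fam" using fam_stable_retract f by blast }
  { assume "f \<in> fam"
    then obtain F e' where F: "F \<in> \<X>" "additive_functor A F" "pres A f F e'" by (rule famE)
    then have "presents A f F" "presents (opcat A) f G"
      using presents_iff[OF F(2)] op.presents_iff[OF fp_additive[OF G(1)]] G(2) by blast+
    then show "G \<in> Tr A \<X>"
      unfolding Tr_def is_transpose_def using G(1) F(1) op.stable_isomorphic_refl[OF G(1)] by auto }
qed

lemma exact_class_fam:
  assumes "resolving (modcat (opcat A)) (Tr A \<X>)"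
  shows "exact_class A fam"
proof -
  interpret op: resolving_subcategory "opcat A" \<iota> "Tr A \<X>"
    by (intro resolving_subcategory.intro resolving_subcategory_axioms.intro abelian_universe_opcat assms)
  have fam: "op.fam = fam" unfolding set_eq_iff
  proof (intro allI)
    fix f
    show "f \<in> op.fam \<longleftrightarrow> f \<in> fam"
    proof (cases "f \<in> Mor A")
      case True
      then have "f \<in> Mor (opcat A)" by simp
      then obtain G :: "('o, 'm, 'g) afun" and e where "finitely_presented (opcat A) G" "pres (opcat A) f G e"
        using op.ex_presented by metis
      then show ?thesis using Tr_iff op.fam_iff by blast
    next
      case False
      then show ?thesis using famD op.famD by auto
    qed
  qed
  have left: "i \<in> fam" if "i \<in> Mor A" "j \<in> Mor A" "Cod A i = Dom A j" "mono_arrow A (j \<odot> i)" "j \<odot> i \<in> fam" for i j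
    using fam_left_cancel that by blast
  have right: "g \<in> fam" if "g \<in> Mor A" "h \<in> Mor A" "Cod A h = Dom A g" "epi_arrow A (g \<odot> h)" "g \<odot> h \<in> fam" for g h
    using op.fam_left_cancel[of g h] that by (simp add: fam)
  show ?thesis
  proof (intro exact_class.intro exact_class_axioms.intro abelian_category_axioms)
    fix k f assume "is_cokernel A k f" "f \<in> fam"
    then show "k \<in> fam" using op.fam_ker[of k f] by (simp add: fam)
  next
    fix p q assume *: "p \<in> fam" "epi_arrow A p" "q \<in> fam" "epi_arrow A q" "Cod A p = Dom A q"
    show "q \<odot> p \<in> fam"
    \<comment> \<open>The exact sequence behind this rule lives in \<open>\<X>\<close>, while the
      right cancellation that it asks for is left cancellation for \<open>Tr \<X>\<close>.\<close>
    proof (rule fam_comp_epi)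
      fix g h assume "g \<in> Mor A" "h \<in> Mor A" "Cod A h = Dom A g" "epi_arrow A (g \<odot> h)" "g \<odot> h \<in> fam"
      then show "g \<in> fam" by (rule right)
    qed (use * in simp_all)
  next
    fix i j assume *: "i \<in> fam" "mono_arrow A i" "j \<in> fam" "mono_arrow A j" "Cod A i = Dom A j"
    have "i \<cdot>\<^bsub>opcat A\<^esub> j \<in> op.fam"
    proof (rule op.fam_comp_epi)
      fix g h assume "g \<in> Mor (opcat A)" "h \<in> Mor (opcat A)" "Cod (opcat A) h = Dom (opcat A) g"
        "epi_arrow (opcat A) (g \<cdot>\<^bsub>opcat A\<^esub> h)" "g \<cdot>\<^bsub>opcat A\<^esub> h \<in> op.fam"
      then show "g \<in> op.fam" using left[of g h] by (simp add: fam)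
    qed (use * in \<open>simp_all add: fam\<close>)
    then show "j \<odot> i \<in> fam" by (simp add: fam)
  next
    fix f assume "f \<in> fam" then show "f \<in> Mor A" by (rule famD)
  next
    fix f g assume "stable_retract A f g" "g \<in> fam" "f \<in> Mor A"
    then show "f \<in> fam" by (rule fam_stable_retract)
  next
    fix X assume "X \<in> Ob A" then show "Id A X \<in> fam" by (rule fam_Id)
  next
    fix k f assume "is_kernel A k f" "f \<in> fam" then show "k \<in> fam" by (rule fam_ker)
  next
    fix i j assume "i \<in> Mor A" "j \<in> Mor A" "Cod A i = Dom A j" "mono_arrow A (j \<odot> i)" "j \<odot> i \<in> fam"
    then show "i \<in> fam" by (rule left)
  next
    fix g h assume "g \<in> Mor A" "h \<in> Mor A" "Cod A h = Dom A g" "epi_arrow A (g \<odot> h)" "g \<odot> h \<in> fam"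
    then show "g \<in> fam" by (rule right)
  qed
qed

text \<open>For an image factorization \<open>f = i p\<close> this reduces to \<open>f\<close> being
  in \<open>fam\<close> iff both factors are. One direction is \<open>fam_comp\<close>; for the
  other, \<open>p\<close> is the cokernel of the kernel of \<open>f\<close>, and \<open>i\<close> is
  the kernel of its cokernel.\<close>

lemma admissible_functors_of_fam:
  assumes "exact_class A fam"
  shows "admissible_functors A (exact_class.conflations A fam) = \<X>"
proof -
  interpret E: exact_class A fam by fact
  note ex = E.exact_structure_conflations
  have iff: "F \<in> admissible_functors A E.conflations \<longleftrightarrow> F \<in> \<X>" if F: "finitely_presented A F" for F
  proof -
    obtain f e where f: "pres A f F e" by (rule fp_pres[OF F])
    note P = presD[OF f]
    obtain p i where ip: "epi_arrow A p" "mono_arrow A i" "Cod A p = Dom A i" "f = i \<odot> p"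
      "\<And>k. is_kernel A k f \<Longrightarrow> is_cokernel A p k"
      by (rule image_factorization[OF P(1)]) blast
    have ty: "p \<in> Mor A" "i \<in> Mor A" using ip by (simp_all add: epi_arrow_iff mono_arrow_def)
    have "F \<in> admissible_functors A E.conflations \<longleftrightarrow> p \<in> fam \<and> i \<in> fam"
      unfolding admissible_functor_iff[OF ex F f[unfolded ip(4)] ip(2,1,3)] E.admissible_epi_iff E.admissible_mono_iff
      using ip(1,2) by blast
    also have "\<dots> \<longleftrightarrow> f \<in> fam"
    proof
      assume "p \<in> fam \<and> i \<in> fam"
      then show "f \<in> fam" using fam_comp[of p i] ip by simp
    next
      assume fF: "f \<in> fam"
      obtain k where k: "is_kernel A k f" using kernels P(1) by blast
      have p: "p \<in> fam" by (rule E.F_coker[OF ip(5)[OF k] fam_ker[OF k fF]])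
      obtain c where c: "is_cokernel A c f" using cokernels P(1) by blast
      note C = is_cokernelD[OF c]
      have cty: "Dom A c = Cod A i" "Dom A f = Dom A p" using C(3) ip(3,4) ty by simp_all
      \<comment> \<open>Because \<open>p\<close> is epi, \<open>c\<close> is also a cokernel of
        \<open>i\<close>, and the mono \<open>i\<close> is then the kernel of
        \<open>c\<close>.\<close>
      have "is_cokernel A c i"
      proof (rule is_cokernelI[OF is_cokernel_epi[OF c] ty(2) cty(1)])
        have z: "(c \<odot> i) \<odot> p = Zero A (Dom A p) (Cod A (c \<odot> i))"
          using C(1,4) ip(3,4) ty cty by (simp add: assoc)
        have "c \<odot> i = Zero A (Cod A p) (Cod A (c \<odot> i))"
          by (rule epi_zero[OF ip(1) _ _ z]) (use C(1) ip(3) ty cty in simp_all)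
        then show "c \<odot> i = Zero A (Dom A i) (Cod A c)" using C(1) ip(3) ty cty by simp
        fix t assume t: "t \<in> Mor A" "Dom A t = Cod A i" "t \<odot> i = Zero A (Dom A i) (Cod A t)"
        have "t \<odot> f = Zero A (Dom A f) (Cod A t)"
          using Cmp_eq_Zero[OF t(3) ty(2) t(1) ty(1)] t(2) ip(3,4) cty by simp
        then show "\<exists>u \<in> homset A (Cod A c) (Cod A t). u \<odot> c = t"
          using is_cokernel_ex[OF c t(1)] t(2) cty C(3) by simp
      qed
      then have "i \<in> fam" using fam_ker[OF mono_kernel_cokernel[OF ip(2)] E.F_coker[OF c fF]] by blast
      then show "p \<in> fam \<and> i \<in> fam" using p by blast
    qed
    also have "\<dots> \<longleftrightarrow> F \<in> \<X>" using fam_iff[OF F f] by blast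
    finally show ?thesis .
  qed
  have "finitely_presented A F" if "F \<in> admissible_functors A E.conflations" for F :: "('o, 'm, 'g) afun"
    using that
    by (simp add: admissible_functors_def locally_representable_def)
  then show ?thesis using iff X_fp by blast
qed

end

context abelian_universe
begin

text \<open>In \<open>opcat A\<close> the image factorization of \<open>f = i p\<close> has
  \<open>p\<close> as its mono part and \<open>i\<close> as its epi part, so the criterion for
  \<open>f\<close> is the same condition with inflations and deflations exchanged.\<close>

lemma Tr_admissible_functors:
  assumes E: "exact_structure A E"
  shows "Tr A (admissible_functors A E :: ('o, 'm, 'g) afun set) = admissible_functors (opcat A) (E\<inverse>)"
  unfolding set_eq_iff
proof (intro allI)
  fix G :: "('o, 'm, 'g) afun"
  interpret X: resolving_subcategory A \<iota> "admissible_functors A E"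
    by (intro resolving_subcategory.intro resolving_subcategory_axioms.intro
        resolving_admissible_functors[OF E] abelian_universe_axioms)
  interpret op: abelian_universe "opcat A" \<iota> by (rule abelian_universe_opcat)
  note E' = exact_structure_opcat[OF E]
  show "G \<in> Tr A (admissible_functors A E) \<longleftrightarrow> G \<in> admissible_functors (opcat A) (E\<inverse>)"
  proof (cases "finitely_presented (opcat A) G")
    case True
    obtain f e where f: "pres (opcat A) f G e" by (rule op.fp_pres[OF True])
    have fM: "f \<in> Mor A" using presD(1)[OF f] by simp
    obtain p i where ip: "epi_arrow A p" "mono_arrow A i" "Cod A p = Dom A i" "f = i \<odot> p"
      by (rule image_factorization[OF fM]) blast
    obtain F :: "('o, 'm, 'g) afun" and e' where F: "finitely_presented A F" "additive_functor A F" "pres A f F e'"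
      by (rule ex_presented[OF fM])
    have "G \<in> Tr A (admissible_functors A E) \<longleftrightarrow> f \<in> X.fam" by (rule X.Tr_iff[OF True f])
    also have "\<dots> \<longleftrightarrow> admissible_epi E p \<and> admissible_mono E i"
      using X.fam_iff[OF F(1,3)] admissible_functor_iff[OF E F(1) F(3)[unfolded ip(4)] ip(2,1,3)] by blast
    also have "\<dots> \<longleftrightarrow> G \<in> admissible_functors (opcat A) (E\<inverse>)"
      using op.admissible_functor_iff[OF E' True, of p i e] f ip by auto
    finally show ?thesis .
  next
    case False
    then show ?thesis by (auto simp: Tr_def admissible_functors_def locally_representable_def)
  qed
qed

end

section \<open>The bijection\<close>

theorem corollary1p7:
  fixes A :: "('o, 'm) acat" and \<iota> :: "'m \<Rightarrow> 'g"
  assumes "abelian_category A"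
    and "inj_on \<iota> (Mor A)"
  shows "\<exists>\<Phi> :: ('m \<times> 'm) set \<Rightarrow> ('o, 'm, 'g) afun set.
           bij_betw \<Phi> {E. exact_structure A E}
             {\<X>. resolving (modcat A) \<X> \<and> resolving (modcat (opcat A)) (Tr A \<X>)}"
proof -
  interpret abelian_universe A \<iota>
    by (intro abelian_universe.intro abelian_universe_axioms.intro assms)
  interpret op: abelian_universe "opcat A" \<iota> by (rule abelian_universe_opcat)
  let ?\<Phi> = "admissible_functors A :: ('m \<times> 'm) set \<Rightarrow> ('o, 'm, 'g) afun set"
  have "inj_on ?\<Phi> {E. exact_structure A E}"
  proof (rule inj_onI)
    fix E E' assume "E \<in> {E. exact_structure A E}" "E' \<in> {E. exact_structure A E}" "?\<Phi> E = ?\<Phi> E'"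
    then show "E = E'"
      using admissible_functors_subset[of E E'] admissible_functors_subset[of E' E] by auto
  qed
  moreover have "?\<Phi> ` {E. exact_structure A E} =
      {\<X>. resolving (modcat A) \<X> \<and> resolving (modcat (opcat A)) (Tr A \<X>)}"
  proof (intro equalityI subsetI)
    fix \<X> assume "\<X> \<in> ?\<Phi> ` {E. exact_structure A E}"
    then obtain E where E: "\<X> = ?\<Phi> E" "exact_structure A E" by auto
    \<comment> \<open>The transpose of the subcategory of \<open>E\<close> is the subcategory of the
      opposite structure, so the second condition is the first one for
      \<open>opcat A\<close>.\<close>
    show "\<X> \<in> {\<X>. resolving (modcat A) \<X> \<and> resolving (modcat (opcat A)) (Tr A \<X>)}"
      using resolving_admissible_functors[OF E(2)] op.resolving_admissible_functors[OF exact_structure_opcat[OF E(2)]]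
      by (simp add: E(1) Tr_admissible_functors[OF E(2)])
  next
    fix \<X> :: "('o, 'm, 'g) afun set"
    assume \<X>: "\<X> \<in> {\<X>. resolving (modcat A) \<X> \<and> resolving (modcat (opcat A)) (Tr A \<X>)}"
    interpret X: resolving_subcategory A \<iota> \<X>
      by (intro resolving_subcategory.intro resolving_subcategory_axioms.intro abelian_universe_axioms)
        (use \<X> in simp)
    have "exact_class A X.fam" by (rule X.exact_class_fam) (use \<X> in simp)
    then show "\<X> \<in> ?\<Phi> ` {E. exact_structure A E}"
      using X.admissible_functors_of_fam exact_class.exact_structure_conflations by blast
  qed
  ultimately show ?thesis unfolding bij_betw_def by blast
qed

end
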